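(* Let $\lambda$ be a Salem number and let $d\geq 3$. Then the set of holonomies $$\{h(g) : g\in\Gamma \text{ loxodromic with } \ell(g)=\log(\lambda),\ \Gamma\leq\mathrm{Isom}^+(\mathbb{H}^d)\text{ an arithmetic lattice of simplest type}\}\subseteq C(\mathrm{SO}(d-1))$$ (taken over all such $\Gamma$ and $g$) is finite.
   Context: $\mathbb{H}^d$ is $d$-dimensional hyperbolic space and $\mathrm{Isom}^+(\mathbb{H}^d)$ its group of orientation-preserving isometries. A Salem number $\lambda$ is a real algebraic integer greater than $1$ which is Galois conjugate to $\lambda^{-1}$, and all of whose Galois conjugates different from $\lambda$ and $\lambda^{-1}$ lie on the unit circle (the quadratic case, with no further conjugates, is allowed). Arithmetic lattices of simplest type: let $k\subset\mathbb{R}$ be a totally real number field with ring of integers $\mathcal{O}_k$ and $q$ a quadratic form in $d+1$ variables over $k$. The pair $(k,q)$ is admissible if $q$ has signature $(d,1)$ at the identity embedding of $k$, and $q^\sigma$ is positive definite for every other real embedding $\sigma$ of $k$. With $Q$ the symmetric coefficient matrix of $q$ and $R\subseteq\mathbb{R}$ a subring, $\mathrm{SO}(q,R)=\{A\in \mathrm{SL}(d+1,R) : A^tQA=Q\}$, and $\mathrm{SO}'(q,R)$ is the subgroup preserving each of the two components of $\{x\in\mathbb{R}^{d+1}: q(x)=-1\}$; $\mathrm{SO}'(q,\mathbb{R})$ is identified with $\mathrm{Isom}^+(\mathbb{H}^d)$ via the hyperboloid model. A discrete subgroup $\Gamma\le\mathrm{Isom}^+(\mathbb{H}^d)$ is arithmetic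 of simplest type if a conjugate of $\Gamma$ is commensurable with $\mathrm{SO}'(q,\mathcal{O}_k)$ (their intersection has finite index in both) for some admissible $(k,q)$; such $\Gamma$ is a lattice. An element $g\in\mathrm{Isom}^+(\mathbb{H}^d)$ is loxodromic if it translates along a unique invariant geodesic (its axis) by a positive distance $\ell(g)$, its translation length. $C(\mathrm{SO}(d-1))$ is the set of conjugacy classes in $\mathrm{SO}(d-1)$. The holonomy $h(g)\in C(\mathrm{SO}(d-1))$ of a loxodromic $g$ is determined by parallel transport along its axis: for a point $p$ on the axis, the differential of $g$ at $p$ followed by parallel transport along the axis from $g(p)$ back to $p$ is an orientation-preserving linear isometry of the $(d-1)$-dimensional orthogonal complement of the axis direction in $T_p\mathbb{H}^d$, and $h(g)$ is its conjugacy class in $\mathrm{SO}(d-1)$ (identifying the complement with $\mathbb{R}^{d-1}$ by an oriented orthonormal frame). Concretely, if $g$ is conjugate in $\mathrm{Isom}^+(\mathbb{H}^d)\cong \mathrm{SO}'(d,1)$ to a block-diagonal matrix with blocks $A\in\mathrm{SO}(d-1)$ and a translation $T\in\mathrm{SO}'(1,1)$, then $h(g)=[A]$. *)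

theory Defs
  imports
    "HOL-Analysis.Function_Topology"
    "HOL-Analysis.Isolated"
    "HOL-Algebra.Coset"
    "HOL-Computational_Algebra.Polynomial_Factorial"
    "Jordan_Normal_Form.Determinant"
begin

definition galois_conjugate :: "complex \<Rightarrow> complex \<Rightarrow> bool" where
  "galois_conjugate x y \<longleftrightarrow>
     (\<exists>p :: rat poly. irreducible p \<and>
        poly (map_poly of_rat p) x = 0 \<and> poly (map_poly of_rat p) y = 0)"

definition salem :: "real \<Rightarrow> bool" where
  "salem lam \<longleftrightarrow> lam > 1 \<and> algebraic_int lam \<and>
     galois_conjugate (of_real lam) (of_real (inverse lam)) \<and>
     (\<forall>z. galois_conjugate (of_real lam) z \<longrightarrow>
        z \<noteq> of_real lam \<longrightarrow> z \<noteq> of_real (inverse lam) \<longrightarrow> cmod z = 1)"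

definition real_number_field :: "real set \<Rightarrow> bool" where
  "real_number_field K \<longleftrightarrow>
     0 \<in> K \<and> 1 \<in> K \<and>
     (\<forall>x\<in>K. \<forall>y\<in>K. x + y \<in> K \<and> x - y \<in> K \<and> x * y \<in> K) \<and>
     (\<forall>x\<in>K. inverse x \<in> K) \<and>
     (\<exists>B. finite B \<and> B \<subseteq> K \<and>
        (\<forall>x\<in>K. \<exists>c :: real \<Rightarrow> rat. x = (\<Sum>b\<in>B. of_rat (c b) * b)))"

text \<open>Embeddings are total functions of which only the values on \<open>K\<close> matter.\<close>

definition field_embedding :: "real set \<Rightarrow> (real \<Rightarrow> 'a :: field) \<Rightarrow> bool" where
  "field_embedding K \<sigma> \<longleftrightarrow> \<sigma> 1 = 1 \<and>
     (\<forall>x\<in>K. \<forall>y\<in>K. \<sigma> (x + y) = \<sigma> x + \<sigma> y \<and> \<sigma> (x * y) = \<sigma> x * \<sigma> y)"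

definition totally_real :: "real set \<Rightarrow> bool" where
  "totally_real K \<longleftrightarrow>
     (\<forall>\<sigma> :: real \<Rightarrow> complex. field_embedding K \<sigma> \<longrightarrow> \<sigma> ` K \<subseteq> \<real>)"

definition ring_of_integers :: "real set \<Rightarrow> real set" where
  "ring_of_integers K = {x \<in> K. algebraic_int x}"

definition signature_mat :: "nat \<Rightarrow> nat \<Rightarrow> real mat" where
  "signature_mat p m = mat (p + m) (p + m)
     (\<lambda>(i, j). if i \<noteq> j then 0 else if i < p then 1 else - 1)"

definition has_signature :: "real mat \<Rightarrow> nat \<Rightarrow> nat \<Rightarrow> bool" where
  "has_signature Q p m \<longleftrightarrow>
     (\<exists>P \<in> carrier_mat (p + m) (p + m). invertible_mat P \<and>
        P\<^sup>T * Q * P = signature_mat p m)"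

definition pos_def :: "real mat \<Rightarrow> bool" where
  "pos_def Q \<longleftrightarrow> (\<forall>x \<in> carrier_vec (dim_row Q). x \<noteq> 0\<^sub>v (dim_row Q) \<longrightarrow> x \<bullet> (Q *\<^sub>v x) > 0)"

text \<open>A quadratic form is given by its symmetric coefficient matrix.\<close>

definition admissible :: "nat \<Rightarrow> real set \<Rightarrow> real mat \<Rightarrow> bool" where
  "admissible d K Q \<longleftrightarrow>
     real_number_field K \<and> totally_real K \<and>
     Q \<in> carrier_mat (d + 1) (d + 1) \<and> Q\<^sup>T = Q \<and> elements_mat Q \<subseteq> K \<and>
     has_signature Q d 1 \<and>
     (\<forall>\<sigma> :: real \<Rightarrow> real. field_embedding K \<sigma> \<longrightarrow> (\<exists>x\<in>K. \<sigma> x \<noteq> x) \<longrightarrow>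
        pos_def (map_mat \<sigma> Q))"

definition SO :: "real mat \<Rightarrow> real set \<Rightarrow> real mat set" where
  "SO Q R = {A \<in> carrier_mat (dim_row Q) (dim_row Q).
     elements_mat A \<subseteq> R \<and> det A = 1 \<and> A\<^sup>T * Q * A = Q}"

text \<open>Vectors and matrices of variable dimension carry no topology in the library. They are
  given the Euclidean one by extending their coordinate functions by zero, the function spaces
  having the product topology.\<close>

definition vec_coords :: "real vec \<Rightarrow> (nat \<Rightarrow> real)" where
  "vec_coords x = (\<lambda>i. if i < dim_vec x then x $ i else 0)"

definition mat_coords :: "real mat \<Rightarrow> (nat \<times> nat \<Rightarrow> real)" where
  "mat_coords A = (\<lambda>(i, j). if i < dim_row A \<and> j < dim_col A then A $$ (i, j) else 0)"

definition hyperboloid :: "real mat \<Rightarrow> real vec set" where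
  "hyperboloid Q = {x \<in> carrier_vec (dim_row Q). x \<bullet> (Q *\<^sub>v x) = - 1}"

definition hyperboloid_components :: "real mat \<Rightarrow> real vec set set" where
  "hyperboloid_components Q =
     {{x \<in> hyperboloid Q. vec_coords x \<in> C} | C. C \<in> components (vec_coords ` hyperboloid Q)}"

definition SO' :: "real mat \<Rightarrow> real set \<Rightarrow> real mat set" where
  "SO' Q R = {A \<in> SO Q R. \<forall>C \<in> hyperboloid_components Q. (\<lambda>x. A *\<^sub>v x) ` C = C}"

text \<open>Hyperboloid model: the timelike coordinate is the last one, with index \<open>d\<close>.\<close>

definition minkowski :: "nat \<Rightarrow> real vec \<Rightarrow> real vec \<Rightarrow> real" where
  "minkowski d x y = x \<bullet> (signature_mat d 1 *\<^sub>v y)"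

definition hyp_space :: "nat \<Rightarrow> real vec set" where
  "hyp_space d = {x \<in> carrier_vec (d + 1). minkowski d x x = - 1 \<and> x $ d > 0}"

definition hyp_dist :: "nat \<Rightarrow> real vec \<Rightarrow> real vec \<Rightarrow> real" where
  "hyp_dist d x y = arcosh (- minkowski d x y)"

definition mat_group :: "nat \<Rightarrow> real mat set \<Rightarrow> real mat monoid" where
  "mat_group n S = \<lparr>carrier = S, monoid.mult = (*), one = 1\<^sub>m n\<rparr>"

definition Isom_plus :: "nat \<Rightarrow> real mat monoid" where
  "Isom_plus d = mat_group (d + 1) (SO' (signature_mat d 1) UNIV)"

definition commensurable :: "('a, 'b) monoid_scheme \<Rightarrow> 'a set \<Rightarrow> 'a set \<Rightarrow> bool" where
  "commensurable G H H' \<longleftrightarrow>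
     finite (rcosets\<^bsub>G\<lparr>carrier := H\<rparr>\<^esub> (H \<inter> H')) \<and>
     finite (rcosets\<^bsub>G\<lparr>carrier := H'\<rparr>\<^esub> (H \<inter> H'))"

text \<open>A change of basis \<open>P\<close> taking \<open>Q\<close> to the standard form, with inverse \<open>P'\<close>, identifies
  \<open>SO' Q UNIV\<close> with the isometry group by \<open>A \<mapsto> P' * A * P\<close>.\<close>

definition standardizes :: "nat \<Rightarrow> real mat \<Rightarrow> real mat \<Rightarrow> real mat \<Rightarrow> bool" where
  "standardizes d Q P P' \<longleftrightarrow>
     P \<in> carrier_mat (d + 1) (d + 1) \<and> P' \<in> carrier_mat (d + 1) (d + 1) \<and>
     inverts_mat P P' \<and> inverts_mat P' P \<and> P\<^sup>T * Q * P = signature_mat d 1"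

definition arithmetic_simplest_type :: "nat \<Rightarrow> real mat set \<Rightarrow> bool" where
  "arithmetic_simplest_type d \<Gamma> \<longleftrightarrow>
     subgroup \<Gamma> (Isom_plus d) \<and> discrete (mat_coords ` \<Gamma>) \<and>
     (\<exists>K Q P P'. admissible d K Q \<and> standardizes d Q P P' \<and>
        (\<exists>h \<in> carrier (Isom_plus d).
           commensurable (Isom_plus d)
             ((\<lambda>g. h \<otimes>\<^bsub>Isom_plus d\<^esub> g \<otimes>\<^bsub>Isom_plus d\<^esub> inv\<^bsub>Isom_plus d\<^esub> h) ` \<Gamma>)
             ((\<lambda>A. P' * A * P) ` SO' Q (ring_of_integers K))))"

definition geodesic_line :: "nat \<Rightarrow> (real \<Rightarrow> real vec) \<Rightarrow> bool" where
  "geodesic_line d \<gamma> \<longleftrightarrow>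
     (\<forall>t. \<gamma> t \<in> hyp_space d) \<and> (\<forall>s t. hyp_dist d (\<gamma> s) (\<gamma> t) = \<bar>s - t\<bar>)"

definition translates_along :: "nat \<Rightarrow> real mat \<Rightarrow> (real \<Rightarrow> real vec) \<Rightarrow> real \<Rightarrow> bool" where
  "translates_along d g \<gamma> l \<longleftrightarrow>
     geodesic_line d \<gamma> \<and> l > 0 \<and> (\<forall>t. g *\<^sub>v \<gamma> t = \<gamma> (t + l))"

definition loxodromic :: "nat \<Rightarrow> real mat \<Rightarrow> bool" where
  "loxodromic d g \<longleftrightarrow>
     (\<exists>\<gamma> l. translates_along d g \<gamma> l \<and>
        (\<forall>\<gamma>'. geodesic_line d \<gamma>' \<longrightarrow> (\<lambda>x. g *\<^sub>v x) ` range \<gamma>' = range \<gamma>' \<longrightarrow>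
           range \<gamma>' = range \<gamma>))"

definition translation_length :: "nat \<Rightarrow> real mat \<Rightarrow> real" where
  "translation_length d g = (THE l. \<exists>\<gamma>. translates_along d g \<gamma> l)"

definition has_vec_derivative ::
    "nat \<Rightarrow> (real \<Rightarrow> real vec) \<Rightarrow> real vec \<Rightarrow> real \<Rightarrow> bool" where
  "has_vec_derivative n f v t \<longleftrightarrow> v \<in> carrier_vec n \<and>
     (\<forall>i<n. ((\<lambda>s. f s $ i) has_real_derivative v $ i) (at t))"

text \<open>The covariant derivative on the hyperboloid is the tangential part of the derivative in the
  ambient Minkowski space, and the normal line at \<open>x\<close> is spanned by \<open>x\<close>. So a tangent field is
  parallel iff its derivative is everywhere a multiple of the position vector.\<close>

definition parallel_along ::
    "nat \<Rightarrow> (real \<Rightarrow> real vec) \<Rightarrow> (real \<Rightarrow> real vec) \<Rightarrow> bool" where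
  "parallel_along d \<gamma> V \<longleftrightarrow>
     (\<forall>t. V t \<in> carrier_vec (d + 1) \<and> minkowski d (V t) (\<gamma> t) = 0 \<and>
        (\<exists>c. has_vec_derivative (d + 1) V (c \<cdot>\<^sub>v \<gamma> t) t))"

text \<open>Oriented orthonormal frames of the orthogonal complement of the direction of \<open>\<gamma>\<close> in the
  tangent space at \<open>\<gamma> 0\<close>. The last condition says that the frame completed by the velocity is a
  positive basis of the tangent space.\<close>

definition normal_frame :: "nat \<Rightarrow> (real \<Rightarrow> real vec) \<Rightarrow> real vec list \<Rightarrow> bool" where
  "normal_frame d \<gamma> es \<longleftrightarrow>
     length es = d - 1 \<and> set es \<subseteq> carrier_vec (d + 1) \<and>
     (\<forall>i<d - 1. \<forall>j<d - 1. minkowski d (es ! i) (es ! j) = (if i = j then 1 else 0)) \<and>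
     (\<exists>u. has_vec_derivative (d + 1) \<gamma> u 0 \<and>
        (\<forall>e \<in> set es. minkowski d e (\<gamma> 0) = 0 \<and> minkowski d e u = 0) \<and>
        det (mat_of_cols (d + 1) (es @ [u, \<gamma> 0])) > 0)"

text \<open>Isometries act linearly, so the differential of \<open>g\<close> at \<open>p = \<gamma> 0\<close> is the restriction of
  \<open>g\<close>. The field \<open>V\<close> carries the image of the \<open>j\<close>-th frame vector back from \<open>g p = \<gamma> l\<close> to \<open>p\<close>,
  where it is expanded in the frame. As \<open>l > 0\<close>, the curve \<open>\<gamma>\<close> runs in the direction of
  translation, which fixes the orientation of the complement.\<close>

definition holonomy_matrix :: "nat \<Rightarrow> real mat \<Rightarrow> real mat \<Rightarrow> bool" where
  "holonomy_matrix d g A \<longleftrightarrow> A \<in> carrier_mat (d - 1) (d - 1) \<and>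
     (\<exists>\<gamma> l es. translates_along d g \<gamma> l \<and> normal_frame d \<gamma> es \<and>
        (\<forall>j<d - 1. \<exists>V. parallel_along d \<gamma> V \<and> V l = g *\<^sub>v (es ! j) \<and>
           V 0 = mat_of_cols (d + 1) es *\<^sub>v col A j))"

definition SO_group :: "nat \<Rightarrow> real mat monoid" where
  "SO_group n = mat_group n (SO (1\<^sub>m n) UNIV)"

definition conjugacy_classes :: "('a, 'b) monoid_scheme \<Rightarrow> 'a set set" where
  "conjugacy_classes G =
     (\<lambda>a. (\<lambda>b. b \<otimes>\<^bsub>G\<^esub> a \<otimes>\<^bsub>G\<^esub> inv\<^bsub>G\<^esub> b) ` carrier G) ` carrier G"

text \<open>A relation, so that no choice of point and frame is needed. For a loxodromic \<open>g\<close> exactly one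
  class is related to \<open>g\<close>, because changing the point or the frame conjugates the matrix by an
  element of the special orthogonal group.\<close>

definition has_holonomy :: "nat \<Rightarrow> real mat \<Rightarrow> real mat set \<Rightarrow> bool" where
  "has_holonomy d g C \<longleftrightarrow>
     C \<in> conjugacy_classes (SO_group (d - 1)) \<and> (\<exists>A\<in>C. holonomy_matrix d g A)"

end

theory Submission
  imports Defs "Jordan_Normal_Form.Char_Poly"
begin

text \<open>Conjugating by the change of basis, \<open>g\<close> becomes an isometry \<open>G\<close> of the form \<open>Q\<close> that
  commensurates the group of integral isometries. Solutions of Pell equations over \<open>K\<close> provide
  integral isometries that rotate in a given rational plane; the algebra over \<open>K\<close> that their powers
  span is the whole matrix algebra, and conjugation by \<open>G\<close> maps it to itself. Hence the products of
  two entries of \<open>G\<close> are in \<open>K\<close>, and \<open>M = G\<^sup>2\<close> has entries in \<open>K\<close>. A power of \<open>M\<close> is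
  integral, so the characteristic polynomial of \<open>M\<close> has algebraic integers as coefficients.

  The eigenvalues of \<open>M\<close> have modulus at most \<open>lam\<^sup>2\<close>, and \<open>lam\<^sup>2\<close> is one of them. At the other
  embeddings of \<open>K\<close> the form is definite, so the eigenvalues of the conjugates of \<open>M\<close> are on the
  unit circle and \<open>lam\<^sup>2\<close> is not among them. Therefore a generator of \<open>K\<close> is the only common root of
  its minimal polynomial and a polynomial over the field generated by \<open>lam\<close>, and \<open>K\<close> is contained
  in that field. The coefficients thus have bounded degree and bounded conjugates, which leaves
  finitely many characteristic polynomials. The squares of the eigenvalues of the holonomy are
  among their roots, and the eigenvalues determine a conjugacy class in the special orthogonal group
  up to finitely many choices.\<close>

section \<open>Algebraic integers of bounded house\<close>

text \<open>Density theorems for arithmetic groups are avoided by working only with planes through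
  one fixed timelike vector a over K. For b orthogonal to a the number D = - q(a) q(b) is positive,
  while at every other embedding it is negative, because q is definite there. So D is not a square
  as soon as K is larger than the rationals, and the relative Pell equation has a nontrivial
  solution. Over the rationals D can be a square; then b is written as a difference of two vectors
  for which it is not. The Pell rotations have infinite order, and by commensurability some power of
  each stays integral after conjugation by G. Conjugation sees G only up to a scalar, so products of
  two entries are the best that can be expected from it: this is why G^2 appears instead of G. The
  price is that the eigenvalues of the holonomy are controlled up to sign, which still leaves
  finitely many. Passing from an orthogonal to a special orthogonal conjugacy class costs one more
  sign, the determinant of the conjugating matrix.\<close>

definition zspan :: "'a :: field_char_0 set \<Rightarrow> 'a set" where
  "zspan B = {\<Sum>b\<in>B. of_int (c b) * b | c. True}"

text \<open>The multiplier ring of the Z-module spanned by B. Integrality is tested by membership in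
  such a ring with B finite and 1 in B; closure under sums and products is then immediate.\<close>

definition stab :: "'a :: field_char_0 set \<Rightarrow> 'a set" where
  "stab B = {z. \<forall>b\<in>B. z * b \<in> zspan B}"

lemma zspan_0: "0 \<in> zspan B"
  unfolding zspan_def by (auto intro!: exI[of _ "\<lambda>_. 0"])

lemma zspan_add: "x \<in> zspan B \<Longrightarrow> y \<in> zspan B \<Longrightarrow> x + y \<in> zspan B"
  unfolding zspan_def
proof clarsimp
  fix c d
  show "\<exists>e. (\<Sum>b\<in>B. of_int (c b) * b) + (\<Sum>b\<in>B. of_int (d b) * b) = (\<Sum>b\<in>B. of_int (e b) * b)"
    by (rule exI[of _ "\<lambda>b. c b + d b"]) (simp add: sum.distrib algebra_simps)
qed

lemma zspan_scale: "x \<in> zspan B \<Longrightarrow> of_int k * x \<in> zspan B"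
  unfolding zspan_def
proof clarsimp
  fix c
  show "\<exists>e. of_int k * (\<Sum>b\<in>B. of_int (c b) * b) = (\<Sum>b\<in>B. of_int (e b) * b)"
    by (rule exI[of _ "\<lambda>b. k * c b"]) (simp add: sum_distrib_left algebra_simps)
qed

lemma zspan_uminus: "x \<in> zspan B \<Longrightarrow> - x \<in> zspan B"
  using zspan_scale[of x B "-1"] by simp

lemma zspan_base: "finite B \<Longrightarrow> b \<in> B \<Longrightarrow> b \<in> zspan B"
  unfolding zspan_def
proof clarify
  assume "finite B" "b \<in> B"
  then have "(\<Sum>x\<in>B. of_int (if x = b then 1 else 0) * x) = (\<Sum>x\<in>B. if x = b then b else 0)"
    by (intro sum.cong) auto
  with \<open>finite B\<close> \<open>b \<in> B\<close> show "\<exists>c. b = (\<Sum>x\<in>B. of_int (c x) * x) \<and> True"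
    by (intro exI[of _ "\<lambda>x. if x = b then 1 else 0"]) simp
qed

lemma zspan_sum: "(\<And>i. i \<in> I \<Longrightarrow> f i \<in> zspan B) \<Longrightarrow> sum f I \<in> zspan B"
  by (induction I rule: infinite_finite_induct) (auto simp: zspan_0 zspan_add)

lemma zspan_mult_closed:
  assumes "x \<in> zspan B" "\<And>b. b \<in> B \<Longrightarrow> z * b \<in> zspan C"
  shows "z * x \<in> zspan C"
proof -
  from assms(1) obtain c where "x = (\<Sum>b\<in>B. of_int (c b) * b)" unfolding zspan_def by auto
  then have "z * x = (\<Sum>b\<in>B. of_int (c b) * (z * b))" by (simp add: sum_distrib_left algebra_simps)
  then show ?thesis using assms(2) by (auto intro!: zspan_sum zspan_scale)
qed

lemma stab_add: "x \<in> stab B \<Longrightarrow> y \<in> stab B \<Longrightarrow> x + y \<in> stab B"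
  by (auto simp: stab_def distrib_right intro!: zspan_add)

lemma stab_mult: "x \<in> stab B \<Longrightarrow> y \<in> stab B \<Longrightarrow> x * y \<in> stab B"
  unfolding stab_def using zspan_mult_closed[of _ B x B] by (simp add: mult.assoc)

lemma stab_of_int: "finite B \<Longrightarrow> of_int k \<in> stab B"
  unfolding stab_def using zspan_scale[OF zspan_base] by blast

text \<open>The determinant trick: multiplication by \<open>z\<close> on the module is given by an integer matrix.\<close>

lemma stab_imp_algebraic_int:
  fixes z :: "'a :: field_char_0"
  assumes "finite B" "1 \<in> B" "z \<in> stab B"
  shows "algebraic_int z"
proof -
  obtain bs where bs: "set bs = B" "distinct bs" using finite_distinct_list[OF assms(1)] by auto
  define n where "n = length bs"
  have "\<forall>b\<in>B. \<exists>c. z * b = (\<Sum>b'\<in>B. of_int (c b') * b')"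
    using assms(3) by (auto simp: stab_def zspan_def)
  then obtain c where c: "\<And>b. b \<in> B \<Longrightarrow> z * b = (\<Sum>b'\<in>B. of_int (c b b') * b')" by metis
  define A :: "int mat" where "A = mat n n (\<lambda>(i,j). c (bs ! i) (bs ! j))"
  define A' :: "'a mat" where "A' = map_mat of_int A"
  define v where "v = vec n (\<lambda>i. bs ! i)"
  have A': "A' \<in> carrier_mat n n" and A: "A \<in> carrier_mat n n" by (auto simp: A'_def A_def)
  have "A' *\<^sub>v v = z \<cdot>\<^sub>v v"
  proof (rule eq_vecI)
    fix i assume "i < dim_vec (z \<cdot>\<^sub>v v)"
    then have i: "i < n" by (simp add: v_def)
    have "(A' *\<^sub>v v) $ i = (\<Sum>j = 0..<n. of_int (c (bs ! i) (bs ! j)) * bs ! j)"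
      using i by (simp add: A'_def A_def v_def mult_mat_vec_def scalar_prod_def)
    also have "\<dots> = (\<Sum>b'\<in>B. of_int (c (bs ! i) b') * b')"
      using bs by (intro sum.reindex_bij_betw bij_betw_nth) (auto simp: n_def)
    also have "\<dots> = z * bs ! i" using c[of "bs ! i"] bs i by (auto simp: n_def)
    finally show "(A' *\<^sub>v v) $ i = (z \<cdot>\<^sub>v v) $ i" using i by (simp add: v_def)
  qed (auto simp: A'_def A_def v_def)
  moreover have "v \<noteq> 0\<^sub>v n"
  proof
    assume *: "v = 0\<^sub>v n"
    obtain i where "i < n" "bs ! i = 1" using assms(2) bs by (metis in_set_conv_nth n_def)
    then have "v $ i = 1" by (simp add: v_def)
    with * \<open>i < n\<close> show False by simp
  qed
  ultimately have "eigenvalue A' z" using A'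
    unfolding eigenvalue_def eigenvector_def by (intro exI[of _ v]) (auto simp: v_def)
  then have "poly (char_poly A') z = 0" using eigenvalue_root_char_poly[OF A'] by simp
  moreover have "char_poly A' = map_poly of_int (char_poly A)"
    unfolding A'_def using of_int_hom.char_poly_hom[OF A] by simp
  ultimately show ?thesis
    using degree_monic_char_poly[OF A] by (auto simp: algebraic_int_altdef_ipoly)
qed

text \<open>The products b y^j with j below the degree span a module that everything in
  \<open>stab B\<close> still preserves. Multiplication by y leaves this spanning set only at the
  top power, which the monic equation rewrites. Coefficients in \<open>stab B\<close> instead of the
  integers make the step repeatable and give transitivity of integrality.\<close>

lemma stab_extend:
  fixes y :: "'a :: field_char_0"
  assumes fin: "finite B" and one: "1 \<in> B" and p: "lead_coeff p = 1" "poly p y = 0"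
    and cf: "\<And>i. coeff p i \<in> stab B"
  shows "\<exists>B'. finite B' \<and> 1 \<in> B' \<and> stab B \<subseteq> stab B' \<and> y \<in> stab B'"
proof -
  define N where "N = degree p"
  have "N > 0"
  proof (rule ccontr)
    assume "\<not> N > 0"
    then have "degree p = 0" by (simp add: N_def)
    then obtain a where "p = [:a:]" by (rule degree_eq_zeroE)
    with p show False by simp
  qed
  define B' where "B' = (\<lambda>(b,j). b * y ^ j) ` (B \<times> {..<N})"
  have fin': "finite B'" using fin by (simp add: B'_def)
  have "(1, 0) \<in> B \<times> {..<N}" using one \<open>N > 0\<close> by auto
  then have one': "1 \<in> B'" unfolding B'_def by force
  have mem: "b * y ^ j \<in> B'" if "b \<in> B" "j < N" for b j
    using that unfolding B'_def by force
  have *: "x * y ^ j \<in> zspan B'" if "x \<in> zspan B" "j < N" for x j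
  proof -
    have "y ^ j * x \<in> zspan B'"
      using that(1) by (rule zspan_mult_closed)
        (use mem[OF _ that(2)] fin' in \<open>auto intro!: zspan_base simp: mult.commute\<close>)
    then show ?thesis by (simp add: mult.commute)
  qed
  have "stab B \<subseteq> stab B'"
  proof
    fix z assume z: "z \<in> stab B"
    show "z \<in> stab B'" unfolding stab_def
    proof clarify
      fix x assume "x \<in> B'"
      then obtain b j where x: "x = b * y ^ j" "b \<in> B" "j < N" unfolding B'_def by auto
      have "z * b \<in> zspan B" using z x by (auto simp: stab_def)
      from *[OF this x(3)] show "z * x \<in> zspan B'" using x by (simp add: mult.assoc)
    qed
  qed
  moreover have "y \<in> stab B'" unfolding stab_def
  proof clarify
    fix x assume "x \<in> B'"
    then obtain b j where x: "x = b * y ^ j" "b \<in> B" "j < N" unfolding B'_def by auto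
    show "y * x \<in> zspan B'"
    proof (cases "Suc j < N")
      case True
      have "y * x = b * y ^ Suc j" using x by simp
      then show ?thesis using mem[OF x(2) True] fin' zspan_base by metis
    next
      case False
      then have j: "Suc j = N" using x by simp
      have "poly p y = (\<Sum>i<N. coeff p i * y ^ i) + y ^ N"
        using p by (simp add: poly_altdef N_def lessThan_Suc_atMost[symmetric])
      then have "y ^ N = - (\<Sum>i<N. coeff p i * y ^ i)" using p
          by (simp add: eq_neg_iff_add_eq_0 add.commute)
      then have "y * x = b * (- (\<Sum>i<N. coeff p i * y ^ i))"
        using x j by (metis mult.left_commute power_Suc)
      also have "\<dots> = - (\<Sum>i<N. (coeff p i * b) * y ^ i)"
        by (simp add: sum_distrib_left algebra_simps)
      also have "\<dots> \<in> zspan B'"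
        using cf x(2) by (intro zspan_uminus zspan_sum *) (auto simp: stab_def)
      finally show ?thesis .
    qed
  qed
  ultimately show ?thesis using fin' one' by blast
qed

lemma algebraic_ints_subset_stab:
  fixes X :: "'a :: field_char_0 set"
  assumes "finite X" "\<And>x. x \<in> X \<Longrightarrow> algebraic_int x"
  shows "\<exists>B. finite B \<and> 1 \<in> B \<and> X \<subseteq> stab B"
  using assms
proof (induction X)
  case empty
  show ?case by (rule exI[of _ "{1}"]) auto
next
  case (insert x X)
  then obtain B where B: "finite B" "1 \<in> B" "X \<subseteq> stab B" by auto
  from insert.prems have "algebraic_int x" by auto
  then obtain p where p: "lead_coeff p = 1" "\<forall>i. coeff p i \<in> \<int>" "poly p x = 0"
    by (auto simp: algebraic_int.simps)
  have "coeff p i \<in> stab B" for i using p(2) B(1) stab_of_int by (metis Ints_cases)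
  from stab_extend[OF B(1,2) p(1,3) this] show ?case using B(3) by blast
qed

lemma algebraic_int_plus:
  assumes "algebraic_int (x :: 'a :: field_char_0)" "algebraic_int y" shows "algebraic_int (x + y)"
proof -
  have "finite {x, y}" by simp
  from algebraic_ints_subset_stab[OF this] assms obtain B where
    "finite B" "1 \<in> B" "{x, y} \<subseteq> stab B" by auto
  then show ?thesis using stab_imp_algebraic_int[of B] stab_add[of x B y] by auto
qed

lemma algebraic_int_times:
  assumes "algebraic_int (x :: 'a :: field_char_0)" "algebraic_int y" shows "algebraic_int (x * y)"
proof -
  have "finite {x, y}" by simp
  from algebraic_ints_subset_stab[OF this] assms obtain B where
    "finite B" "1 \<in> B" "{x, y} \<subseteq> stab B" by auto
  then show ?thesis using stab_imp_algebraic_int[of B] stab_mult[of x B y] by auto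
qed

lemma algebraic_int_diff:
  "algebraic_int (x :: 'a :: field_char_0) \<Longrightarrow> algebraic_int y \<Longrightarrow> algebraic_int (x - y)"
  using algebraic_int_plus[of x "- y"] by auto

lemma algebraic_int_power: "algebraic_int (x :: 'a :: field_char_0) \<Longrightarrow> algebraic_int (x ^ k)"
  by (induction k) (auto intro: algebraic_int_times)

lemma algebraic_int_sum:
  "(\<And>i. i \<in> I \<Longrightarrow> algebraic_int (f i :: 'a :: field_char_0)) \<Longrightarrow> algebraic_int (sum f I)"
  by (induction I rule: infinite_finite_induct) (auto intro: algebraic_int_plus)

text \<open>The coefficients are placed in one common multiplier ring, to which the root is then
  adjoined.\<close>

lemma algebraic_int_root_monic:
  fixes y :: "'a :: field_char_0"
  assumes "lead_coeff p = 1" "poly p y = 0" "\<And>i. algebraic_int (coeff p i)"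
  shows "algebraic_int y"
proof -
  have "finite (coeff p ` {..degree p})" by simp
  from algebraic_ints_subset_stab[OF this] assms(3) obtain B where
    B: "finite B" "1 \<in> B" "coeff p ` {..degree p} \<subseteq> stab B" by auto
  have "coeff p i \<in> stab B" for i
  proof (cases "i \<le> degree p")
    case False
    then have "coeff p i = 0" by (simp add: coeff_eq_0)
    then show ?thesis using stab_of_int[OF B(1), of 0] by simp
  qed (use B in auto)
  from stab_extend[OF B(1,2) assms(1,2) this] show ?thesis using stab_imp_algebraic_int by blast
qed

section \<open>Coefficients and roots of monic polynomials\<close>

lemma coeff_prod_linear_algebraic_int:
  "(\<And>a. a \<in> set as \<Longrightarrow> algebraic_int (a :: 'a :: field_char_0)) \<Longrightarrow>
     algebraic_int (coeff (\<Prod>a\<leftarrow>as. [:- a, 1:]) i)"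
proof (induction as arbitrary: i)
  case Nil
  then show ?case by (cases i) auto
next
  case (Cons a as)
  have "coeff (\<Prod>a\<leftarrow>a # as. [:- a, 1:]) i =
    (case i of 0 \<Rightarrow> 0 | Suc j \<Rightarrow> coeff (\<Prod>a\<leftarrow>as. [:- a, 1:]) j) - a * coeff (\<Prod>a\<leftarrow>as. [:- a, 1:]) i"
    by (simp add: coeff_pCons split: nat.splits)
  then show ?case using Cons.IH Cons.prems
    by (auto intro!: algebraic_int_diff algebraic_int_times split: nat.splits)
qed

text \<open>Each linear factor X - a replaces a coefficient by a difference whose norm is at most 1
  + B times the previous bound.\<close>

lemma coeff_prod_linear_bound:
  assumes "\<And>a. a \<in> set as \<Longrightarrow> norm (a :: complex) \<le> B" "B \<ge> 0"
  shows "norm (coeff (\<Prod>a\<leftarrow>as. [:- a, 1:]) i) \<le> (1 + B) ^ length as"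
  using assms(1)
proof (induction as arbitrary: i)
  case Nil
  then show ?case by (cases i) auto
next
  case (Cons a as)
  let ?p = "\<Prod>a\<leftarrow>as. [:- a, 1:]"
  let ?c = "case i of 0 \<Rightarrow> 0 | Suc j \<Rightarrow> coeff ?p j"
  have 1: "coeff (\<Prod>a\<leftarrow>a # as. [:- a, 1:]) i = ?c - a * coeff ?p i"
    by (simp add: coeff_pCons split: nat.splits)
  have 2: "norm (?c - a * coeff ?p i) \<le> norm ?c + norm a * norm (coeff ?p i)"
    using norm_triangle_ineq4[of ?c "a * coeff ?p i"] by (simp only: norm_mult)
  have 3: "norm ?c \<le> (1 + B) ^ length as"
    using Cons.IH[of "i - 1"] Cons.prems assms(2) by (cases i) simp_all
  have 4: "norm a * norm (coeff ?p i) \<le> B * (1 + B) ^ length as"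
    by (rule mult_mono) (use Cons.IH[of i] Cons.prems assms(2) in simp_all)
  have 5: "(1 + B) ^ length (a # as) = (1 + B) ^ length as + B * (1 + B) ^ length as"
    by (simp add: distrib_right)
  show ?case unfolding 1 5 using 2 3 4 by linarith
qed

lemma monic_complex_factorization:
  assumes "lead_coeff (p :: complex poly) = 1"
  shows "\<exists>as. p = (\<Prod>a\<leftarrow>as. [:- a, 1:]) \<and> length as = degree p \<and> (\<forall>z. poly p z = 0 \<longleftrightarrow> z \<in> set as)"
proof -
  from fundamental_theorem_algebra_factorized[of p] assms
  obtain as where as: "p = (\<Prod>a\<leftarrow>as. [:- a, 1:])" by auto
  moreover have "length as = degree p"
    using degree_linear_factors[of uminus as] as by simp
  moreover have "poly p z = 0 \<longleftrightarrow> z \<in> set as" for z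
    unfolding as by (induction as) auto
  ultimately show ?thesis by blast
qed

lemma coeff_algebraic_int_if_roots:
  assumes "lead_coeff (p :: complex poly) = 1" "\<And>z. poly p z = 0 \<Longrightarrow> algebraic_int z"
  shows "algebraic_int (coeff p i)"
proof -
  obtain as where as: "p = (\<Prod>a\<leftarrow>as. [:- a, 1:])" "length as = degree p"
      "\<forall>z. poly p z = 0 \<longleftrightarrow> z \<in> set as"
    using monic_complex_factorization[OF assms(1)] by blast
  have "algebraic_int (coeff (\<Prod>a\<leftarrow>as. [:- a, 1:]) i)"
  proof (rule coeff_prod_linear_algebraic_int)
    fix a assume "a \<in> set as"
    then have "poly p a = 0" using as(3) by blast
    then show "algebraic_int a" by (rule assms(2))
  qed
  then show ?thesis by (simp only: as(1))
qed

lemma coeff_bound_if_roots: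
  assumes "lead_coeff (p :: complex poly) = 1" "\<And>z. poly p z = 0 \<Longrightarrow> norm z \<le> B" "B \<ge> 0"
  shows "norm (coeff p i) \<le> (1 + B) ^ degree p"
proof -
  obtain as where as: "p = (\<Prod>a\<leftarrow>as. [:- a, 1:])" "length as = degree p"
      "\<forall>z. poly p z = 0 \<longleftrightarrow> z \<in> set as"
    using monic_complex_factorization[OF assms(1)] by blast
  have "norm (coeff (\<Prod>a\<leftarrow>as. [:- a, 1:]) i) \<le> (1 + B) ^ length as"
    using as(3) assms(2,3) by (intro coeff_prod_linear_bound) auto
  then show ?thesis using as(1,2) by simp
qed

lemma finite_polys_coeffs_in:
  assumes "finite C"
  shows "finite {p :: 'a :: comm_monoid_add poly. degree p \<le> n \<and> (\<forall>i\<le>n. coeff p i \<in> C)}"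
proof (rule finite_subset)
  show "{p :: 'a poly. degree p \<le> n \<and> (\<forall>i\<le>n. coeff p i \<in> C)}
    \<subseteq> (\<lambda>f. \<Sum>i\<le>n. monom (f i) i) ` ({..n} \<rightarrow>\<^sub>E C)"
  proof clarify
    fix p :: "'a poly" assume p: "degree p \<le> n" "\<forall>i\<le>n. coeff p i \<in> C"
    have "p = (\<Sum>i\<le>n. monom (restrict (coeff p) {..n} i) i)"
      using poly_as_sum_of_monoms'[OF p(1)] by simp
    moreover have "restrict (coeff p) {..n} \<in> {..n} \<rightarrow>\<^sub>E C"
      using p(2) by auto
    ultimately show "p \<in> (\<lambda>f. \<Sum>i\<le>n. monom (f i) i) ` ({..n} \<rightarrow>\<^sub>E C)" by blast
  qed
qed (use assms in \<open>auto intro!: finite_PiE\<close>)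

text \<open>The house of an algebraic integer is the largest modulus of its conjugates. The witness
  p need not be irreducible: its roots contain all conjugates of z, and any monic integer
  polynomial, such as a characteristic polynomial, can serve.\<close>

definition bounded_house :: "nat \<Rightarrow> real \<Rightarrow> complex set" where
  "bounded_house s B = {z. \<exists>p :: int poly. lead_coeff p = 1 \<and> degree p \<le> s \<and>
     poly (map_poly of_int p) z = 0 \<and> (\<forall>y. poly (map_poly of_int p) y = 0 \<longrightarrow> cmod y \<le> B)}"

text \<open>Northcott's argument: the bound on the roots bounds the integer coefficients by (1 +
  B)^s, so finitely many polynomials of degree at most s occur, each with finitely many
  roots.\<close>

lemma finite_bounded_house:
  assumes "B \<ge> 0"
  shows "finite (bounded_house s B)"
proof -
  define M where "M = \<lceil>(1 + B) ^ s\<rceil>"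
  define S where "S = {p :: int poly. degree p \<le> s \<and> (\<forall>i\<le>s. coeff p i \<in> {-M..M})}"
  have "bounded_house s B \<subseteq> (\<Union>p\<in>S - {0}. {z. poly (map_poly of_int p) z = 0})"
  proof
    fix z assume "z \<in> bounded_house s B"
    then obtain p :: "int poly" where p: "lead_coeff p = 1" "degree p \<le> s"
      "poly (map_poly of_int p) z = 0" "\<And>y :: complex. poly (map_poly of_int p) y = 0 \<Longrightarrow> cmod y \<le> B"
      by (auto simp: bounded_house_def)
    have "\<bar>coeff p i\<bar> \<le> M" for i
    proof -
      have "cmod (coeff (map_poly of_int p) i) \<le> (1 + B) ^ degree (map_poly of_int p :: complex
          poly)"
        using p assms by (intro coeff_bound_if_roots) auto
      also have "\<dots> \<le> (1 + B) ^ s" using p(2) assms by (intro power_increasing) auto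
      finally have "of_int \<bar>coeff p i\<bar> \<le> (1 + B) ^ s" by simp
      then show ?thesis unfolding M_def by linarith
    qed
    then have "coeff p i \<in> {-M..M}" for i by (metis abs_le_iff atLeastAtMost_iff minus_le_iff)
    then have "p \<in> S - {0}" using p(1,2) by (auto simp: S_def)
    then show "z \<in> (\<Union>p\<in>S - {0}. {z. poly (map_poly of_int p) z = 0})" using p(3) by blast
  qed
  moreover have "finite (\<Union>p\<in>S - {0}. {z :: complex. poly (map_poly of_int p) z = 0})"
    using finite_polys_coeffs_in[of "{-M..M}" s] by (auto simp: S_def intro!: poly_roots_finite)
  ultimately show ?thesis by (rule finite_subset)
qed

section \<open>Subfields of the reals and their conjugates\<close>

definition subfield_set :: "'a :: field set \<Rightarrow> bool" where
  "subfield_set S \<longleftrightarrow> 0 \<in> S \<and> 1 \<in> S \<and>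
     (\<forall>x\<in>S. \<forall>y\<in>S. x + y \<in> S \<and> x - y \<in> S \<and> x * y \<in> S) \<and> (\<forall>x\<in>S. inverse x \<in> S)"

lemma subfield_setD:
  assumes "subfield_set S"
  shows "0 \<in> S" "1 \<in> S" "x \<in> S \<Longrightarrow> y \<in> S \<Longrightarrow> x + y \<in> S" "x \<in> S \<Longrightarrow> y \<in> S \<Longrightarrow> x - y \<in> S"
    "x \<in> S \<Longrightarrow> y \<in> S \<Longrightarrow> x * y \<in> S" "x \<in> S \<Longrightarrow> inverse x \<in> S" "x \<in> S \<Longrightarrow> y \<in> S \<Longrightarrow> x / y \<in> S"
    "x \<in> S \<Longrightarrow> - x \<in> S" "x \<in> S \<Longrightarrow> x ^ k \<in> S"
proof -
  show *: "0 \<in> S" "1 \<in> S" "x \<in> S \<Longrightarrow> y \<in> S \<Longrightarrow> x + y \<in> S" "x \<in> S \<Longrightarrow> y \<in> S \<Longrightarrow> x - y \<in> S"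
    "x \<in> S \<Longrightarrow> y \<in> S \<Longrightarrow> x * y \<in> S" "x \<in> S \<Longrightarrow> inverse x \<in> S" for x y
    using assms by (auto simp: subfield_set_def)
  show "x \<in> S \<Longrightarrow> y \<in> S \<Longrightarrow> x / y \<in> S" using * by (simp add: divide_inverse)
  show "x \<in> S \<Longrightarrow> - x \<in> S" using *(4)[of 0 x] *(1) by simp
  show "x \<in> S \<Longrightarrow> x ^ k \<in> S" using * by (induction k) auto
qed

lemma subfield_set_sum:
  "subfield_set S \<Longrightarrow> (\<And>i. i \<in> I \<Longrightarrow> f i \<in> S) \<Longrightarrow> sum f I \<in> S"
  by (induction I rule: infinite_finite_induct) (auto intro: subfield_setD)

lemma subfield_set_prod:
  "subfield_set S \<Longrightarrow> (\<And>i. i \<in> I \<Longrightarrow> f i \<in> S) \<Longrightarrow> prod f I \<in> S"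
  by (induction I rule: infinite_finite_induct) (auto intro: subfield_setD)

lemma subfield_set_of_nat: "subfield_set S \<Longrightarrow> of_nat k \<in> S"
  by (induction k) (auto intro: subfield_setD)

lemma subfield_set_of_int:
  assumes "subfield_set S" shows "of_int k \<in> S"
proof (cases "k \<ge> 0")
  case True
  then show ?thesis using subfield_set_of_nat[OF assms, of "nat k"] by simp
next
  case False
  then show ?thesis using subfield_setD(8)[OF assms subfield_set_of_nat[OF assms,
      of "nat (- k)"]] by simp
qed

lemma subfield_set_of_rat:
  fixes S :: "'a :: field_char_0 set"
  assumes "subfield_set S" shows "of_rat q \<in> S"
proof -
  obtain a b where "q = Rat.Fract a b" "b > 0" using Rat_cases by blast
  then have "of_rat q = (of_int a / of_int b :: 'a)" by (simp add: of_rat_rat)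
  then show ?thesis using subfield_setD(7)[OF assms] subfield_set_of_int[OF assms] by simp
qed

text \<open>A polynomial over the subfield stays a polynomial over the ambient field, so that its
  roots there can be discussed without changing the type.\<close>

definition polys_over :: "'a :: comm_ring_1 set \<Rightarrow> 'a poly set" where
  "polys_over S = {p. \<forall>i. coeff p i \<in> S}"

lemma polys_overD: "p \<in> polys_over S \<Longrightarrow> coeff p i \<in> S"
  by (simp add: polys_over_def)

lemma polys_over_closed:
  assumes S: "subfield_set S"
  shows "0 \<in> polys_over S" "1 \<in> polys_over S" "p \<in> polys_over S \<Longrightarrow> q \<in> polys_over S \<Longrightarrow>
      p + q \<in> polys_over S"
    "p \<in> polys_over S \<Longrightarrow> q \<in> polys_over S \<Longrightarrow> p - q \<in> polys_over S"
    "p \<in> polys_over S \<Longrightarrow> q \<in> polys_over S \<Longrightarrow> p * q \<in> polys_over S"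
    "c \<in> S \<Longrightarrow> monom c k \<in> polys_over S"
    "c \<in> S \<Longrightarrow> p \<in> polys_over S \<Longrightarrow> smult c p \<in> polys_over S"
  using subfield_setD[OF S]
  by (auto simp: polys_over_def coeff_mult intro!: subfield_set_sum[OF S])

text \<open>Each step of long division divides only by the leading coefficient of q, which lies in
  S. The induction is on a bound for the degree of p.\<close>

lemma polys_over_division:
  assumes S: "subfield_set S" and q: "q \<in> polys_over S" "q \<noteq> 0" and p: "p \<in> polys_over S"
  shows "\<exists>k\<in>polys_over S. \<exists>r\<in>polys_over S. p = k * q + r \<and> (r = 0 \<or> degree r < degree q)"
proof -
  have "p = 0 \<or> degree p < n \<Longrightarrow> p \<in> polys_over S \<Longrightarrow>
     \<exists>k\<in>polys_over S. \<exists>r\<in>polys_over S. p = k * q + r \<and> (r = 0 \<or> degree r < degree q)" for n p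
  proof (induction n arbitrary: p)
    case 0
    then show ?case using polys_over_closed(1)[OF S] by (intro bexI[of _ 0]) auto
  next
    case (Suc n)
    show ?case
    proof (cases "p = 0 \<or> degree p < degree q")
      case True
      then show ?thesis using polys_over_closed(1)[OF S] Suc.prems
        by (intro bexI[of _ 0] bexI[of _ p]) auto
    next
      case False
      define c where "c = lead_coeff p / lead_coeff q"
      define t where "t = monom c (degree p - degree q)"
      define p' where "p' = p - t * q"
      have c: "c \<in> S" "c \<noteq> 0" using False q polys_overD[OF q(1)] polys_overD[OF Suc.prems(2)]
        by (auto simp: c_def intro!: subfield_setD(7)[OF S])
      have t: "t \<in> polys_over S" unfolding t_def by (rule polys_over_closed(6)[OF S c(1)])
      have p': "p' \<in> polys_over S" unfolding p'_def
        by (intro polys_over_closed(4,5)[OF S] t q Suc.prems)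
      have t0: "t \<noteq> 0" "degree t = degree p - degree q"
        using c by (simp_all add: t_def degree_monom_eq)
      have dtq: "degree (t * q) = degree p" using t0 q False by (simp add: degree_mult_eq)
      have "degree p' \<le> degree p" unfolding p'_def using degree_diff_le_max[of p "t * q"] dtq
          by simp
      moreover have "coeff (t * q) (degree p) = lead_coeff p"
      proof -
        have "lead_coeff (t * q) = c * lead_coeff q"
          unfolding lead_coeff_mult t0(2) using t0(2) by (simp add: t_def)
        then show ?thesis using q(2) dtq by (simp add: c_def)
      qed
      then have "coeff p' (degree p) = 0" by (simp add: p'_def)
      ultimately have "p' = 0 \<or> degree p' < degree p"
        by (metis le_neq_implies_less leading_coeff_0_iff)
      then have "p' = 0 \<or> degree p' < n" using Suc.prems(1) False by auto
      from Suc.IH[OF this p'] obtain k r where kr: "k \<in> polys_over S" "r \<in> polys_over S"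
        "p' = k * q + r" "r = 0 \<or> degree r < degree q" by blast
      have "p = (k + t) * q + r" using kr(3) by (simp add: p'_def algebra_simps)
      then show ?thesis using kr t polys_over_closed(3)[OF S kr(1) t] by blast
    qed
  qed
  from this[of p "Suc (degree p)"] p show ?thesis by auto
qed

text \<open>A nonzero element of least degree in the ideal generated by p and q divides everything
  in the ideal; normalising it keeps its coefficients in S.\<close>

lemma polys_over_bezout:
  assumes S: "subfield_set S" and pq: "p \<in> polys_over S" "q \<in> polys_over S" "p \<noteq> 0"
  shows "\<exists>g\<in>polys_over S. \<exists>u\<in>polys_over S. \<exists>v\<in>polys_over S.
    g = u * p + v * q \<and> g dvd p \<and> g dvd q \<and> lead_coeff g = 1"
proof -
  define I where "I = {u * p + v * q | u v. u \<in> polys_over S \<and> v \<in> polys_over S}"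
  have sub: "I \<subseteq> polys_over S" unfolding I_def
    using pq by (auto intro!: polys_over_closed[OF S])
  have pI: "p \<in> I" unfolding I_def using polys_over_closed(1,2)[OF S]
    by (intro CollectI exI[of _ 1] exI[of _ 0]) auto
  have qI: "q \<in> I" unfolding I_def using polys_over_closed(1,2)[OF S]
    by (intro CollectI exI[of _ 0] exI[of _ 1]) auto
  define P where "P = (\<lambda>h. h \<in> I \<and> h \<noteq> 0)"
  have "P p" using pI pq by (simp add: P_def)
  then obtain h where h: "P h" "\<And>h'. P h' \<Longrightarrow> degree h \<le> degree h'"
    using ex_has_least_nat[of P p degree] by blast
  have hI: "h \<in> I" "h \<noteq> 0" using h(1) by (auto simp: P_def)
  have dvd: "h dvd f" if f: "f \<in> I" for f
  proof -
    have fh: "f \<in> polys_over S" "h \<in> polys_over S" using f hI sub by auto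
    obtain k r where kr: "k \<in> polys_over S" "r \<in> polys_over S" "f = k * h + r"
        "r = 0 \<or> degree r < degree h"
      using polys_over_division[OF S fh(2) hI(2) fh(1)] by blast
    obtain u v where uv: "u \<in> polys_over S" "v \<in> polys_over S" "h = u * p + v * q" using hI
        by (auto simp: I_def)
    obtain u' v' where uv': "u' \<in> polys_over S" "v' \<in> polys_over S" "f = u' * p + v' * q" using f
        by (auto simp: I_def)
    have "r = (u' - k * u) * p + (v' - k * v) * q" using kr(3) uv(3) uv'(3)
        by (simp add: algebra_simps)
    moreover have "u' - k * u \<in> polys_over S" "v' - k * v \<in> polys_over S"
      using uv uv' kr by (auto intro!: polys_over_closed[OF S])
    ultimately have "r \<in> I" unfolding I_def by blast
    then have "r \<noteq> 0 \<Longrightarrow> degree h \<le> degree r" using h(2)[of r] by (simp add: P_def)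
    then have "r = 0" using kr(4) by linarith
    then show ?thesis using kr(3) by simp
  qed
  define c where "c = inverse (lead_coeff h)"
  have c: "c \<in> S" "c \<noteq> 0" using hI sub polys_overD[of h S]
      by (auto simp: c_def intro!: subfield_setD(6)[OF S])
  obtain u v where uv: "u \<in> polys_over S" "v \<in> polys_over S" "h = u * p + v * q" using hI
      by (auto simp: I_def)
  have "smult c h = smult c u * p + smult c v * q" by (simp add: uv(3) smult_add_right)
  moreover have "smult c h \<in> polys_over S" "smult c u \<in> polys_over S" "smult c v \<in> polys_over S"
    using uv(1,2) c hI(1) sub by (auto intro!: polys_over_closed(7)[OF S])
  moreover have "smult c h dvd p" "smult c h dvd q" using dvd pI qI c by (auto simp: smult_dvd_iff)
  moreover have "lead_coeff (smult c h) = 1" using hI by (simp add: c_def)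
  ultimately show ?thesis by blast
qed

interpretation of_real_poly_hom: map_poly_inj_idom_hom complex_of_real ..

interpretation of_rat_poly_hom: map_poly_inj_idom_hom "of_rat :: rat \<Rightarrow> 'a :: field_char_0" ..

lemma polys_over_UNIV: "p \<in> polys_over UNIV"
  by (simp add: polys_over_def)

text \<open>The greatest common divisor of two polynomials over a subfield is again over the subfield.\<close>

lemma common_root_in_subfield:
  fixes S :: "real set" and p q :: "real poly"
  assumes S: "subfield_set S" and pq: "p \<in> polys_over S" "q \<in> polys_over S" "p \<noteq> 0"
    and simple: "\<And>z. poly (map_poly complex_of_real p) z = 0 \<Longrightarrow>
        poly (map_poly complex_of_real (pderiv p)) z \<noteq> 0"
    and root: "poly p x = 0" "poly q x = 0"
    and uniq: "\<And>z. poly (map_poly complex_of_real p) z = 0 \<Longrightarrow> poly (map_poly complex_of_real q) z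
        = 0 \<Longrightarrow> z = of_real x"
  shows "x \<in> S"
proof -
  obtain g u v where g: "g \<in> polys_over S" "g = u * p + v * q" "g dvd p" "g dvd q"
      "lead_coeff g = 1"
    using polys_over_bezout[OF S pq] by blast
  let ?c = "map_poly complex_of_real"
  have gx: "poly g x = 0" using root by (simp add: g(2))
  have "lead_coeff (?c g) = 1" using g(5) by simp
  then obtain as where as: "?c g = (\<Prod>a\<leftarrow>as. [:- a, 1:])" "length as = degree (?c g)"
    "\<forall>z. poly (?c g) z = 0 \<longleftrightarrow> z \<in> set as"
    using monic_complex_factorization by blast
  obtain p' where p': "p = g * p'" using g(3) by (auto elim: dvdE)
  obtain q' where q': "q = g * q'" using g(4) by (auto elim: dvdE)
  have all: "z = of_real x" if "z \<in> set as" for z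
    using uniq[of z] as(3) that by (auto simp: p' q' hom_distribs)
  have "length as \<noteq> 0"
  proof
    assume "length as = 0"
    then have "degree g = 0" using as(2) by simp
    then obtain a where "g = [:a:]" by (rule degree_eq_zeroE)
    then show False using g(5) gx by simp
  qed
  \<comment> \<open>All roots of g equal x, so two of them would make x a double root of p, which
    \<open>simple\<close> forbids. Hence g is X - x, and x is minus its constant
    coefficient.\<close>
  moreover have "length as < 2"
  proof (rule ccontr)
    assume "\<not> length as < 2"
    then obtain a b bs where abs: "as = a # b # bs" by (cases as rule: remdups_adj.cases) auto
    then have ab: "a = of_real x" "b = of_real x" using all by auto
    have "?c p = ?c g * ?c p'" by (simp add: p' hom_distribs)
    then have *: "?c p = [:- of_real x, 1:] * ([:- of_real x, 1:] * ((\<Prod>a\<leftarrow>bs. [:- a, 1:]) * ?c p'))"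
      unfolding as(1) abs ab by (simp only: list.map prod_list.Cons mult.assoc)
    have "poly (pderiv (?c p)) (of_real x) = 0" unfolding * pderiv_mult[of "[:- of_real x, 1:]"]
        by simp
    moreover have "pderiv (?c p) = ?c (pderiv p)" by (simp add: of_real_hom.map_poly_pderiv)
    ultimately show False using simple[of "of_real x"] root by (simp add: of_real_hom.poly_map_poly)
  qed
  ultimately have "length as = 1" by linarith
  then have "degree g = 1" using as(2) by simp
  then have "g = [:coeff g 0, 1:]"
    using g(5) by (intro poly_eqI) (auto simp: coeff_pCons coeff_eq_0 split: nat.splits)
  then have "poly [:coeff g 0, 1:] x = 0" using gx by simp
  then have "x = - coeff g 0" by simp
  then show ?thesis using polys_overD[OF g(1)] subfield_setD(8)[OF S] by auto
qed


text \<open>One rational polynomial is evaluated in several fields: at the real generator of K and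
  at its real and complex conjugates. Embeddings of K are handled through this change of
  argument.\<close>

definition reval :: "rat poly \<Rightarrow> 'a :: field_char_0 \<Rightarrow> 'a" where
  "reval p x = poly (map_poly of_rat p) x"

interpretation reval_hom: comm_ring_hom "\<lambda>p. reval p x" for x :: "'a :: field_char_0"
  by unfold_locales (auto simp: reval_def hom_distribs)

lemma reval_add: "reval (p + q) x = reval p x + reval q x"
  and reval_diff: "reval (p - q) x = reval p x - reval q x"
  and reval_mult: "reval (p * q) x = reval p x * reval q x"
  and reval_power: "reval (p ^ k) x = reval p x ^ k"
  and reval_sum: "reval (sum f I) x = (\<Sum>i\<in>I. reval (f i) x)"
  by (simp_all add: hom_distribs)

lemma reval_smult: "reval (smult c p) x = of_rat c * reval p x"
  by (simp add: reval_def hom_distribs)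

lemma reval_simps [simp]:
  "reval 0 x = 0" "reval 1 x = 1" "reval [:c:] x = of_rat c" "reval [:0, 1:] x = x"
  "reval (monom c k) x = of_rat c * x ^ k"
  by (simp_all add: reval_def hom_distribs poly_monom)

lemma reval_pCons: "reval (pCons c p) x = of_rat c + x * reval p x"
  by (simp add: reval_def hom_distribs)

lemma of_real_of_rat: "of_real (of_rat a) = (of_rat a :: 'a :: real_field)"
proof -
  obtain p q where "a = Rat.Fract p q" "q > 0" using Rat_cases by blast
  then show ?thesis by (simp add: of_rat_rat)
qed

lemma reval_of_real: "reval p (of_real x :: 'a :: real_field) = of_real (reval p x)"
  by (induction p) (simp_all add: reval_pCons of_real_of_rat)

lemma reval_altdef: "degree p < n \<Longrightarrow> reval p x = (\<Sum>i<n. of_rat (coeff p i) * x ^ i)"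
proof -
  assume n: "degree p < n"
  have "reval p x = (\<Sum>i\<le>degree p. of_rat (coeff p i) * x ^ i)"
    by (simp add: reval_def poly_altdef)
  also have "\<dots> = (\<Sum>i<n. of_rat (coeff p i) * x ^ i)"
    using n by (intro sum.mono_neutral_left) (auto simp: coeff_eq_0)
  finally show ?thesis .
qed

lemma subfield_set_reval: "subfield_set S \<Longrightarrow> x \<in> S \<Longrightarrow> reval p x \<in> S"
  by (induction p) (auto simp: reval_pCons intro!: subfield_setD subfield_set_of_rat)

text \<open>Irreducibility is encoded as divisibility of every annihilating polynomial, the form in
  which it is applied.\<close>

definition minpoly :: "'a :: field_char_0 \<Rightarrow> rat poly \<Rightarrow> bool" where
  "minpoly x m \<longleftrightarrow> lead_coeff m = 1 \<and> reval m x = 0 \<and> (\<forall>h. reval h x = 0 \<longrightarrow> m dvd h)"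

lemma subfield_set_UNIV: "subfield_set (UNIV :: 'a :: field set)"
  by (simp add: subfield_set_def)

lemma minpoly_exists:
  assumes "p \<noteq> 0" "reval p x = 0"
  shows "\<exists>m. minpoly x m"
proof -
  define P where "P = (\<lambda>h. reval h x = 0 \<and> h \<noteq> 0)"
  have "P p" using assms by (simp add: P_def)
  then obtain h where h: "P h" "\<And>h'. P h' \<Longrightarrow> degree h \<le> degree h'"
    using ex_has_least_nat[of P p degree] by blast
  define m where "m = smult (inverse (lead_coeff h)) h"
  have h0: "h \<noteq> 0" "reval h x = 0" using h(1) by (auto simp: P_def)
  have dm: "degree m = degree h" "m \<noteq> 0" "reval m x = 0" using h0
      by (simp_all add: m_def reval_smult)
  have "m dvd f" if f: "reval f x = 0" for f
  proof -
    obtain k r where kr: "f = k * m + r" "r = 0 \<or> degree r < degree m"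
        using polys_over_division[OF subfield_set_UNIV polys_over_UNIV dm(2) polys_over_UNIV]
            by blast
    have "reval r x = 0" using f dm(3) by (simp add: kr(1) reval_add reval_mult)
    then have "r \<noteq> 0 \<Longrightarrow> degree h \<le> degree r" using h(2)[of r] by (simp add: P_def)
    then have "r = 0" using kr(2) dm(1) by linarith
    then show ?thesis using kr(1) by simp
  qed
  then have "minpoly x m" using dm h0 unfolding minpoly_def by (simp add: m_def)
  then show ?thesis ..
qed

lemma minpoly_degree_pos: "minpoly x m \<Longrightarrow> degree m > 0"
proof (rule ccontr)
  assume m: "minpoly x m" "\<not> degree m > 0"
  then have "degree m = 0" by simp
  then obtain a where "m = [:a:]" by (rule degree_eq_zeroE)
  then show False using m by (auto simp: minpoly_def)
qed

text \<open>Write m = g e with g a monic common divisor of m and h. As h does not vanish at x,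
  neither does g; so e vanishes there, m divides e, and g is constant.\<close>

lemma minpoly_bezout:
  assumes m: "minpoly x m" and h: "reval h x \<noteq> 0"
  shows "\<exists>u v. u * m + v * h = 1"
proof -
  have m0: "m \<noteq> 0" using m by (auto simp: minpoly_def)
  obtain g u v where g: "g = u * m + v * h" "g dvd m" "g dvd h" "lead_coeff g = 1"
    using polys_over_bezout[OF subfield_set_UNIV polys_over_UNIV polys_over_UNIV m0] by blast
  obtain e where e: "m = g * e" using g(2) by (auto elim: dvdE)
  have "reval g x \<noteq> 0" using g(3) h by (auto elim!: dvdE simp: reval_mult)
  then have "reval e x = 0" using m e by (auto simp: minpoly_def reval_mult)
  then obtain k where k: "e = m * k" using m by (auto simp: minpoly_def elim: dvdE)
  then have "m * 1 = m * (g * k)" using e by (simp add: mult.left_commute)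
  then have "g * k = 1" using m0 by (metis mult_left_cancel)
  then have "degree g = 0"
    by (metis degree_1 degree_mult_eq add_is_0 mult_zero_left mult_zero_right zero_neq_one)
  then obtain a where "g = [:a:]" by (rule degree_eq_zeroE)
  then have "g = 1" using g(4) by (simp add: one_pCons)
  then show ?thesis using g(1) by metis
qed

text \<open>This makes evaluation at y well defined on the field generated by x and moves matrix
  identities to conjugate matrices. For the converse direction a Bezout identity u m + v h = 1,
  evaluated at y, would give 0 = 1.\<close>

lemma minpoly_conjugate:
  fixes y :: "'b :: field_char_0"
  assumes m: "minpoly x m" and y: "reval m y = 0"
  shows "reval h x = 0 \<longleftrightarrow> reval h y = 0"
proof
  assume "reval h x = 0"
  then show "reval h y = 0" using m y by (auto simp: minpoly_def reval_mult elim!: dvdE)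
next
  assume hy: "reval h y = 0"
  show "reval h x = 0"
  proof (rule ccontr)
    assume "reval h x \<noteq> 0"
    from minpoly_bezout[OF m this] obtain u v where "u * m + v * h = 1" by blast
    then have "reval (u * m + v * h) y = 1" by simp
    then show False using y hy by (simp add: reval_add reval_mult)
  qed
qed

text \<open>In characteristic 0 the derivative is nonzero and of smaller degree, so it does not
  vanish at x, hence not at the conjugate y either.\<close>

lemma minpoly_simple_roots:
  fixes y :: "'b :: field_char_0"
  assumes m: "minpoly x m" and y: "reval m y = 0"
  shows "reval (pderiv m) y \<noteq> 0"
proof -
  have "reval (pderiv m) x \<noteq> 0"
  proof
    assume "reval (pderiv m) x = 0"
    then have "m dvd pderiv m" using m by (auto simp: minpoly_def)
    moreover have "pderiv m \<noteq> 0" using minpoly_degree_pos[OF m] by (simp add: pderiv_eq_0_iff)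
    ultimately have "degree m \<le> degree (pderiv m)" by (rule dvd_imp_degree_le)
    then show False using minpoly_degree_pos[OF m] by (simp add: degree_pderiv)
  qed
  then show ?thesis using minpoly_conjugate[OF m y] by blast
qed

section \<open>Simple extensions of the rationals and their degrees\<close>

definition adjoin :: "'a :: field_char_0 \<Rightarrow> 'a set" where
  "adjoin x = range (\<lambda>p. reval p x)"

lemma subfield_set_adjoin:
  assumes m: "minpoly x m"
  shows "subfield_set (adjoin x)"
  unfolding subfield_set_def
proof (intro conjI ballI)
  show "0 \<in> adjoin x" unfolding adjoin_def by (rule range_eqI[of _ _ 0]) simp
  show "1 \<in> adjoin x" unfolding adjoin_def by (rule range_eqI[of _ _ 1]) simp
next
  fix a b assume "a \<in> adjoin x" "b \<in> adjoin x"
  then obtain p q where "a = reval p x" "b = reval q x" by (auto simp: adjoin_def)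
  then have "a + b = reval (p + q) x" "a - b = reval (p - q) x" "a * b = reval (p * q) x"
    by (simp_all add: reval_add reval_diff reval_mult)
  then show "a + b \<in> adjoin x" "a - b \<in> adjoin x" "a * b \<in> adjoin x" unfolding adjoin_def by blast+
next
  fix a assume "a \<in> adjoin x"
  then obtain p where p: "a = reval p x" by (auto simp: adjoin_def)
  show "inverse a \<in> adjoin x"
  proof (cases "a = 0")
    case True
    then show ?thesis unfolding adjoin_def by (intro range_eqI[of _ _ 0]) simp
  next
    case False
    then obtain u v where "u * m + v * p = 1" using minpoly_bezout[OF m] p by blast
    then have "reval (u * m + v * p) x = 1" by simp
    then have "reval v x * a = 1" using m p by (simp add: minpoly_def reval_add reval_mult)
    then have "inverse a = reval v x" by (metis inverse_unique mult.commute)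
    then show ?thesis unfolding adjoin_def by blast
  qed
qed

lemma adjoin_self: "x \<in> adjoin x"
  unfolding adjoin_def by (rule range_eqI[of _ _ "[:0, 1:]"]) simp

text \<open>A zero column is appended to the coefficient matrix so that it becomes square and
  singular; a kernel vector of its transpose is the relation sought.\<close>

lemma rational_dependence:
  fixes w :: "nat \<Rightarrow> 'a :: field_char_0"
  assumes "\<And>j. j \<le> N \<Longrightarrow> \<exists>c :: nat \<Rightarrow> rat. w j = (\<Sum>i<N. of_rat (c i) * v i)"
  shows "\<exists>a :: nat \<Rightarrow> rat. (\<exists>j\<le>N. a j \<noteq> 0) \<and> (\<Sum>j\<le>N. of_rat (a j) * w j) = 0"
proof -
  from assms have "\<forall>j. \<exists>c :: nat \<Rightarrow> rat. j \<le> N \<longrightarrow> w j = (\<Sum>i<N. of_rat (c i) * v i)" by blast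
  then obtain c :: "nat \<Rightarrow> nat \<Rightarrow> rat" where
    c: "\<And>j. j \<le> N \<Longrightarrow> w j = (\<Sum>i<N. of_rat (c j i) * v i)" by metis
  define A :: "rat mat" where "A = mat (Suc N) (Suc N) (\<lambda>(j,i). if i < N then c j i else 0)"
  have A: "A \<in> carrier_mat (Suc N) (Suc N)" by (simp add: A_def)
  have "A *\<^sub>v unit_vec (Suc N) N = 0\<^sub>v (Suc N)"
    by (rule eq_vecI) (auto simp: A_def mult_mat_vec_def scalar_prod_def unit_vec_def if_distrib
        cong: if_cong)
  then have "det A = 0"
    using det_0_iff_vec_prod_zero[OF A] by (auto intro!: exI[of _ "unit_vec (Suc N) N"])
  then have "det (A\<^sup>T) = 0" using det_transpose[OF A] by simp
  then obtain u where u: "u \<in> carrier_vec (Suc N)" "u \<noteq> 0\<^sub>v (Suc N)" "A\<^sup>T *\<^sub>v u = 0\<^sub>v (Suc N)"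
    using det_0_iff_vec_prod_zero[of "A\<^sup>T" "Suc N"] A by auto
  have row: "(\<Sum>j\<le>N. u $ j * c j i) = 0" if "i < N" for i
  proof -
    have "(A\<^sup>T *\<^sub>v u) $ i = 0" using u(3) that by simp
    moreover have "(A\<^sup>T *\<^sub>v u) $ i = (\<Sum>j<Suc N. c j i * u $ j)"
      using that u(1) by (simp add: A_def mult_mat_vec_def scalar_prod_def atLeast0LessThan)
    ultimately show ?thesis by (simp add: lessThan_Suc_atMost mult.commute)
  qed
  have "(\<Sum>j\<le>N. of_rat (u $ j) * w j) = (\<Sum>j\<le>N. \<Sum>i<N. of_rat (u $ j * c j i) * v i)"
    by (intro sum.cong) (auto simp: c sum_distrib_left of_rat_mult mult.assoc)
  also have "\<dots> = (\<Sum>i<N. of_rat (\<Sum>j\<le>N. u $ j * c j i) * v i)"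
    by (subst sum.swap) (simp add: of_rat_sum sum_distrib_right)
  also have "\<dots> = 0" using row by simp
  finally have "(\<Sum>j\<le>N. of_rat (u $ j) * w j) = 0" .
  moreover have "\<exists>j\<le>N. u $ j \<noteq> 0"
  proof (rule ccontr)
    assume "\<not> (\<exists>j\<le>N. u $ j \<noteq> 0)"
    then have "u = 0\<^sub>v (Suc N)" using u(1) by (intro eq_vecI) auto
    then show False using u(2) by simp
  qed
  ultimately show ?thesis by (intro exI[of _ "\<lambda>j. u $ j"]) simp
qed

lemma degree_minpoly_le:
  assumes m: "minpoly x m"
    and span: "\<And>j. \<exists>c :: nat \<Rightarrow> rat. x ^ j = (\<Sum>i<N. of_rat (c i) * v i)"
  shows "degree m \<le> N"
proof -
  obtain a :: "nat \<Rightarrow> rat" where a: "\<exists>j\<le>N. a j \<noteq> 0" "(\<Sum>j\<le>N. of_rat (a j) * x ^ j) = 0"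
    using rational_dependence[of N "\<lambda>j. x ^ j" v] span by blast
  define h where "h = (\<Sum>j\<le>N. monom (a j) j)"
  have cf: "coeff h j = (if j \<le> N then a j else 0)" for j
      by (simp add: h_def coeff_sum if_distrib cong: if_cong)
  have "h \<noteq> 0" using a(1) cf by (metis coeff_0)
  moreover have "reval h x = 0" using a(2) by (simp add: h_def reval_sum)
  then have "m dvd h" using m by (simp add: minpoly_def)
  ultimately have "degree m \<le> degree h" by (intro dvd_imp_degree_le)
  also have "\<dots> \<le> N" using cf by (intro degree_le) auto
  finally show ?thesis .
qed

lemma minpoly_exists_if_spanned:
  assumes span: "\<And>j. \<exists>c :: nat \<Rightarrow> rat. (x :: 'a :: field_char_0) ^ j = (\<Sum>i<N. of_rat (c i) * v i)"
  shows "\<exists>m. minpoly x m"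
proof -
  obtain a :: "nat \<Rightarrow> rat" where a: "\<exists>j\<le>N. a j \<noteq> 0" "(\<Sum>j\<le>N. of_rat (a j) * x ^ j) = 0"
    using rational_dependence[of N "\<lambda>j. x ^ j" v] span by blast
  define h where "h = (\<Sum>j\<le>N. monom (a j) j)"
  have cf: "coeff h j = (if j \<le> N then a j else 0)" for j
      by (simp add: h_def coeff_sum if_distrib cong: if_cong)
  have "h \<noteq> 0" using a(1) cf by (metis coeff_0)
  moreover have "reval h x = 0" using a(2) by (simp add: h_def reval_sum)
  ultimately show ?thesis by (rule minpoly_exists)
qed

text \<open>Reduction modulo m' writes every power of x as a rational combination of the first
  \<open>degree m'\<close> powers of y. This will bound the degree of K by that of
  \<open>lam\<close>.\<close>

lemma adjoin_degree_mono:
  assumes m: "minpoly (x :: 'a :: field_char_0) m" and m': "minpoly y m'" and xy: "x \<in> adjoin y"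
  shows "degree m \<le> degree m'"
proof (rule degree_minpoly_le[OF m])
  fix j
  have "x ^ j \<in> adjoin y" using subfield_setD(9)[OF subfield_set_adjoin[OF m'] xy] .
  then obtain p where p: "x ^ j = reval p y" by (auto simp: adjoin_def)
  have m0: "m' \<noteq> 0" using m' by (auto simp: minpoly_def)
  obtain k r where kr: "p = k * m' + r" "r = 0 \<or> degree r < degree m'"
    using polys_over_division[OF subfield_set_UNIV polys_over_UNIV m0 polys_over_UNIV] by blast
  have "reval p y = reval r y" using m' by (simp add: kr(1) minpoly_def reval_add reval_mult)
  moreover have "degree r < degree m'" using kr(2) minpoly_degree_pos[OF m'] by auto
  ultimately show "\<exists>c. x ^ j = (\<Sum>i<degree m'. of_rat (c i) * y ^ i)"
    using p reval_altdef by metis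
qed

lemma real_number_field_subfield: "real_number_field K \<Longrightarrow> subfield_set K"
  by (simp add: real_number_field_def subfield_set_def)

lemma real_number_field_minpoly:
  assumes K: "real_number_field K" and x: "x \<in> K"
  shows "\<exists>m. minpoly x m"
proof -
  obtain B where B: "finite B" "B \<subseteq> K" "\<forall>x\<in>K. \<exists>c :: real \<Rightarrow> rat. x = (\<Sum>b\<in>B. of_rat (c b) * b)"
    using K by (auto simp: real_number_field_def)
  obtain bs where bs: "set bs = B" "distinct bs" using finite_distinct_list[OF B(1)] by auto
  show ?thesis
  proof (rule minpoly_exists_if_spanned)
    fix j
    have "x ^ j \<in> K" using subfield_setD(9)[OF real_number_field_subfield[OF K] x] .
    then obtain c :: "real \<Rightarrow> rat" where "x ^ j = (\<Sum>b\<in>B. of_rat (c b) * b)" using B(3) by blast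
    also have "\<dots> = (\<Sum>i<length bs. of_rat (c (bs ! i)) * bs ! i)"
      using bs by (intro sum.reindex_bij_betw[symmetric] bij_betw_nth) auto
    finally show "\<exists>c. x ^ j = (\<Sum>i<length bs. of_rat (c i) * bs ! i)"
        by (intro exI[of _ "\<lambda>i. c (bs ! i)"])
  qed
qed


lemma of_real_map_poly_of_rat: "map_poly complex_of_real (map_poly of_rat p) = map_poly of_rat p"
  by (rule poly_eqI) (simp add: of_real_of_rat)

section \<open>The primitive element theorem for real number fields\<close>

lemma polys_over_pcompose:
  assumes S: "subfield_set S" and q: "q \<in> polys_over S"
  shows "p \<in> polys_over S \<Longrightarrow> p \<circ>\<^sub>p q \<in> polys_over S"
proof (induction p)
  case (pCons a p)
  have "p \<in> polys_over S" "a \<in> S"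
    using pCons.prems unfolding polys_over_def by (auto dest: spec[of _ "Suc _"] spec[of _ 0])
  then have "p \<circ>\<^sub>p q \<in> polys_over S" "[:a:] \<in> polys_over S"
    using pCons.IH polys_over_closed(6)[OF S, of a 0] by (auto simp: monom_0)
  then show ?case unfolding pcompose_pCons by (intro polys_over_closed[OF S] q)
qed (simp add: polys_over_closed[OF S])

text \<open>The generator is t = x + c y for a natural number c. The polynomial mx(t - c Z) over the
  field of t vanishes at y, and c is chosen so that y is its only common root with my.\<close>

lemma primitive_pair:
  assumes K: "real_number_field K" and xy: "x \<in> K" "y \<in> K"
  shows "\<exists>t\<in>K. x \<in> adjoin t \<and> y \<in> adjoin t"
proof -
  have KS: "subfield_set K" using K by (rule real_number_field_subfield)
  obtain mx my where m: "minpoly x mx" "minpoly y my"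
    using real_number_field_minpoly[OF K] xy by blast
  have m0: "mx \<noteq> 0" "my \<noteq> 0" using m by (auto simp: minpoly_def)
  define X where "X = {z :: complex. reval mx z = 0}"
  define Y where "Y = {z :: complex. reval my z = 0}"
  have "finite X" "finite Y" using m0 unfolding X_def Y_def reval_def
      by (auto intro!: poly_roots_finite)
  \<comment> \<open>These are the c for which x + c y = a + c b with conjugates a of x and b of y, b
    different from y. The pairs with b = y contribute only 0, the value of division by zero.\<close>
  define bad where "bad = (\<lambda>(a, b). (a - of_real x) / (of_real y - b)) ` (X \<times> Y)"
  have "finite bad" using \<open>finite X\<close> \<open>finite Y\<close> by (simp add: bad_def)
  then have "finite (of_nat -` bad :: nat set)" by (rule finite_vimageI) (simp add: inj_of_nat)
  then obtain c :: nat where c: "of_nat c \<notin> bad" using ex_new_if_finite[OF infinite_UNIV_nat]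
      by blast
  define t where "t = x + of_nat c * y"
  have t: "t \<in> K" unfolding t_def by (intro subfield_setD(3,5)[OF KS] subfield_set_of_nat[OF KS] xy)
  then obtain mt where mt: "minpoly t mt" using real_number_field_minpoly[OF K] by blast
  define S where "S = adjoin t"
  have S: "subfield_set S" unfolding S_def using mt by (rule subfield_set_adjoin)
  have tS: "t \<in> S" unfolding S_def by (rule adjoin_self)
  define p where "p = (map_poly of_rat my :: real poly)"
  define l where "l = [:t, - of_nat c:]"
  define q where "q = (map_poly of_rat mx :: real poly) \<circ>\<^sub>p l"
  have ratS: "map_poly of_rat h \<in> polys_over S" for h
    using subfield_set_of_rat[OF S] by (simp add: polys_over_def)
  have l: "l \<in> polys_over S" unfolding l_def polys_over_def
    using tS subfield_setD(1,8)[OF S] subfield_set_of_nat[OF S]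
        by (auto simp: coeff_pCons split: nat.splits)
  have cp: "poly (map_poly complex_of_real p) z = reval my z" for z
    by (simp add: p_def of_real_map_poly_of_rat reval_def)
  have cq: "poly (map_poly complex_of_real q) z = reval mx (of_real t - of_nat c * z)" for z
    unfolding q_def of_real_hom.map_poly_pcompose poly_pcompose of_real_map_poly_of_rat
    by (simp add: reval_def l_def hom_distribs mult.commute)
  have "y \<in> S"
  proof (rule common_root_in_subfield[OF S, of p q])
    show "p \<in> polys_over S" unfolding p_def by (rule ratS)
    show "q \<in> polys_over S" unfolding q_def by (rule polys_over_pcompose[OF S l ratS])
    show "p \<noteq> 0" using m0 by (simp add: p_def)
    show "poly (map_poly complex_of_real (pderiv p)) z \<noteq> 0"
        if "poly (map_poly complex_of_real p) z = 0" for z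
    proof -
      have "map_poly complex_of_real (pderiv p) = map_poly of_rat (pderiv my)"
        by (simp add: p_def of_rat_hom.map_poly_pderiv[symmetric] of_real_map_poly_of_rat)
      then show ?thesis using minpoly_simple_roots[OF m(2), of z] that cp by (simp add: reval_def)
    qed
    show "poly p y = 0" using m(2) by (simp add: p_def minpoly_def reval_def)
    show "poly q y = 0" using m(1)
      by (simp add: q_def poly_pcompose l_def t_def minpoly_def reval_def algebra_simps)
    show "z = of_real y" if z: "poly (map_poly complex_of_real p) z = 0"
        "poly (map_poly complex_of_real q) z = 0" for z
    proof (rule ccontr)
      assume neq: "z \<noteq> of_real y"
      define a where "a = of_real t - of_nat c * z"
      have "a \<in> X" "z \<in> Y" using z cp cq by (auto simp: X_def Y_def a_def)
      moreover have "of_nat c = (a - of_real x) / (of_real y - z)"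
        using neq by (simp add: a_def t_def field_simps)
      ultimately have "of_nat c \<in> bad" unfolding bad_def by force
      then show False using c by simp
    qed
  qed
  moreover have "x = t - of_nat c * y" by (simp add: t_def)
  then have "x \<in> S" using \<open>y \<in> S\<close> tS subfield_set_of_nat[OF S] subfield_setD(4,5)[OF S] by metis
  ultimately show ?thesis using t unfolding S_def by blast
qed

text \<open>The elements of a finite spanning set are absorbed one at a time into the field of a
  single generator.\<close>

theorem primitive_element:
  assumes K: "real_number_field K"
  shows "\<exists>t\<in>K. K = adjoin t"
proof -
  have KS: "subfield_set K" using K by (rule real_number_field_subfield)
  obtain B where B: "finite B" "B \<subseteq> K" "\<forall>x\<in>K. \<exists>c :: real \<Rightarrow> rat. x = (\<Sum>b\<in>B. of_rat (c b) * b)"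
    using K by (auto simp: real_number_field_def)
  have "\<exists>t\<in>K. B \<subseteq> adjoin t" using B(1,2)
  proof (induction B)
    case empty
    then show ?case using subfield_setD(1)[OF KS] by auto
  next
    case (insert b B)
    then obtain t where t: "t \<in> K" "B \<subseteq> adjoin t" "b \<in> K" by auto
    obtain s where s: "s \<in> K" "t \<in> adjoin s" "b \<in> adjoin s" using primitive_pair[OF K t(1,3)]
        by blast
    obtain ms where "minpoly s ms" using real_number_field_minpoly[OF K s(1)] by blast
    then have "subfield_set (adjoin s)" by (rule subfield_set_adjoin)
    then have "adjoin t \<subseteq> adjoin s" using subfield_set_reval[OF _ s(2)]
        by (auto simp: adjoin_def[of t])
    then show ?case using s t by blast
  qed
  then obtain t where t: "t \<in> K" "B \<subseteq> adjoin t" by blast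
  obtain mt where "minpoly t mt" using real_number_field_minpoly[OF K t(1)] by blast
  then have S: "subfield_set (adjoin t)" by (rule subfield_set_adjoin)
  have "K \<subseteq> adjoin t"
  proof
    fix x assume "x \<in> K"
    then obtain c :: "real \<Rightarrow> rat" where "x = (\<Sum>b\<in>B. of_rat (c b) * b)" using B(3) by blast
    then show "x \<in> adjoin t"
      using t(2) by (auto intro!: subfield_set_sum[OF S] subfield_setD(5)[OF S]
          subfield_set_of_rat[OF S])
  qed
  moreover have "adjoin t \<subseteq> K" using subfield_set_reval[OF KS t(1)] by (auto simp: adjoin_def)
  ultimately show ?thesis using t(1) by blast
qed

section \<open>Denominators and integrality\<close>

lemma common_denominator:
  assumes "finite (R :: rat set)"
  shows "\<exists>N::int. N > 0 \<and> (\<forall>q\<in>R. of_int N * q \<in> \<int>)"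
  using assms
proof (induction R)
  case empty
  show ?case by (rule exI[of _ 1]) simp
next
  case (insert q R)
  then obtain N where N: "N > 0" "\<forall>q\<in>R. of_int N * q \<in> \<int>" by blast
  obtain a b where ab: "q = Rat.Fract a b" "b > 0" using Rat_cases by blast
  have "of_int (N * b) * q = of_int (N * a)" using ab by (simp add: Fract_of_int_quotient)
  then have "of_int (N * b) * q \<in> \<int>" by (metis Ints_of_int)
  moreover have "of_int (N * b) * q' \<in> \<int>" if "q' \<in> R" for q'
  proof -
    have "of_int (N * b) * q' = of_int b * (of_int N * q')" by (simp add: mult_ac)
    then show ?thesis using N(2) that by (metis Ints_mult Ints_of_int)
  qed
  ultimately show ?case using N(1) ab(2) by (intro exI[of _ "N * b"]) auto
qed

text \<open>With N a common denominator of the coefficients of m, the polynomial N^n m(X / N) is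
  monic with integer coefficients and has N x as a root; its coefficients are the numbers
  \<open>c i\<close>.\<close>

lemma algebraic_int_multiple:
  fixes x :: "'a :: field_char_0"
  assumes m: "minpoly x m"
  shows "\<exists>N::int. N > 0 \<and> algebraic_int (of_int N * x)"
proof -
  define n where "n = degree m"
  obtain N :: int where N: "N > 0" "\<forall>q\<in>coeff m ` {..n}. of_int N * q \<in> \<int>"
    using common_denominator[of "coeff m ` {..n}"] by auto
  define c where "c = (\<lambda>i. of_int N ^ (n - i) * coeff m i)"
  define q where "q = (\<Sum>i\<le>n. monom (c i) i)"
  have cn: "c n = 1" using m by (simp add: c_def n_def minpoly_def)
  have cint: "c i \<in> \<int>" if "i \<le> n" for i
  proof (cases "i = n")
    case False
    then have "n - i = Suc (n - i - 1)" using that by simp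
    then have "c i = of_int N ^ (n - i - 1) * (of_int N * coeff m i)"
      unfolding c_def by (metis mult.assoc mult.commute power_Suc)
    then show ?thesis using N(2) that by (metis Ints_mult Ints_of_int Ints_power atMost_iff
        image_eqI)
  qed (simp add: cn)
  have cf: "coeff q i = (if i \<le> n then c i else 0)" for i
    by (simp add: q_def coeff_sum if_distrib cong: if_cong)
  have dq: "degree q = n" using cf cn by (intro antisym degree_le le_degree) auto
  have "reval q (of_int N * x) = (\<Sum>i\<le>n. of_rat (c i) * (of_int N * x) ^ i)"
    by (simp add: q_def reval_sum)
  also have "\<dots> = (\<Sum>i\<le>n. of_int N ^ n * (of_rat (coeff m i) * x ^ i))"
  proof (intro sum.cong refl)
    fix i assume "i \<in> {..n}"
    then have "(of_int N :: 'a) ^ n = of_int N ^ (n - i) * of_int N ^ i"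
        by (simp add: power_add[symmetric])
    then show "of_rat (c i) * (of_int N * x) ^ i = of_int N ^ n * (of_rat (coeff m i) * x ^ i)"
      by (simp add: c_def of_rat_mult of_rat_power power_mult_distrib mult_ac)
  qed
  also have "\<dots> = of_int N ^ n * reval m x"
    by (simp add: sum_distrib_left reval_def poly_altdef n_def)
  also have "\<dots> = 0" using m by (simp add: minpoly_def)
  finally have "poly (map_poly of_rat q) (of_int N * x) = 0" by (simp add: reval_def)
  moreover have "coeff (map_poly of_rat q :: 'a poly) i \<in> \<int>" for i
  proof -
    have "coeff q i \<in> \<int>" using cf cint by simp
    then obtain k where "coeff q i = of_int k" by (auto elim: Ints_cases)
    then show ?thesis by simp
  qed
  moreover have "lead_coeff (map_poly of_rat q :: 'a poly) = 1" using dq cf cn by simp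
  ultimately have "algebraic_int (of_int N * x)"
      by (intro algebraic_int.intros[of "map_poly of_rat q"]) auto
  then show ?thesis using N(1) by blast
qed

text \<open>The coefficients are rational, and they are algebraic integers because the roots
  are.\<close>

lemma integral_rat_poly:
  assumes "lead_coeff (p :: rat poly) = 1" "\<And>z :: complex. reval p z = 0 \<Longrightarrow> algebraic_int z"
  shows "\<exists>q :: int poly. p = map_poly of_int q"
proof -
  have "coeff p i \<in> \<int>" for i
  proof -
    have "algebraic_int (coeff (map_poly of_rat p :: complex poly) i)"
      using assms by (intro coeff_algebraic_int_if_roots) (auto simp: reval_def)
    then have "complex_of_real (of_rat (coeff p i)) \<in> \<int>"
      by (intro rational_algebraic_int_is_int) (simp_all add: of_real_of_rat)
    then obtain k where "complex_of_real (of_rat (coeff p i)) = of_int k" by (auto elim: Ints_cases)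
    then have "(of_rat (coeff p i) :: complex) = of_rat (of_int k)" by (simp add: of_real_of_rat)
    then have "coeff p i = of_int k" by (simp only: of_rat_eq_iff)
    then show ?thesis by simp
  qed
  then have "map_poly of_int (map_poly floor p) = p"
    by (intro poly_eqI) (auto simp: coeff_map_poly elim!: Ints_cases)
  then show ?thesis by metis
qed


text \<open>For a conjugate z of t, the embedding of the field of t that sends t to z, computed from
  any polynomial expression in t; \<open>minpoly_conjugate\<close> makes the choice irrelevant.
  Outside this field the values are arbitrary.\<close>

definition conj_emb :: "real \<Rightarrow> 'b :: field_char_0 \<Rightarrow> real \<Rightarrow> 'b" where
  "conj_emb t z x = reval (SOME p. reval p t = x) z"

lemma conj_emb_reval:
  assumes m: "minpoly t m" and z: "reval m z = 0"
  shows "conj_emb t z (reval p t) = reval p z"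
proof -
  define q where "q = (SOME q. reval q t = reval p t)"
  have "reval q t = reval p t" unfolding q_def by (rule someI[of _ p]) simp
  then have "reval (q - p) t = 0" by (simp add: reval_diff)
  then have "reval (q - p) z = 0" using minpoly_conjugate[OF m z] by blast
  then show ?thesis by (simp add: conj_emb_def q_def[symmetric] reval_diff)
qed

lemma field_embedding_conj_emb:
  assumes m: "minpoly t m" and z: "reval m z = 0"
  shows "field_embedding (adjoin t) (conj_emb t z)"
proof -
  note e = conj_emb_reval[OF m z]
  have "conj_emb t z 1 = 1" using e[of 1] by simp
  moreover have "conj_emb t z (x + y) = conj_emb t z x + conj_emb t z y"
    "conj_emb t z (x * y) = conj_emb t z x * conj_emb t z y" if xy: "x \<in> adjoin t" "y \<in> adjoin t"
        for x y
  proof -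
    obtain p q where pq: "x = reval p t" "y = reval q t" using xy by (auto simp: adjoin_def)
    show "conj_emb t z (x + y) = conj_emb t z x + conj_emb t z y"
      unfolding pq reval_add[symmetric] e by (simp add: reval_add)
    show "conj_emb t z (x * y) = conj_emb t z x * conj_emb t z y"
      unfolding pq reval_mult[symmetric] e by (simp add: reval_mult)
  qed
  ultimately show ?thesis by (simp add: field_embedding_def)
qed

lemma reval_pcompose: "reval (p \<circ>\<^sub>p q) x = reval p (reval q x)"
  by (simp add: reval_def of_rat_hom.map_poly_pcompose poly_pcompose)

lemma reval_of_int_poly: "reval (map_poly of_int p) x = poly (map_poly of_int p) x"
proof -
  have "map_poly of_rat (map_poly of_int p) = (map_poly of_int p :: 'a :: field_char_0 poly)"
    by (rule poly_eqI) simp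
  then show ?thesis by (simp add: reval_def)
qed

lemma algebraic_int_conjugate:
  assumes m: "minpoly t m" and z: "reval m z = 0" and c: "algebraic_int (reval p t)"
  shows "algebraic_int (reval p z)"
proof -
  obtain h :: "int poly" where h: "poly (map_poly of_int h) (reval p t) = 0" "lead_coeff h = 1"
    using c by (auto simp: algebraic_int_altdef_ipoly)
  have "reval (map_poly of_int h \<circ>\<^sub>p p) t = 0" using h(1)
      by (simp add: reval_pcompose reval_of_int_poly)
  then have "reval (map_poly of_int h \<circ>\<^sub>p p) z = 0" using minpoly_conjugate[OF m z] by blast
  then have "poly (map_poly of_int h) (reval p z) = 0"
      by (simp add: reval_pcompose reval_of_int_poly)
  then show ?thesis using h(2) by (auto simp: algebraic_int_altdef_ipoly)
qed

text \<open>The roots are simple, so the polynomial is the product of the factors X - z over its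
  distinct complex roots.\<close>

lemma card_minpoly_roots:
  assumes m: "minpoly t m"
  shows "card {z :: complex. reval m z = 0} = degree m"
proof -
  let ?p = "map_poly of_rat m :: complex poly"
  have p1: "lead_coeff ?p = 1" using m by (simp add: minpoly_def)
  have "rsquarefree ?p"
    unfolding rsquarefree_roots
    using minpoly_simple_roots[OF m, where 'b = complex]
        by (auto simp: reval_def of_rat_hom.map_poly_pderiv)
  then have "(\<Prod>z\<in>{z. poly ?p z = 0}. [:- z, 1:]) = ?p"
    using complex_poly_decompose_rsquarefree[of ?p] p1 by simp
  then have "degree ?p = degree (\<Prod>z\<in>{z. poly ?p z = 0}. [:- z, 1:])" by simp
  also have "\<dots> = card {z. poly ?p z = 0}" by (subst degree_prod_eq_sum_degree) auto
  finally show ?thesis by (simp add: reval_def)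
qed

text \<open>All conjugates of an element \<open>reval p t\<close> are among the values \<open>reval p z\<close> at the conjugates
  \<open>z\<close> of \<open>t\<close>: these are the eigenvalues of the rational matrix of multiplication by it.\<close>

lemma conjugates_bounded_house:
  assumes m: "minpoly (t :: real) m" and c: "algebraic_int (reval p t)"
    and bd: "\<And>z :: complex. reval m z = 0 \<Longrightarrow> cmod (reval p z) \<le> B"
  shows "complex_of_real (reval p t) \<in> bounded_house (degree m) B"
proof -
  define r where "r = degree m"
  have r: "r > 0" unfolding r_def using m by (rule minpoly_degree_pos)
  have m0: "m \<noteq> 0" using m by (auto simp: minpoly_def)
  \<comment> \<open>\<open>T j\<close> is the reduction of p X^j modulo m; its coefficients form row
    j of the matrix of multiplication by p(t).\<close>
  define T where "T = (\<lambda>j. (p * monom 1 j) mod m)"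
  have dT: "degree (T j) < r" for j
    using degree_mod_less[OF m0, of "p * monom 1 j"] r by (auto simp: T_def r_def)
  have T: "reval (T j) z = reval p z * z ^ j" if "reval m z = 0" for j and z :: complex
  proof -
    have "p * monom 1 j = (p * monom 1 j) div m * m + T j" unfolding T_def
        by (rule div_mult_mod_eq[symmetric])
    then have "reval (p * monom 1 j) z = reval ((p * monom 1 j) div m * m + T j) z" by simp
    then show ?thesis using that by (simp add: reval_mult reval_add)
  qed
  define Bm where "Bm = mat r r (\<lambda>(j,k). coeff (T j) k)"
  define Bc :: "complex mat" where "Bc = map_mat of_rat Bm"
  have Bm: "Bm \<in> carrier_mat r r" and Bc: "Bc \<in> carrier_mat r r" by (auto simp: Bm_def Bc_def)
  \<comment> \<open>The vector of powers of a conjugate z is an eigenvector with eigenvalue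
    p(z).\<close>
  define u where "u = (\<lambda>z::complex. vec r (\<lambda>k. z ^ k))"
  have u: "u z \<in> carrier_vec r" for z by (simp add: u_def)
  have Bu: "Bc *\<^sub>v u z = reval p z \<cdot>\<^sub>v u z" if "reval m z = 0" for z
  proof (rule eq_vecI)
    fix j assume "j < dim_vec (reval p z \<cdot>\<^sub>v u z)"
    then have j: "j < r" by (simp add: u_def)
    have "(Bc *\<^sub>v u z) $ j = (\<Sum>k<r. of_rat (coeff (T j) k) * z ^ k)"
      using j by (simp add: Bc_def Bm_def u_def mult_mat_vec_def scalar_prod_def atLeast0LessThan)
    also have "\<dots> = reval (T j) z" by (rule reval_altdef[OF dT, symmetric])
    also have "\<dots> = reval p z * z ^ j" using T[OF that] .
    finally show "(Bc *\<^sub>v u z) $ j = (reval p z \<cdot>\<^sub>v u z) $ j" using j by (simp add: u_def)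
  qed (auto simp: u_def Bc_def Bm_def)
  define F where "F = char_poly Bm"
  have F1: "degree F = r" "lead_coeff F = 1" using degree_monic_char_poly[OF Bm]
      by (auto simp: F_def)
  have FB: "poly (char_poly Bc) z = reval F z" for z
    unfolding Bc_def F_def reval_def of_rat_hom.char_poly_hom[OF Bm] ..
  \<comment> \<open>An eigenvector w of the transpose, paired with \<open>u y\<close>, gives W(y)
    for a nonzero polynomial W of degree below r. It cannot vanish at all r conjugates of t, and
    where it does not, the two eigenvalues agree.\<close>
  have roots: "\<exists>y. reval m y = 0 \<and> z = reval p y" if "reval F z = 0" for z :: complex
  proof -
    have BT: "Bc\<^sup>T \<in> carrier_mat r r" using Bc by simp
    have "poly (char_poly (Bc\<^sup>T)) z = 0" using that FB char_poly_transpose_mat[OF Bc] by simp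
    then have "eigenvalue (Bc\<^sup>T) z" using eigenvalue_root_char_poly[OF BT] by simp
    then obtain w where w: "w \<in> carrier_vec r" "w \<noteq> 0\<^sub>v r" "Bc\<^sup>T *\<^sub>v w = z \<cdot>\<^sub>v w"
      using Bc by (auto simp: eigenvalue_def eigenvector_def)
    define W where "W = (\<Sum>k<r. monom (w $ k) k)"
    have Wcf: "coeff W k = (if k < r then w $ k else 0)" for k
      by (simp add: W_def coeff_sum if_distrib cong: if_cong)
    have "W \<noteq> 0"
    proof
      assume "W = 0"
      then have "w = 0\<^sub>v r" using w(1) Wcf by (intro eq_vecI) (auto, metis coeff_0)
      then show False using w(2) by simp
    qed
    have wu: "w \<bullet> u y = poly W y" for y
      using w(1) by (simp add: W_def poly_sum poly_monom scalar_prod_def u_def atLeast0LessThan)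
    have "\<exists>y. reval m y = 0 \<and> poly W y \<noteq> 0"
    proof (rule ccontr)
      assume "\<not> ?thesis"
      then have sub: "{z. reval m z = 0} \<subseteq> {z. poly W z = 0}" by auto
      have "degree W \<le> r - 1" using Wcf by (intro degree_le) auto
      have "card {z :: complex. reval m z = 0} \<le> card {z. poly W z = 0}"
        using \<open>W \<noteq> 0\<close> by (intro card_mono sub poly_roots_finite)
      also have "\<dots> \<le> degree W" using \<open>W \<noteq> 0\<close> by (rule card_poly_roots_bound)
      finally show False using card_minpoly_roots[OF m] \<open>degree W \<le> r - 1\<close> r by (simp add: r_def)
    qed
    then obtain y where y: "reval m y = 0" "poly W y \<noteq> 0" by blast
    have "w \<bullet> (Bc *\<^sub>v u y) = (Bc\<^sup>T *\<^sub>v w) \<bullet> u y"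
      using transpose_vec_mult_scalar[OF Bc u w(1)] by simp
    then have "reval p y * (w \<bullet> u y) = z * (w \<bullet> u y)"
      unfolding Bu[OF y(1)] w(3) using w(1) u by simp
    then show ?thesis using y by (auto simp: wu)
  qed
  have "\<exists>q :: int poly. F = map_poly of_int q"
    using F1(2)
  proof (rule integral_rat_poly)
    fix z :: complex assume "reval F z = 0"
    then show "algebraic_int z" using roots algebraic_int_conjugate[OF m _ c] by blast
  qed
  then obtain q :: "int poly" where q: "F = map_poly of_int q" by blast
  have qz: "poly (map_poly of_int q) z = reval F z" for z :: complex
    unfolding q by (rule reval_of_int_poly[symmetric])
  have tz: "reval m (complex_of_real t) = 0" using m by (simp add: minpoly_def reval_of_real)
  have "eigenvalue Bc (reval p (complex_of_real t))"
  proof -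
    have "u (complex_of_real t) $ 0 = 1" using r by (simp add: u_def)
    then have "u (complex_of_real t) \<noteq> 0\<^sub>v r" using r by (metis index_zero_vec(1) zero_neq_one)
    then show ?thesis using Bu[OF tz] u Bc by (auto simp: eigenvalue_def eigenvector_def)
  qed
  then have "reval F (complex_of_real (reval p t)) = 0"
    using eigenvalue_root_char_poly[OF Bc] FB by (simp add: reval_of_real)
  moreover have "lead_coeff q = 1" "degree q = r" using F1 by (simp_all add: q)
  moreover have "cmod y \<le> B" if "reval F y = 0" for y :: complex
    using roots[OF that] bd by blast
  ultimately show ?thesis
    using qz by (auto simp: bounded_house_def r_def intro!: exI[of _ q])
qed

text \<open>The integral generator t gives the order Z[t]; its elements are represented by integer
  polynomials, and every element of K has a positive integer multiple in it. The order takes the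
  place of an integral basis of the ring of integers.\<close>

locale tr_field =
  fixes K :: "real set" and t :: real and m :: "rat poly"
  assumes field: "real_number_field K" and real: "totally_real K" and K: "K = adjoin t"
    and m: "minpoly t m" and integral: "algebraic_int t"
begin

lemma sub: "subfield_set K"
  using field by (rule real_number_field_subfield)

text \<open>A complex root z of m defines an embedding of K sending t to z, whose image is real by
  total reality.\<close>

lemma root_real:
  assumes "reval m (z :: complex) = 0"
  shows "\<exists>y :: real. z = of_real y \<and> reval m y = 0"
proof -
  have "conj_emb t z ` K \<subseteq> \<real>" using real field_embedding_conj_emb[OF m assms]
      by (auto simp: totally_real_def K)
  moreover have "conj_emb t z (reval [:0, 1:] t) = z"
      using conj_emb_reval[OF m assms, of "[:0, 1:]"] by simp
  moreover have "reval [:0, 1:] t \<in> K" by (simp add: K adjoin_self)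
  ultimately have "z \<in> \<real>" by (metis image_subset_iff)
  then obtain y where y: "z = of_real y" by (auto elim: Reals_cases)
  with assms show ?thesis by (auto simp: reval_of_real)
qed

lemma bounded_house:
  assumes "algebraic_int (reval p t)" "\<And>y :: real. reval m y = 0 \<Longrightarrow> \<bar>reval p y\<bar> \<le> B"
  shows "complex_of_real (reval p t) \<in> bounded_house (degree m) B"
proof (rule conjugates_bounded_house[OF m assms(1)])
  fix z :: complex assume "reval m z = 0"
  then obtain y where "z = of_real y" "reval m y = 0" using root_real by blast
  then show "cmod (reval p z) \<le> B" using assms(2) by (simp add: reval_of_real)
qed

end

lemma tr_field_exists:
  assumes "real_number_field K" "totally_real K"
  shows "\<exists>t m. tr_field K t m"
proof -
  obtain s where s: "s \<in> K" "K = adjoin s" using primitive_element[OF assms(1)] by blast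
  obtain ms where ms: "minpoly s ms" using real_number_field_minpoly[OF assms(1) s(1)] by blast
  obtain N :: int where N: "N > 0" "algebraic_int (of_int N * s)"
      using algebraic_int_multiple[OF ms] by blast
  define t where "t = of_int N * s"
  have KS: "subfield_set K" using assms(1) by (rule real_number_field_subfield)
  have tK: "t \<in> K" unfolding t_def by (intro subfield_setD(5)[OF KS] s(1)
      subfield_set_of_int[OF KS])
  then obtain m where m: "minpoly t m" using real_number_field_minpoly[OF assms(1)] by blast
  have St: "subfield_set (adjoin t)" using m by (rule subfield_set_adjoin)
  have "s = t / of_int N" using N(1) by (simp add: t_def)
  then have "s \<in> adjoin t" using subfield_setD(7)[OF St adjoin_self subfield_set_of_int[OF St]]
      by simp
  then have "adjoin s \<subseteq> adjoin t" using subfield_set_reval[OF St] by (auto simp: adjoin_def[of s])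
  moreover have "adjoin t \<subseteq> K" using subfield_set_reval[OF KS tK] by (auto simp: adjoin_def)
  ultimately have "tr_field K t m" using assms s(2) m N(2) by unfold_locales (auto simp: t_def)
  then show ?thesis by blast
qed

section \<open>The Pell equation over a totally real field\<close>

text \<open>Integer polynomials represent the elements of Z[t]; evaluated at the other roots of m
  they give the conjugates.\<close>

definition ieval :: "int poly \<Rightarrow> 'a :: field_char_0 \<Rightarrow> 'a" where
  "ieval p x = poly (map_poly of_int p) x"

interpretation ieval_hom: comm_ring_hom "\<lambda>p. ieval p x" for x :: "'a :: field_char_0"
  by unfold_locales (auto simp: ieval_def hom_distribs)

lemma ieval_add: "ieval (p + q) x = ieval p x + ieval q x"
  and ieval_diff: "ieval (p - q) x = ieval p x - ieval q x"
  and ieval_mult: "ieval (p * q) x = ieval p x * ieval q x"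
  and ieval_sum: "ieval (sum f I) x = (\<Sum>i\<in>I. ieval (f i) x)"
  by (simp_all add: hom_distribs)

lemma ieval_simps [simp]:
  "ieval 0 x = 0" "ieval 1 x = 1" "ieval (monom c k) x = of_int c * x ^ k"
      "ieval [:c:] x = of_int c"
  by (simp_all add: ieval_def hom_distribs poly_monom)

lemma ieval_smult: "ieval (smult c p) x = of_int c * ieval p x"
  by (simp add: ieval_def hom_distribs)

lemma reval_of_int: "reval (map_poly of_int p) x = ieval p x"
  by (simp add: ieval_def reval_of_int_poly)

lemma algebraic_int_ieval:
  assumes "algebraic_int (x :: 'a :: field_char_0)" shows "algebraic_int (ieval p x)"
proof -
  have "ieval p x = (\<Sum>i\<le>degree p. of_int (coeff p i) * x ^ i)"
    by (simp add: ieval_def poly_altdef)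
  moreover have "algebraic_int (of_int (coeff p i) * x ^ i)" for i
    by (rule algebraic_int_times[OF int_imp_algebraic_int algebraic_int_power[OF assms]]) simp
  ultimately show ?thesis by (simp only: algebraic_int_sum)
qed

lemma minpoly_ieval_eq_0:
  assumes m: "minpoly x m" and p: "degree p < degree m" "ieval p x = 0"
  shows "p = 0"
proof (rule ccontr)
  assume "p \<noteq> 0"
  then have "map_poly of_int p \<noteq> (0 :: rat poly)" by simp
  moreover have "m dvd map_poly of_int p" using m p(2) by (simp add: minpoly_def reval_of_int)
  ultimately have "degree m \<le> degree (map_poly of_int p :: rat poly)" by (intro dvd_imp_degree_le)
  then show False using p(1) by simp
qed

lemma floor_eq_imp_abs_diff_less: "\<lfloor>a :: real\<rfloor> = \<lfloor>b\<rfloor> \<Longrightarrow> \<bar>a - b\<bar> < 1"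
  by linarith

lemma floor_mem_interval:
  assumes "\<bar>a :: real\<bar> \<le> of_int k" shows "\<lfloor>a\<rfloor> \<in> {-k..k}"
proof -
  have "- k \<le> \<lfloor>a\<rfloor>" using assms by (simp add: le_floor_iff)
  moreover have "\<lfloor>a\<rfloor> \<le> k" using assms by (simp add: floor_le_iff)
  ultimately show ?thesis by simp
qed

text \<open>For \<open>s = sqrt D\<close> the element \<open>p\<^sup>2 - D q\<^sup>2\<close> and its conjugates stay bounded as \<open>B\<close> grows, so that
  infinitely many of the pairs have the same value of it; this is the source of solutions of the
  Pell equation.\<close>

lemma dirichlet_pigeonhole:
  fixes Y :: "real set" and t s :: real and r :: nat
  assumes Y: "finite Y" "card Y < r"
  shows "\<exists>S M. \<forall>B>0. \<exists>p q :: int poly. degree p < r \<and> degree q < r \<and> (p, q) \<noteq> (0, 0) \<and>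
     \<bar>ieval p t - s * ieval q t\<bar> \<le> S / of_nat B \<and>
     \<bar>ieval p t\<bar> \<le> M * of_nat B \<and> \<bar>ieval q t\<bar> \<le> M * of_nat B \<and>
     (\<forall>y\<in>Y. \<bar>ieval p y\<bar> \<le> 1 \<and> \<bar>ieval q y\<bar> \<le> 1)"
proof -
  \<comment> \<open>A polynomial with r coefficients of size at most A has absolute value at most c
    A at t and at the points of Y.\<close>
  define c where "c = nat \<lceil>\<Sum>y\<in>insert t Y. \<Sum>j<r. \<bar>y\<bar> ^ j\<rceil> + 1"
  have c: "(\<Sum>j<r. \<bar>y\<bar> ^ j) \<le> real c" if "y \<in> insert t Y" for y
  proof -
    have "(\<Sum>j<r. \<bar>y\<bar> ^ j) \<le> (\<Sum>y\<in>insert t Y. \<Sum>j<r. \<bar>y\<bar> ^ j)"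
      using that Y(1) by (intro member_le_sum) (auto intro!: sum_nonneg)
    then show ?thesis unfolding c_def by linarith
  qed
  have c1: "c \<ge> 1" by (simp add: c_def)
  define S where "S = nat \<lceil>(1 + \<bar>s\<bar>) * real c\<rceil> + 1"
  have S: "(1 + \<bar>s\<bar>) * real c \<le> real S" "S \<ge> 1" unfolding S_def by linarith+
  \<comment> \<open>With A = W B this choice turns the bound 3 B A (3 c A)^(2 |Y|) for the number of
    cells into A^(2 |Y| + 2), which is at most A^(2 r) and so less than the number (A + 1)^(2 r) of
    pairs.\<close>
  define W where "W = 3 * (3 * c) ^ (2 * card Y)"
  have W: "W \<ge> 1" using c1 by (simp add: W_def)
  define e where "e = (\<lambda>(f :: nat \<Rightarrow> int) (y :: real). \<Sum>j<r. of_int (f j) * y ^ j)"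
  have e_bound: "\<bar>e f y\<bar> \<le> real c * real A"
    if "y \<in> insert t Y" "\<And>j. j < r \<Longrightarrow> \<bar>f j\<bar> \<le> int A" for f y A
  proof -
    have "\<bar>e f y\<bar> \<le> (\<Sum>j<r. \<bar>of_int (f j) * y ^ j\<bar>)" unfolding e_def by (rule sum_abs)
    also have "\<dots> \<le> (\<Sum>j<r. real A * \<bar>y\<bar> ^ j)"
    proof (rule sum_mono)
      fix j assume "j \<in> {..<r}"
      then have "\<bar>f j\<bar> \<le> int A" using that(2) by simp
      then have "\<bar>real_of_int (f j)\<bar> \<le> real A" by linarith
      then show "\<bar>of_int (f j) * y ^ j\<bar> \<le> real A * \<bar>y\<bar> ^ j"
        by (simp add: abs_mult power_abs mult_right_mono)
    qed
    also have "\<dots> = real A * (\<Sum>j<r. \<bar>y\<bar> ^ j)" by (simp add: sum_distrib_left)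
    also have "\<dots> \<le> real A * real c" using c[OF that(1)] by (intro mult_left_mono) auto
    finally show ?thesis by (simp add: mult.commute)
  qed
  show ?thesis
  proof (rule exI[of _ "real S"], rule exI[of _ "real (c * W)"], intro allI impI)
    fix B :: nat assume B: "B > 0"
    define A where "A = W * B"
    have A: "A \<ge> 1" using W B by (simp add: A_def)
    define box where "box = ({..<r} \<rightarrow>\<^sub>E {0..int A})"
    \<comment> \<open>The cell of a pair: its linear form at t in steps of S / B, and its values at
      the points of Y in unit steps.\<close>
    define \<Phi> where "\<Phi> = (\<lambda>(f, g). (\<lfloor>(e f t - s * e g t) * real B / real S\<rfloor>,
      restrict (\<lambda>y. \<lfloor>e f y\<rfloor>) Y, restrict (\<lambda>y. \<lfloor>e g y\<rfloor>) Y))"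
    define R where "R = {- int (B * A)..int (B * A)} \<times> (Y \<rightarrow>\<^sub>E {- int (c * A)..int (c * A)}) \<times>
        (Y \<rightarrow>\<^sub>E {- int (c * A)..int (c * A)})"
    have box_abs: "\<bar>f j\<bar> \<le> int A" if "f \<in> box" "j < r" for f j
      using that by (auto simp: box_def PiE_iff)
    have "\<Phi> (f, g) \<in> R" if fg: "f \<in> box" "g \<in> box" for f g
    proof -
      have b: "\<bar>e f y\<bar> \<le> of_int (int (c * A))" "\<bar>e g y\<bar> \<le> of_int (int (c * A))"
          if "y \<in> insert t Y" for y
        using e_bound[OF that, of f A] e_bound[OF that, of g A] box_abs fg by auto
      have "\<bar>e f t - s * e g t\<bar> \<le> \<bar>e f t\<bar> + \<bar>s\<bar> * \<bar>e g t\<bar>"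
        by (metis abs_mult abs_triangle_ineq4)
      also have "\<dots> \<le> real (c * A) + \<bar>s\<bar> * real (c * A)"
        using b[of t] by (intro add_mono mult_left_mono) auto
      also have "\<dots> = (1 + \<bar>s\<bar>) * real c * real A" by (simp add: algebra_simps)
      also have "\<dots> \<le> real S * real A" using S(1) by (intro mult_right_mono) auto
      finally have "\<bar>e f t - s * e g t\<bar> * real B \<le> real S * real A * real B"
          by (intro mult_right_mono) auto
      then have "\<bar>(e f t - s * e g t) * real B / real S\<bar> \<le> of_int (int (B * A))"
        using S(2) by (simp add: abs_mult divide_le_eq mult_ac)
      then have "\<lfloor>(e f t - s * e g t) * real B / real S\<rfloor> \<in> {- int (B * A)..int (B * A)}"
        by (rule floor_mem_interval)
      moreover have "\<lfloor>e f y\<rfloor> \<in> {- int (c * A)..int (c * A)}"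
          "\<lfloor>e g y\<rfloor> \<in> {- int (c * A)..int (c * A)}" if "y \<in> Y" for y
        using b[of y] that by (auto intro!: floor_mem_interval simp del: atLeastAtMost_iff)
      ultimately show ?thesis unfolding \<Phi>_def R_def by (simp add: PiE_iff)
    qed
    then have "\<Phi> ` (box \<times> box) \<subseteq> R" by auto
    moreover have finR: "finite R" unfolding R_def using Y(1)
        by (intro finite_cartesian_product finite_PiE) auto
    ultimately have "card (\<Phi> ` (box \<times> box)) \<le> card R" by (intro card_mono)
    also have "card R = (2 * (B * A) + 1) * ((2 * (c * A) + 1) ^ card Y * (2 * (c * A) + 1) ^
        card Y)"
    proof -
      have i: "card {- int k..int k} = 2 * k + 1" for k by simp
      show ?thesis unfolding R_def card_cartesian_product card_PiE[OF Y(1)] prod_constant i ..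
    qed
    also have "\<dots> \<le> (3 * (B * A)) * ((3 * (c * A)) ^ card Y * (3 * (c * A)) ^ card Y)"
      using A B c1 by (intro mult_mono power_mono) auto
    also have "\<dots> = 3 * B * A * (3 * c * A) ^ (2 * card Y)"
        by (simp only: mult_2 power_add mult.assoc)
    also have "\<dots> = (W * B) * A ^ (2 * card Y + 1)"
      by (simp add: W_def power_mult_distrib power_add mult_ac)
    also have "\<dots> = A ^ (2 * card Y + 2)" by (simp add: A_def)
    also have "\<dots> \<le> A ^ (2 * r)" using A Y(2) by (intro power_increasing) auto
    also have "\<dots> < (A + 1) ^ (2 * r)" using Y(2) by (intro power_strict_mono) auto
    also have "\<dots> = card (box \<times> box)"
    proof -
      have "card box = (A + 1) ^ r" unfolding box_def
          by (subst card_PiE) (auto simp: nat_add_distrib)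
      then show ?thesis by (simp add: card_cartesian_product power_add[symmetric] mult_2)
    qed
    finally have "\<not> inj_on \<Phi> (box \<times> box)" using pigeonhole by blast
    then obtain f g f' g' where fg: "f \<in> box" "g \<in> box" "f' \<in> box" "g' \<in> box"
      "(f, g) \<noteq> (f', g')" "\<Phi> (f, g) = \<Phi> (f', g')" unfolding inj_on_def by blast
    define pol where "pol = (\<lambda>h. \<Sum>j<r. monom (h j) j :: int poly)"
    define p where "p = pol (\<lambda>j. f j - f' j)"
    define q where "q = pol (\<lambda>j. g j - g' j)"
    have cf: "coeff (pol h) j = (if j < r then h j else 0)" for h j
      by (simp add: pol_def coeff_sum if_distrib cong: if_cong)
    have deg: "degree (pol h) < r" for h
    proof -
      have "degree (pol h) \<le> r - 1" using cf by (intro degree_le) auto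
      then show ?thesis using Y(2) by simp
    qed
    have ev: "ieval (pol h) y = e h y" for h and y :: real
      by (simp add: pol_def ieval_sum e_def)
    have evp: "ieval p y = e f y - e f' y" and evq: "ieval q y = e g y - e g' y" for y
      unfolding p_def q_def ev by (simp_all add: e_def sum_subtractf[symmetric] algebra_simps)
    have ne: "(p, q) \<noteq> (0, 0)"
    proof
      assume "(p, q) = (0, 0)"
      then have "f j = f' j \<and> g j = g' j" if "j < r" for j
        using that cf[of "\<lambda>j. f j - f' j" j] cf[of "\<lambda>j. g j - g' j" j] by (simp add: p_def q_def)
      then have "f = f'" "g = g'"
        using fg(1-4) PiE_ext[of f "{..<r}" "\<lambda>_. {0..int A}" f']
            PiE_ext[of g "{..<r}" "\<lambda>_. {0..int A}" g']
        by (auto simp: box_def)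
      then show False using fg(5) by simp
    qed
    have small: "\<bar>ieval p t - s * ieval q t\<bar> \<le> real S / real B"
    proof -
      have "\<lfloor>(e f t - s * e g t) * real B / real S\<rfloor> = \<lfloor>(e f' t - s * e g' t) * real B / real S\<rfloor>"
        using fg(6) by (simp add: \<Phi>_def)
      then have "\<bar>(e f t - s * e g t) * real B / real S - (e f' t - s * e g' t) * real B / real
          S\<bar> < 1"
        by (rule floor_eq_imp_abs_diff_less)
      also have "(e f t - s * e g t) * real B / real S - (e f' t - s * e g' t) * real B / real S
         = (ieval p t - s * ieval q t) * (real B / real S)"
        by (simp add: evp evq algebra_simps diff_divide_distrib add_divide_distrib)
      finally have "\<bar>ieval p t - s * ieval q t\<bar> * (real B / real S) < 1" by (simp add: abs_mult)
      then show ?thesis using B S(2) by (simp add: field_simps)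
    qed
    have d: "\<bar>f j - f' j\<bar> \<le> int A" "\<bar>g j - g' j\<bar> \<le> int A" if "j < r" for j
    proof -
      have "0 \<le> h j \<and> h j \<le> int A" if "h \<in> box" for h
        using that \<open>j < r\<close> by (auto simp: box_def PiE_iff)
      then have "0 \<le> f j \<and> f j \<le> int A" "0 \<le> f' j \<and> f' j \<le> int A" "0 \<le> g j \<and> g j \<le> int A"
          "0 \<le> g' j \<and> g' j \<le> int A"
        using fg(1-4) by blast+
      then show "\<bar>f j - f' j\<bar> \<le> int A" "\<bar>g j - g' j\<bar> \<le> int A" by linarith+
    qed
    have big: "\<bar>ieval p t\<bar> \<le> real (c * W) * real B" "\<bar>ieval q t\<bar> \<le> real (c * W) * real B"
      using e_bound[of t "\<lambda>j. f j - f' j" A] e_bound[of t "\<lambda>j. g j - g' j" A] d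
      by (auto simp: p_def q_def ev A_def mult.assoc)
    have other: "\<bar>ieval p y\<bar> \<le> 1 \<and> \<bar>ieval q y\<bar> \<le> 1" if "y \<in> Y" for y
    proof -
      have "restrict (\<lambda>y. \<lfloor>e f y\<rfloor>) Y y = restrict (\<lambda>y. \<lfloor>e f' y\<rfloor>) Y y"
        "restrict (\<lambda>y. \<lfloor>e g y\<rfloor>) Y y = restrict (\<lambda>y. \<lfloor>e g' y\<rfloor>) Y y"
        using fg(6) by (simp_all add: \<Phi>_def)
      then have "\<lfloor>e f y\<rfloor> = \<lfloor>e f' y\<rfloor>" "\<lfloor>e g y\<rfloor> = \<lfloor>e g' y\<rfloor>" using that by auto
      then show ?thesis unfolding evp evq using floor_eq_imp_abs_diff_less
          by (simp add: less_imp_le)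
    qed
    show "\<exists>p q :: int poly. degree p < r \<and> degree q < r \<and> (p, q) \<noteq> (0, 0) \<and>
     \<bar>ieval p t - s * ieval q t\<bar> \<le> real S / of_nat B \<and>
     \<bar>ieval p t\<bar> \<le> real (c * W) * of_nat B \<and> \<bar>ieval q t\<bar> \<le> real (c * W) * of_nat B \<and>
     (\<forall>y\<in>Y. \<bar>ieval p y\<bar> \<le> 1 \<and> \<bar>ieval q y\<bar> \<le> 1)"
      using deg ne small big other unfolding p_def q_def by blast
  qed
qed

context tr_field
begin

lemma int_multiple:
  assumes "x \<in> K"
  shows "\<exists>T::int. T > 0 \<and> (\<exists>w. of_int T * x = ieval w t)"
proof -
  obtain p where p: "x = reval p t" using assms by (auto simp: K adjoin_def)
  obtain T :: int where T: "T > 0" "\<forall>q\<in>coeff p ` {..degree p}. of_int T * q \<in> \<int>"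
    using common_denominator[of "coeff p ` {..degree p}"] by auto
  have int: "of_int T * coeff p i \<in> \<int>" for i
    by (cases "i \<le> degree p") (use T(2) in \<open>auto simp: coeff_eq_0\<close>)
  define w where "w = map_poly floor (smult (of_int T) p)"
  have "map_poly of_int w = smult (of_int T) p"
    unfolding w_def by (intro poly_eqI) (use int in \<open>auto simp: coeff_map_poly elim!: Ints_cases\<close>)
  then have "ieval w t = reval (smult (of_int T) p) t" by (metis reval_of_int)
  then have "of_int T * x = ieval w t" by (simp add: reval_smult p)
  then show ?thesis using T(1) by blast
qed

lemma ieval_in_K: "ieval p t \<in> K"
  unfolding K adjoin_def reval_of_int[symmetric] by blast

lemma finite_roots: "finite {y :: real. reval m y = 0}"
  using m unfolding reval_def minpoly_def by (intro poly_roots_finite) auto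

lemma card_roots_le: "card {y :: real. reval m y = 0} \<le> degree m"
proof -
  have m0: "map_poly of_rat m \<noteq> (0 :: real poly)" using m by (auto simp: minpoly_def)
  show ?thesis using card_poly_roots_bound[OF m0] by (simp add: reval_def)
qed

text \<open>By \<open>dirichlet_pigeonhole\<close> and the finiteness of bounded houses infinitely
  many pairs share one norm n, and two of them are congruent modulo an integer T that is a multiple
  of n in Z[t]. The quotient of the two elements x + s y is then integral over Z[t] in both
  coordinates and has norm one.\<close>

theorem pell_equation:
  fixes D :: real
  assumes D: "D = ieval \<delta> t" "D > 0" and nonsquare: "\<And>z. z \<in> K \<Longrightarrow> z\<^sup>2 \<noteq> D"
  shows "\<exists>p q. (ieval p t)\<^sup>2 - D * (ieval q t)\<^sup>2 = 1 \<and> ieval q t \<noteq> 0"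
proof -
  define r where "r = degree m"
  define s where "s = sqrt D"
  have s: "s\<^sup>2 = D" "s > 0" using D by (simp_all add: s_def)
  define Y where "Y = {y :: real. reval m y = 0} - {t}"
  have tm: "reval m t = 0" using m by (simp add: minpoly_def)
  have Y: "finite Y" "card Y < r"
  proof -
    show "finite Y" using finite_roots by (simp add: Y_def)
    have "card Y < card {y :: real. reval m y = 0}"
      unfolding Y_def using finite_roots tm by (intro psubset_card_mono) auto
    then show "card Y < r" using card_roots_le by (simp add: r_def)
  qed
  obtain S M where SM: "\<forall>B>0. \<exists>p q :: int poly. degree p < r \<and> degree q < r \<and> (p, q) \<noteq> (0, 0) \<and>
     \<bar>ieval p t - s * ieval q t\<bar> \<le> S / of_nat B \<and>
     \<bar>ieval p t\<bar> \<le> M * of_nat B \<and> \<bar>ieval q t\<bar> \<le> M * of_nat B \<and>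
     (\<forall>y\<in>Y. \<bar>ieval p y\<bar> \<le> 1 \<and> \<bar>ieval q y\<bar> \<le> 1)"
    using dirichlet_pigeonhole[OF Y, of t s] by blast
  define nrm where "nrm = (\<lambda>(p, q). (ieval p t)\<^sup>2 - D * (ieval q t)\<^sup>2)"
  define lf where "lf = (\<lambda>(p, q). ieval p t - s * ieval q t)"
  \<comment> \<open>The first term bounds the norm p^2 - D q^2 at t, where one linear factor is
    small and the other large; the sum bounds its conjugates, where p and q are at most 1 in
    absolute value.\<close>
  define H where "H = \<bar>S * (M + s * M)\<bar> + (\<Sum>y\<in>Y. 1 + \<bar>ieval \<delta> y\<bar>)"
  have H0: "H \<ge> 0" by (simp add: H_def sum_nonneg)
  define N0 where "N0 = {x :: real. complex_of_real x \<in> bounded_house r H}"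
  have "N0 = complex_of_real -` bounded_house r H" by (auto simp: N0_def)
  then have finN0: "finite N0" using finite_bounded_house[OF H0]
      by (simp add: finite_vimageI inj_of_real)
  define good where "good = (\<lambda>(p :: int poly, q :: int poly). degree p < r \<and> degree q < r \<and>
      (p, q) \<noteq> (0, 0) \<and> nrm (p, q) \<in> N0)"
  \<comment> \<open>A vanishing factor would make D the square of x / y in K, or else force p = q =
    0 by the degree bound.\<close>
  have indep: "x - s * y \<noteq> 0 \<and> x + s * y \<noteq> 0"
      if xy: "x = ieval p t" "y = ieval q t" "degree p < r" "degree q < r" "(p, q) \<noteq> (0, 0)"
      for x y p q
  proof -
    have "x\<^sup>2 \<noteq> D * y\<^sup>2"
    proof
      assume eq: "x\<^sup>2 = D * y\<^sup>2"
      have "y \<noteq> 0"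
      proof
        assume "y = 0"
        then have "x = 0" using eq by simp
        then have "p = 0" "q = 0" using minpoly_ieval_eq_0[OF m] xy \<open>y = 0\<close> by (auto simp: r_def)
        then show False using xy by simp
      qed
      then have "(x / y)\<^sup>2 = D" using eq by (simp add: power_divide)
      moreover have "x / y \<in> K" using xy ieval_in_K by (auto intro!: subfield_setD(7)[OF sub])
      ultimately show False using nonsquare by blast
    qed
    moreover have "(x - s * y) * (x + s * y) = x\<^sup>2 - D * y\<^sup>2"
      using s(1) by (simp add: algebra_simps power2_eq_square)
    ultimately show ?thesis by auto
  qed
  have small: "\<exists>pq. good pq \<and> \<bar>lf pq\<bar> \<le> S / of_nat B" if B: "B > 0" for B :: nat
  proof -
    obtain p q :: "int poly" where pq: "degree p < r" "degree q < r" "(p, q) \<noteq> (0, 0)"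
     "\<bar>ieval p t - s * ieval q t\<bar> \<le> S / of_nat B"
     "\<bar>ieval p t\<bar> \<le> M * of_nat B" "\<bar>ieval q t\<bar> \<le> M * of_nat B"
     "\<forall>y\<in>Y. \<bar>ieval p y\<bar> \<le> 1 \<and> \<bar>ieval q y\<bar> \<le> 1" using SM B by blast
    define \<nu> where "\<nu> = p * p - \<delta> * (q * q)"
    have \<nu>: "ieval \<nu> y = (ieval p y)\<^sup>2 - ieval \<delta> y * (ieval q y)\<^sup>2" for y :: real
      by (simp add: \<nu>_def ieval_diff ieval_mult power2_eq_square)
    have bd: "\<bar>reval (map_poly of_int \<nu>) y\<bar> \<le> H" if y: "reval m y = 0" for y :: real
    proof (cases "y = t")
      case True
      have "ieval \<nu> t = (ieval p t - s * ieval q t) * (ieval p t + s * ieval q t)"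
        using s(1) D(1) by (simp add: \<nu> algebra_simps power2_eq_square)
      then have "\<bar>ieval \<nu> t\<bar> = \<bar>ieval p t - s * ieval q t\<bar> * \<bar>ieval p t + s * ieval q t\<bar>"
        by (simp add: abs_mult)
      also have "\<dots> \<le> (S / of_nat B) * (M * of_nat B + s * (M * of_nat B))"
      proof (rule mult_mono)
        have "\<bar>ieval p t + s * ieval q t\<bar> \<le> \<bar>ieval p t\<bar> + s * \<bar>ieval q t\<bar>"
          using s(2) by (metis abs_mult abs_of_pos abs_triangle_ineq)
        also have "\<dots> \<le> M * of_nat B + s * (M * of_nat B)"
          using pq(5,6) s(2) by (intro add_mono mult_left_mono) auto
        finally show "\<bar>ieval p t + s * ieval q t\<bar> \<le> M * of_nat B + s * (M * of_nat B)" .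
      qed (use pq(4) in auto)
      also have "\<dots> = S * (M + s * M)" using B by (simp add: field_simps)
      also have "\<dots> \<le> H" unfolding H_def by (simp add: sum_nonneg add_increasing2 abs_ge_self)
      finally show ?thesis using True by (simp add: reval_of_int)
    next
      case False
      then have yY: "y \<in> Y" using y by (simp add: Y_def)
      have b: "(ieval p y)\<^sup>2 \<le> 1" "(ieval q y)\<^sup>2 \<le> 1" using pq(7) yY
          by (simp_all add: abs_square_le_1)
      have "\<bar>ieval \<nu> y\<bar> \<le> \<bar>(ieval p y)\<^sup>2\<bar> + \<bar>ieval \<delta> y * (ieval q y)\<^sup>2\<bar>"
        unfolding \<nu> by (rule abs_triangle_ineq4)
      also have "\<dots> = (ieval p y)\<^sup>2 + \<bar>ieval \<delta> y\<bar> * (ieval q y)\<^sup>2" by (simp add: abs_mult)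
      also have "\<dots> \<le> 1 + \<bar>ieval \<delta> y\<bar> * 1" using b by (intro add_mono mult_left_mono) auto
      also have "\<dots> \<le> (\<Sum>y\<in>Y. 1 + \<bar>ieval \<delta> y\<bar>)"
        using member_le_sum[of y Y "\<lambda>y. 1 + \<bar>ieval \<delta> y\<bar>"] yY Y(1) by simp
      also have "\<dots> \<le> H" by (simp add: H_def)
      finally show ?thesis by (simp add: reval_of_int)
    qed
    have "complex_of_real (reval (map_poly of_int \<nu>) t) \<in> bounded_house (degree m) H"
      using bounded_house[of "map_poly of_int \<nu>" H] bd algebraic_int_ieval[OF integral, of \<nu>]
      by (simp add: reval_of_int)
    then have "nrm (p, q) \<in> N0" by (simp add: reval_of_int N0_def r_def nrm_def \<nu> D(1))
    then show ?thesis using pq by (intro exI[of _ "(p, q)"]) (simp add: good_def lf_def)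
  qed
  \<comment> \<open>The values |p - s q| are positive but get arbitrarily small, so there are
    infinitely many of them. Indexing the pairs by this value ensures that different indices exclude
    a quotient of 1 or -1.\<close>
  define V where "V = (\<lambda>pq. \<bar>lf pq\<bar>) ` {pq. good pq}"
  have Vpos: "v > 0" if "v \<in> V" for v
    using that indep by (auto simp: V_def good_def lf_def)
  have infV: "infinite V"
  proof
    assume fin: "finite V"
    have "V \<noteq> {}" using small[of 1] by (auto simp: V_def)
    then have "Min V > 0" using Vpos fin by simp
    obtain B :: nat where B: "B > 0" "S / of_nat B < Min V"
    proof -
      obtain B :: nat where "S / Min V < of_nat B" using reals_Archimedean2 by blast
      then have "S < of_nat (Suc B) * Min V" using \<open>Min V > 0\<close> by (simp add: field_simps)
      then show thesis using that[of "Suc B"] by (simp add: divide_less_eq mult.commute)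
    qed
    obtain pq where "good pq" "\<bar>lf pq\<bar> \<le> S / of_nat B" using small[OF B(1)] by blast
    moreover have "Min V \<le> \<bar>lf pq\<bar>" using fin \<open>good pq\<close> by (intro Min_le) (auto simp: V_def)
    ultimately show False using B(2) by linarith
  qed
  define ch where "ch = (\<lambda>v. SOME pq. good pq \<and> \<bar>lf pq\<bar> = v)"
  have ch: "good (ch v)" "\<bar>lf (ch v)\<bar> = v" if "v \<in> V" for v
  proof -
    have "\<exists>pq. good pq \<and> \<bar>lf pq\<bar> = v" using that by (auto simp: V_def)
    then have "good (ch v) \<and> \<bar>lf (ch v)\<bar> = v" unfolding ch_def by (rule someI_ex)
    then show "good (ch v)" "\<bar>lf (ch v)\<bar> = v" by auto
  qed
  have "nrm pq \<in> N0" if "good pq" for pq using that by (cases pq) (simp add: good_def)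
  then have "(\<lambda>v. nrm (ch v)) ` V \<subseteq> N0" using ch(1) by blast
  then have "finite ((\<lambda>v. nrm (ch v)) ` V)" using finN0 finite_subset by blast
  from pigeonhole_infinite[OF infV this] obtain v0 where
    v0: "v0 \<in> V" "infinite {v \<in> V. nrm (ch v) = nrm (ch v0)}" by blast
  define n where "n = nrm (ch v0)"
  define V1 where "V1 = {v \<in> V. nrm (ch v) = n}"
  have infV1: "infinite V1" using v0 by (simp add: V1_def n_def)
  have n0: "n \<noteq> 0" and nK: "n \<in> K"
  proof -
    obtain p q where pq: "ch v0 = (p, q)" by fastforce
    have "good (p, q)" using ch(1)[OF v0(1)] pq by simp
    then have "(ieval p t - s * ieval q t) * (ieval p t + s * ieval q t) \<noteq> 0"
      using indep[of "ieval p t" p "ieval q t" q] by (auto simp: good_def)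
    moreover have "n = (ieval p t - s * ieval q t) * (ieval p t + s * ieval q t)"
      using s(1) by (simp add: n_def pq nrm_def algebra_simps power2_eq_square)
    ultimately show "n \<noteq> 0" by simp
    have "n = ieval (p * p - \<delta> * (q * q)) t"
      by (simp add: n_def pq nrm_def ieval_diff ieval_mult D(1) power2_eq_square)
    then show "n \<in> K" using ieval_in_K by metis
  qed
  \<comment> \<open>T is n times an element of Z[t], so a congruence modulo T becomes divisibility
    by n.\<close>
  obtain T :: int and w where T: "T > 0" "of_int T * inverse n = ieval w t"
    using int_multiple[OF subfield_setD(6)[OF sub nK]] by blast
  define red where "red = (\<lambda>p :: int poly. restrict (\<lambda>j. coeff p j mod T) {..<r})"
  have "(\<lambda>v. (red (fst (ch v)), red (snd (ch v)))) ` V1 \<subseteq> ({..<r} \<rightarrow>\<^sub>E {0..<T}) \<times> ({..<r} \<rightarrow>\<^sub>E {0..<T})"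
  proof -
    have "red p \<in> {..<r} \<rightarrow>\<^sub>E {0..<T}" for p
      unfolding red_def using T(1) by (simp add: restrict_PiE_iff)
    then show ?thesis by blast
  qed
  then have "finite ((\<lambda>v. (red (fst (ch v)), red (snd (ch v)))) ` V1)"
    by (rule finite_subset) (intro finite_cartesian_product finite_PiE; simp)
  from pigeonhole_infinite[OF infV1 this] obtain v1 where
    v1: "v1 \<in> V1" "infinite {v \<in> V1. (red (fst (ch v)), red (snd (ch v))) =
        (red (fst (ch v1)), red (snd (ch v1)))}"
    by blast
  define V2
      where "V2 = {v \<in> V1. (red (fst (ch v)), red (snd (ch v))) =
      (red (fst (ch v1)), red (snd (ch v1)))}"
  have "infinite (V2 - {v1})" using v1(2) unfolding V2_def by (rule infinite_remove)
  then obtain v2 where "v2 \<in> V2 - {v1}" using infinite_imp_nonempty by blast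
  then have v2: "v2 \<in> V1" "v2 \<noteq> v1"
      "red (fst (ch v2)) = red (fst (ch v1))" "red (snd (ch v2)) = red (snd (ch v1))"
    by (simp_all add: V2_def)
  obtain p1 q1 p2 q2 where pq: "ch v1 = (p1, q1)" "ch v2 = (p2, q2)" by (meson surj_pair)
  have g: "good (p1, q1)" "good (p2, q2)" using ch(1)[of v1] ch(1)[of v2] v1(1) v2(1) pq
      by (simp_all add: V1_def)
  have cong: "\<exists>a. p' = p + smult T a" if "red p = red p'" "degree p < r" "degree p' < r" for p p'
  proof -
    have dvd: "T dvd coeff (p' - p) j" for j
    proof (cases "j < r")
      case True
      have "red p j = red p' j" using that(1) by simp
      then have "coeff p j mod T = coeff p' j mod T" using True by (simp add: red_def)
      then show ?thesis by (metis coeff_diff mod_eq_dvd_iff)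
    next
      case False
      then show ?thesis using that by (simp add: coeff_eq_0)
    qed
    have "smult T (map_poly (\<lambda>c. c div T) (p' - p)) = p' - p"
      using dvd by (intro poly_eqI) (simp add: coeff_map_poly)
    then show ?thesis by (metis add.commute diff_add_cancel)
  qed
  obtain a b where ab: "p2 = p1 + smult T a" "q2 = q1 + smult T b"
    using cong[of p1 p2] cong[of q1 q2] v2(3,4) g by (auto simp: pq good_def)
  define x1 y1 x2 y2 where xy: "x1 = ieval p1 t" "y1 = ieval q1 t" "x2 = ieval p2 t"
      "y2 = ieval q2 t"
  define \<alpha> \<beta> where ab': "\<alpha> = ieval a t" "\<beta> = ieval b t"
  have x2: "x2 = x1 + of_int T * \<alpha>" and y2: "y2 = y1 + of_int T * \<beta>"
    by (simp_all add: xy ab ab' ieval_add ieval_smult)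
  have n1: "x1\<^sup>2 - D * y1\<^sup>2 = n" and n2: "x2\<^sup>2 - D * y2\<^sup>2 = n"
    using v1(1) v2(1) by (simp_all add: V1_def pq nrm_def xy)
  have Tn: "of_int T = n * ieval w t" using T(2) n0 by (simp add: field_simps)
  \<comment> \<open>Here u + s v = (x1 + s y1) / (x2 + s y2): multiplying numerator and denominator
    by x2 - s y2 gives the right sides of \<open>nu\<close> and \<open>nv\<close> over n. The form
    chosen shows that u and v are in Z[t].\<close>
  define u v where uv: "u = 1 + ieval w t * (x1 * \<alpha> - D * y1 * \<beta>)"
      "v = ieval w t * (\<alpha> * y1 - x1 * \<beta>)"
  have nu: "n * u = x1 * x2 - D * y1 * y2"
  proof -
    have "n * u = n + of_int T * (x1 * \<alpha> - D * y1 * \<beta>)" by (simp add: uv Tn algebra_simps)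
    also have "\<dots> = x1 * x2 - D * y1 * y2"
      unfolding x2 y2 n1[symmetric] by (simp add: algebra_simps power2_eq_square)
    finally show ?thesis .
  qed
  have nv: "n * v = x2 * y1 - x1 * y2"
  proof -
    have "n * v = of_int T * (\<alpha> * y1 - x1 * \<beta>)" by (simp add: uv Tn algebra_simps)
    also have "\<dots> = x2 * y1 - x1 * y2" unfolding x2 y2 by (simp add: algebra_simps)
    finally show ?thesis .
  qed
  have "n\<^sup>2 * (u\<^sup>2 - D * v\<^sup>2) = (n * u)\<^sup>2 - D * (n * v)\<^sup>2"
      by (simp add: algebra_simps power_mult_distrib)
  also have "\<dots> = (x1\<^sup>2 - D * y1\<^sup>2) * (x2\<^sup>2 - D * y2\<^sup>2)"
    unfolding nu nv by (simp add: algebra_simps power2_eq_square)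
  also have "\<dots> = n\<^sup>2" unfolding n1 n2 by (simp add: power2_eq_square)
  finally have pell: "u\<^sup>2 - D * v\<^sup>2 = 1" using n0 by simp
  \<comment> \<open>Otherwise u is 1 or -1 and the two linear forms agree up to sign, although their
    absolute values v1 and v2 differ.\<close>
  have "v \<noteq> 0"
  proof
    assume v: "v = 0"
    have e1: "x2 - s * y2 \<noteq> 0" "x2 + s * y2 \<noteq> 0"
      using indep[OF xy(3,4)] g(2) by (auto simp: good_def)
    have "(x1 - s * y1) * (x2 + s * y2) = (x1 * x2 - s\<^sup>2 * y1 * y2) - s * (x2 * y1 - x1 * y2)"
      by (simp add: algebra_simps power2_eq_square)
    also have "\<dots> = n * u" using nu nv v s(1) by simp
    also have "\<dots> = u * (x2 - s * y2) * (x2 + s * y2)"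
      unfolding n2[symmetric] s(1)[symmetric] by (simp add: algebra_simps power2_eq_square)
    finally have "x1 - s * y1 = u * (x2 - s * y2)" using e1 by simp
    moreover have "\<bar>u\<bar> = 1" using pell v by (auto simp: power2_eq_1_iff)
    ultimately have "\<bar>x1 - s * y1\<bar> = \<bar>x2 - s * y2\<bar>" by (simp add: abs_mult)
    moreover have "\<bar>x1 - s * y1\<bar> = v1" using ch(2)[of v1] v1(1) by (simp add: V1_def pq lf_def xy)
    moreover have "\<bar>x2 - s * y2\<bar> = v2" using ch(2)[of v2] v2(1) by (simp add: V1_def pq lf_def xy)
    ultimately show False using v2(2) by simp
  qed
  moreover have "u = ieval (1 + w * (p1 * a - \<delta> * q1 * b)) t" "v = ieval (w * (a * q1 - p1 * b)) t"
    by (simp_all add: uv xy ab' D(1) ieval_add ieval_diff ieval_mult)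
  ultimately show ?thesis using pell by metis
qed

end

section \<open>Elements of the commensurator\<close>

definition ip :: "nat \<Rightarrow> (nat \<Rightarrow> real) \<Rightarrow> (nat \<Rightarrow> real) \<Rightarrow> real" where
  "ip n A c = (\<Sum>k<n. A k * c k)"

text \<open>The matrix p A^T + q B^T. Infinitesimal rotations, rank one matrices and plane rotations
  minus the identity all have this shape, and it is kept under products, so that matrix identities
  reduce to scalar ones.\<close>

definition tens2 :: "nat \<Rightarrow> (nat \<Rightarrow> real) \<Rightarrow> (nat \<Rightarrow> real) \<Rightarrow> (nat \<Rightarrow> real) \<Rightarrow> (nat \<Rightarrow> real) \<Rightarrow> real mat"
    where
  "tens2 n p A q B = mat n n (\<lambda>(i, j). p i * A j + q i * B j)"

lemma ip_comm: "ip n x y = ip n y x"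
  by (simp add: ip_def mult.commute)

lemma ip_linear:
  "ip n A (\<lambda>i. c * x i + d * y i) = c * ip n A x + d * ip n A y"
  "ip n A (\<lambda>i. c * x i - d * y i) = c * ip n A x - d * ip n A y"
  "ip n A (\<lambda>i. c * x i) = c * ip n A x"
  "ip n A (\<lambda>i. - x i) = - ip n A x"
  "ip n A (\<lambda>i. 0) = 0"
  by (simp_all add: ip_def algebra_simps sum.distrib sum_subtractf sum_distrib_left sum_negf)

lemma tens2_carrier [simp]: "tens2 n p A q B \<in> carrier_mat n n"
  by (simp add: tens2_def)

lemma tens2_dim [simp]: "dim_row (tens2 n p A q B) = n" "dim_col (tens2 n p A q B) = n"
  by (simp_all add: tens2_def)

lemma tens2_index: "i < n \<Longrightarrow> j < n \<Longrightarrow> tens2 n p A q B $$ (i, j) = p i * A j + q i * B j"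
  by (simp add: tens2_def)

lemma one_add_mult_one_add:
  fixes A B :: "real mat"
  assumes "A \<in> carrier_mat n n" "B \<in> carrier_mat n n"
  shows "(1\<^sub>m n + A) * (1\<^sub>m n + B) = 1\<^sub>m n + B + (A + A * B)"
proof -
  have "(1\<^sub>m n + A) * (1\<^sub>m n + B) = 1\<^sub>m n * (1\<^sub>m n + B) + A * (1\<^sub>m n + B)"
    by (rule add_mult_distrib_mat[of _ n n]) (use assms in auto)
  also have "A * (1\<^sub>m n + B) = A * 1\<^sub>m n + A * B"
    by (rule mult_add_distrib_mat[of _ n n]) (use assms in auto)
  finally show ?thesis using assms left_mult_one_mat[of "1\<^sub>m n + B" n n] right_mult_one_mat[of A n
      n] by simp
qed

lemma tens2_mult:
  "tens2 n p A q B * tens2 n c C d D =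
     tens2 n (\<lambda>i. p i * ip n A c + q i * ip n B c) C (\<lambda>i. p i * ip n A d + q i * ip n B d) D"
proof (rule eq_matI)
  fix i j
  assume "i < dim_row (tens2 n (\<lambda>i. p i * ip n A c + q i * ip n B c) C (\<lambda>i. p i * ip n A d + q i
      * ip n B d) D)"
    "j < dim_col (tens2 n (\<lambda>i. p i * ip n A c + q i * ip n B c) C (\<lambda>i. p i * ip n A d + q i * ip
        n B d) D)"
  then have ij: "i < n" "j < n" by (simp_all add: tens2_def)
  have "(tens2 n p A q B * tens2 n c C d D) $$ (i, j) =
      (\<Sum>k<n. (p i * A k + q i * B k) * (c k * C j + d k * D j))"
    using ij by (simp add: tens2_def scalar_prod_def atLeast0LessThan)
  also have "\<dots> = (p i * ip n A c + q i * ip n B c) * C j + (p i * ip n A d + q i * ip n B d) * D j"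
    by (simp add: ip_def algebra_simps sum.distrib sum_distrib_left)
  finally show "(tens2 n p A q B * tens2 n c C d D) $$ (i, j) =
      tens2 n (\<lambda>i. p i * ip n A c + q i * ip n B c) C (\<lambda>i. p i * ip n A d + q i * ip n B d) D $$
          (i, j)"
    using ij by (simp add: tens2_def)
qed (simp_all add: tens2_def)

section \<open>Isometries of a quadratic form that rotate a plane\<close>

locale quad =
  fixes n :: nat and Q :: "real mat"
  assumes Q: "Q \<in> carrier_mat n n" and sym: "Q\<^sup>T = Q"
begin

definition Qf :: "(nat \<Rightarrow> real) \<Rightarrow> nat \<Rightarrow> real" where
  "Qf w j = (\<Sum>l<n. Q $$ (j, l) * w l)"

definition bl :: "(nat \<Rightarrow> real) \<Rightarrow> (nat \<Rightarrow> real) \<Rightarrow> real" where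
  "bl u w = ip n u (Qf w)"

lemma Q_sym: "i < n \<Longrightarrow> j < n \<Longrightarrow> Q $$ (i, j) = Q $$ (j, i)"
  using Q index_transpose_mat(1)[of j Q i] by (simp add: sym)

lemma bl_comm: "bl u w = bl w u"
proof -
  have "bl u w = (\<Sum>i<n. \<Sum>j<n. u i * (Q $$ (i, j) * w j))"
    by (simp add: bl_def ip_def Qf_def sum_distrib_left)
  also have "\<dots> = (\<Sum>j<n. \<Sum>i<n. u i * (Q $$ (i, j) * w j))" by (rule sum.swap)
  also have "\<dots> = (\<Sum>j<n. \<Sum>i<n. w j * (Q $$ (j, i) * u i))"
    by (intro sum.cong refl) (use Q_sym in auto)
  also have "\<dots> = bl w u" by (simp add: bl_def ip_def Qf_def sum_distrib_left)
  finally show ?thesis .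
qed

lemma ip_Qf: "ip n (Qf w) u = bl u w" "ip n u (Qf w) = bl u w"
  by (simp_all add: bl_def ip_comm)

lemma Qf_linear:
  "Qf (\<lambda>i. c * x i + d * y i) j = c * Qf x j + d * Qf y j"
  "Qf (\<lambda>i. c * x i - d * y i) j = c * Qf x j - d * Qf y j"
  "Qf (\<lambda>i. c * x i) j = c * Qf x j" "Qf (\<lambda>i. - x i) j = - Qf x j"
  by (simp_all add: Qf_def algebra_simps sum.distrib sum_subtractf sum_distrib_left sum_negf)

lemma bl_linear:
  "bl (\<lambda>i. c * x i + d * y i) w = c * bl x w + d * bl y w"
  "bl (\<lambda>i. c * x i - d * y i) w = c * bl x w - d * bl y w"
  "bl (\<lambda>i. c * x i) w = c * bl x w" "bl (\<lambda>i. - x i) w = - bl x w"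
  unfolding bl_comm[of _ w] by (simp_all add: bl_def ip_def Qf_linear algebra_simps sum.distrib
      sum_subtractf sum_distrib_left sum_negf)

lemma bl_linear':
  "bl w (\<lambda>i. c * x i + d * y i) = c * bl w x + d * bl w y"
  "bl w (\<lambda>i. c * x i - d * y i) = c * bl w x - d * bl w y"
  "bl w (\<lambda>i. c * x i) = c * bl w x" "bl w (\<lambda>i. - x i) = - bl w x"
  unfolding bl_comm[of w] bl_linear by simp_all

text \<open>\<open>rot a b x y\<close> acts on the plane spanned by the orthogonal vectors \<open>a\<close> and \<open>b\<close> like
  multiplication by \<open>x + y \<surd>D\<close> with \<open>D = - bl a a * bl b b\<close>, and trivially on its complement;
  \<open>wedge a b\<close> is its infinitesimal generator.\<close>

definition rot :: "(nat \<Rightarrow> real) \<Rightarrow> (nat \<Rightarrow> real) \<Rightarrow> real \<Rightarrow> real \<Rightarrow> real mat" where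
  "rot a b x y = 1\<^sub>m n + tens2 n (\<lambda>i. (x - 1) / bl a a * a i + y * b i) (Qf a)
     (\<lambda>i. (x - 1) / bl b b * b i - y * a i) (Qf b)"

definition wedge :: "(nat \<Rightarrow> real) \<Rightarrow> (nat \<Rightarrow> real) \<Rightarrow> real mat" where
  "wedge a b = tens2 n b (Qf a) (\<lambda>i. - a i) (Qf b)"

lemma rot_carrier [simp]: "rot a b x y \<in> carrier_mat n n"
  by (simp add: rot_def)

lemma rot_dim [simp]: "dim_row (rot a b x y) = n" "dim_col (rot a b x y) = n"
  by (simp_all add: rot_def)

lemma rot_1 [simp]: "rot a b 1 0 = 1\<^sub>m n"
  by (rule eq_matI) (auto simp: rot_def tens2_def)

lemma rot_index:
  "i < n \<Longrightarrow> j < n \<Longrightarrow> rot a b x y $$ (i, j) = (if i = j then 1 else 0) +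
     (((x - 1) / bl a a * a i + y * b i) * Qf a j + ((x - 1) / bl b b * b i - y * a i) * Qf b j)"
  by (simp add: rot_def tens2_def)

text \<open>This is the product (x + y sqrt D)(x' + y' sqrt D) in coordinates.\<close>

lemma rot_mult:
  assumes "bl a b = 0" "bl a a \<noteq> 0" "bl b b \<noteq> 0"
  shows "rot a b x y * rot a b x' y' = rot a b (x * x' - bl a a * bl b b * y * y')
      (x * y' + y * x')"
proof -
  let ?p = "\<lambda>x y i. (x - 1) / bl a a * a i + y * b i"
  let ?q = "\<lambda>x y i. (x - 1) / bl b b * b i - y * a i"
  let ?T = "\<lambda>x y. tens2 n (?p x y) (Qf a) (?q x y) (Qf b)"
  have ba: "bl b a = 0" using assms(1) bl_comm by simp
  have "rot a b x y * rot a b x' y' = 1\<^sub>m n + ?T x' y' + (?T x y + ?T x y * ?T x' y')"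
    unfolding rot_def by (rule one_add_mult_one_add) simp_all
  also have "\<dots> = rot a b (x * x' - bl a a * bl b b * y * y') (x * y' + y * x')"
    unfolding tens2_mult ip_linear ip_Qf ba assms(1)
  proof (rule eq_matI)
    fix i j assume "i < dim_row (rot a b (x * x' - bl a a * bl b b * y * y') (x * y' + y * x'))"
      "j < dim_col (rot a b (x * x' - bl a a * bl b b * y * y') (x * y' + y * x'))"
    then have ij: "i < n" "j < n" by (auto simp: rot_def)
    show "(1\<^sub>m n + ?T x' y' + (?T x y + tens2 n
         (\<lambda>i. ?p x y i * ((x' - 1) / bl a a * bl a a + y' * 0) + ?q x y i *
             ((x' - 1) / bl a a * 0 + y' * bl b b)) (Qf a)
         (\<lambda>i. ?p x y i * ((x' - 1) / bl b b * 0 - y' * bl a a) + ?q x y i *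
             ((x' - 1) / bl b b * bl b b - y' * 0)) (Qf b))) $$ (i, j)
      = rot a b (x * x' - bl a a * bl b b * y * y') (x * y' + y * x') $$ (i, j)"
      using ij assms(2,3) by (simp add: rot_index tens2_def field_simps)
  qed (auto simp: rot_def tens2_def)
  finally show ?thesis .
qed

lemma tens2_adjoint:
  "(tens2 n p (Qf a) q (Qf b))\<^sup>T * Q = Q * tens2 n a (Qf p) b (Qf q)"
proof (rule eq_matI)
  fix i j assume "i < dim_row (Q * tens2 n a (Qf p) b (Qf q))"
      "j < dim_col (Q * tens2 n a (Qf p) b (Qf q))"
  then have ij: "i < n" "j < n" using Q by (auto simp: tens2_def)
  have "((tens2 n p (Qf a) q (Qf b))\<^sup>T * Q) $$ (i, j) = (\<Sum>k<n. (p k * Qf a i + q k * Qf b i) * Q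
      $$ (k, j))"
    using ij Q by (simp add: tens2_def scalar_prod_def atLeast0LessThan)
  also have "\<dots> = (\<Sum>k<n. (p k * Qf a i + q k * Qf b i) * Q $$ (j, k))"
    using Q_sym ij by (intro sum.cong) auto
  also have "\<dots> = Qf a i * Qf p j + Qf b i * Qf q j"
    by (simp add: Qf_def[of _ j] algebra_simps sum.distrib sum_distrib_left)
  also have "\<dots> = (\<Sum>k<n. Q $$ (i, k) * (a k * Qf p j + b k * Qf q j))"
    by (simp add: Qf_def[of _ i] algebra_simps sum.distrib sum_distrib_left)
  also have "\<dots> = (Q * tens2 n a (Qf p) b (Qf q)) $$ (i, j)"
    using ij Q by (simp add: tens2_def scalar_prod_def atLeast0LessThan)
  finally show "((tens2 n p (Qf a) q (Qf b))\<^sup>T * Q) $$ (i, j) = (Q * tens2 n a (Qf p) b (Qf q)) $$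
      (i, j)" .
qed (use Q in \<open>auto simp: tens2_def\<close>)

text \<open>The adjoint with respect to Q is the conjugation y to - y of the quadratic extension, so
  x^2 - D y^2 = 1 becomes the isometry condition in \<open>rot_isometry\<close>.\<close>

lemma rot_adjoint: "(rot a b x y)\<^sup>T * Q = Q * rot a b x (- y)"
proof -
  let ?p = "\<lambda>x y i. (x - 1) / bl a a * a i + y * b i"
  let ?q = "\<lambda>x y i. (x - 1) / bl b b * b i - y * a i"
  have "(rot a b x y)\<^sup>T = 1\<^sub>m n + (tens2 n (?p x y) (Qf a) (?q x y) (Qf b))\<^sup>T"
    unfolding rot_def by (subst transpose_add[of _ n n]) auto
  then have "(rot a b x y)\<^sup>T * Q = Q + (tens2 n (?p x y) (Qf a) (?q x y) (Qf b))\<^sup>T * Q"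
    using Q by (simp add: add_mult_distrib_mat[of _ n n])
  also have "\<dots> = Q + Q * tens2 n a (Qf (?p x y)) b (Qf (?q x y))" by (simp only: tens2_adjoint)
  also have "tens2 n a (Qf (?p x y)) b (Qf (?q x y)) = tens2 n (?p x (- y)) (Qf a) (?q x (- y))
      (Qf b)"
    unfolding tens2_def Qf_linear by (rule eq_matI) (simp_all add: algebra_simps)
  also have "Q + Q * tens2 n (?p x (- y)) (Qf a) (?q x (- y)) (Qf b) = Q * rot a b x (- y)"
    unfolding rot_def using mult_add_distrib_mat[OF Q one_carrier_mat tens2_carrier] Q by simp
  finally show ?thesis .
qed

lemma rot_isometry:
  assumes "bl a b = 0" "bl a a \<noteq> 0" "bl b b \<noteq> 0" "x\<^sup>2 + bl a a * bl b b * y\<^sup>2 = 1"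
  shows "(rot a b x y)\<^sup>T * Q * rot a b x y = Q" "rot a b x (- y) * rot a b x y = 1\<^sub>m n"
    "rot a b x y * rot a b x (- y) = 1\<^sub>m n"
proof -
  show *: "rot a b x (- y) * rot a b x y = 1\<^sub>m n" "rot a b x y * rot a b x (- y) = 1\<^sub>m n"
    using assms(4) unfolding rot_mult[OF assms(1-3)]
        by (simp_all add: power2_eq_square mult.assoc algebra_simps)
  show "(rot a b x y)\<^sup>T * Q * rot a b x y = Q"
    unfolding rot_adjoint assoc_mult_mat[OF Q rot_carrier rot_carrier] * using Q by simp
qed

lemma det_isometry:
  assumes "det Q \<noteq> 0" "A \<in> carrier_mat n n" "A\<^sup>T * Q * A = Q"
  shows "det A * det A = 1"
proof -
  have "det (A\<^sup>T * Q * A) = det A * det Q * det A"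
    using assms(2) Q by (simp add: det_mult[of _ n] det_transpose)
  then show ?thesis using assms(1,3) by simp
qed

text \<open>Write R for the rotation, E for the projection onto its plane and N for
  \<open>wedge a b\<close>. Then R = 1 + (x - 1) E + y N and R^2 = 1 + 2 (x^2 - 1) E + 2 x y N;
  eliminating E leaves N. The coefficients are in K when x and y are, so the K-algebra generated by
  R contains N.\<close>

lemma rot_sq_relation:
  assumes "bl a b = 0" "bl a a \<noteq> 0" "bl b b \<noteq> 0" "x\<^sup>2 + bl a a * bl b b * y\<^sup>2 = 1" "y \<noteq> 0"
  shows "wedge a b = (- 1 / (2 * y)) \<cdot>\<^sub>m (rot a b x y * rot a b x y) + ((1 + x) / y) \<cdot>\<^sub>m rot a b x y
    + (- (1 + 2 * x) / (2 * y)) \<cdot>\<^sub>m 1\<^sub>m n"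
proof -
  have e: "x * x - bl a a * bl b b * y * y = 2 * x\<^sup>2 - 1" using assms(4)
      by (simp add: power2_eq_square algebra_simps)
  have "rot a b x y * rot a b x y = rot a b (2 * x\<^sup>2 - 1) (2 * x * y)"
    unfolding rot_mult[OF assms(1-3)] e by (simp add: algebra_simps)
  moreover have "wedge a b = (- 1 / (2 * y)) \<cdot>\<^sub>m rot a b (2 * x\<^sup>2 - 1) (2 * x * y) + ((1 + x) / y)
      \<cdot>\<^sub>m rot a b x y
    + (- (1 + 2 * x) / (2 * y)) \<cdot>\<^sub>m 1\<^sub>m n"
  proof (rule eq_matI)
    fix i j assume "i < dim_row ((- 1 / (2 * y)) \<cdot>\<^sub>m rot a b (2 * x\<^sup>2 - 1) (2 * x * y) +
        ((1 + x) / y) \<cdot>\<^sub>m rot a b x y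
    + (- (1 + 2 * x) / (2 * y)) \<cdot>\<^sub>m 1\<^sub>m n)" "j < dim_col ((- 1 / (2 * y)) \<cdot>\<^sub>m rot a b (2 * x\<^sup>2 - 1)
        (2 * x * y) + ((1 + x) / y) \<cdot>\<^sub>m rot a b x y
    + (- (1 + 2 * x) / (2 * y)) \<cdot>\<^sub>m 1\<^sub>m n)"
    then have ij: "i < n" "j < n" by auto
    show "wedge a b $$ (i, j) = ((- 1 / (2 * y)) \<cdot>\<^sub>m rot a b (2 * x\<^sup>2 - 1) (2 * x * y) +
        ((1 + x) / y) \<cdot>\<^sub>m rot a b x y
    + (- (1 + 2 * x) / (2 * y)) \<cdot>\<^sub>m 1\<^sub>m n) $$ (i, j)"
      using ij assms(2,3,5) by (simp add: rot_index wedge_def tens2_def field_simps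
          power2_eq_square)
  qed (auto simp: wedge_def tens2_def)
  ultimately show ?thesis by simp
qed

lemma isometry_hyperboloid:
  assumes A: "A \<in> carrier_mat n n" "A\<^sup>T * Q * A = Q" and x: "x \<in> hyperboloid Q"
  shows "A *\<^sub>v x \<in> hyperboloid Q"
proof -
  have xc: "x \<in> carrier_vec n" "x \<bullet> (Q *\<^sub>v x) = - 1" using x Q by (auto simp: hyperboloid_def)
  have Ax: "A *\<^sub>v x \<in> carrier_vec n" using A(1) xc(1) by (rule mult_mat_vec_carrier)
  have "(A *\<^sub>v x) \<bullet> (Q *\<^sub>v (A *\<^sub>v x)) = (Q *\<^sub>v (A *\<^sub>v x)) \<bullet> (A *\<^sub>v x)"
    by (rule comm_scalar_prod) (use Q Ax in auto)
  also have "\<dots> = (A\<^sup>T *\<^sub>v (Q *\<^sub>v (A *\<^sub>v x))) \<bullet> x"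
    using transpose_vec_mult_scalar[OF A(1) xc(1), of "Q *\<^sub>v (A *\<^sub>v x)"] Q Ax by simp
  also have "A\<^sup>T *\<^sub>v (Q *\<^sub>v (A *\<^sub>v x)) = (A\<^sup>T * Q * A) *\<^sub>v x"
    using A(1) Q xc(1) by (simp add: assoc_mult_mat_vec[of _ n n _ n])
  also have "\<dots> = Q *\<^sub>v x" by (simp only: A(2))
  also have "(Q *\<^sub>v x) \<bullet> x = x \<bullet> (Q *\<^sub>v x)"
    by (rule comm_scalar_prod) (use Q xc in auto)
  finally show ?thesis using Ax Q xc by (auto simp: hyperboloid_def)
qed

text \<open>The path of isometries moves x through a connected subset of the hyperboloid, which
  stays in the component of x.\<close>

lemma isometry_path_component:
  assumes A: "\<And>s :: real. A s \<in> carrier_mat n n" "\<And>s. (A s)\<^sup>T * Q * A s = Q" "A 0 = 1\<^sub>m n"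
    and cont: "\<And>i j. i < n \<Longrightarrow> j < n \<Longrightarrow> continuous_on UNIV (\<lambda>s. A s $$ (i, j))"
    and C: "C \<in> hyperboloid_components Q" and x: "x \<in> C"
  shows "A s *\<^sub>v x \<in> C"
proof -
  obtain C' where C': "C' \<in> components (vec_coords ` hyperboloid Q)"
      "C = {x \<in> hyperboloid Q. vec_coords x \<in> C'}"
    using C by (auto simp: hyperboloid_components_def)
  have xh: "x \<in> hyperboloid Q" "vec_coords x \<in> C'" using x C'(2) by auto
  have xc: "x \<in> carrier_vec n" using xh Q by (auto simp: hyperboloid_def)
  define f where "f = (\<lambda>s. vec_coords (A s *\<^sub>v x))"
  have "continuous_on UNIV f"
  proof (rule continuous_on_coordinatewise_then_product)
    fix i
    have "f s i = (if i < n then \<Sum>j<n. A s $$ (i, j) * x $ j else 0)" for s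
      using A(1)[of s] xc by (auto simp: f_def vec_coords_def scalar_prod_def atLeast0LessThan)
    then have eq: "(\<lambda>s. f s i) = (\<lambda>s. if i < n then \<Sum>j<n. A s $$ (i, j) * x $ j else 0)"
        by (rule ext)
    show "continuous_on UNIV (\<lambda>s. f s i)"
      unfolding eq using cont by (cases "i < n") (auto intro!: continuous_intros)
  qed
  then have conn: "connected (range f)" by (intro connected_continuous_image) auto
  have sub: "range f \<subseteq> vec_coords ` hyperboloid Q"
    using isometry_hyperboloid[OF A(1) A(2) xh(1)] by (auto simp: f_def)
  have "f 0 = vec_coords x" using A(3) xc by (simp add: f_def)
  then have "C' \<inter> range f \<noteq> {}" using xh(2) by (metis IntI empty_iff rangeI)
  then have "range f \<subseteq> C'" using components_maximal[OF C'(1) conn sub] by simp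
  then show ?thesis using C'(2) isometry_hyperboloid[OF A(1) A(2) xh(1)] by (auto simp: f_def)
qed

text \<open>For D > 0 the solutions of x^2 - D y^2 = 1 with x > 0 form one branch of a hyperbola,
  parametrised by cosh s and sinh s / sqrt D, which joins the rotation to the identity. The inverse
  rotation gives surjectivity.\<close>

lemma rot_preserves_components:
  assumes ab: "bl a b = 0" "bl a a \<noteq> 0" "bl b b \<noteq> 0" and D: "- bl a a * bl b b > 0"
    and xy: "x\<^sup>2 + bl a a * bl b b * y\<^sup>2 = 1" "x > 0"
    and C: "C \<in> hyperboloid_components Q"
  shows "(\<lambda>v. rot a b x y *\<^sub>v v) ` C = C"
proof -
  have sub: "rot a b x y *\<^sub>v v \<in> C" if xy: "x\<^sup>2 + bl a a * bl b b * y\<^sup>2 = 1" "x > 0" and v: "v \<in> C"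
      for x y v
  proof -
    define k where "k = sqrt (- bl a a * bl b b)"
    have k: "k > 0" "k\<^sup>2 = - bl a a * bl b b" using D by (simp_all add: k_def)
    define A where "A = (\<lambda>s. rot a b (cosh s) (sinh s / k))"
    have iso: "(A s)\<^sup>T * Q * A s = Q" for s
      unfolding A_def
    proof (rule rot_isometry(1)[OF ab])
      have "bl a a * bl b b * (sinh s / k)\<^sup>2 = - (sinh s)\<^sup>2"
        using k ab by (simp add: power_divide)
      then show "(cosh s)\<^sup>2 + bl a a * bl b b * (sinh s / k)\<^sup>2 = 1" using cosh_square_eq[of s] by simp
    qed
    define s where "s = arsinh (k * y)"
    have "sinh s = k * y" by (simp add: s_def)
    moreover have "cosh s = x"
    proof -
      have "(cosh s)\<^sup>2 = x\<^sup>2"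
        using cosh_square_eq[of s] \<open>sinh s = k * y\<close> k(2) xy(1) by (simp add: power_mult_distrib)
      then show ?thesis using xy(2) cosh_real_nonneg[of s] by (simp add: power2_eq_iff_nonneg)
    qed
    ultimately have "A s = rot a b x y" using k(1) by (simp add: A_def)
    moreover have "A s *\<^sub>v v \<in> C"
    proof (rule isometry_path_component[OF _ iso _ _ C v])
      show "A s \<in> carrier_mat n n" for s by (simp add: A_def)
      show "A 0 = 1\<^sub>m n" by (simp add: A_def)
      show "continuous_on UNIV (\<lambda>s. A s $$ (i, j))" if "i < n" "j < n" for i j
        unfolding A_def rot_index[OF that] using k(1) ab by (auto intro!: continuous_intros)
    qed
    ultimately show ?thesis by simp
  qed
  show ?thesis
  proof
    show "(\<lambda>v. rot a b x y *\<^sub>v v) ` C \<subseteq> C" using sub[OF xy] by blast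
    show "C \<subseteq> (\<lambda>v. rot a b x y *\<^sub>v v) ` C"
    proof
      fix v assume v: "v \<in> C"
      then have vc: "v \<in> carrier_vec n" using C Q
          by (auto simp: hyperboloid_components_def hyperboloid_def)
      have "rot a b x (- y) *\<^sub>v v \<in> C" using sub[of x "- y"] xy v by simp
      moreover have "rot a b x y *\<^sub>v (rot a b x (- y) *\<^sub>v v) = v"
        using rot_isometry(3)[OF ab xy(1)] vc by (simp flip: assoc_mult_mat_vec[of _ n n _ n])
      ultimately show "v \<in> (\<lambda>v. rot a b x y *\<^sub>v v) ` C" by (metis imageI)
    qed
  qed
qed

end


text \<open>Clearing denominators by N turns the value into A^2 + N C with A = s U. For s at least N
  C it lies strictly between A^2 and (A + 1)^2, whereas a rational square root would be an
  integer.\<close>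

lemma nonsquare_eventually:
  fixes u c :: real
  assumes "u \<in> \<rat>" "c \<in> \<rat>" "u > 0" "c > 0"
  shows "\<exists>s0::nat. \<forall>s\<ge>s0. \<forall>w\<in>\<rat>. w\<^sup>2 \<noteq> (real s)\<^sup>2 * u\<^sup>2 + c"
proof -
  obtain u' c' where uc: "u = of_rat u'" "c = of_rat c'" using assms(1,2)
      by (auto elim!: Rats_cases)
  obtain N :: int where N: "N > 0" "\<forall>q\<in>{u', c'}. of_int N * q \<in> \<int>"
      using common_denominator[of "{u', c'}"] by auto
  have int: "real_of_int N * of_rat q \<in> \<int>" if "q \<in> {u', c'}" for q
  proof -
    have "of_int N * q \<in> \<int>" using N(2) that by blast
    then obtain k where "of_int N * q = of_int k" by (rule Ints_cases)
    then have "real_of_rat (of_int N * q) = real_of_rat (of_int k)" by simp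
    then show ?thesis by (simp add: of_rat_mult)
  qed
  obtain U where U: "real_of_int N * u = of_int U" using int[of u'] uc by (auto elim: Ints_cases)
  obtain C where C: "real_of_int N * c = of_int C" using int[of c'] uc by (auto elim: Ints_cases)
  have U0: "U > 0" using U N(1) assms(3) by (metis mult_pos_pos of_int_0_less_iff)
  have "w\<^sup>2 \<noteq> (real s)\<^sup>2 * u\<^sup>2 + c" if s: "s \<ge> nat (N * C)" and w: "w \<in> \<rat>" for s w
  proof
    assume eq: "w\<^sup>2 = (real s)\<^sup>2 * u\<^sup>2 + c"
    define W where "W = real_of_int N * \<bar>w\<bar>"
    have W2: "W\<^sup>2 = of_int ((int s * U)\<^sup>2 + N * C)"
    proof -
      have "W\<^sup>2 = (real s)\<^sup>2 * (real_of_int N * u)\<^sup>2 + of_int N * (of_int N * c)"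
        unfolding W_def power_mult_distrib power2_abs eq
            by (simp add: algebra_simps power2_eq_square)
      then show ?thesis unfolding U C by (simp add: power_mult_distrib)
    qed
    have "W \<ge> 0" using N(1) by (simp add: W_def)
    then have "W = sqrt (of_int ((int s * U)\<^sup>2 + N * C))" using W2
        by (intro real_sqrt_unique[symmetric])
    moreover have "algebraic_int (sqrt (real_of_int ((int s * U)\<^sup>2 + N * C)))"
      by (intro algebraic_int_sqrt int_imp_algebraic_int Ints_of_int)
    ultimately have "algebraic_int W" by simp
    moreover have "W \<in> \<rat>" using w by (simp add: W_def)
    ultimately have "W \<in> \<int>" by (rule rational_algebraic_int_is_int)
    then obtain V where V: "W = of_int V" by (auto elim: Ints_cases)
    have V0: "V \<ge> 0" using \<open>W \<ge> 0\<close> V by simp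
    have VV: "V\<^sup>2 = (int s * U)\<^sup>2 + N * C" using W2 unfolding V
        by (simp only: of_int_power[symmetric] of_int_eq_iff)
    have C0: "C > 0" using C N(1) assms(4) by (metis mult_pos_pos of_int_0_less_iff)
    have NC: "N * C > 0" using C0 N(1) by simp
    define A where "A = int s * U"
    have A0: "A \<ge> 0" using U0 by (simp add: A_def)
    have "int s * 1 \<le> A" unfolding A_def using U0 by (intro mult_left_mono) auto
    moreover have "N * C \<le> int s" using s by linarith
    ultimately have ANC: "N * C \<le> A" by linarith
    have VA: "V\<^sup>2 = A\<^sup>2 + N * C" using VV by (simp add: A_def)
    then have "A\<^sup>2 < V\<^sup>2" using NC by linarith
    then have "A < V" using V0 by (rule power2_less_imp_less)
    then have "(A + 1)\<^sup>2 \<le> V\<^sup>2" using A0 by (intro power_mono) auto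
    moreover have "(A + 1)\<^sup>2 = A\<^sup>2 + 2 * A + 1" by (simp add: power2_eq_square algebra_simps)
    ultimately show False using VA ANC A0 by linarith
  qed
  then show ?thesis by blast
qed

text \<open>Otherwise the third unit vector forces the minor of a and b in the coordinates 0 and 1
  to vanish, while by the first two unit vectors that minor is a factor of 1.\<close>

lemma unit_vectors_not_in_plane:
  fixes a b p q :: "nat \<Rightarrow> real"
  assumes "n \<ge> 3"
  shows "\<exists>k<3. \<exists>i<n. (if i = k then 1 else 0) \<noteq> p k * a i + q k * b i"
proof (rule ccontr)
  assume "\<not> ?thesis"
  then have e: "(if i = k then 1 else 0) = p k * a i + q k * b i" if "k < 3" "i < 3" for i k
    using that assms by auto
  have "1 = p 0 * a 0 + q 0 * b 0" "0 = p 0 * a 1 + q 0 * b 1" "0 = p 1 * a 0 + q 1 * b 0"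
      "1 = p 1 * a 1 + q 1 * b 1"
    "0 = p 2 * a 0 + q 2 * b 0" "0 = p 2 * a 1 + q 2 * b 1" "1 = p 2 * a 2 + q 2 * b 2"
    using e[of 0 0] e[of 0 1] e[of 1 0] e[of 1 1] e[of 2 0] e[of 2 1] e[of 2 2] by simp_all
  note e' = this
  have "(a 0 * b 1 - a 1 * b 0) * (p 2 * a 2 + q 2 * b 2) =
      (p 2 * a 0 + q 2 * b 0) * (a 2 * b 1 - a 1 * b 2) + (p 2 * a 1 + q 2 * b 1) *
          (a 0 * b 2 - a 2 * b 0)"
    by (simp add: algebra_simps)
  then have c: "a 0 * b 1 - a 1 * b 0 = 0" unfolding e'(5-7)[symmetric] by simp
  have "(p 0 * a 0 + q 0 * b 0) * (p 1 * a 1 + q 1 * b 1) - (p 1 * a 0 + q 1 * b 0) *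
      (p 0 * a 1 + q 0 * b 1)
     = (p 0 * q 1 - p 1 * q 0) * (a 0 * b 1 - a 1 * b 0)"
    by (simp add: algebra_simps)
  then show False unfolding e'(1-4)[symmetric] c by simp
qed

lemma (in tr_field) int_multiple_finite:
  assumes "finite X" "X \<subseteq> K"
  shows "\<exists>T::int. T > 0 \<and> (\<forall>x\<in>X. \<exists>w. of_int T * x = ieval w t)"
  using assms
proof (induction X)
  case empty
  show ?case by (rule exI[of _ 1]) simp
next
  case (insert x X)
  then obtain T where T: "T > 0" "\<forall>x\<in>X. \<exists>w. of_int T * x = ieval w t" by auto
  obtain T' w where T': "T' > 0" "of_int T' * x = ieval w t"
      using int_multiple[of x] insert.prems by auto
  have "of_int (T * T') * x = ieval (smult T w) t"
      by (simp add: ieval_smult T'(2)[symmetric] mult.assoc)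
  moreover have "\<exists>w. of_int (T * T') * z = ieval w t" if "z \<in> X" for z
  proof -
    obtain w where "of_int T * z = ieval w t" using T(2) \<open>z \<in> X\<close> by blast
    then have "of_int (T * T') * z = ieval (smult T' w) t" by (simp add: ieval_smult mult_ac)
    then show ?thesis by blast
  qed
  ultimately show ?case using T(1) T'(1) by (intro exI[of _ "T * T'"]) auto
qed

lemma elements_mat_entry: "X \<in> carrier_mat n k \<Longrightarrow> i < n \<Longrightarrow> j < k \<Longrightarrow> X $$ (i, j) \<in> elements_mat X"
  by (fastforce simp: elements_mat_def)

text \<open>Signature (d, 1) enters as \<open>lorentz\<close> and as a timelike vector over K;
  definiteness at the other embeddings is stated at the real roots of m different from t, which
  correspond to them.\<close>

locale adm = tr_field K t m + quad n Q for K t m n Q +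
  assumes QK: "elements_mat Q \<subseteq> K" and n3: "n \<ge> 3" and detQ: "det Q \<noteq> 0"
    and lorentz: "\<And>a b. bl a a < 0 \<Longrightarrow> bl a b = 0 \<Longrightarrow> \<exists>i<n. b i \<noteq> 0 \<Longrightarrow> bl b b > 0"
    and timelike: "\<exists>a. (\<forall>i. a i \<in> K) \<and> bl a a < 0"
    and conj_pos_def: "\<And>y. reval m y = 0 \<Longrightarrow> y \<noteq> t \<Longrightarrow> pos_def (map_mat (conj_emb t y) Q)"
begin

definition KV :: "(nat \<Rightarrow> real) set" where "KV = {a. \<forall>i. a i \<in> K}"

definition KM :: "real mat set" where
  "KM = {X \<in> carrier_mat n n. \<forall>i<n. \<forall>j<n. X $$ (i, j) \<in> K}"

lemma KM_iff: "X \<in> carrier_mat n n \<Longrightarrow> X \<in> KM \<longleftrightarrow> elements_mat X \<subseteq> K"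
  using elements_mat_entry[of X n n] by (auto simp: KM_def elements_mat_def)

lemma Q_in_K: "i < n \<Longrightarrow> j < n \<Longrightarrow> Q $$ (i, j) \<in> K"
  using QK elements_mat_entry[OF Q] by blast

lemmas K_closed = subfield_setD[OF sub]

lemma Qf_in_K: "w \<in> KV \<Longrightarrow> j < n \<Longrightarrow> Qf w j \<in> K"
  unfolding Qf_def KV_def by (intro subfield_set_sum[OF sub] K_closed(5)) (auto simp: Q_in_K)

lemma bl_in_K: "u \<in> KV \<Longrightarrow> w \<in> KV \<Longrightarrow> bl u w \<in> K"
  unfolding bl_def ip_def by (intro subfield_set_sum[OF sub] K_closed(5))
      (auto simp: Qf_in_K KV_def)

lemma KV_closed:
  "a \<in> KV \<Longrightarrow> b \<in> KV \<Longrightarrow> c \<in> K \<Longrightarrow> d \<in> K \<Longrightarrow> (\<lambda>i. c * a i + d * b i) \<in> KV"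
  "a \<in> KV \<Longrightarrow> b \<in> KV \<Longrightarrow> c \<in> K \<Longrightarrow> d \<in> K \<Longrightarrow> (\<lambda>i. c * a i - d * b i) \<in> KV"
  "(\<lambda>i. if i = k then 1 else 0) \<in> KV"
  by (auto simp: KV_def intro!: K_closed)

text \<open>The rotation of a Pell solution is squared. Then the determinant is 1, x = 1 + 2 D y0^2
  is positive, and the denominator disappears from (x - 1) / q(a) = - 2 q(b) y0^2. A factor T in y0
  clears the denominators of a, b and Q.\<close>

lemma rot_in_SO':
  assumes ab: "a \<in> KV" "b \<in> KV" "bl a b = 0" "bl a a < 0" "bl b b > 0"
    and nonsquare: "\<And>z. z \<in> K \<Longrightarrow> z\<^sup>2 \<noteq> - bl a a * bl b b"
  shows "\<exists>x\<in>K. \<exists>y\<in>K. rot a b x y \<in> SO' Q (ring_of_integers K) \<and>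
    x\<^sup>2 + bl a a * bl b b * y\<^sup>2 = 1 \<and> y \<noteq> 0 \<and> x \<ge> 1"
proof -
  define \<alpha> where "\<alpha> = bl a a"
  define \<beta> where "\<beta> = bl b b"
  define D where "D = - \<alpha> * \<beta>"
  have ne: "\<alpha> \<noteq> 0" "\<beta> \<noteq> 0" "bl a a \<noteq> 0" "bl b b \<noteq> 0" using ab by (auto simp: \<alpha>_def \<beta>_def)
  have D0: "D > 0" using ab by (simp add: D_def \<alpha>_def \<beta>_def mult_neg_pos)
  have abK: "\<alpha> \<in> K" "\<beta> \<in> K" "a i \<in> K" "b i \<in> K" for i using ab bl_in_K
      by (auto simp: \<alpha>_def \<beta>_def KV_def)
  \<comment> \<open>The field elements that occur in the entries of the rotation once the divisions
    by q(a) and q(b) are resolved; T makes all of them integral.\<close>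
  define X where "X = insert D ((\<lambda>(i, j). \<beta> * (a i * Qf a j)) ` ({..<n} \<times> {..<n}) \<union>
      (\<lambda>(i, j). \<alpha> * (b i * Qf b j)) ` ({..<n} \<times> {..<n})
     \<union> (\<lambda>(i, j). b i * Qf a j) ` ({..<n} \<times> {..<n}) \<union> (\<lambda>(i, j). a i * Qf b j) ` ({..<n} \<times> {..<n}))"
  have XK: "X \<subseteq> K"
    using abK Qf_in_K[OF ab(1)] Qf_in_K[OF ab(2)]
    by (auto simp: X_def D_def intro!: K_closed(5) K_closed(8))
  have "finite X" by (auto simp: X_def)
  then obtain T :: int where T: "T > 0" "\<forall>x\<in>X. \<exists>w. of_int T * x = ieval w t"
    using int_multiple_finite XK by blast
  have algX: "algebraic_int (of_int T * x)" if "x \<in> X" for x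
    using T(2) that algebraic_int_ieval[OF integral] by metis
  obtain w where w: "of_int T * D = ieval w t" using T(2) by (auto simp: X_def)
  have TK: "real_of_int T \<in> K" by (rule subfield_set_of_int[OF sub])
  have D1: "(of_int T)\<^sup>2 * D = ieval (smult T w) t"
      by (simp add: ieval_smult w[symmetric] power2_eq_square mult.assoc)
  have "z\<^sup>2 \<noteq> (of_int T)\<^sup>2 * D" if z: "z \<in> K" for z
  proof
    assume "z\<^sup>2 = (of_int T)\<^sup>2 * D"
    then have "(z / of_int T)\<^sup>2 = D" using T(1) by (simp add: power_divide)
    moreover have "z / of_int T \<in> K" using z TK by (rule K_closed(7))
    ultimately show False using nonsquare by (simp add: D_def \<alpha>_def \<beta>_def)
  qed
  then obtain p q where pq: "(ieval p t)\<^sup>2 - (of_int T)\<^sup>2 * D * (ieval q t)\<^sup>2 = 1" "ieval q t \<noteq> 0"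
    using pell_equation[OF D1] D0 T(1) by auto
  define x0 where "x0 = ieval p t"
  define y1 where "y1 = ieval q t"
  define y0 where "y0 = of_int T * y1"
  define x where "x = x0 * x0 - \<alpha> * \<beta> * y0 * y0"
  define y where "y = x0 * y0 + y0 * x0"
  have K0: "x0 \<in> K" "y1 \<in> K" "y0 \<in> K" using ieval_in_K TK
      by (auto simp: x0_def y1_def y0_def intro!: K_closed(5))
  have alg0: "algebraic_int x0" "algebraic_int y1"
    using algebraic_int_ieval[OF integral] by (auto simp: x0_def y1_def)
  have pell: "x0\<^sup>2 + \<alpha> * \<beta> * y0\<^sup>2 = 1"
    using pq(1) by (simp add: x0_def y0_def y1_def D_def power_mult_distrib mult_ac)
  have "x0 \<noteq> 0"
  proof
    assume "x0 = 0"
    then have "D * y0\<^sup>2 = -1" using pell by (simp add: D_def)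
    moreover have "D * y0\<^sup>2 \<ge> 0" using D0 by simp
    ultimately show False by linarith
  qed
  moreover have "y0 \<noteq> 0" using pq(2) T(1) by (simp add: y0_def y1_def)
  ultimately have yne: "y \<noteq> 0" by (simp add: y_def)
  have xD: "x = 1 + 2 * D * y0\<^sup>2" using pell by (simp add: x_def D_def power2_eq_square)
  then have x1: "x \<ge> 1" using D0 by simp
  have E2: "rot a b x y = rot a b x0 y0 * rot a b x0 y0"
    unfolding rot_mult[OF ab(3) ne(3,4)] by (simp add: x_def y_def \<alpha>_def \<beta>_def)
  have iso0: "(rot a b x0 y0)\<^sup>T * Q * rot a b x0 y0 = Q"
    using rot_isometry(1)[OF ab(3) ne(3,4), of x0 y0] pell by (simp add: \<alpha>_def \<beta>_def)
  have det1: "det (rot a b x y) = 1"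
    unfolding E2 using det_isometry[OF detQ rot_carrier iso0] by (simp add: det_mult[of _ n])
  have norm: "x\<^sup>2 + \<alpha> * \<beta> * y\<^sup>2 = 1"
  proof -
    have "x\<^sup>2 + \<alpha> * \<beta> * y\<^sup>2 = (x0\<^sup>2 + \<alpha> * \<beta> * y0\<^sup>2)\<^sup>2"
      by (simp add: x_def y_def power2_eq_square algebra_simps)
    then show ?thesis using pell by simp
  qed
  have iso: "(rot a b x y)\<^sup>T * Q * rot a b x y = Q"
    using rot_isometry(1)[OF ab(3) ne(3,4), of x y] norm by (simp add: \<alpha>_def \<beta>_def)
  have K1: "x \<in> K" "y \<in> K" unfolding x_def y_def by (intro K_closed(3-5) K0 abK)+
  have ent: "rot a b x y $$ (i, j) \<in> ring_of_integers K" if ij: "i < n" "j < n" for i j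
  proof -
    have xa: "(x - 1) / bl a a = - 2 * \<beta> * y0\<^sup>2" using ne by (simp add: xD D_def \<alpha>_def[symmetric])
    have xb: "(x - 1) / bl b b = - 2 * \<alpha> * y0\<^sup>2" using ne by (simp add: xD D_def \<beta>_def[symmetric])
    define e0 :: real where "e0 = (if i = j then 1 else 0)"
    define c :: real where "c = of_int (- 2 * T)"
    define M1 where "M1 = of_int T * (\<beta> * (a i * Qf a j))"
    define M2 where "M2 = of_int T * (\<alpha> * (b i * Qf b j))"
    define M3 where "M3 = of_int T * (b i * Qf a j)"
    define M4 where "M4 = of_int T * (a i * Qf b j)"
    \<comment> \<open>One factor T of y0^2 = T^2 y1^2 goes into M1 and M2, the other into c; the
      single factor T of y goes into M3 and M4.\<close>
    have e: "rot a b x y $$ (i, j) = e0 + c * y1 * y1 * M1 + c * y1 * y1 * M2 + (x0 + x0) * y1 *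
        M3 - (x0 + x0) * y1 * M4"
      unfolding rot_index[OF ij] xa xb
      by (simp add: y0_def y_def e0_def c_def M1_def M2_def M3_def M4_def power2_eq_square
          algebra_simps)
    have mem: "\<beta> * (a i * Qf a j) \<in> X" "\<alpha> * (b i * Qf b j) \<in> X" "b i * Qf a j \<in> X"
        "a i * Qf b j \<in> X"
      using ij by (auto simp: X_def)
    have alg: "algebraic_int e0" "algebraic_int c" "algebraic_int M1" "algebraic_int M2"
        "algebraic_int M3" "algebraic_int M4"
      unfolding M1_def M2_def M3_def M4_def e0_def c_def
      by (rule algX[OF mem(1)] algX[OF mem(2)] algX[OF mem(3)] algX[OF mem(4)] | simp add:
          int_imp_algebraic_int)+
    have "e0 \<in> K" "c \<in> K" using K_closed(1,2) subfield_set_of_int[OF sub] unfolding e0_def c_def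
        by (metis, metis)
    moreover have "M1 \<in> K" "M2 \<in> K" "M3 \<in> K" "M4 \<in> K" unfolding M1_def M2_def M3_def M4_def
      using mem XK by (auto intro!: K_closed(5)[OF TK])
    ultimately have "rot a b x y $$ (i, j) \<in> K"
      unfolding e using K0 by (intro K_closed(3-5)) auto
    moreover have "algebraic_int (rot a b x y $$ (i, j))"
      unfolding e using alg alg0 by (intro algebraic_int_plus algebraic_int_diff
          algebraic_int_times)
    ultimately show ?thesis by (simp add: ring_of_integers_def)
  qed
  have "rot a b x y \<in> SO Q (ring_of_integers K)"
    using ent det1 iso Q by (auto simp: SO_def elements_mat_def)
  moreover have "(\<lambda>v. rot a b x y *\<^sub>v v) ` C = C" if "C \<in> hyperboloid_components Q" for C
    by (rule rot_preserves_components[OF ab(3) ne(3,4) _ _ _ that])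
      (use D0 norm x1 in \<open>auto simp: D_def \<alpha>_def \<beta>_def\<close>)
  ultimately have "rot a b x y \<in> SO' Q (ring_of_integers K)" by (simp add: SO'_def)
  then show ?thesis using K1 norm yne x1 by (auto simp: \<alpha>_def \<beta>_def)
qed

text \<open>With x and x' at least 1, the new coordinate x' y + y' x keeps the sign of y. So no
  positive power degenerates to y' = 0, by which \<open>rot_sq_relation\<close> could not
  divide.\<close>

lemma rot_pow:
  assumes ab: "a \<in> KV" "b \<in> KV" "bl a b = 0" "bl a a < 0" "bl b b > 0"
    and xy: "x \<in> K" "y \<in> K" "x\<^sup>2 + bl a a * bl b b * y\<^sup>2 = 1" "y \<noteq> 0" "x \<ge> 1"
  shows "\<exists>x'\<in>K. \<exists>y'\<in>K. rot a b x y ^\<^sub>m Suc k = rot a b x' y' \<and>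
    x'\<^sup>2 + bl a a * bl b b * y'\<^sup>2 = 1 \<and> y' * y > 0 \<and> x' \<ge> 1"
proof (induction k)
  case 0
  have "y * y > 0" using xy(4) by (metis not_real_square_gt_zero)
  then show ?case using xy left_mult_one_mat[OF rot_carrier]
      by (intro bexI[of _ x] bexI[of _ y]) auto
next
  case (Suc k)
  then obtain x' y' where IH: "x' \<in> K" "y' \<in> K" "rot a b x y ^\<^sub>m Suc k = rot a b x' y'"
    "x'\<^sup>2 + bl a a * bl b b * y'\<^sup>2 = 1" "y' * y > 0" "x' \<ge> 1" by blast
  have ne: "bl a a \<noteq> 0" "bl b b \<noteq> 0" using ab by auto
  define x'' where "x'' = x' * x - bl a a * bl b b * y' * y"
  define y'' where "y'' = x' * y + y' * x"
  have "rot a b x y ^\<^sub>m Suc (Suc k) = rot a b x' y' * rot a b x y" using IH(3) by simp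
  also have "\<dots> = rot a b x'' y''" unfolding rot_mult[OF ab(3) ne] x''_def y''_def ..
  finally have 1: "rot a b x y ^\<^sub>m Suc (Suc k) = rot a b x'' y''" .
  have "x''\<^sup>2 + bl a a * bl b b * y''\<^sup>2 = (x'\<^sup>2 + bl a a * bl b b * y'\<^sup>2) * (x\<^sup>2 + bl a a * bl b b * y\<^sup>2)"
    by (simp add: x''_def y''_def power2_eq_square algebra_simps)
  then have 2: "x''\<^sup>2 + bl a a * bl b b * y''\<^sup>2 = 1" using IH(4) xy(3) by simp
  have "y'' * y = x' * (y * y) + x * (y' * y)" by (simp add: y''_def algebra_simps)
  moreover have "y * y > 0" using xy(4) by (metis not_real_square_gt_zero)
  ultimately have 3: "y'' * y > 0" using IH(5,6) xy(5) by (simp add: add_pos_pos)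
  have "(- bl a a * bl b b) * (y' * y) > 0" using mult_pos_pos[of "- bl a a * bl b b" "y' * y"]
      mult_neg_pos[OF ab(4,5)] IH(5) by simp
  moreover have "x' * x \<ge> 1 * 1" using IH(6) xy(5) by (intro mult_mono) auto
  ultimately have 4: "x'' \<ge> 1" by (simp add: x''_def mult.assoc)
  have "x'' \<in> K" "y'' \<in> K" unfolding x''_def y''_def
    using IH xy bl_in_K ab by (auto intro!: K_closed(3-5))
  then show ?case using 1 2 3 4 by blast
qed


lemma KM_mult: "X \<in> KM \<Longrightarrow> Y \<in> KM \<Longrightarrow> X * Y \<in> KM"
  unfolding KM_def by (auto simp: scalar_prod_def intro!: subfield_set_sum[OF sub] K_closed(5))

lemma KM_add: "X \<in> KM \<Longrightarrow> Y \<in> KM \<Longrightarrow> X + Y \<in> KM"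
  unfolding KM_def by (auto intro!: K_closed(3))

lemma KM_smult: "c \<in> K \<Longrightarrow> X \<in> KM \<Longrightarrow> c \<cdot>\<^sub>m X \<in> KM"
  unfolding KM_def by (auto intro!: K_closed(5))

lemma KM_carrier: "X \<in> KM \<Longrightarrow> X \<in> carrier_mat n n"
  by (simp add: KM_def)

lemma KM_one: "1\<^sub>m n \<in> KM"
  using K_closed(1,2) by (auto simp: KM_def)

text \<open>At the embedding belonging to y the form is positive definite, so both values become
  positive and D becomes negative, while z^2 stays the square of a real number.\<close>

lemma nonsquare_if_conjugate:
  assumes y: "reval m (y :: real) = 0" "y \<noteq> t"
    and ab: "a \<in> KV" "b \<in> KV" "bl a a < 0" "bl b b > 0" and z: "z \<in> K"
  shows "z\<^sup>2 \<noteq> - bl a a * bl b b"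
proof
  assume eq: "z\<^sup>2 = - bl a a * bl b b"
  define \<sigma> where "\<sigma> = conj_emb t y"
  have emb: "field_embedding K \<sigma>" unfolding \<sigma>_def K by (rule field_embedding_conj_emb[OF m y(1)])
  have add: "\<sigma> (u + v) = \<sigma> u + \<sigma> v" and mult: "\<sigma> (u * v) = \<sigma> u * \<sigma> v" if "u \<in> K" "v \<in> K" for u v
    using emb that by (auto simp: field_embedding_def)
  have one: "\<sigma> 1 = 1" using emb by (simp add: field_embedding_def)
  have zero: "\<sigma> 0 = 0" using add[of 0 0] K_closed(1) by simp
  have sum: "\<sigma> (sum f I) = (\<Sum>i\<in>I. \<sigma> (f i))" if "\<And>i. i \<in> I \<Longrightarrow> f i \<in> K" for f and I :: "nat set"
    using that by (induction I rule: infinite_finite_induct)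
        (auto simp: zero add subfield_set_sum[OF sub])
  have nz: "\<sigma> u \<noteq> 0" if "u \<in> K" "u \<noteq> 0" for u
  proof -
    have "\<sigma> u * \<sigma> (inverse u) = \<sigma> (u * inverse u)"
        by (rule mult[symmetric]) (use that K_closed(6) in auto)
    then show ?thesis using that one by auto
  qed
  have pos: "\<sigma> (bl c c) > 0" if c: "c \<in> KV" "bl c c \<noteq> 0" for c
  proof -
    define x where "x = vec n (\<lambda>i. \<sigma> (c i))"
    have cK: "c i \<in> K" for i using c by (simp add: KV_def)
    have "\<exists>i<n. c i \<noteq> 0"
    proof (rule ccontr)
      assume "\<not> ?thesis"
      then have "bl c c = 0" by (simp add: bl_def ip_def)
      then show False using c by simp
    qed
    then obtain i where i: "i < n" "c i \<noteq> 0" by blast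
    have "x \<noteq> 0\<^sub>v n"
    proof
      assume "x = 0\<^sub>v n"
      then have "x $ i = 0" using i by simp
      then show False using nz[OF cK i(2)] i by (simp add: x_def)
    qed
    moreover have "pos_def (map_mat \<sigma> Q)" unfolding \<sigma>_def by (rule conj_pos_def[OF y])
    ultimately have "x \<bullet> (map_mat \<sigma> Q *\<^sub>v x) > 0"
      using Q unfolding pos_def_def by (auto simp: x_def)
    also have "x \<bullet> (map_mat \<sigma> Q *\<^sub>v x) = (\<Sum>i<n. \<sigma> (c i) * (\<Sum>j<n. \<sigma> (Q $$ (i, j)) * \<sigma> (c j)))"
      using Q by (simp add: x_def scalar_prod_def atLeast0LessThan)
    also have "\<dots> = (\<Sum>i<n. \<sigma> (c i * (\<Sum>j<n. Q $$ (i, j) * c j)))"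
    proof (rule sum.cong[OF refl])
      fix i assume i: "i \<in> {..<n}"
      have Kij: "Q $$ (i, j) * c j \<in> K" if "j \<in> {..<n}" for j
        using i that Q_in_K cK by (auto intro!: K_closed(5))
      have "\<sigma> (c i * (\<Sum>j<n. Q $$ (i, j) * c j)) = \<sigma> (c i) * \<sigma> (\<Sum>j<n. Q $$ (i, j) * c j)"
        by (rule mult[OF cK subfield_set_sum[OF sub Kij]])
      also have "\<sigma> (\<Sum>j<n. Q $$ (i, j) * c j) = (\<Sum>j<n. \<sigma> (Q $$ (i, j) * c j))"
        by (rule sum[OF Kij])
      also have "\<dots> = (\<Sum>j<n. \<sigma> (Q $$ (i, j)) * \<sigma> (c j))"
        using i Q_in_K cK by (intro sum.cong refl mult) auto
      finally show "\<sigma> (c i) * (\<Sum>j<n. \<sigma> (Q $$ (i, j)) * \<sigma> (c j)) =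
          \<sigma> (c i * (\<Sum>j<n. Q $$ (i, j) * c j))" by simp
    qed
    also have "\<dots> = \<sigma> (\<Sum>i<n. c i * (\<Sum>j<n. Q $$ (i, j) * c j))"
      using Q_in_K cK by (intro sum[symmetric] K_closed(5) subfield_set_sum[OF sub]) auto
    also have "\<dots> = \<sigma> (bl c c)" by (simp add: bl_def ip_def Qf_def)
    finally show ?thesis .
  qed
  have "\<sigma> (bl a a) > 0" "\<sigma> (bl b b) > 0" using pos ab by auto
  then have "\<sigma> (bl a a) * \<sigma> (bl b b) > 0" by simp
  moreover have "z * z + bl a a * bl b b = 0" using eq by (simp add: power2_eq_square)
  then have "\<sigma> z * \<sigma> z + \<sigma> (bl a a) * \<sigma> (bl b b) = 0"
    using zero add[of "z * z" "bl a a * bl b b"] mult[OF z z] mult[of "bl a a" "bl b b"]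
      K_closed(5)[OF z z] K_closed(5)[of "bl a a" "bl b b"] bl_in_K ab by simp
  ultimately show False using zero_le_square[of "\<sigma> z"] by linarith
qed

text \<open>All complex roots of m are real, so t is the only one; as the roots are simple, m is
  linear.\<close>

lemma K_rational_if_no_conjugate:
  assumes "\<And>y :: real. reval m y = 0 \<Longrightarrow> y = t"
  shows "K \<subseteq> \<rat>"
proof -
  have "{z :: complex. reval m z = 0} \<subseteq> {of_real t}" using root_real assms by blast
  then have "card {z :: complex. reval m z = 0} \<le> 1"
      by (metis card_mono card.empty card.insert finite.emptyI finite.insertI empty_iff One_nat_def)
  then have "degree m = 1" using card_minpoly_roots[OF m] minpoly_degree_pos[OF m] by simp
  then have "reval m t = (\<Sum>i<2. of_rat (coeff m i) * t ^ i)" by (intro reval_altdef) simp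
  then have "reval m t = of_rat (coeff m 0) + t"
    using m \<open>degree m = 1\<close> by (simp add: minpoly_def numeral_2_eq_2)
  then have "t = - of_rat (coeff m 0)" using m by (simp add: minpoly_def)
  then have "t \<in> \<rat>" by simp
  moreover have "subfield_set (\<rat> :: real set)" by (simp add: subfield_set_def)
  ultimately show ?thesis unfolding K adjoin_def using subfield_set_reval by blast
qed

lemma wedge_diff:
  "wedge a (\<lambda>i. b i - c i) = wedge a b + (- 1) \<cdot>\<^sub>m wedge a c"
proof -
  have "Qf (\<lambda>i. b i - c i) j = Qf b j - Qf c j" for j using Qf_linear(2)[of 1 b 1 c j] by simp
  then show ?thesis unfolding wedge_def tens2_def
      by (intro eq_matI) (simp_all add: right_diff_distrib left_diff_distrib)
qed

text \<open>Gram-Schmidt applied to one of three unit vectors that is outside the plane of a and b.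
  The case b = 0, where q is 0 by division by zero, yields a vector orthogonal to a alone.\<close>

lemma orthogonal_vector:
  assumes "a \<in> KV" "b \<in> KV" "bl a b = 0" "bl a a \<noteq> 0" "bl b b \<noteq> 0 \<or> b = (\<lambda>_. 0)"
  shows "\<exists>c\<in>KV. bl a c = 0 \<and> bl b c = 0 \<and> (\<exists>i<n. c i \<noteq> 0)"
proof -
  define e where "e = (\<lambda>(k::nat) (i::nat). if i = k then 1 else 0 :: real)"
  define p where "p = (\<lambda>k. bl a (e k) / bl a a)"
  define q where "q = (\<lambda>k. bl b (e k) / bl b b)"
  obtain k where k: "k < 3" "\<exists>i<n. e k i \<noteq> p k * a i + q k * b i"
    using unit_vectors_not_in_plane[OF n3, of p a q b] by (auto simp: e_def)
  define c where "c = (\<lambda>i. 1 * e k i - 1 * (p k * a i + q k * b i))"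
  have eK: "e k \<in> KV" using KV_closed(3)[of k] by (simp add: e_def)
  have pqK: "p k \<in> K" "q k \<in> K" using bl_in_K eK assms(1,2)
      by (auto simp: p_def q_def intro!: K_closed(7))
  have "c \<in> KV" unfolding c_def by (intro KV_closed eK assms(1,2) pqK K_closed)
  moreover have "bl a c = 0" unfolding c_def bl_linear' using assms(3,4) by (simp add: p_def)
  moreover have "bl b c = 0"
  proof (cases "bl b b \<noteq> 0")
    case True
    have "bl b a = 0" using assms(3) by (simp add: bl_comm)
    then show ?thesis unfolding c_def bl_linear' using True by (simp add: q_def)
  next
    case False
    then have "b = (\<lambda>_. 0)" using assms(5) by auto
    then show ?thesis by (simp add: bl_def ip_def)
  qed
  moreover have "\<exists>i<n. c i \<noteq> 0" using k(2) by (simp add: c_def)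
  ultimately show ?thesis by blast
qed


definition rk :: "(nat \<Rightarrow> real) \<Rightarrow> (nat \<Rightarrow> real) \<Rightarrow> real mat" where
  "rk u w = tens2 n u (Qf w) (\<lambda>_. 0) (\<lambda>_. 0)"

text \<open>For pairwise orthogonal a, b, c the product \<open>wedge a b * wedge a c\<close> is -
  q(a) times the rank one matrix \<open>rk b c\<close>. From such matrices one gets
  \<open>rk b b\<close>, from the square of \<open>wedge a b\<close> then \<open>rk a a\<close>, and
  further wedges move either factor to any vector. The third vector c is where dimension at least 3
  enters: in a plane the wedges generate only a commutative algebra.\<close>

lemma wedges_generate:
  assumes S: "\<And>X Y. X \<in> S \<Longrightarrow> Y \<in> S \<Longrightarrow> X + Y \<in> S" "\<And>X Y. X \<in> S \<Longrightarrow> Y \<in> S \<Longrightarrow> X * Y \<in> S"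
      "\<And>X c. X \<in> S \<Longrightarrow> c \<in> K \<Longrightarrow> c \<cdot>\<^sub>m X \<in> S"
    and a: "a \<in> KV" "bl a a < 0"
    and wedge: "\<And>b. b \<in> KV \<Longrightarrow> bl a b = 0 \<Longrightarrow> wedge a b \<in> S"
    and uw: "u \<in> KV" "w \<in> KV"
  shows "rk u w \<in> S"
proof -
  define \<alpha> where "\<alpha> = bl a a"
  have \<alpha>: "\<alpha> \<noteq> 0" "\<alpha> \<in> K" using a bl_in_K by (auto simp: \<alpha>_def)
  have zero: "(\<lambda>_. 0) \<in> KV" using K_closed(1) by (simp add: KV_def)
  have bl0: "bl a (\<lambda>_. 0) = 0" by (simp add: bl_def ip_def Qf_def)
  obtain b where b: "b \<in> KV" "bl a b = 0" "\<exists>i<n. b i \<noteq> 0"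
    using orthogonal_vector[OF a(1) zero bl0] a(2) by auto
  have bb: "bl b b > 0" using lorentz[OF a(2) b(2,3)] .
  obtain c where c: "c \<in> KV" "bl a c = 0" "bl b c = 0" "\<exists>i<n. c i \<noteq> 0"
    using orthogonal_vector[OF a(1) b(1,2)] a(2) bb by auto
  have cc: "bl c c > 0" using lorentz[OF a(2) c(2,4)] .
  note orth = b(2) c(2,3) b(2)[unfolded bl_comm[of a b]] c(2)[unfolded bl_comm[of a c]]
      c(3)[unfolded bl_comm[of b c]]
  have rbc: "rk b c \<in> S"
  proof -
    have "rk b c = (- 1 / \<alpha>) \<cdot>\<^sub>m (wedge a b * wedge a c)"
      unfolding wedge_def rk_def tens2_mult ip_linear ip_Qf
      by (rule eq_matI) (use \<alpha> in \<open>simp_all add: tens2_index orth \<alpha>_def[symmetric]\<close>)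
    then show ?thesis using S wedge[OF b(1,2)] wedge[OF c(1,2)] \<alpha> by (auto intro!: S K_closed)
  qed
  have rcb: "rk c b \<in> S"
  proof -
    have "rk c b = (- 1 / \<alpha>) \<cdot>\<^sub>m (wedge a c * wedge a b)"
      unfolding wedge_def rk_def tens2_mult ip_linear ip_Qf
      by (rule eq_matI) (use \<alpha> in \<open>simp_all add: tens2_index orth \<alpha>_def[symmetric]\<close>)
    then show ?thesis using S wedge[OF b(1,2)] wedge[OF c(1,2)] \<alpha> by (auto intro!: S K_closed)
  qed
  have rbb: "rk b b \<in> S"
  proof -
    have "rk b b = (1 / bl c c) \<cdot>\<^sub>m (rk b c * rk c b)"
      unfolding wedge_def rk_def tens2_mult ip_linear ip_Qf
      by (rule eq_matI) (use cc in \<open>simp_all add: tens2_index orth\<close>)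
    then show ?thesis using rbc rcb bl_in_K[OF c(1) c(1)] by (auto intro!: S K_closed)
  qed
  have raa: "rk a a \<in> S"
  proof -
    have "rk a a = (- 1 / bl b b) \<cdot>\<^sub>m (wedge a b * wedge a b + \<alpha> \<cdot>\<^sub>m rk b b)"
      unfolding wedge_def rk_def tens2_mult ip_linear ip_Qf
      by (rule eq_matI) (use bb in \<open>simp_all add: tens2_index orth \<alpha>_def[symmetric] field_simps\<close>)
    then show ?thesis using rbb \<alpha> bl_in_K[OF b(1) b(1)] wedge[OF b(1,2)]
        by (auto intro!: S K_closed)
  qed
  have proj: "\<exists>v\<in>KV. bl a v = 0 \<and> (\<forall>i. x i = bl a x / \<alpha> * a i + 1 * v i)" if "x \<in> KV" for x
  proof
    show "(\<lambda>i. 1 * x i - bl a x / \<alpha> * a i) \<in> KV"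
      using that a \<alpha> bl_in_K[OF a(1) that] by (intro KV_closed K_closed) auto
    show "bl a (\<lambda>i. 1 * x i - bl a x / \<alpha> * a i) = 0 \<and>
      (\<forall>i. x i = bl a x / \<alpha> * a i + 1 * (1 * x i - bl a x / \<alpha> * a i))"
      unfolding bl_linear' using \<alpha> by (simp add: \<alpha>_def)
  qed
  have rua: "rk x a \<in> S" if x: "x \<in> KV" for x
  proof -
    obtain v where v: "v \<in> KV" "bl a v = 0" "\<And>i. x i = bl a x / \<alpha> * a i + 1 * v i"
        using proj[OF x] by blast
    have va: "bl v a = 0" using v(2) by (simp add: bl_comm)
    have "rk x a = (bl a x / \<alpha>) \<cdot>\<^sub>m rk a a + (1 / \<alpha>) \<cdot>\<^sub>m (wedge a v * rk a a)"
      unfolding wedge_def rk_def tens2_mult ip_linear ip_Qf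
      by (rule eq_matI) (use \<alpha> v(3) in \<open>simp_all add: tens2_index va v(2) \<alpha>_def[symmetric]
          distrib_right\<close>)
    then show ?thesis using raa \<alpha> bl_in_K[OF a(1) x] wedge[OF v(1,2)] by (auto intro!: S K_closed)
  qed
  have raw: "rk a x \<in> S" if x: "x \<in> KV" for x
  proof -
    obtain v where v: "v \<in> KV" "bl a v = 0" "\<And>i. x i = bl a x / \<alpha> * a i + 1 * v i"
        using proj[OF x] by blast
    have va: "bl v a = 0" using v(2) by (simp add: bl_comm)
    have "x = (\<lambda>i. bl a x / \<alpha> * a i + 1 * v i)" using v(3) by (rule ext)
    then have q: "Qf x j = bl a x / \<alpha> * Qf a j + 1 * Qf v j" for j using Qf_linear(1) by metis
    have "rk a x = (bl a x / \<alpha>) \<cdot>\<^sub>m rk a a + (- 1 / \<alpha>) \<cdot>\<^sub>m (rk a a * wedge a v)"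
      unfolding wedge_def rk_def tens2_mult ip_linear ip_Qf
      by (rule eq_matI) (use \<alpha> in \<open>simp_all add: tens2_index va v(2) q \<alpha>_def[symmetric]
          distrib_left\<close>)
    then show ?thesis using raa \<alpha> bl_in_K[OF a(1) x] wedge[OF v(1,2)] by (auto intro!: S K_closed)
  qed
  have "rk u w = (1 / \<alpha>) \<cdot>\<^sub>m (rk u a * rk a w)"
    unfolding rk_def tens2_mult ip_linear ip_Qf
    by (rule eq_matI) (use \<alpha> in \<open>simp_all add: tens2_index \<alpha>_def[symmetric]\<close>)
  then show ?thesis using rua[OF uw(1)] raw[OF uw(2)] \<alpha> by (auto intro!: S K_closed)
qed

text \<open>A commensurator element maps the matrix algebra over the field to itself, so its entries
  become elements of the field up to a common factor, which squaring removes.\<close>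

theorem square_of_commensurator:
  assumes g: "g \<in> carrier_mat n n" "gi \<in> carrier_mat n n" "g * gi = 1\<^sub>m n" "gi * g = 1\<^sub>m n"
    and iso: "g\<^sup>T * Q * g = Q"
    and comm: "\<And>\<eta>. \<eta> \<in> SO' Q (ring_of_integers K) \<Longrightarrow> \<exists>k\<ge>1. elements_mat (g * (\<eta> ^\<^sub>m k) * gi) \<subseteq> K"
  shows "g * g \<in> KM"
proof -
  \<comment> \<open>The K-algebra of matrices over K that conjugation by g keeps over K; the aim is
    that it contains every \<open>rk u w\<close> with u and w over K.\<close>
  define S where "S = {X \<in> KM. g * X * gi \<in> KM}"
  obtain a where a: "a \<in> KV" "bl a a < 0" using timelike by (auto simp: KV_def)
  have Sadd: "X + Y \<in> S" if "X \<in> S" "Y \<in> S" for X Y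
  proof -
    have XY: "X \<in> carrier_mat n n" "Y \<in> carrier_mat n n" using that by (auto simp: S_def KM_def)
    have "g * (X + Y) * gi = g * X * gi + g * Y * gi"
      using mult_add_distrib_mat[OF g(1) XY] add_mult_distrib_mat[OF _ _ g(2), of "g * X" n
          "g * Y"] g XY by simp
    then show ?thesis using that by (auto simp: S_def intro: KM_add)
  qed
  have Smult: "X * Y \<in> S" if "X \<in> S" "Y \<in> S" for X Y
  proof -
    have XY: "X \<in> carrier_mat n n" "Y \<in> carrier_mat n n" using that by (auto simp: S_def KM_def)
    have "(g * X * gi) * (g * Y * gi) = g * X * (gi * g) * Y * gi"
      using g(1,2) XY by (simp add: assoc_mult_mat[of _ n n _ n _ n])
    also have "\<dots> = g * (X * Y) * gi"
      unfolding g(4) using g(1,2) XY by (simp add: assoc_mult_mat[of _ n n _ n _ n]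
          right_mult_one_mat[of _ n n])
    finally show ?thesis using that KM_mult by (auto simp: S_def) (metis KM_mult)
  qed
  have Ssmult: "c \<cdot>\<^sub>m X \<in> S" if "X \<in> S" "c \<in> K" for c X
  proof -
    have X: "X \<in> carrier_mat n n" using that by (auto simp: S_def KM_def)
    have "g * (c \<cdot>\<^sub>m X) * gi = c \<cdot>\<^sub>m (g * X * gi)"
      using mult_smult_distrib[OF g(1) X] mult_smult_assoc_mat[OF mult_carrier_mat[OF g(1) X]
          g(2)] by simp
    then show ?thesis using that by (auto simp: S_def intro: KM_smult)
  qed
  have Sone: "1\<^sub>m n \<in> S" using g KM_one by (simp add: S_def right_mult_one_mat[of _ n n])
  \<comment> \<open>A power of the Pell rotation is in S by commensurability, and its infinitesimal
    generator is a polynomial in it with coefficients in K.\<close>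
  have good: "wedge a b \<in> S" if b: "b \<in> KV" "bl a b = 0" "\<exists>i<n. b i \<noteq> 0"
      and ns: "\<And>z. z \<in> K \<Longrightarrow> z\<^sup>2 \<noteq> - bl a a * bl b b" for b
  proof -
    have bb: "bl b b > 0" using lorentz[OF a(2) b(2,3)] .
    obtain x y where xy: "x \<in> K" "y \<in> K" "rot a b x y \<in> SO' Q (ring_of_integers K)"
      "x\<^sup>2 + bl a a * bl b b * y\<^sup>2 = 1" "y \<noteq> 0" "x \<ge> 1"
      using rot_in_SO'[OF a(1) b(1,2) a(2) bb ns] by blast
    obtain k where k: "k \<ge> 1" "elements_mat (g * (rot a b x y ^\<^sub>m k) * gi) \<subseteq> K"
        using comm[OF xy(3)] by blast
    obtain k' where k': "k = Suc k'" using k(1) by (cases k) auto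
    obtain x' y' where xy': "x' \<in> K" "y' \<in> K" "rot a b x y ^\<^sub>m k = rot a b x' y'"
      "x'\<^sup>2 + bl a a * bl b b * y'\<^sup>2 = 1" "y' * y > 0"
      using rot_pow[OF a(1) b(1,2) a(2) bb xy(1,2,4-6), of k'] unfolding k' by blast
    have y'0: "y' \<noteq> 0" using xy'(5) by auto
    have ne: "bl a a \<noteq> 0" "bl b b \<noteq> 0" using a bb by auto
    have "rot a b x' y' \<in> KM"
      unfolding KM_def using rot_index xy' a(1) b(1) Qf_in_K bl_in_K K_closed(1,2)
      by (auto simp: KV_def intro!: K_closed(3-5) K_closed(7))
    moreover have "g * rot a b x' y' * gi \<in> KM"
      using k(2) KM_iff[OF mult_carrier_mat[OF mult_carrier_mat[OF g(1) rot_carrier] g(2)]]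
          unfolding xy'(3) by blast
    ultimately have "rot a b x' y' \<in> S" by (simp add: S_def)
    then show ?thesis
      unfolding rot_sq_relation[OF b(2) ne xy'(4) y'0]
      using xy' K_closed(2) subfield_set_of_nat[OF sub, of 2] Sone
          by (intro Sadd Smult Ssmult K_closed) auto
  qed
  have wedge: "wedge a b \<in> S" if b: "b \<in> KV" "bl a b = 0" for b
  proof (cases "\<exists>i<n. b i \<noteq> 0")
    case False
    then have "Qf b j = 0" for j by (simp add: Qf_def)
    then have "wedge a b = 0 \<cdot>\<^sub>m 1\<^sub>m n" using False
        by (intro eq_matI) (auto simp: wedge_def tens2_def)
    then show ?thesis using Ssmult[OF Sone K_closed(1)] by simp
  next
    case b0: True
    have bb: "bl b b > 0" using lorentz[OF a(2) b(2) b0] .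
    show ?thesis
    proof (cases "\<forall>z\<in>K. z\<^sup>2 \<noteq> - bl a a * bl b b")
      case True
      then show ?thesis using good[OF b b0] by blast
    next
      case False
      then obtain z where z: "z \<in> K" "z\<^sup>2 = - bl a a * bl b b" by blast
      \<comment> \<open>A square D can occur only if K has no further embedding.\<close>
      have rat: "K \<subseteq> \<rat>"
        using K_rational_if_no_conjugate nonsquare_if_conjugate[OF _ _ a(1) b(1) a(2) bb z(1)]
            z(2) by blast
      obtain c where c: "c \<in> KV" "bl a c = 0" "bl b c = 0" "\<exists>i<n. c i \<noteq> 0"
        using orthogonal_vector[OF a(1) b] a(2) bb by auto
      have cc: "bl c c > 0" using lorentz[OF a(2) c(2,4)] .
      have z0: "\<bar>z\<bar> > 0" using z(2) a(2) bb by auto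
      have D2: "- bl a a * bl c c > 0" using a(2) cc by (simp add: mult_neg_pos)
      have "\<bar>z\<bar> \<in> \<rat>" "- bl a a * bl c c \<in> \<rat>"
        using z(1) rat bl_in_K[OF a(1) a(1)] bl_in_K[OF c(1) c(1)]
            by (auto simp: subset_eq intro!: Rats_mult)
      from nonsquare_eventually[OF this z0 D2] obtain s0 where
        s0: "\<And>s w. s \<ge> s0 \<Longrightarrow> w \<in> \<rat> \<Longrightarrow> w\<^sup>2 \<noteq> (real s)\<^sup>2 * \<bar>z\<bar>\<^sup>2 + - bl a a * bl c c" by blast
      \<comment> \<open>For the vector s b + c the number D equals s^2 z^2 - q(a) q(c), which is no
        square for large s; b itself is the difference of two consecutive vectors of this
        kind.\<close>
      define v where "v = (\<lambda>(s::nat) i. real s * b i + 1 * c i)"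
      have cb: "bl c b = 0" using c(3) by (simp add: bl_comm)
      have v: "wedge a (v s) \<in> S" if s: "s \<ge> s0" for s
      proof (rule good)
        show "v s \<in> KV" unfolding v_def
          using b(1) c(1) K_closed(2) subfield_set_of_nat[OF sub] by (intro KV_closed) auto
        show "bl a (v s) = 0" unfolding v_def bl_linear' using b(2) c(2) by simp
        have q: "bl (v s) (v s) = (real s)\<^sup>2 * bl b b + bl c c"
          unfolding v_def bl_linear bl_linear' cb c(3) by (simp add: power2_eq_square)
        show "\<exists>i<n. v s i \<noteq> 0"
        proof (rule ccontr)
          assume "\<not> ?thesis"
          then have "bl (v s) (v s) = 0" by (simp add: bl_def ip_def)
          moreover have "(real s)\<^sup>2 * bl b b \<ge> 0" using bb by simp
          ultimately show False using q cc by linarith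
        qed
        fix w assume "w \<in> K"
        then have "w\<^sup>2 \<noteq> (real s)\<^sup>2 * z\<^sup>2 + - bl a a * bl c c" using s0[OF s] rat by auto
        then show "w\<^sup>2 \<noteq> - bl a a * bl (v s) (v s)" unfolding q z(2) by (simp add: algebra_simps)
      qed
      have "b = (\<lambda>i. v (Suc s0) i - v s0 i)" by (rule ext) (simp add: v_def algebra_simps)
      then have "wedge a b = wedge a (v (Suc s0)) + (- 1) \<cdot>\<^sub>m wedge a (v s0)" using wedge_diff
          by metis
      then show ?thesis using v[of "Suc s0"] v[of s0] K_closed(2,8) by (auto intro!: Sadd Ssmult)
    qed
  qed
  have rkS: "rk u w \<in> S" if "u \<in> KV" "w \<in> KV" for u w
    by (rule wedges_generate[OF Sadd Smult Ssmult a wedge that])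
  text \<open>The entry of \<open>g * rk e\<^sub>k e\<^sub>l * gi * Q\<^sup>-\<^sup>1\<close> is a product of two entries of \<open>g\<close>; multiplication
      by \<open>Q\<close> on both
    sides avoids the inverse.\<close>
  have adj: "Q * gi = g\<^sup>T * Q"
  proof -
    have "Q * gi = g\<^sup>T * Q * g * gi" using iso by simp
    also have "\<dots> = g\<^sup>T * Q * (g * gi)" using g Q by (simp add: assoc_mult_mat[of _ n n _ n _ n])
    finally show ?thesis using g Q by simp
  qed
  have prods: "(\<Sum>l<n. Q $$ (l, q) * (g $$ (p, k) * g $$ (l, r))) \<in> K"
      if "p < n" "q < n" "k < n" "r < n" for p q k r
  proof -
    define e where "e = (\<lambda>(k::nat) (i::nat). if i = k then 1 else 0 :: real)"
    have eK: "e i \<in> KV" for i unfolding e_def by (rule KV_closed(3))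
    have "rk (e k) (e r) \<in> S" by (rule rkS[OF eK eK])
    then have "g * rk (e k) (e r) * gi \<in> KM" by (simp add: S_def)
    then have el: "(g * rk (e k) (e r) * gi) $$ (p, q) \<in> K" using that by (simp add: KM_def)
    have Qe: "Qf (e r) j = Q $$ (j, r)" if "j < n" for j
      using \<open>r < n\<close> by (simp add: Qf_def e_def if_distrib cong: if_cong)
    have gr: "(g * rk (e k) (e r)) $$ (p, j) = g $$ (p, k) * Q $$ (r, j)" if "j < n" for j
    proof -
      have "(g * rk (e k) (e r)) $$ (p, j) = (\<Sum>i<n. g $$ (p, i) * (e k i * Q $$ (j, r)))"
        using \<open>p < n\<close> that g by (simp add: rk_def tens2_def scalar_prod_def atLeast0LessThan Qe)
      also have "\<dots> = (\<Sum>i<n. if i = k then g $$ (p, k) * Q $$ (j, r) else 0)"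
        by (intro sum.cong) (auto simp: e_def)
      also have "\<dots> = g $$ (p, k) * Q $$ (r, j)"
        using \<open>k < n\<close> Q_sym[OF that \<open>r < n\<close>] by simp
      finally show ?thesis .
    qed
    have rc: "rk (e k) (e r) \<in> carrier_mat n n" by (simp add: rk_def)
    define G where "G = g * rk (e k) (e r)"
    have "G \<in> carrier_mat n n" unfolding G_def using g(1) rc by (rule mult_carrier_mat)
    then have "(G * gi) $$ (p, q) = (\<Sum>j<n. G $$ (p, j) * gi $$ (j, q))"
      using that g by (simp add: scalar_prod_def atLeast0LessThan)
    then have "(g * rk (e k) (e r) * gi) $$ (p, q) = (\<Sum>j<n. (g * rk (e k) (e r)) $$ (p, j) * gi
        $$ (j, q))"
      unfolding G_def .
    also have "\<dots> = (\<Sum>j<n. g $$ (p, k) * (Q $$ (r, j) * gi $$ (j, q)))"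
      by (intro sum.cong refl) (simp add: gr mult.assoc)
    also have "\<dots> = g $$ (p, k) * (Q * gi) $$ (r, q)"
      using that g Q by (simp add: scalar_prod_def atLeast0LessThan sum_distrib_left)
    also have "(Q * gi) $$ (r, q) = (\<Sum>l<n. g $$ (l, r) * Q $$ (l, q))"
      unfolding adj using that g Q by (simp add: scalar_prod_def atLeast0LessThan)
    also have "g $$ (p, k) * (\<Sum>l<n. g $$ (l, r) * Q $$ (l, q)) =
        (\<Sum>l<n. Q $$ (l, q) * (g $$ (p, k) * g $$ (l, r)))"
      by (simp add: sum_distrib_left mult_ac)
    finally show ?thesis using el by simp
  qed
  \<comment> \<open>Setting p and r of \<open>prods\<close> to one index and summing over it
    contracts the two entries of g to an entry of Q g^2.\<close>
  have QggK: "Q * (g * g) \<in> KM"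
    unfolding KM_def
  proof (intro CollectI conjI allI impI)
    show "Q * (g * g) \<in> carrier_mat n n" using Q g by simp
    fix q r assume qr: "q < n" "r < n"
    have "(Q * (g * g)) $$ (q, r) = (\<Sum>l<n. Q $$ (q, l) * (\<Sum>k<n. g $$ (l, k) * g $$ (k, r)))"
      using qr Q g by (simp add: scalar_prod_def atLeast0LessThan)
    also have "\<dots> = (\<Sum>l<n. \<Sum>k<n. Q $$ (l, q) * (g $$ (k, r) * g $$ (l, k)))"
      using Q_sym[OF qr(1)] by (intro sum.cong refl) (simp add: sum_distrib_left mult_ac)
    also have "\<dots> = (\<Sum>k<n. \<Sum>l<n. Q $$ (l, q) * (g $$ (k, r) * g $$ (l, k)))" by (rule sum.swap)
    also have "\<dots> \<in> K" by (rule subfield_set_sum[OF sub]) (use prods qr in auto)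
    finally show "(Q * (g * g)) $$ (q, r) \<in> K" .
  qed
  define R where "R = (1 / det Q) \<cdot>\<^sub>m adj_mat Q"
  have adjQ: "adj_mat Q \<in> carrier_mat n n" "adj_mat Q * Q = det Q \<cdot>\<^sub>m 1\<^sub>m n" using adj_mat[OF Q]
      by auto
  \<comment> \<open>The Leibniz formula keeps determinants in K, and with them the adjugate by which
    Q is removed.\<close>
  have detK: "det X \<in> K" if X: "X \<in> carrier_mat k k" "\<And>i j. i < k \<Longrightarrow> j < k \<Longrightarrow> X $$ (i, j) \<in> K"
      for X and k :: nat
  proof -
    have s: "(signof p :: real) \<in> K" for p using K_closed(2,8) by (auto simp: sign_def)
    show ?thesis unfolding det_def'[OF X(1)]
      by (intro subfield_set_sum[OF sub] K_closed(5) s subfield_set_prod[OF sub])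
        (auto intro!: X(2) simp: permutes_in_image)
  qed
  have adjK: "adj_mat Q \<in> KM"
    unfolding KM_def
  proof (intro CollectI conjI allI impI adjQ(1))
    fix i j assume ij: "i < n" "j < n"
    have "det (mat_delete Q j i) \<in> K"
    proof (rule detK)
      show "mat_delete Q j i \<in> carrier_mat (n - 1) (n - 1)" using Q by (rule mat_delete_carrier)
      show "mat_delete Q j i $$ (i', j') \<in> K" if "i' < n - 1" "j' < n - 1" for i' j'
        using that Q by (auto simp: mat_delete_def intro!: Q_in_K)
    qed
    moreover have "(- 1 :: real) ^ (j + i) \<in> K" by (intro K_closed(9) K_closed(8) K_closed(2))
    ultimately have "(- 1) ^ (j + i) * det (mat_delete Q j i) \<in> K" by (rule K_closed(5)[rotated])
    then show "adj_mat Q $$ (i, j) \<in> K" using ij Q by (simp add: adj_mat_def cofactor_def)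
  qed
  have "adj_mat Q * (Q * (g * g)) = (adj_mat Q * Q) * (g * g)"
    using assoc_mult_mat[OF adjQ(1) Q, of "g * g" n] g by simp
  also have "\<dots> = det Q \<cdot>\<^sub>m (g * g)"
    unfolding adjQ(2) using g mult_smult_assoc_mat[of "1\<^sub>m n" n n "g * g" n "det Q"] by simp
  finally have "(1 / det Q) \<cdot>\<^sub>m (adj_mat Q * (Q * (g * g))) = g * g"
    using detQ g by (intro eq_matI) auto
  moreover have "(1 / det Q) \<cdot>\<^sub>m (adj_mat Q * (Q * (g * g))) \<in> KM"
    using detK[OF Q Q_in_K] K_closed(2) by (intro KM_smult KM_mult adjK QggK K_closed(7)) auto
  ultimately show ?thesis by simp
qed

end

section \<open>Eigenvalues of isometries with an integral power\<close>

lemma bounded_house_mono: "r \<le> s \<Longrightarrow> bounded_house r B \<subseteq> bounded_house s B"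
  unfolding bounded_house_def by (auto intro: le_trans)

text \<open>The coefficients are algebraic integers of bounded degree and house, not rational
  integers; as they come from a finite set, finitely many polynomials remain.\<close>

definition bounded_roots :: "nat \<Rightarrow> nat \<Rightarrow> real \<Rightarrow> complex set" where
  "bounded_roots n s B = {z. \<exists>p. lead_coeff p = 1 \<and> degree p = n \<and>
     (\<forall>i. coeff p i \<in> bounded_house s B) \<and> poly p z = 0}"

lemma finite_bounded_roots:
  assumes "B \<ge> 0"
  shows "finite (bounded_roots n s B)"
proof (rule finite_subset)
  let ?P = "{p. degree p \<le> n \<and> (\<forall>i\<le>n. coeff p i \<in> bounded_house s B)} - {0}"
  show "bounded_roots n s B \<subseteq> (\<Union>p\<in>?P. {z. poly p z = 0})"
    unfolding bounded_roots_def by fastforce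
  show "finite (\<Union>p\<in>?P. {z. poly p z = 0})"
    using finite_polys_coeffs_in[OF finite_bounded_house[OF assms]]
        by (auto intro!: poly_roots_finite)
qed

text \<open>Integrality of all coefficients, the predicate P, is closed under the sums and products
  in the Leibniz formula for the determinant.\<close>

lemma algebraic_int_coeff_char_poly:
  fixes A :: "'a :: field_char_0 mat"
  assumes A: "A \<in> carrier_mat n n" "\<And>i j. i < n \<Longrightarrow> j < n \<Longrightarrow> algebraic_int (A $$ (i, j))"
  shows "algebraic_int (coeff (char_poly A) k)"
proof -
  define P where "P = (\<lambda>p :: 'a poly. \<forall>i. algebraic_int (coeff p i))"
  have Psum: "P (sum f I)" if "\<And>i. i \<in> I \<Longrightarrow> P (f i)" for f :: "(nat \<Rightarrow> nat) \<Rightarrow> 'a poly" and I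
    using that by (simp add: P_def coeff_sum algebraic_int_sum)
  have Pmult: "P (p * q)" if "P p" "P q" for p q
    using that by (auto simp: P_def coeff_mult intro!: algebraic_int_sum algebraic_int_times)
  have P1: "P 1" by (auto simp: P_def coeff_1 intro!: int_imp_algebraic_int)
  have Pprod: "P (prod f I)" if "\<And>i. i \<in> I \<Longrightarrow> P (f i)" for f :: "nat \<Rightarrow> 'a poly" and I
    using that by (induction I rule: infinite_finite_induct) (auto simp: P1 Pmult)
  define X where "X = [:0, 1:] \<cdot>\<^sub>m 1\<^sub>m n + map_mat (\<lambda>a. [:- a:]) A"
  have X: "X \<in> carrier_mat n n" using A by (simp add: X_def)
  have Pm: "P (- p)" if "P p" for p using that by (simp add: P_def)
  have Psgn: "P (signof p)" for p using P1 Pm[OF P1] by (simp add: sign_def)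
  have PX: "P (X $$ (i, j))" if "i < n" "j < n" for i j
  proof -
    have "coeff (X $$ (i, j)) l \<in> {0, 1, - A $$ (i, j)}" for l
      using that A(1) by (auto simp: X_def coeff_pCons one_pCons split: nat.splits)
    moreover have "algebraic_int x" if "x \<in> {0, 1, - A $$ (i, j)}" for x
      using that A(2)[OF \<open>i < n\<close> \<open>j < n\<close>] by (auto simp: int_imp_algebraic_int)
    ultimately show ?thesis unfolding P_def by blast
  qed
  have "char_poly A = det X" using A(1) by (simp add: char_poly_defs X_def)
  also have "P (det X)" unfolding det_def'[OF X]
    by (intro Psum Pmult Psgn Pprod PX) (auto simp: permutes_in_image)
  finally show ?thesis by (simp add: P_def)
qed

text \<open>z^k is an eigenvalue of the integral matrix A^k, and a k-th root of an algebraic integer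
  is again one.\<close>

lemma algebraic_int_eigenvalue_power:
  fixes A :: "'a :: field_char_0 mat"
  assumes A: "A \<in> carrier_mat n n" and k: "k \<ge> 1" and z: "eigenvalue A z"
    and alg: "\<And>i j. i < n \<Longrightarrow> j < n \<Longrightarrow> algebraic_int ((A ^\<^sub>m k) $$ (i, j))"
  shows "algebraic_int z"
proof -
  obtain v where v: "eigenvector A v z" using z by (auto simp: eigenvalue_def)
  have Ak: "A ^\<^sub>m k \<in> carrier_mat n n" using A by simp
  have "eigenvector (A ^\<^sub>m k) v (z ^ k)"
    using eigenvector_pow[OF A v, of k] v A by (simp add: eigenvector_def)
  then have "eigenvalue (A ^\<^sub>m k) (z ^ k)" by (auto simp: eigenvalue_def)
  then have "poly (char_poly (A ^\<^sub>m k)) (z ^ k) = 0" using eigenvalue_root_char_poly[OF Ak] by simp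
  then have zk: "algebraic_int (z ^ k)"
    using algebraic_int_root_monic[of "char_poly (A ^\<^sub>m k)"] degree_monic_char_poly[OF Ak]
      algebraic_int_coeff_char_poly[OF Ak alg] by auto
  show ?thesis
  proof (rule algebraic_int_root[OF zk])
    show "poly (monom 1 k) z = z ^ k" by (simp add: poly_monom)
    show "\<forall>i. coeff (monom (1 :: 'a) k) i \<in> \<int>" by simp
    show "lead_coeff (monom (1 :: 'a) k) = 1" by (simp add: degree_monom_eq)
    show "degree (monom (1 :: 'a) k) > 0" using k by (simp add: degree_monom_eq)
  qed
qed

text \<open>x and y are the real and imaginary parts of a complex eigenvector. This form lets
  complex eigenvalues be combined with real quadratic forms.\<close>

lemma eigenvalue_real_imag:
  fixes A :: "real mat"
  assumes A: "A \<in> carrier_mat n n" and z: "eigenvalue (map_mat complex_of_real A) z"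
  shows "\<exists>x\<in>carrier_vec n. \<exists>y\<in>carrier_vec n. (x \<noteq> 0\<^sub>v n \<or> y \<noteq> 0\<^sub>v n) \<and>
    A *\<^sub>v x = Re z \<cdot>\<^sub>v x - Im z \<cdot>\<^sub>v y \<and> A *\<^sub>v y = Im z \<cdot>\<^sub>v x + Re z \<cdot>\<^sub>v y"
proof -
  obtain v where v: "v \<in> carrier_vec n" "v \<noteq> 0\<^sub>v n" "map_mat complex_of_real A *\<^sub>v v = z \<cdot>\<^sub>v v"
    using z A by (auto simp: eigenvalue_def eigenvector_def)
  define x where "x = vec n (\<lambda>i. Re (v $ i))"
  define y where "y = vec n (\<lambda>i. Im (v $ i))"
  have xy: "x \<in> carrier_vec n" "y \<in> carrier_vec n" by (auto simp: x_def y_def)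
  have row: "(\<Sum>j<n. complex_of_real (A $$ (i, j)) * v $ j) = z * v $ i" if "i < n" for i
  proof -
    have "(map_mat complex_of_real A *\<^sub>v v) $ i = (z \<cdot>\<^sub>v v) $ i" by (simp only: v(3))
    then show ?thesis using that A(1) v(1) by (simp add: scalar_prod_def atLeast0LessThan)
  qed
  have "A *\<^sub>v x = Re z \<cdot>\<^sub>v x - Im z \<cdot>\<^sub>v y"
  proof (rule eq_vecI)
    fix i assume "i < dim_vec (Re z \<cdot>\<^sub>v x - Im z \<cdot>\<^sub>v y)"
    then have i: "i < n" by (simp add: y_def)
    have "(A *\<^sub>v x) $ i = Re (\<Sum>j<n. complex_of_real (A $$ (i, j)) * v $ j)"
      using i A(1) by (simp add: x_def scalar_prod_def atLeast0LessThan)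
    then show "(A *\<^sub>v x) $ i = (Re z \<cdot>\<^sub>v x - Im z \<cdot>\<^sub>v y) $ i"
      unfolding row[OF i] using i by (simp add: x_def y_def)
  qed (use A in \<open>auto simp: y_def\<close>)
  moreover have "A *\<^sub>v y = Im z \<cdot>\<^sub>v x + Re z \<cdot>\<^sub>v y"
  proof (rule eq_vecI)
    fix i assume "i < dim_vec (Im z \<cdot>\<^sub>v x + Re z \<cdot>\<^sub>v y)"
    then have i: "i < n" by (simp add: y_def)
    have "(A *\<^sub>v y) $ i = Im (\<Sum>j<n. complex_of_real (A $$ (i, j)) * v $ j)"
      using i A(1) by (simp add: y_def scalar_prod_def atLeast0LessThan)
    then show "(A *\<^sub>v y) $ i = (Im z \<cdot>\<^sub>v x + Re z \<cdot>\<^sub>v y) $ i"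
      unfolding row[OF i] using i by (simp add: x_def y_def)
  qed (use A in \<open>auto simp: y_def\<close>)
  moreover have "x \<noteq> 0\<^sub>v n \<or> y \<noteq> 0\<^sub>v n"
  proof (rule ccontr)
    assume *: "\<not> ?thesis"
    have "v = 0\<^sub>v n"
    proof (rule eq_vecI)
      fix i assume "i < dim_vec (0\<^sub>v n :: complex vec)"
      then have i: "i < n" by simp
      have "x $ i = 0" "y $ i = 0" using * i by simp_all
      then show "v $ i = 0\<^sub>v n $ i" using i by (simp add: x_def y_def complex_eq_iff)
    qed (use v in auto)
    then show False using v by simp
  qed
  ultimately show ?thesis using xy by blast
qed

text \<open>For the real and imaginary parts x, y of an eigenvector, \<open>f x x + f y y\<close> is
  its Hermitian norm; the eigenvalue scales it by |z|^2, while the isometry keeps it.\<close>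

lemma pos_def_isometry_eigenvalue:
  fixes A S :: "real mat"
  assumes S: "S \<in> carrier_mat n n" "pos_def S" and A: "A \<in> carrier_mat n n" "A\<^sup>T * S * A = S"
    and z: "eigenvalue (map_mat complex_of_real A) z"
  shows "cmod z = 1"
proof -
  define c d where cd: "c = Re z" "d = Im z"
  obtain x y where xy: "x \<in> carrier_vec n" "y \<in> carrier_vec n" and ne: "x \<noteq> 0\<^sub>v n \<or> y \<noteq> 0\<^sub>v n"
    and Ax: "A *\<^sub>v x = c \<cdot>\<^sub>v x - d \<cdot>\<^sub>v y" and Ay: "A *\<^sub>v y = d \<cdot>\<^sub>v x + c \<cdot>\<^sub>v y"
    using eigenvalue_real_imag[OF A(1) z] unfolding cd by blast
  define f where "f = (\<lambda>u w. \<Sum>i<n. \<Sum>j<n. u $ i * (S $$ (i, j) * w $ j))"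
  have f: "u \<bullet> (S *\<^sub>v w) = f u w" if "u \<in> carrier_vec n" "w \<in> carrier_vec n" for u w
    using that S(1) by (simp add: f_def scalar_prod_def atLeast0LessThan sum_distrib_left)
  have inv: "(A *\<^sub>v u) \<bullet> (S *\<^sub>v (A *\<^sub>v u)) = u \<bullet> (S *\<^sub>v u)" if u: "u \<in> carrier_vec n" for u
  proof -
    have Au: "A *\<^sub>v u \<in> carrier_vec n" using A(1) u by (rule mult_mat_vec_carrier)
    have SAu: "S *\<^sub>v (A *\<^sub>v u) \<in> carrier_vec n" using S(1) Au by (rule mult_mat_vec_carrier)
    have "(A *\<^sub>v u) \<bullet> (S *\<^sub>v (A *\<^sub>v u)) = (S *\<^sub>v (A *\<^sub>v u)) \<bullet> (A *\<^sub>v u)"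
      by (rule comm_scalar_prod[OF Au SAu])
    also have "\<dots> = (A\<^sup>T *\<^sub>v (S *\<^sub>v (A *\<^sub>v u))) \<bullet> u"
      using transpose_vec_mult_scalar[OF A(1) u SAu] by simp
    also have "A\<^sup>T *\<^sub>v (S *\<^sub>v (A *\<^sub>v u)) = (A\<^sup>T * S * A) *\<^sub>v u"
      using A(1) S(1) u by (simp add: assoc_mult_mat_vec[of _ n n _ n])
    also have "((A\<^sup>T * S * A) *\<^sub>v u) \<bullet> u = u \<bullet> (S *\<^sub>v u)"
      unfolding A(2) using S(1) u by (intro comm_scalar_prod[of _ n]) auto
    finally show ?thesis .
  qed
  have "f (c \<cdot>\<^sub>v x - d \<cdot>\<^sub>v y) (c \<cdot>\<^sub>v x - d \<cdot>\<^sub>v y) + f (d \<cdot>\<^sub>v x + c \<cdot>\<^sub>v y) (d \<cdot>\<^sub>v x + c \<cdot>\<^sub>v y) =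
      (c\<^sup>2 + d\<^sup>2) * (f x x + f y y)"
    unfolding f_def sum_distrib_left sum.distrib[symmetric]
    by (intro sum.cong refl) (use xy in \<open>simp add: power2_eq_square algebra_simps\<close>)
  moreover have "f (c \<cdot>\<^sub>v x - d \<cdot>\<^sub>v y) (c \<cdot>\<^sub>v x - d \<cdot>\<^sub>v y) = f x x"
    using inv[OF xy(1)] xy unfolding Ax by (simp add: f)
  moreover have "f (d \<cdot>\<^sub>v x + c \<cdot>\<^sub>v y) (d \<cdot>\<^sub>v x + c \<cdot>\<^sub>v y) = f y y"
    using inv[OF xy(2)] xy unfolding Ay by (simp add: f)
  ultimately have eq: "f x x + f y y = (c\<^sup>2 + d\<^sup>2) * (f x x + f y y)" by simp
  have pos: "f u u > 0" if "u \<in> carrier_vec n" "u \<noteq> 0\<^sub>v n" for u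
    using S that f[of u u] by (auto simp: pos_def_def)
  have nn: "f u u \<ge> 0" if "u \<in> carrier_vec n" for u
    using pos[OF that] by (cases "u = 0\<^sub>v n") (auto simp: f_def)
  have "f x x + f y y > 0" using pos nn xy ne by (meson add_nonneg_pos add_pos_nonneg)
  then have "c\<^sup>2 + d\<^sup>2 = 1" using eq by simp
  then show ?thesis by (simp add: cd cmod_def)
qed

context adm
begin

text \<open>The house bound needs all conjugates of the coefficients of the characteristic
  polynomial. At t they come from M itself, whose eigenvalues have modulus at most l, and at the
  other roots of m from isometries of definite forms, whose eigenvalues have modulus 1.\<close>

theorem eigenvalues_bounded:
  assumes M: "M \<in> KM" "M\<^sup>T * Q * M = Q"
    and k: "k \<ge> 1" "\<And>i j. i < n \<Longrightarrow> j < n \<Longrightarrow> algebraic_int ((M ^\<^sub>m k) $$ (i, j))"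
    and l: "l > 1" "eigenvalue M l" "\<And>z. eigenvalue (map_mat complex_of_real M) z \<Longrightarrow> cmod z \<le> l"
    and s: "minpoly s h" "l \<in> adjoin s"
    and z: "eigenvalue (map_mat complex_of_real M) z"
  shows "z \<in> bounded_roots n (degree h) ((1 + l) ^ n)"
proof -
  define Mc where "Mc = map_mat complex_of_real M"
  have Mn: "M \<in> carrier_mat n n" using M(1) by (rule KM_carrier)
  have Mcn: "Mc \<in> carrier_mat n n" using Mn by (simp add: Mc_def)
  \<comment> \<open>Entries in K are represented by rational polynomials in t, so that evaluation at
    another root y of m produces the conjugate of the matrix.\<close>
  define lift where "lift = (\<lambda>x. SOME p. reval p t = x)"
  have lift: "reval (lift x) t = x" if "x \<in> K" for x
  proof -
    have "\<exists>p. reval p t = x" using that by (auto simp: K adjoin_def)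
    then show ?thesis unfolding lift_def by (rule someI_ex)
  qed
  define L where "L = map_mat lift M"
  define R where "R = map_mat lift Q"
  have LR: "L \<in> carrier_mat n n" "R \<in> carrier_mat n n" using Mn Q by (auto simp: L_def R_def)
  define ev where "ev = (\<lambda>y :: real. map_mat (\<lambda>p. reval p y))"
  have evc: "ev y X \<in> carrier_mat n n" if "X \<in> carrier_mat n n" for X y using that
      by (simp add: ev_def)
  have evt: "ev t L = M" "ev t R = Q"
    using Mn Q M(1) Q_in_K lift by (auto simp: ev_def L_def R_def KM_def intro!: eq_matI)
  \<comment> \<open>Entry by entry the isometry relation is a rational relation satisfied by t,
    hence it holds at every root y of m.\<close>
  have iso: "(ev y L)\<^sup>T * ev y R * ev y L = ev y R" if y: "reval m y = 0" for y
  proof -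
    have hom: "ev y' (L\<^sup>T * R * L) = (ev y' L)\<^sup>T * ev y' R * ev y' L" for y'
    proof -
      have "ev y' (L\<^sup>T * R * L) = ev y' (L\<^sup>T * R) * ev y' L"
        unfolding ev_def by (rule reval_hom.mat_hom_mult[of _ n n _ n]) (use LR in auto)
      also have "ev y' (L\<^sup>T * R) = ev y' (L\<^sup>T) * ev y' R"
        unfolding ev_def by (rule reval_hom.mat_hom_mult[of _ n n _ n]) (use LR in auto)
      also have "ev y' (L\<^sup>T) = (ev y' L)\<^sup>T" by (rule eq_matI) (auto simp: ev_def)
      finally show ?thesis .
    qed
    have "ev y (L\<^sup>T * R * L) = ev y R"
    proof (rule eq_matI)
      fix i j assume "i < dim_row (ev y R)" "j < dim_col (ev y R)"
      then have ij: "i < n" "j < n" using LR by (auto simp: ev_def)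
      have d: "dim_row (L\<^sup>T * R * L) = n" "dim_col (L\<^sup>T * R * L) = n" "dim_row R = n"
          "dim_col R = n" using LR by auto
      have "ev t (L\<^sup>T * R * L) $$ (i, j) = ev t R $$ (i, j)" unfolding hom evt M(2) ..
      then have "reval ((L\<^sup>T * R * L) $$ (i, j) - R $$ (i, j)) t = 0"
        using ij d by (simp add: ev_def reval_diff)
      then have "reval ((L\<^sup>T * R * L) $$ (i, j) - R $$ (i, j)) y = 0"
        using minpoly_conjugate[OF m y] by blast
      then show "ev y (L\<^sup>T * R * L) $$ (i, j) = ev y R $$ (i, j)" using ij d
          by (simp add: ev_def reval_diff)
    qed (use LR in \<open>auto simp: ev_def\<close>)
    then show ?thesis unfolding hom .
  qed
  have unit: "cmod z = 1" if y: "reval m y = 0" "y \<noteq> t"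
      and z: "eigenvalue (map_mat complex_of_real (ev y L)) z" for y z
  proof (rule pos_def_isometry_eigenvalue[OF _ _ _ iso[OF y(1)] z])
    show "ev y R \<in> carrier_mat n n" "ev y L \<in> carrier_mat n n" using LR evc by auto
    have "ev y R = map_mat (conj_emb t y) Q"
    proof (rule eq_matI)
      fix i j assume "i < dim_row (map_mat (conj_emb t y) Q)"
          "j < dim_col (map_mat (conj_emb t y) Q)"
      then have ij: "i < n" "j < n" using Q by auto
      have "conj_emb t y (reval (lift (Q $$ (i, j))) t) = reval (lift (Q $$ (i, j))) y"
        by (rule conj_emb_reval[OF m y(1)])
      then show "ev y R $$ (i, j) = map_mat (conj_emb t y) Q $$ (i, j)"
        using ij Q lift[OF Q_in_K[OF ij]] by (simp add: ev_def R_def)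
    qed (use Q in \<open>auto simp: ev_def R_def\<close>)
    then show "pos_def (ev y R)" using conj_pos_def[OF y] by simp
  qed
  define \<gamma> where "\<gamma> = coeff (char_poly L)"
  have dL: "degree (char_poly L) = n" using degree_monic_char_poly[OF LR(1)] by simp
  have cf: "coeff (char_poly (ev y L)) i = reval (\<gamma> i) y" for y i
    unfolding ev_def \<gamma>_def reval_hom.char_poly_hom[OF LR(1)] by simp
  have cpc: "char_poly (map_mat complex_of_real X) = map_poly complex_of_real (char_poly X)"
      if "X \<in> carrier_mat n n" for X
    by (rule of_real_hom.char_poly_hom[OF that])
  have bound: "\<bar>reval (\<gamma> i) y\<bar> \<le> (1 + l) ^ n" if y: "reval m y = 0" for y i
  proof -
    have Xy: "ev y L \<in> carrier_mat n n" using LR evc by auto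
    have Xc: "map_mat complex_of_real (ev y L) \<in> carrier_mat n n" using Xy by simp
    let ?p = "char_poly (map_mat complex_of_real (ev y L))"
    have dp: "degree ?p = n" "lead_coeff ?p = 1" using degree_monic_char_poly[OF Xc] by auto
    have "norm (coeff ?p i) \<le> (1 + l) ^ degree ?p"
    proof (rule coeff_bound_if_roots[OF dp(2)])
      fix z assume "poly ?p z = 0"
      then have ez: "eigenvalue (map_mat complex_of_real (ev y L)) z"
          using eigenvalue_root_char_poly[OF Xc] by simp
      show "cmod z \<le> l"
      proof (cases "y = t")
        case True
        then show ?thesis using l(3) ez evt by simp
      next
        case False
        then show ?thesis using unit[OF y False ez] l(1) by simp
      qed
    qed (use l in simp)
    then have "norm (coeff ?p i) \<le> (1 + l) ^ n" by (simp only: dp(1))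
    then show ?thesis unfolding cpc[OF Xy] by (simp add: cf)
  qed
  have t0: "reval m t = 0" using m by (simp add: minpoly_def)
  have "algebraic_int (reval (\<gamma> i) t)" for i
  proof -
    have "algebraic_int (coeff (char_poly Mc) i)"
    proof (rule coeff_algebraic_int_if_roots)
      show "lead_coeff (char_poly Mc) = 1" using degree_monic_char_poly[OF Mcn] by simp
      fix z assume "poly (char_poly Mc) z = 0"
      then have "eigenvalue Mc z" using eigenvalue_root_char_poly[OF Mcn] by simp
      then show "algebraic_int z"
      proof (rule algebraic_int_eigenvalue_power[OF Mcn k(1)])
        fix i j assume ij: "i < n" "j < n"
        have "Mc ^\<^sub>m k = map_mat complex_of_real (M ^\<^sub>m k)"
          unfolding Mc_def by (rule of_real_hom.mat_hom_pow[OF Mn, symmetric])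
        then show "algebraic_int ((Mc ^\<^sub>m k) $$ (i, j))" using ij Mn k(2)[OF ij] by simp
      qed
    qed
    then show ?thesis using cf[of t i] unfolding Mc_def cpc[OF Mn] by (simp add: evt)
  qed
  then have house: "complex_of_real (reval (\<gamma> i) t) \<in> bounded_house (degree m) ((1 + l) ^ n)" for i
    using bound by (intro bounded_house)
  have "t \<in> adjoin s"
  proof -
    define S where "S = adjoin s"
    have S: "subfield_set S" unfolding S_def using s(1) by (rule subfield_set_adjoin)
    define p where "p = (map_poly of_rat m :: real poly)"
    \<comment> \<open>The characteristic polynomial at l, with its coefficients read as polynomials
      in t and t replaced by the variable. It is a polynomial over the field of s; at a root y of m
      it gives the value at l of the conjugate characteristic polynomial, which is zero only for y =
      t.\<close>
    define q where "q = (\<Sum>i\<le>n. smult (l ^ i) (map_poly of_rat (\<gamma> i)) :: real poly)"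
    have ratS: "map_poly of_rat f \<in> polys_over S" for f
      using subfield_set_of_rat[OF S] by (simp add: polys_over_def)
    have lS: "l ^ i \<in> S" for i using subfield_setD(9)[OF S] s(2) by (simp add: S_def)
    have q: "poly q y = poly (char_poly (ev y L)) l" for y
    proof -
      have Xy: "ev y L \<in> carrier_mat n n" using LR evc by auto
      have "poly (char_poly (ev y L)) l = (\<Sum>i\<le>n. reval (\<gamma> i) y * l ^ i)"
        using degree_monic_char_poly[OF Xy] by (simp add: poly_altdef cf)
      then show ?thesis by (simp add: q_def poly_sum reval_def mult.commute)
    qed
    have "t \<in> S"
    proof (rule common_root_in_subfield[OF S, of p q])
      show "p \<in> polys_over S" unfolding p_def by (rule ratS)
      show "q \<in> polys_over S" unfolding q_def polys_over_def
        using lS subfield_set_of_rat[OF S] by (auto simp: coeff_sum intro!: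
            subfield_set_sum[OF S] subfield_setD(5)[OF S])
      show "p \<noteq> 0" using m by (auto simp: p_def minpoly_def)
      show "poly (map_poly complex_of_real (pderiv p)) z \<noteq> 0"
          if "poly (map_poly complex_of_real p) z = 0" for z
      proof -
        have "map_poly complex_of_real (pderiv p) = map_poly of_rat (pderiv m)"
          by (simp add: p_def of_rat_hom.map_poly_pderiv[symmetric] of_real_map_poly_of_rat)
        then show ?thesis using minpoly_simple_roots[OF m, of z] that
          by (simp add: reval_def p_def of_real_map_poly_of_rat)
      qed
      show "poly p t = 0" using t0 by (simp add: p_def reval_def)
      show "poly q t = 0" using l(2) eigenvalue_root_char_poly[OF Mn] by (simp add: q evt)
      fix z assume z: "poly (map_poly complex_of_real p) z = 0"
          "poly (map_poly complex_of_real q) z = 0"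
      then have "reval m z = 0" by (simp add: p_def of_real_map_poly_of_rat reval_def)
      then obtain y where y: "z = of_real y" "reval m y = 0" using root_real by blast
      have Xy: "ev y L \<in> carrier_mat n n" using LR evc by auto
      have "poly (char_poly (ev y L)) l = 0" using z(2) y(1)
          by (simp add: of_real_hom.poly_map_poly q)
      then have "poly (char_poly (map_mat complex_of_real (ev y L))) (of_real l) = 0"
        unfolding cpc[OF Xy] by (simp add: of_real_hom.poly_map_poly)
      then have ez: "eigenvalue (map_mat complex_of_real (ev y L)) (of_real l)"
        using eigenvalue_root_char_poly[of "map_mat complex_of_real (ev y L)" n] Xy by simp
      have "y = t" using unit[OF y(2) _ ez] l(1) by (cases "y = t") auto
      then show "z = of_real t" using y(1) by simp
    qed
    then show ?thesis by (simp add: S_def)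
  qed
  then have deg: "degree m \<le> degree h" by (rule adjoin_degree_mono[OF m s(1)])
  have "poly (char_poly Mc) z = 0" using z eigenvalue_root_char_poly[OF Mcn] by (simp add: Mc_def)
  moreover have "coeff (char_poly Mc) i \<in> bounded_house (degree h) ((1 + l) ^ n)" for i
    using house[of i] bounded_house_mono[OF deg] cf[of t i] unfolding Mc_def cpc[OF Mn]
        by (auto simp: evt)
  ultimately show ?thesis unfolding bounded_roots_def
    using degree_monic_char_poly[OF Mcn] by (intro CollectI exI[of _ "char_poly Mc"]) auto
qed

end

section \<open>Conjugacy classes of the special orthogonal group\<close>

lemma char_poly_four_block_lower_left_zero:
  fixes A :: "'a :: idom mat"
  assumes A: "A \<in> carrier_mat k k" and B: "B \<in> carrier_mat k l" and D: "D \<in> carrier_mat l l"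
  shows "char_poly (four_block_mat A B (0\<^sub>m l k) D) = char_poly A * char_poly D"
proof -
  let ?m = "map_mat (\<lambda>a. [:- a:])"
  have "char_poly_matrix (four_block_mat A B (0\<^sub>m l k) D) =
    four_block_mat (char_poly_matrix A) (?m B) (0\<^sub>m l k) (char_poly_matrix D)"
    using A B D by (intro eq_matI) (auto simp: char_poly_matrix_def)
  then show ?thesis
    unfolding char_poly_def using A B D
    by (simp add: det_four_block_mat_lower_left_zero[of _ k _ l])
qed

definition orth_mats :: "nat \<Rightarrow> real mat set" where
  "orth_mats n = {A \<in> carrier_mat n n. A\<^sup>T * A = 1\<^sub>m n}"

lemma orth_matsD:
  assumes "A \<in> orth_mats n"
  shows "A \<in> carrier_mat n n" "A\<^sup>T * A = 1\<^sub>m n" "A * A\<^sup>T = 1\<^sub>m n" "A\<^sup>T \<in> orth_mats n"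
proof -
  show *: "A \<in> carrier_mat n n" "A\<^sup>T * A = 1\<^sub>m n" using assms by (auto simp: orth_mats_def)
  show "A * A\<^sup>T = 1\<^sub>m n" by (rule mat_mult_left_right_inverse[OF _ *(1,2)]) (use * in simp)
  then show "A\<^sup>T \<in> orth_mats n" using * by (simp add: orth_mats_def)
qed

lemma orth_mats_mult:
  assumes "A \<in> orth_mats n" "B \<in> orth_mats n" shows "A * B \<in> orth_mats n"
proof -
  note A = orth_matsD[OF assms(1)] and B = orth_matsD[OF assms(2)]
  have "(A * B)\<^sup>T * (A * B) = B\<^sup>T * (A\<^sup>T * A) * B"
    using A(1) B(1) by (simp add: transpose_mult[of _ n n _ n] assoc_mult_mat[of _ n n _ n _ n])
  also have "\<dots> = 1\<^sub>m n" using A B by simp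
  finally show ?thesis using A(1) B(1) by (simp add: orth_mats_def)
qed

lemma orth_mats_one: "1\<^sub>m n \<in> orth_mats n"
  by (simp add: orth_mats_def)

lemma orth_mats_scalar_prod:
  assumes A: "A \<in> orth_mats n" and uv: "u \<in> carrier_vec n" "v \<in> carrier_vec n"
  shows "(A *\<^sub>v u) \<bullet> (A *\<^sub>v v) = u \<bullet> v"
proof -
  note A = orth_matsD[OF A]
  have Au: "A *\<^sub>v u \<in> carrier_vec n" using A(1) uv(1) by (rule mult_mat_vec_carrier)
  have "(A *\<^sub>v u) \<bullet> (A *\<^sub>v v) = (A\<^sup>T *\<^sub>v (A *\<^sub>v u)) \<bullet> v"
    using transpose_vec_mult_scalar[OF A(1) uv(2) Au] by simp
  also have "A\<^sup>T *\<^sub>v (A *\<^sub>v u) = u"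
    using A uv(1) assoc_mult_mat_vec[of "A\<^sup>T" n n A n u] by simp
  finally show ?thesis .
qed

text \<open>H is the reflection in the hyperplane orthogonal to w - e. A vector with equal products
  with w and e lies in this hyperplane; thus a second reflection can leave an already placed basis
  vector alone.\<close>

lemma householder:
  fixes w e :: "real vec"
  assumes w: "w \<in> carrier_vec n" "e \<in> carrier_vec n" "w \<bullet> w = e \<bullet> e"
  shows "\<exists>H\<in>orth_mats n. H *\<^sub>v w = e \<and> (\<forall>f\<in>carrier_vec n. f \<bullet> w = f \<bullet> e \<longrightarrow> H *\<^sub>v f = f)"
proof (cases "w = e")
  case True
  then show ?thesis using w orth_mats_one by (intro bexI[of _ "1\<^sub>m n"]) auto
next
  case False
  define u where "u = w - e"
  have u: "u \<in> carrier_vec n" using w by (simp add: u_def)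
  define N where "N = (\<Sum>i<n. u $ i * u $ i)"
  have N0: "N \<noteq> 0"
  proof
    assume "N = 0"
    then have "\<forall>i\<in>{..<n}. u $ i * u $ i = 0" unfolding N_def
        by (subst (asm) sum_nonneg_eq_0_iff) auto
    then have "w $ i = e $ i" if "i < n" for i using that w by (auto simp: u_def)
    then have "w = e" using w by (intro eq_vecI) auto
    then show False using False by simp
  qed
  define c where "c = 2 / N"
  define H where "H = mat n n (\<lambda>(i, j). (if i = j then 1 else 0) - c * (u $ i * u $ j))"
  have Hc: "H \<in> carrier_mat n n" by (simp add: H_def)
  have Hv: "H *\<^sub>v f = f - (c * (\<Sum>j<n. u $ j * f $ j)) \<cdot>\<^sub>v u" if f: "f \<in> carrier_vec n" for f
  proof (rule eq_vecI)
    fix i assume "i < dim_vec (f - (c * (\<Sum>j<n. u $ j * f $ j)) \<cdot>\<^sub>v u)"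
    then have i: "i < n" using u by simp
    have "(H *\<^sub>v f) $ i = (\<Sum>j<n. ((if i = j then 1 else 0) - c * (u $ i * u $ j)) * f $ j)"
      using i f by (simp add: H_def scalar_prod_def atLeast0LessThan)
    also have "\<dots> = (\<Sum>j<n. (if i = j then f $ j else 0) - c * u $ i * (u $ j * f $ j))"
      by (intro sum.cong) (auto simp: algebra_simps)
    also have "\<dots> = f $ i - c * u $ i * (\<Sum>j<n. u $ j * f $ j)"
      using i by (simp add: sum_subtractf sum_distrib_left)
    finally show "(H *\<^sub>v f) $ i = (f - (c * (\<Sum>j<n. u $ j * f $ j)) \<cdot>\<^sub>v u) $ i"
      using i u f by (simp add: algebra_simps)
  qed (use u f in \<open>auto simp: H_def\<close>)
  have uf: "(\<Sum>j<n. u $ j * f $ j) = f \<bullet> w - f \<bullet> e" if "f \<in> carrier_vec n" for f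
    using w that by (simp add: u_def scalar_prod_def atLeast0LessThan sum_subtractf[symmetric]
        algebra_simps)
  have "H \<in> orth_mats n"
    unfolding orth_mats_def
  proof (intro CollectI conjI Hc eq_matI)
    fix i j assume "i < dim_row (1\<^sub>m n :: real mat)" "j < dim_col (1\<^sub>m n :: real mat)"
    then have ij: "i < n" "j < n" by auto
    have "(H\<^sup>T * H) $$ (i, j) = (\<Sum>k<n. ((if k = i then 1 else 0) - c * (u $ k * u $ i)) *
        ((if k = j then 1 else 0) - c * (u $ k * u $ j)))"
      using ij by (simp add: H_def scalar_prod_def atLeast0LessThan)
    also have "\<dots> = (\<Sum>k<n. (if k = i then (if i = j then 1 else 0) - c * (u $ i * u $ j) else 0)
        - (if k = j then c * (u $ j * u $ i) else 0) + c * c * (u $ i * u $ j) * (u $ k * u $ k))"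
      by (intro sum.cong) (auto simp: algebra_simps)
    also have "\<dots> = (if i = j then 1 else 0) - 2 * (c * (u $ i * u $ j)) + c * c * (u $ i * u $ j)
        * N"
      using ij by (simp add: sum.distrib sum_subtractf sum_distrib_left[symmetric] N_def)
    also have "\<dots> = (if i = j then 1 else 0)" using N0 by (simp add: c_def field_simps)
    finally show "(H\<^sup>T * H) $$ (i, j) = 1\<^sub>m n $$ (i, j)" using ij by simp
  qed (auto simp: H_def)
  moreover have "H *\<^sub>v w = e"
  proof -
    have "w \<bullet> e = e \<bullet> w" using w by (intro comm_scalar_prod)
    have "N = (\<Sum>j<n. u $ j * w $ j) - (\<Sum>j<n. u $ j * e $ j)"
      using w by (simp add: N_def u_def sum_subtractf[symmetric] algebra_simps)
    also have "\<dots> = 2 * (w \<bullet> w - w \<bullet> e)"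
      unfolding uf[OF w(1)] uf[OF w(2)] using w(3) \<open>w \<bullet> e = e \<bullet> w\<close> by simp
    finally have "c * (\<Sum>j<n. u $ j * w $ j) = 1"
      using N0 unfolding uf[OF w(1)] c_def by simp
    then have "H *\<^sub>v w = w - 1 \<cdot>\<^sub>v u" using Hv[OF w(1)] by simp
    then show ?thesis using w by (auto simp: u_def)
  qed
  moreover have "H *\<^sub>v f = f" if "f \<in> carrier_vec n" "f \<bullet> w = f \<bullet> e" for f
    using Hv[OF that(1)] uf[OF that(1)] that u by auto
  ultimately show ?thesis by blast
qed

text \<open>The upper left block B satisfies B^T B = 1 and is square, hence invertible, so that B^T
  C = 0 kills the upper right block C.\<close>

lemma orth_mats_block:
  assumes A: "A \<in> orth_mats n" and k: "k \<le> n" and z: "\<And>i j. k \<le> i \<Longrightarrow> i < n \<Longrightarrow> j < k \<Longrightarrow> A $$ (i, j) = 0"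
  shows "\<exists>D\<in>orth_mats (n - k). A = four_block_mat (mat k k (\<lambda>ij. A $$ ij)) (0\<^sub>m k (n - k))
      (0\<^sub>m (n - k) k) D"
proof -
  note A = orth_matsD[OF A]
  define l where "l = n - k"
  have n: "n = k + l" using k by (simp add: l_def)
  define B where "B = mat k k (\<lambda>ij. A $$ ij)"
  define C where "C = mat k l (\<lambda>(i, j). A $$ (i, j + k))"
  define D where "D = mat l l (\<lambda>(i, j). A $$ (i + k, j + k))"
  have c: "B \<in> carrier_mat k k" "C \<in> carrier_mat k l" "D \<in> carrier_mat l l"
      by (auto simp: B_def C_def D_def)
  have eq: "A = four_block_mat B C (0\<^sub>m l k) D"
    using A(1) z by (intro eq_matI) (auto simp: B_def C_def D_def n)
  have "A\<^sup>T = four_block_mat (B\<^sup>T) (0\<^sub>m k l) (C\<^sup>T) (D\<^sup>T)"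
    unfolding eq using c by (subst transpose_four_block_mat[of _ k k _ l _ l]) auto
  then have "A\<^sup>T * A = four_block_mat (B\<^sup>T) (0\<^sub>m k l) (C\<^sup>T) (D\<^sup>T) * four_block_mat B C (0\<^sub>m l k) D"
    using eq by simp
  also have "\<dots> = four_block_mat (B\<^sup>T * B) (B\<^sup>T * C) (C\<^sup>T * B) (C\<^sup>T * C + D\<^sup>T * D)"
    using c by (subst mult_four_block_mat[of _ k k _ l _ l _ _ k _ l]) auto
  finally have blk: "1\<^sub>m n = four_block_mat (B\<^sup>T * B) (B\<^sup>T * C) (C\<^sup>T * B) (C\<^sup>T * C + D\<^sup>T * D)"
    using A(2) by simp
  have ent: "1\<^sub>m n $$ (i, j) = four_block_mat (B\<^sup>T * B) (B\<^sup>T * C) (C\<^sup>T * B) (C\<^sup>T * C + D\<^sup>T * D) $$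
      (i, j)" for i j
    using blk by simp
  have BB: "B\<^sup>T * B = 1\<^sub>m k"
  proof (rule eq_matI)
    fix i j assume "i < dim_row (1\<^sub>m k :: real mat)" "j < dim_col (1\<^sub>m k :: real mat)"
    then show "(B\<^sup>T * B) $$ (i, j) = 1\<^sub>m k $$ (i, j)" using ent[of i j] c by (simp add: n)
  qed (use c in auto)
  have BC: "B\<^sup>T * C = 0\<^sub>m k l"
  proof (rule eq_matI)
    fix i j assume "i < dim_row (0\<^sub>m k l :: real mat)" "j < dim_col (0\<^sub>m k l :: real mat)"
    then show "(B\<^sup>T * C) $$ (i, j) = 0\<^sub>m k l $$ (i, j)" using ent[of i "j + k"] c by (simp add: n)
  qed (use c in auto)
  have "B * B\<^sup>T = 1\<^sub>m k" by (rule mat_mult_left_right_inverse[OF _ c(1) BB]) (use c in simp)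
  then have "C = (B * B\<^sup>T) * C" using c by simp
  also have "\<dots> = B * (B\<^sup>T * C)" using c by (intro assoc_mult_mat) auto
  also have "\<dots> = 0\<^sub>m k l" unfolding BC using c by simp
  finally have C0: "C = 0\<^sub>m k l" .
  have DD: "D\<^sup>T * D = 1\<^sub>m l"
  proof (rule eq_matI)
    fix i j assume "i < dim_row (1\<^sub>m l :: real mat)" "j < dim_col (1\<^sub>m l :: real mat)"
    then show "(D\<^sup>T * D) $$ (i, j) = 1\<^sub>m l $$ (i, j)" using ent[of "i + k" "j + k"] c C0
        by (simp add: n)
  qed (use c in auto)
  show ?thesis using eq c DD unfolding C0 B_def[symmetric] l_def[symmetric]
    by (intro bexI[of _ D]) (auto simp: orth_mats_def)
qed

text \<open>The matrix of x to c x - d y, y to d x + c y for z = c + i d, which is the action on the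
  real and imaginary parts of an eigenvector.\<close>

definition rot_block :: "complex \<Rightarrow> real mat" where
  "rot_block z = mat 2 2 (\<lambda>(i, j). if i = j then Re z else if i < j then Im z else - Im z)"

text \<open>P brings k columns into the form given by R, orthogonality splits off the complementary
  block D, and a block diagonal conjugation brings D to its normal form. The eigenvalues of D stay
  in E because its characteristic polynomial divides that of A.\<close>

lemma orth_normal_form_step:
  assumes A: "A \<in> orth_mats n" and P: "P \<in> orth_mats n" and k: "k \<le> n"
    and R: "R \<in> carrier_mat k k" and col: "\<And>j. j < k \<Longrightarrow> (P * A * P\<^sup>T) *\<^sub>v unit_vec n j =
        vec n (\<lambda>i. if i < k then R $$ (i, j) else 0)"
    and N: "\<And>D. D \<in> orth_mats (n - k) \<Longrightarrow> (\<forall>z. eigenvalue (map_mat complex_of_real D) z \<longrightarrow> z \<in> E) \<Longrightarrow>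
      \<exists>O'\<in>orth_mats (n - k). O' * D * O'\<^sup>T \<in> N"
    and E: "\<And>z. eigenvalue (map_mat complex_of_real A) z \<Longrightarrow> z \<in> E"
  shows "\<exists>O'\<in>orth_mats n. \<exists>X\<in>N. O' * A * O'\<^sup>T = four_block_mat R (0\<^sub>m k (n - k)) (0\<^sub>m (n - k) k) X"
proof -
  note Ad = orth_matsD[OF A] and Pd = orth_matsD[OF P]
  define l where "l = n - k"
  have n: "n = k + l" using k by (simp add: l_def)
  define A1 where "A1 = P * A * P\<^sup>T"
  have A1: "A1 \<in> orth_mats n" unfolding A1_def using A P Pd(4) orth_mats_mult by blast
  note A1d = orth_matsD[OF A1]
  have ent: "A1 $$ (i, j) = (if i < k then R $$ (i, j) else 0)" if "i < n" "j < k" for i j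
  proof -
    have "j < n" using that k by simp
    have "(A1 *\<^sub>v unit_vec n j) $ i = A1 $$ (i, j)" using that \<open>j < n\<close> A1d(1) by simp
    then show ?thesis using col[OF that(2)] that(1) unfolding A1_def by simp
  qed
  obtain D where D: "D \<in> orth_mats l" "A1 = four_block_mat (mat k k (\<lambda>ij. A1 $$ ij)) (0\<^sub>m k l)
      (0\<^sub>m l k) D"
    using orth_mats_block[OF A1 k] ent unfolding l_def by auto
  note Dd = orth_matsD[OF D(1)]
  have "mat k k (\<lambda>ij. A1 $$ ij) = R" using R ent k by (intro eq_matI) auto
  then have A1R: "A1 = four_block_mat R (0\<^sub>m k l) (0\<^sub>m l k) D" using D(2) by simp
  have "z \<in> E" if z: "eigenvalue (map_mat complex_of_real D) z" for z
  proof (rule E)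
    let ?c = "map_mat complex_of_real"
    have "similar_mat A1 A"
      using Ad(1) Pd by (intro similar_matI[of _ _ P "P\<^sup>T" n]) (auto simp: A1_def)
    then have "char_poly (?c A1) = char_poly (?c A)"
      using of_real_hom.char_poly_hom[OF Ad(1)] of_real_hom.char_poly_hom[OF A1d(1)]
          char_poly_similar by metis
    moreover have "?c A1 = four_block_mat (?c R) (0\<^sub>m k l) (0\<^sub>m l k) (?c D)"
      unfolding A1R using R Dd(1) by (subst map_four_block_mat[of _ k k _ l _ l]) auto
    then have "char_poly (?c A1) = char_poly (?c R) * char_poly (?c D)"
      using R Dd(1) by (simp add: char_poly_four_block_lower_left_zero)
    moreover have "poly (char_poly (?c D)) z = 0" using z eigenvalue_root_char_poly[of "?c D" l]
        Dd(1) by simp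
    ultimately have "poly (char_poly (?c A)) z = 0" by (metis mult_zero_right poly_mult)
    then show "eigenvalue (?c A) z" using eigenvalue_root_char_poly[of "?c A" n] Ad(1) by simp
  qed
  then obtain O' where O': "O' \<in> orth_mats l" "O' * D * O'\<^sup>T \<in> N" using N[of D] D(1)
      unfolding l_def by blast
  note Od = orth_matsD[OF O'(1)]
  define O1 where "O1 = four_block_mat (1\<^sub>m k) (0\<^sub>m k l) (0\<^sub>m l k) O'"
  have O1T: "O1\<^sup>T = four_block_mat (1\<^sub>m k) (0\<^sub>m k l) (0\<^sub>m l k) (O'\<^sup>T)"
    unfolding O1_def using Od(1) by (subst transpose_four_block_mat[of _ k k _ l _ l]) auto
  have O1: "O1 \<in> orth_mats n"
  proof -
    have "O1\<^sup>T * O1 = four_block_mat (1\<^sub>m k) (0\<^sub>m k l) (0\<^sub>m l k) (1\<^sub>m l)"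
      unfolding O1T unfolding O1_def using Od
      by (subst mult_four_block_mat[of _ k k _ l _ l _ _ k _ l]) auto
    also have "\<dots> = 1\<^sub>m n" by (simp add: n)
    finally show ?thesis using Od(1) by (simp add: orth_mats_def O1_def n)
  qed
  have "O1 * A1 * O1\<^sup>T = four_block_mat R (0\<^sub>m k l) (0\<^sub>m l k) (O' * D * O'\<^sup>T)"
    unfolding O1T A1R unfolding O1_def using R Od(1) Dd(1)
    by (subst mult_four_block_mat[of _ k k _ l _ l _ _ k _ l], simp_all)
      (subst mult_four_block_mat[of _ k k _ l _ l _ _ k _ l], simp_all)
  moreover have "O1 * A1 * O1\<^sup>T = (O1 * P) * A * (O1 * P)\<^sup>T"
    using orth_matsD(1)[OF O1] Pd(1) Ad(1)
    by (simp add: A1_def transpose_mult[of _ n n _ n] assoc_mult_mat[of _ n n _ n _ n])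
  ultimately show ?thesis using O'(2) orth_mats_mult[OF O1 P] unfolding l_def by metis
qed

text \<open>Induction on n: a real eigenvalue splits off a block of size 1, a non-real one a block
  of size 2. Each block is determined by an element of E, so finitely many normal forms
  arise.\<close>

lemma orth_normal_forms:
  assumes E: "finite E"
  shows "\<exists>N. finite N \<and> (\<forall>A\<in>orth_mats n. (\<forall>z. eigenvalue (map_mat complex_of_real A) z \<longrightarrow> z \<in> E) \<longrightarrow>
    (\<exists>P\<in>orth_mats n. P * A * P\<^sup>T \<in> N))"
proof (induction n rule: less_induct)
  case (less n)
  show ?case
  proof (cases "n = 0")
    case True
    have "A = 1\<^sub>m 0" if "A \<in> carrier_mat 0 0" for A :: "real mat" using that by (intro eq_matI) auto
    then have "P * A * P\<^sup>T \<in> {1\<^sub>m 0}" if "A \<in> orth_mats n" "P \<in> orth_mats n" for A P :: "real mat"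
    proof -
      have "A \<in> carrier_mat 0 0" "P \<in> carrier_mat 0 0" using that orth_matsD(1) True by auto
      then have "P * A * P\<^sup>T \<in> carrier_mat 0 0" by simp
      then show ?thesis using \<open>\<And>A :: real mat. A \<in> carrier_mat 0 0 \<Longrightarrow> A = 1\<^sub>m 0\<close> by blast
    qed
    then show ?thesis using orth_mats_one[of n] by (intro exI[of _ "{1\<^sub>m 0}"]) blast
  next
    case False
    obtain N1 where N1: "finite N1" "\<And>A. A \<in> orth_mats (n - 1) \<Longrightarrow>
        (\<forall>z. eigenvalue (map_mat complex_of_real A) z \<longrightarrow> z \<in> E) \<Longrightarrow>
      \<exists>P\<in>orth_mats (n - 1). P * A * P\<^sup>T \<in> N1"
      using less.IH[of "n - 1"] False by auto
    obtain N2 where N2: "finite N2" "\<And>A. A \<in> orth_mats (n - 2) \<Longrightarrow>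
        (\<forall>z. eigenvalue (map_mat complex_of_real A) z \<longrightarrow> z \<in> E) \<Longrightarrow>
      \<exists>P\<in>orth_mats (n - 2). P * A * P\<^sup>T \<in> N2"
      using less.IH[of "n - 2"] False by auto
    define N where "N = (\<lambda>(z, X). four_block_mat (mat 1 1 (\<lambda>_. Re z)) (0\<^sub>m 1 (n - 1))
        (0\<^sub>m (n - 1) 1) X) ` (E \<times> N1)
      \<union> (\<lambda>(z, X). four_block_mat (rot_block z) (0\<^sub>m 2 (n - 2)) (0\<^sub>m (n - 2) 2) X) ` (E \<times> N2)"
    have "finite N" using E N1(1) N2(1) by (simp add: N_def)
    moreover have "\<exists>P\<in>orth_mats n. P * A * P\<^sup>T \<in> N"
      if A: "A \<in> orth_mats n" and AE: "\<And>z. eigenvalue (map_mat complex_of_real A) z \<Longrightarrow> z \<in> E" for A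
    proof -
      note Ad = orth_matsD[OF A]
      have Ac: "map_mat complex_of_real A \<in> carrier_mat n n" using Ad(1) by simp
      have "degree (char_poly (map_mat complex_of_real A)) \<noteq> 0"
          using degree_monic_char_poly[OF Ac] False by simp
      then obtain z where "poly (char_poly (map_mat complex_of_real A)) z = 0"
        using fundamental_theorem_of_algebra[of "char_poly (map_mat complex_of_real A)"]
            constant_degree by metis
      then have z: "eigenvalue (map_mat complex_of_real A) z"
          using eigenvalue_root_char_poly[OF Ac] by simp
      define c d where cd: "c = Re z" "d = Im z"
      obtain x y where xy: "x \<in> carrier_vec n" "y \<in> carrier_vec n" and ne: "x \<noteq> 0\<^sub>v n \<or> y \<noteq> 0\<^sub>v n"
        and Ax: "A *\<^sub>v x = c \<cdot>\<^sub>v x - d \<cdot>\<^sub>v y" and Ay: "A *\<^sub>v y = d \<cdot>\<^sub>v x + c \<cdot>\<^sub>v y"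
        using eigenvalue_real_imag[OF Ad(1) z] unfolding cd by blast
      have conj: "(P * A * P\<^sup>T) *\<^sub>v e = P *\<^sub>v (A *\<^sub>v w)"
          if "P \<in> orth_mats n" "w \<in> carrier_vec n" "P *\<^sub>v w = e" for P w e
      proof -
        note Pd = orth_matsD[OF that(1)]
        have ec: "e \<in> carrier_vec n" using that Pd(1) by auto
        have "P\<^sup>T *\<^sub>v e = w"
          using that Pd assoc_mult_mat_vec[of "P\<^sup>T" n n P n w] by simp
        then show ?thesis using Pd(1) Ad(1) ec by (simp add: assoc_mult_mat_vec[of _ n n _ n])
      qed
      have sq: "u \<bullet> u > 0" if "u \<in> carrier_vec n" "u \<noteq> 0\<^sub>v n" for u :: "real vec"
      proof -
        have "u \<bullet> u = (\<Sum>i<n. u $ i * u $ i)" using that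
            by (simp add: scalar_prod_def atLeast0LessThan)
        moreover have "\<exists>i<n. u $ i \<noteq> 0"
        proof (rule ccontr)
          assume "\<not> ?thesis"
          then have "u = 0\<^sub>v n" using that(1) by (intro eq_vecI) auto
          then show False using that(2) by simp
        qed
        then obtain i where i: "i < n" "u $ i \<noteq> 0" by blast
        then have "u $ i * u $ i > 0" using not_real_square_gt_zero by blast
        then have "(\<Sum>i<n. u $ i * u $ i) > 0"
          using i(1) by (intro sum_pos2[of _ i]) auto
        ultimately show ?thesis by simp
      qed
      show ?thesis
      proof (cases "d = 0")
        case True
        obtain w where w: "w \<in> carrier_vec n" "w \<noteq> 0\<^sub>v n" "A *\<^sub>v w = c \<cdot>\<^sub>v w"
        proof (cases "x = 0\<^sub>v n")
          case True
          have "A *\<^sub>v y = c \<cdot>\<^sub>v y" unfolding Ay using xy \<open>d = 0\<close> by (intro eq_vecI) auto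
          then show thesis using that[of y] ne xy True by auto
        next
          case False
          have "A *\<^sub>v x = c \<cdot>\<^sub>v x" unfolding Ax using xy \<open>d = 0\<close> by (intro eq_vecI) auto
          then show thesis using that[of x] xy False by auto
        qed
        define s where "s = 1 / sqrt (w \<bullet> w)"
        define w' where "w' = s \<cdot>\<^sub>v w"
        have w': "w' \<in> carrier_vec n" "A *\<^sub>v w' = c \<cdot>\<^sub>v w'"
          using w Ad(1) by (auto simp: w'_def mult_mat_vec[of _ n n] smult_smult_assoc mult.commute)
        have "w' \<bullet> w' = s * s * (w \<bullet> w)" using w(1) by (simp add: w'_def)
        also have "\<dots> = 1" using sq[OF w(1,2)] by (simp add: s_def)
        finally have "w' \<bullet> w' = unit_vec n 0 \<bullet> unit_vec n 0" using False by simp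
        then obtain P where P: "P \<in> orth_mats n" "P *\<^sub>v w' = unit_vec n 0"
          using householder[OF w'(1)] by (metis unit_vec_carrier)
        have "(P * A * P\<^sup>T) *\<^sub>v unit_vec n 0 = P *\<^sub>v (c \<cdot>\<^sub>v w')" using conj[OF P(1) w'(1) P(2)] w'(2)
            by simp
        also have "\<dots> = c \<cdot>\<^sub>v unit_vec n 0" using P(2) w'(1) orth_matsD(1)[OF P(1)]
            by (simp add: mult_mat_vec[of _ n n])
        finally have col: "(P * A * P\<^sup>T) *\<^sub>v unit_vec n j =
            vec n (\<lambda>i. if i < 1 then mat 1 1 (\<lambda>_. Re z) $$ (i, j) else 0)" if "j < 1" for j
          using that False by (intro eq_vecI) (auto simp: cd)
        obtain O' X where "O' \<in> orth_mats n" "X \<in> N1"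
            "O' * A * O'\<^sup>T = four_block_mat (mat 1 1 (\<lambda>_. Re z)) (0\<^sub>m 1 (n - 1)) (0\<^sub>m (n - 1) 1) X"
          using orth_normal_form_step[OF A P(1) _ _ col N1(2) AE] False
              by (metis (no_types, lifting) One_nat_def Suc_leI mat_carrier neq0_conv)
        moreover have "z \<in> E" using AE z by blast
        ultimately have "O' * A * O'\<^sup>T \<in> N" unfolding N_def by force
        then show ?thesis using \<open>O' \<in> orth_mats n\<close> by blast
      next
        case d: False
        \<comment> \<open>A preserves the Gram matrix of x and y. The relations \<open>e1\<close> to
          \<open>e3\<close> force |z| = 1 and, as d is nonzero, also r = 0 and p = q: x and y are
          orthogonal and equally long.\<close>
        define p q r where pqr: "p = x \<bullet> x" "q = y \<bullet> y" "r = x \<bullet> y"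
        have ryx: "y \<bullet> x = r" using xy by (simp add: pqr comm_scalar_prod[of y n x])
        have e1: "c * c * p - 2 * c * d * r + d * d * q = p"
        proof -
          have "(A *\<^sub>v x) \<bullet> (A *\<^sub>v x) = p" using orth_mats_scalar_prod[OF A xy(1,1)]
              by (simp add: pqr)
          then show ?thesis unfolding Ax using xy
            by (simp add: minus_scalar_prod_distrib[of _ n] scalar_prod_minus_distrib[of _ n] ryx
                pqr[symmetric] algebra_simps)
        qed
        have e2: "c * d * p + (c * c - d * d) * r - c * d * q = r"
        proof -
          have "(A *\<^sub>v x) \<bullet> (A *\<^sub>v y) = r" using orth_mats_scalar_prod[OF A xy] by (simp add: pqr)
          then show ?thesis unfolding Ax Ay using xy
            by (simp add: minus_scalar_prod_distrib[of _ n] scalar_prod_add_distrib[of _ n] ryx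
                pqr[symmetric] algebra_simps)
        qed
        have e3: "d * d * p + 2 * c * d * r + c * c * q = q"
        proof -
          have "(A *\<^sub>v y) \<bullet> (A *\<^sub>v y) = q" using orth_mats_scalar_prod[OF A xy(2,2)]
              by (simp add: pqr)
          then show ?thesis unfolding Ay using xy
            by (simp add: add_scalar_prod_distrib[of _ n] scalar_prod_add_distrib[of _ n] ryx
                pqr[symmetric] algebra_simps)
        qed
        have pq: "p + q > 0"
        proof -
          have "p \<ge> 0" "q \<ge> 0" using xy by (auto simp: pqr scalar_prod_def intro!: sum_nonneg)
          then show ?thesis using ne sq xy pqr by (metis add_nonneg_pos add_pos_nonneg)
        qed
        have "(c * c + d * d) * (p + q) = p + q" using e1 e3 by (simp add: algebra_simps)
        then have cd1: "c * c + d * d = 1" using pq by simp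
        have u: "c * c * v + d * d * v = v" for v using cd1 by (metis distrib_right mult_1)
        have f1: "d * (d * (q - p)) = d * (2 * c * r)" using e1 u[of p] by (simp add: algebra_simps)
        then have f1': "d * (q - p) = 2 * c * r" using d by simp
        have f2: "d * (c * (p - q)) = d * (2 * d * r)" using e2 u[of r] by (simp add: algebra_simps)
        then have f2': "c * (p - q) = 2 * d * r" using d by simp
        have "c * (d * (q - p)) = c * (2 * c * r)" "d * (c * (p - q)) = d * (2 * d * r)"
          using f1' f2' by simp_all
        then have "2 * r * (c * c + d * d) = 0" by (simp add: algebra_simps)
        then have r0: "r = 0" using cd1 by simp
        then have qp: "q = p" using f1' d by simp
        then have p0: "p > 0" using pq by simp
        define s where "s = 1 / sqrt p"
        have ss: "s * s * p = 1" using p0 by (simp add: s_def)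
        define x' y' where xy': "x' = s \<cdot>\<^sub>v x" "y' = s \<cdot>\<^sub>v y"
        have c': "x' \<in> carrier_vec n" "y' \<in> carrier_vec n" using xy by (auto simp: xy')
        have ip': "x' \<bullet> x' = 1" "y' \<bullet> y' = 1" "x' \<bullet> y' = 0"
          using xy ss qp r0 by (simp_all add: xy' pqr[symmetric] mult.assoc)
        have Ax': "A *\<^sub>v x' = c \<cdot>\<^sub>v x' - d \<cdot>\<^sub>v y'"
          unfolding xy' mult_mat_vec[OF Ad(1) xy(1)] Ax using xy
              by (intro eq_vecI) (auto simp: algebra_simps)
        have Ay': "A *\<^sub>v y' = d \<cdot>\<^sub>v x' + c \<cdot>\<^sub>v y'"
          unfolding xy' mult_mat_vec[OF Ad(1) xy(2)] Ay using xy
              by (intro eq_vecI) (auto simp: algebra_simps)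
        have n2: "n \<ge> 2"
        proof (rule ccontr)
          assume "\<not> n \<ge> 2"
          then have "n = 1" using False by simp
          then have "x' $ 0 * x' $ 0 = 1" "y' $ 0 * y' $ 0 = 1" "x' $ 0 * y' $ 0 = 0"
            using ip' c' by (simp_all add: scalar_prod_def)
          then show False by auto
        qed
        let ?e0 = "unit_vec n 0 :: real vec" and ?e1 = "unit_vec n 1 :: real vec"
        \<comment> \<open>The first reflection places x' at \<open>?e0\<close>. The second places
          the image of y' at \<open>?e1\<close> and fixes \<open>?e0\<close>, which is orthogonal to
          both of these vectors.\<close>
        obtain P1 where P1: "P1 \<in> orth_mats n" "P1 *\<^sub>v x' = ?e0"
          using householder[OF c'(1), of ?e0] ip'(1) n2 by auto
        define y1 where "y1 = P1 *\<^sub>v y'"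
        have y1: "y1 \<in> carrier_vec n" unfolding y1_def using orth_matsD(1)[OF P1(1)] c'(2)
            by (rule mult_mat_vec_carrier)
        have y1y1: "y1 \<bullet> y1 = 1" unfolding y1_def using orth_mats_scalar_prod[OF P1(1) c'(2,2)]
            ip' by simp
        have "?e0 \<bullet> y1 = 0" unfolding y1_def P1(2)[symmetric]
            using orth_mats_scalar_prod[OF P1(1) c'] ip' by simp
        moreover have "?e0 \<bullet> ?e1 = 0" using n2 by simp
        moreover have "y1 \<bullet> y1 = ?e1 \<bullet> ?e1" using y1y1 n2 by simp
        ultimately obtain P2 where P2: "P2 \<in> orth_mats n" "P2 *\<^sub>v y1 = ?e1" "P2 *\<^sub>v ?e0 = ?e0"
          using householder[OF y1, of ?e1] by auto
        define P where "P = P2 * P1"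
        have P: "P \<in> orth_mats n" unfolding P_def using P2(1) P1(1) by (rule orth_mats_mult)
        have Px: "P *\<^sub>v x' = ?e0" and Py: "P *\<^sub>v y' = ?e1"
          using P1 P2 c' orth_matsD(1)[OF P1(1)] orth_matsD(1)[OF P2(1)]
          by (simp_all add: P_def assoc_mult_mat_vec[of _ n n _ n] y1_def[symmetric])
        note Pc = orth_matsD(1)[OF P]
        have "(P * A * P\<^sup>T) *\<^sub>v ?e0 = c \<cdot>\<^sub>v ?e0 - d \<cdot>\<^sub>v ?e1"
          unfolding conj[OF P c'(1) Px] Ax' using c' Pc Px Py
              by (simp add: mult_minus_distrib_mat_vec[of _ n n] mult_mat_vec[of _ n n])
        moreover have "(P * A * P\<^sup>T) *\<^sub>v ?e1 = d \<cdot>\<^sub>v ?e0 + c \<cdot>\<^sub>v ?e1"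
          unfolding conj[OF P c'(2) Py] Ay' using c' Pc Px Py
              by (simp add: mult_add_distrib_mat_vec[of _ n n] mult_mat_vec[of _ n n])
        ultimately have col: "(P * A * P\<^sup>T) *\<^sub>v unit_vec n j = vec n (\<lambda>i. if i < 2 then rot_block z
            $$ (i, j) else 0)" if "j < 2" for j
        proof -
          have "j = 0 \<or> j = 1" using that by auto
          then show ?thesis
          proof
            assume "j = 0"
            then show ?thesis using \<open>(P * A * P\<^sup>T) *\<^sub>v ?e0 = c \<cdot>\<^sub>v ?e0 - d \<cdot>\<^sub>v ?e1\<close> n2
              by (intro eq_vecI) (auto simp: rot_block_def cd)
          next
            assume "j = 1"
            then show ?thesis using \<open>(P * A * P\<^sup>T) *\<^sub>v ?e1 = d \<cdot>\<^sub>v ?e0 + c \<cdot>\<^sub>v ?e1\<close> n2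
              by (intro eq_vecI) (auto simp: rot_block_def cd)
          qed
        qed
        have rb: "rot_block z \<in> carrier_mat 2 2" by (simp add: rot_block_def)
        obtain O' X where "O' \<in> orth_mats n" "X \<in> N2"
            "O' * A * O'\<^sup>T = four_block_mat (rot_block z) (0\<^sub>m 2 (n - 2)) (0\<^sub>m (n - 2) 2) X"
          using orth_normal_form_step[OF A P n2 rb col N2(2) AE] by blast
        moreover have "z \<in> E" using AE z by blast
        ultimately have "O' * A * O'\<^sup>T \<in> N" unfolding N_def by force
        then show ?thesis using \<open>O' \<in> orth_mats n\<close> by blast
      qed
    qed
    ultimately show ?thesis by blast
  qed
qed

section \<open>From orthogonal to special orthogonal conjugacy\<close>

lemma (in group) conjugacy_class_eqI:
  assumes C: "C \<in> conjugacy_classes G" "C' \<in> conjugacy_classes G" and x: "x \<in> C" "x' \<in> C'"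
    and r: "r \<in> carrier G" "x' = r \<otimes> x \<otimes> inv r"
  shows "C = C'"
proof -
  define cl where "cl = (\<lambda>a. (\<lambda>b. b \<otimes> a \<otimes> inv b) ` carrier G)"
  have sub: "cl (b \<otimes> a \<otimes> inv b) \<subseteq> cl a" if "a \<in> carrier G" "b \<in> carrier G" for a b
  proof
    fix y assume "y \<in> cl (b \<otimes> a \<otimes> inv b)"
    then obtain c where c: "c \<in> carrier G" "y = c \<otimes> (b \<otimes> a \<otimes> inv b) \<otimes> inv c" by (auto simp: cl_def)
    then have "y = (c \<otimes> b) \<otimes> a \<otimes> inv (c \<otimes> b)" using that by (simp add: m_assoc inv_mult_group)
    then show "y \<in> cl a" using c(1) that by (auto simp: cl_def)
  qed
  have eq: "cl (b \<otimes> a \<otimes> inv b) = cl a" if ab: "a \<in> carrier G" "b \<in> carrier G" for a b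
  proof
    show "cl (b \<otimes> a \<otimes> inv b) \<subseteq> cl a" using sub[OF ab] .
    have "inv b \<otimes> (b \<otimes> a \<otimes> inv b) \<otimes> inv (inv b) = a" using ab
        by (simp add: m_assoc) (simp flip: m_assoc)
    then show "cl a \<subseteq> cl (b \<otimes> a \<otimes> inv b)" using sub[of "b \<otimes> a \<otimes> inv b" "inv b"] ab by simp
  qed
  obtain a where a: "a \<in> carrier G" "C = cl a" using C(1)
      by (auto simp: conjugacy_classes_def cl_def)
  obtain a' where a': "a' \<in> carrier G" "C' = cl a'" using C(2)
      by (auto simp: conjugacy_classes_def cl_def)
  obtain b where b: "b \<in> carrier G" "x = b \<otimes> a \<otimes> inv b" using x(1) a(2) by (auto simp: cl_def)
  obtain b' where b': "b' \<in> carrier G" "x' = b' \<otimes> a' \<otimes> inv b'" using x(2) a'(2)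
      by (auto simp: cl_def)
  have xG: "x \<in> carrier G" using a b by simp
  have "cl x = C" using eq[OF a(1) b(1)] a(2) b(2) by simp
  moreover have "cl x' = C'" using eq[OF a'(1) b'(1)] a'(2) b'(2) by simp
  moreover have "cl x' = cl x" using eq[OF xG r(1)] r(2) by simp
  ultimately show ?thesis by simp
qed

lemma SO_one_iff: "A \<in> SO (1\<^sub>m n) UNIV \<longleftrightarrow> A \<in> orth_mats n \<and> det A = 1"
  by (auto simp: SO_def orth_mats_def)

lemma carrier_SO_group: "carrier (SO_group n) = {A \<in> orth_mats n. det A = 1}"
  using SO_one_iff by (auto simp: SO_group_def mat_group_def)

lemma mult_SO_group [simp]: "A \<otimes>\<^bsub>SO_group n\<^esub> B = A * B"
  and one_SO_group [simp]: "\<one>\<^bsub>SO_group n\<^esub> = 1\<^sub>m n"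
  by (simp_all add: SO_group_def mat_group_def)

lemma group_SO_group: "group (SO_group n)"
proof (rule groupI)
  fix A B C assume A: "A \<in> carrier (SO_group n)"
  note Ad = orth_matsD[of A n]
  have A': "A \<in> orth_mats n" "det A = 1" using A by (auto simp: carrier_SO_group)
  show "\<one>\<^bsub>SO_group n\<^esub> \<otimes>\<^bsub>SO_group n\<^esub> A = A" using Ad A' by simp
  show "\<exists>y\<in>carrier (SO_group n). y \<otimes>\<^bsub>SO_group n\<^esub> A = \<one>\<^bsub>SO_group n\<^esub>"
    using Ad A' by (intro bexI[of _ "A\<^sup>T"]) (auto simp: carrier_SO_group det_transpose)
  assume B: "B \<in> carrier (SO_group n)"
  have B': "B \<in> orth_mats n" "det B = 1" using B by (auto simp: carrier_SO_group)
  show "A \<otimes>\<^bsub>SO_group n\<^esub> B \<in> carrier (SO_group n)"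
    using A' B' orth_mats_mult orth_matsD(1) by (auto simp: carrier_SO_group det_mult[of _ n])
  assume C: "C \<in> carrier (SO_group n)"
  show "A \<otimes>\<^bsub>SO_group n\<^esub> B \<otimes>\<^bsub>SO_group n\<^esub> C = A \<otimes>\<^bsub>SO_group n\<^esub> (B \<otimes>\<^bsub>SO_group n\<^esub> C)"
    using A B C orth_matsD(1) assoc_mult_mat[of A n n B n C n] by (auto simp: carrier_SO_group)
qed (simp add: carrier_SO_group orth_mats_one)

lemma inv_SO_group:
  assumes "A \<in> carrier (SO_group n)" shows "inv\<^bsub>SO_group n\<^esub> A = A\<^sup>T"
  using assms orth_matsD[of A n]
  by (intro group.inv_equality[OF group_SO_group]) (auto simp: carrier_SO_group det_transpose)

text \<open>The normal form is reached by an orthogonal matrix P, so it determines the class only in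
  the full orthogonal group. Recording det P as well repairs this: for equal data the transition
  matrix P'^T P has determinant 1.\<close>

theorem finite_SO_classes:
  assumes E: "finite E"
  shows "finite {C \<in> conjugacy_classes (SO_group n). \<exists>A\<in>C. \<forall>z. eigenvalue
      (map_mat complex_of_real A) z \<longrightarrow> z \<in> E}"
    (is "finite ?S")
proof -
  interpret G: group "SO_group n" by (rule group_SO_group)
  obtain N where N: "finite N" "\<And>A. A \<in> orth_mats n \<Longrightarrow> (\<forall>z. eigenvalue (map_mat complex_of_real A)
      z \<longrightarrow> z \<in> E) \<Longrightarrow>
    \<exists>P\<in>orth_mats n. P * A * P\<^sup>T \<in> N" using orth_normal_forms[OF E, of n] by blast
  define R where "R = (\<lambda>C (X, e). \<exists>A\<in>C. \<exists>P\<in>orth_mats n. P * A * P\<^sup>T = X \<and> det P = e)"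
  define f where "f = (\<lambda>C. SOME Xe. Xe \<in> N \<times> {1, -1} \<and> R C Xe)"
  have CG: "C \<subseteq> carrier (SO_group n)" if "C \<in> conjugacy_classes (SO_group n)" for C
    using that unfolding conjugacy_classes_def by (auto intro!: G.m_closed simp del: mult_SO_group)
  have f: "f C \<in> N \<times> {1, -1} \<and> R C (f C)" if C: "C \<in> ?S" for C
  proof -
    obtain A where A: "A \<in> C" "\<forall>z. eigenvalue (map_mat complex_of_real A) z \<longrightarrow> z \<in> E" using C
        by blast
    have "A \<in> orth_mats n" using CG C A(1) by (auto simp: carrier_SO_group)
    then obtain P where P: "P \<in> orth_mats n" "P * A * P\<^sup>T \<in> N" using N(2) A(2) by blast
    have "det (P\<^sup>T * P) = 1" using orth_matsD(2)[OF P(1)] by simp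
    then have "det P * det P = 1" using orth_matsD(1)[OF P(1)]
        by (simp add: det_mult[of _ n] det_transpose)
    then have "det P \<in> {1, -1}" by (auto simp: square_eq_1_iff)
    then have "\<exists>Xe. Xe \<in> N \<times> {1, -1} \<and> R C Xe"
      using A(1) P by (intro exI[of _ "(P * A * P\<^sup>T, det P)"]) (auto simp: R_def)
    then show ?thesis unfolding f_def by (rule someI_ex)
  qed
  have "inj_on f ?S"
  proof (rule inj_onI)
    fix C C' assume C: "C \<in> ?S" "C' \<in> ?S" and eq: "f C = f C'"
    obtain X e where Xe: "f C = (X, e)" by fastforce
    obtain A P where A: "A \<in> C" and P: "P \<in> orth_mats n" "P * A * P\<^sup>T = X" "det P = e"
      using f[OF C(1)] Xe by (auto simp: R_def)
    obtain A' P' where A': "A' \<in> C'" and P': "P' \<in> orth_mats n" "P' * A' * P'\<^sup>T = X" "det P' = e"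
      using f[OF C(2)] Xe eq by (auto simp: R_def)
    note Pd = orth_matsD[OF P(1)] and Pd' = orth_matsD[OF P'(1)]
    have Ac: "A \<in> carrier_mat n n" "A' \<in> carrier_mat n n"
      using A A' CG C orth_matsD(1) by (auto simp: carrier_SO_group)
    define r where "r = P'\<^sup>T * P"
    have ro: "r \<in> orth_mats n" unfolding r_def by (rule orth_mats_mult[OF Pd'(4) P(1)])
    have "det P' * det P = 1"
    proof -
      have "det (P\<^sup>T * P) = 1" using Pd(2) by simp
      then show ?thesis using Pd(1) P(3) P'(3) by (simp add: det_mult[of _ n] det_transpose)
    qed
    then have rG: "r \<in> carrier (SO_group n)"
      using ro Pd(1) Pd'(1) by (simp add: carrier_SO_group r_def det_mult[of _ n] det_transpose)
    have "r * A * r\<^sup>T = P'\<^sup>T * (P * A * P\<^sup>T) * P'"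
      unfolding r_def using Ac Pd(1) Pd'(1) by (simp add: transpose_mult[of _ n n _ n]
          assoc_mult_mat[of _ n n _ n _ n])
    also have "\<dots> = P'\<^sup>T * (P' * A' * P'\<^sup>T) * P'" using P(2) P'(2) by simp
    also have "\<dots> = (P'\<^sup>T * P') * A' * (P'\<^sup>T * P')"
      using Ac Pd'(1) by (simp add: assoc_mult_mat[of _ n n _ n _ n])
    also have "\<dots> = A'" using Ac Pd'(2) by simp
    finally have "A' = r \<otimes>\<^bsub>SO_group n\<^esub> A \<otimes>\<^bsub>SO_group n\<^esub> inv\<^bsub>SO_group n\<^esub> r"
      using inv_SO_group[OF rG] by simp
    then show "C = C'" using C by (intro G.conjugacy_class_eqI[OF _ _ A A' rG]) auto
  qed
  moreover have "finite (f ` ?S)"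
  proof (rule finite_subset)
    show "f ` ?S \<subseteq> N \<times> {1, -1}" using f by blast
    show "finite (N \<times> {1, -1 :: real})" using N(1) by simp
  qed
  ultimately show ?thesis by (rule finite_imageD[rotated])
qed

section \<open>Eigenvalues of the holonomy\<close>

text \<open>Cauchy-Schwarz on the first d coordinates bounds the square of \<open>x d * y d\<close>
  by the product of the two spatial norms. If y were not spacelike, its coordinate d would therefore
  vanish, and then all others.\<close>

lemma lorentz_orthogonal:
  fixes x y :: "nat \<Rightarrow> real"
  assumes x: "(\<Sum>i<d. x i * x i) < x d * x d" and xy: "(\<Sum>i<d. x i * y i) = x d * y d"
    and y: "\<exists>i\<le>d. y i \<noteq> 0"
  shows "y d * y d < (\<Sum>i<d. y i * y i)"
proof (rule ccontr)
  assume "\<not> ?thesis"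
  then have le: "(\<Sum>i<d. y i * y i) \<le> y d * y d" by simp
  have cs: "(\<Sum>i<d. x i * y i)\<^sup>2 \<le> (\<Sum>i<d. (x i)\<^sup>2) * (\<Sum>i<d. (y i)\<^sup>2)" by (rule Cauchy_Schwarz_ineq_sum)
  define X where "X = (\<Sum>i<d. x i * x i)"
  define Y where "Y = (\<Sum>i<d. y i * y i)"
  have XY0: "X \<ge> 0" "Y \<ge> 0" by (auto simp: X_def Y_def intro!: sum_nonneg)
  have "(x d * x d) * (y d * y d) \<le> X * Y"
    using cs unfolding xy by (simp add: X_def Y_def power2_eq_square mult_ac)
  also have "\<dots> \<le> X * (y d * y d)" using le XY0 by (intro mult_left_mono) (auto simp: Y_def)
  finally have "(x d * x d - X) * (y d * y d) \<le> 0" by (simp add: left_diff_distrib)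
  moreover have "x d * x d - X > 0" using x by (simp add: X_def)
  ultimately have "y d * y d \<le> 0" by (simp add: mult_le_0_iff)
  then have "y d * y d = 0" using zero_le_square[of "y d"] by linarith
  then have "y d = 0" by simp
  then have "Y = 0" using le XY0 by (simp add: Y_def)
  then have "\<forall>i\<in>{..<d}. y i * y i = 0" unfolding Y_def by (subst (asm) sum_nonneg_eq_0_iff) auto
  then have "y i = 0" if "i \<le> d" for i using that \<open>y d = 0\<close> by (cases "i = d") auto
  then show False using y by blast
qed

section \<open>Minkowski space, geodesics and parallel transport\<close>

lemma signature_mat_carrier [simp]: "signature_mat p m \<in> carrier_mat (p + m) (p + m)"
  by (simp add: signature_mat_def)

lemma minkowski_sum:
  assumes "x \<in> carrier_vec (d + 1)" "y \<in> carrier_vec (d + 1)"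
  shows "minkowski d x y = (\<Sum>i<d. x $ i * y $ i) - x $ d * y $ d"
proof -
  have "(signature_mat d 1 *\<^sub>v y) $ i = (if i < d then y $ i else - y $ i)" if "i < d + 1" for i
  proof -
    have "(signature_mat d 1 *\<^sub>v y) $ i = (\<Sum>j<d + 1. (if i \<noteq> j then 0 else if i < d then 1 else -
        1) * y $ j)"
      using that assms by (simp add: signature_mat_def scalar_prod_def atLeast0LessThan)
    also have "\<dots> = (\<Sum>j<d + 1. if j = i then (if i < d then y $ i else - y $ i) else 0)"
      by (intro sum.cong) auto
    finally show ?thesis using that by simp
  qed
  then have "minkowski d x y = (\<Sum>i<Suc d. x $ i * (if i < d then y $ i else - y $ i))"
    using assms by (simp add: minkowski_def scalar_prod_def atLeast0LessThan signature_mat_def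
        del: sum.lessThan_Suc)
  then show ?thesis by simp
qed

lemma minkowski_comm:
  "x \<in> carrier_vec (d + 1) \<Longrightarrow> y \<in> carrier_vec (d + 1) \<Longrightarrow> minkowski d x y = minkowski d y x"
  by (simp add: minkowski_sum mult.commute)

lemma minkowski_comb:
  assumes "x \<in> carrier_vec (d + 1)" "y \<in> carrier_vec (d + 1)" "z \<in> carrier_vec (d + 1)"
  shows "minkowski d (a \<cdot>\<^sub>v x + b \<cdot>\<^sub>v y) z = a * minkowski d x z + b * minkowski d y z"
    "minkowski d z (a \<cdot>\<^sub>v x + b \<cdot>\<^sub>v y) = a * minkowski d z x + b * minkowski d z y"
    "minkowski d (a \<cdot>\<^sub>v x) z = a * minkowski d x z"
  using assms by (simp_all add: minkowski_sum algebra_simps sum.distrib sum_distrib_left)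

text \<open>Serves to identify two vectors whose difference is null and orthogonal to a timelike
  vector.\<close>

lemma minkowski_timelike:
  assumes x: "x \<in> carrier_vec (d + 1)" "minkowski d x x < 0"
      and y: "y \<in> carrier_vec (d + 1)" "minkowski d x y = 0"
    and "minkowski d y y = 0"
  shows "y = 0\<^sub>v (d + 1)"
proof (rule ccontr)
  assume "y \<noteq> 0\<^sub>v (d + 1)"
  have "\<exists>i\<le>d. y $ i \<noteq> 0"
  proof (rule ccontr)
    assume "\<not> ?thesis"
    then have "y = 0\<^sub>v (d + 1)" using y(1) by (intro eq_vecI) auto
    then show False using \<open>y \<noteq> 0\<^sub>v (d + 1)\<close> by simp
  qed
  then have "y $ d * y $ d < (\<Sum>i<d. y $ i * y $ i)"
    using lorentz_orthogonal[where d = d and x = "\<lambda>i. x $ i" and y = "\<lambda>i. y $ i"] assms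
        by (simp add: minkowski_sum)
  then show False using assms(5) y(1) by (simp add: minkowski_sum)
qed

text \<open>Cauchy-Schwarz together with (a^2 - 1)(b^2 - 1) <= (a b - 1)^2. The bound puts
  \<open>- minkowski d x y\<close> into the range where \<open>cosh\<close> inverts
  \<open>arcosh\<close>.\<close>

lemma hyp_space_minkowski_le:
  assumes "x \<in> hyp_space d" "y \<in> hyp_space d"
  shows "minkowski d x y \<le> - 1"
proof -
  have c: "x \<in> carrier_vec (d + 1)" "y \<in> carrier_vec (d + 1)" and pos: "x $ d > 0" "y $ d > 0"
    and xx: "(\<Sum>i<d. x $ i * x $ i) = x $ d * x $ d - 1"
        and yy: "(\<Sum>i<d. y $ i * y $ i) = y $ d * y $ d - 1"
    using assms by (auto simp: hyp_space_def minkowski_sum)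
  define a b where ab: "a = x $ d" "b = y $ d"
  have a1: "a \<ge> 1"
  proof -
    have "(\<Sum>i<d. x $ i * x $ i) \<ge> 0" by (auto intro!: sum_nonneg)
    then have "1\<^sup>2 \<le> a\<^sup>2" using xx by (simp add: ab power2_eq_square)
    then show ?thesis using pos by (intro power2_le_imp_le[of 1 a]) (auto simp: ab)
  qed
  have b1: "b \<ge> 1"
  proof -
    have "(\<Sum>i<d. y $ i * y $ i) \<ge> 0" by (auto intro!: sum_nonneg)
    then have "1\<^sup>2 \<le> b\<^sup>2" using yy by (simp add: ab power2_eq_square)
    then show ?thesis using pos by (intro power2_le_imp_le[of 1 b]) (auto simp: ab)
  qed
  have "(\<Sum>i<d. x $ i * y $ i)\<^sup>2 \<le> (\<Sum>i<d. (x $ i)\<^sup>2) * (\<Sum>i<d. (y $ i)\<^sup>2)"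
      by (rule Cauchy_Schwarz_ineq_sum)
  also have "\<dots> = (a * a - 1) * (b * b - 1)" using xx yy by (simp add: power2_eq_square ab)
  also have "\<dots> = (a * b - 1)\<^sup>2 - (a - b)\<^sup>2" by (simp add: power2_eq_square algebra_simps)
  also have "\<dots> \<le> (a * b - 1)\<^sup>2" by simp
  finally have "(\<Sum>i<d. x $ i * y $ i) \<le> a * b - 1"
  proof (rule power2_le_imp_le)
    have "1 * 1 \<le> a * b" using a1 b1 by (intro mult_mono) auto
    then show "a * b - 1 \<ge> 0" by simp
  qed
  then show ?thesis using c by (simp add: minkowski_sum ab)
qed

lemma geodesic_minkowski:
  assumes "geodesic_line d \<gamma>"
  shows "minkowski d (\<gamma> s) (\<gamma> t) = - cosh (s - t)"
proof -
  have h: "\<gamma> s \<in> hyp_space d" "\<gamma> t \<in> hyp_space d" and "arcosh (- minkowski d (\<gamma> s) (\<gamma> t)) = \<bar>s - t\<bar>"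
    using assms by (auto simp: geodesic_line_def hyp_dist_def)
  then have "cosh (arcosh (- minkowski d (\<gamma> s) (\<gamma> t))) = cosh \<bar>s - t\<bar>" by simp
  moreover have "cosh (arcosh (- minkowski d (\<gamma> s) (\<gamma> t))) = - minkowski d (\<gamma> s) (\<gamma> t)"
    using hyp_space_minkowski_le[OF h] by (intro cosh_arcosh_real) simp
  moreover have "cosh \<bar>s - t\<bar> = cosh (s - t)" by (cases "s - t \<ge> 0") (auto simp: abs_if)
  ultimately show ?thesis by linarith
qed

text \<open>A geodesic is given by distances alone, so its hyperbolic parametrisation has to be
  derived: the difference r of both sides is a null vector orthogonal to p = \<gamma> 0, hence zero.
  Differentiating at 0 then identifies w with u.\<close>

lemma geodesic_form:
  assumes \<gamma>: "geodesic_line d \<gamma>" and u: "has_vec_derivative (d + 1) \<gamma> u 0"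
  shows "\<gamma> t = cosh t \<cdot>\<^sub>v \<gamma> 0 + sinh t \<cdot>\<^sub>v u" "\<gamma> t \<in> carrier_vec (d + 1)"
    "minkowski d (\<gamma> 0) (\<gamma> 0) = - 1" "minkowski d u u = 1" "minkowski d (\<gamma> 0) u = 0"
proof -
  note mk = geodesic_minkowski[OF \<gamma>]
  have c: "\<gamma> t \<in> carrier_vec (d + 1)" for t using \<gamma> by (auto simp: geodesic_line_def hyp_space_def)
  define p where "p = \<gamma> 0"
  \<comment> \<open>The unit tangent at p, solved from the expected equation \<gamma> 1 = cosh 1 p +
    sinh 1 w.\<close>
  define w where "w = (1 / sinh 1) \<cdot>\<^sub>v \<gamma> 1 + (- cosh 1 / sinh 1) \<cdot>\<^sub>v p"
  have pc: "p \<in> carrier_vec (d + 1)" and wc: "w \<in> carrier_vec (d + 1)" using c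
      by (auto simp: p_def w_def)
  have s1: "sinh (1::real) \<noteq> 0" by simp
  have pp: "minkowski d p p = - 1" using mk[of 0 0] by (simp add: p_def)
  have pt: "minkowski d p (\<gamma> t) = - cosh t" for t using mk[of 0 t] by (simp add: p_def)
  have pw: "minkowski d p w = 0"
    unfolding w_def minkowski_comb(2)[OF c pc pc] pp pt by simp
  have tw: "minkowski d (\<gamma> t) w = sinh t" for t
  proof -
    have "minkowski d (\<gamma> t) w = 1 / sinh 1 * minkowski d (\<gamma> t) (\<gamma> 1) + - cosh 1 / sinh 1 *
        minkowski d (\<gamma> t) p"
      unfolding w_def by (rule minkowski_comb(2)[OF c pc c])
    also have "\<dots> = 1 / sinh 1 * - cosh (t - 1) + - cosh 1 / sinh 1 * - cosh (t - 0)"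
      unfolding p_def mk ..
    also have "\<dots> = sinh t" using s1 by (simp add: cosh_diff field_simps)
    finally show ?thesis .
  qed
  have ww: "minkowski d w w = 1"
  proof -
    have "minkowski d w w = 1 / sinh 1 * minkowski d (\<gamma> 1) w + - cosh 1 / sinh 1 * minkowski d p w"
      by (subst (1) w_def) (rule minkowski_comb(1)[OF c pc wc])
    then show ?thesis using s1 by (simp add: tw pw)
  qed
  have form: "\<gamma> t = cosh t \<cdot>\<^sub>v p + sinh t \<cdot>\<^sub>v w" for t
  proof -
    define v where "v = cosh t \<cdot>\<^sub>v p + sinh t \<cdot>\<^sub>v w"
    define r where "r = 1 \<cdot>\<^sub>v \<gamma> t + (- 1) \<cdot>\<^sub>v v"
    have vc: "v \<in> carrier_vec (d + 1)" and rc: "r \<in> carrier_vec (d + 1)" using pc wc c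
        by (auto simp: v_def r_def)
    have wp: "minkowski d w p = 0" using pw minkowski_comm[OF pc wc] by simp
    have pv: "minkowski d p v = - cosh t" unfolding v_def minkowski_comb(2)[OF pc wc pc] pp pw
        by simp
    have wv: "minkowski d w v = sinh t" unfolding v_def minkowski_comb(2)[OF pc wc wc] wp ww by simp
    have vv: "minkowski d v v = - 1"
    proof -
      have "minkowski d v v = cosh t * minkowski d p v + sinh t * minkowski d w v"
        by (subst (1) v_def) (rule minkowski_comb(1)[OF pc wc vc])
      then show ?thesis using cosh_square_eq[of t] by (simp add: pv wv power2_eq_square)
    qed
    have tv: "minkowski d (\<gamma> t) v = - 1"
    proof -
      have "minkowski d (\<gamma> t) v = cosh t * minkowski d (\<gamma> t) p + sinh t * minkowski d (\<gamma> t) w"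
        unfolding v_def by (rule minkowski_comb(2)[OF pc wc c])
      also have "minkowski d (\<gamma> t) p = - cosh t" using pt minkowski_comm[OF c pc] by simp
      finally show ?thesis using cosh_square_eq[of t] by (simp add: tw power2_eq_square)
    qed
    have pr: "minkowski d p r = 0" unfolding r_def minkowski_comb(2)[OF c vc pc] pt pv by simp
    have tr: "minkowski d (\<gamma> t) r = 0" unfolding r_def minkowski_comb(2)[OF c vc c] tv mk by simp
    have vr: "minkowski d v r = 0"
      unfolding r_def minkowski_comb(2)[OF c vc vc] vv using tv minkowski_comm[OF c vc] by simp
    have "minkowski d r r = 1 * minkowski d (\<gamma> t) r + (- 1) * minkowski d v r"
      by (subst (1) r_def) (rule minkowski_comb(1)[OF c vc rc])
    then have "minkowski d r r = 0" using tr vr by simp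
    then have r0: "r = 0\<^sub>v (d + 1)" using minkowski_timelike[OF pc _ rc pr] pp by simp
    show ?thesis unfolding v_def[symmetric]
    proof (rule eq_vecI)
      fix i assume "i < dim_vec v"
      then have i: "i < d + 1" using vc by simp
      have "r $ i = 0" using r0 i by simp
      then show "\<gamma> t $ i = v $ i" using i c[of t] vc by (simp add: r_def)
    qed (use c[of t] vc in auto)
  qed
  have "u = w"
  proof (rule eq_vecI)
    have uc: "u \<in> carrier_vec (d + 1)" using u by (simp add: has_vec_derivative_def)
    fix i assume "i < dim_vec w"
    then have i: "i < d + 1" using wc by simp
    have "((\<lambda>s. \<gamma> s $ i) has_real_derivative u $ i) (at 0)" using u i
        by (simp add: has_vec_derivative_def)
    moreover have "(\<lambda>s. \<gamma> s $ i) = (\<lambda>s. cosh s * p $ i + sinh s * w $ i)"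
      unfolding form using i pc wc by simp
    moreover have "((\<lambda>s. cosh s * p $ i + sinh s * w $ i) has_real_derivative w $ i) (at 0)"
      by (auto intro!: derivative_eq_intros)
    ultimately show "u $ i = w $ i" using DERIV_unique by fastforce
  qed (use u wc in \<open>auto simp: has_vec_derivative_def\<close>)
  then show "\<gamma> t = cosh t \<cdot>\<^sub>v \<gamma> 0 + sinh t \<cdot>\<^sub>v u" using form[of t] unfolding p_def by (simp only:)
  show "\<gamma> t \<in> carrier_vec (d + 1)" by (rule c)
  show "minkowski d (\<gamma> 0) (\<gamma> 0) = - 1" using pp unfolding p_def .
  show "minkowski d u u = 1" using ww unfolding \<open>u = w\<close> .
  show "minkowski d (\<gamma> 0) u = 0" using pw unfolding \<open>u = w\<close> p_def .
qed

lemma minkowski_has_derivative: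
  assumes V: "has_vec_derivative (d + 1) V v t" "\<And>s. V s \<in> carrier_vec (d + 1)"
    and W: "has_vec_derivative (d + 1) W w t" "\<And>s. W s \<in> carrier_vec (d + 1)"
  shows "((\<lambda>s. minkowski d (V s) (W s)) has_real_derivative minkowski d v (W t) + minkowski d
      (V t) w) (at t)"
proof -
  have c: "v \<in> carrier_vec (d + 1)" "w \<in> carrier_vec (d + 1)" using V(1) W(1)
      by (auto simp: has_vec_derivative_def)
  have Vi: "((\<lambda>s. V s $ i) has_real_derivative v $ i) (at t)"
      and Wi: "((\<lambda>s. W s $ i) has_real_derivative w $ i) (at t)"
    if "i < d + 1" for i using V(1) W(1) that by (auto simp: has_vec_derivative_def)
  have "((\<lambda>s. (\<Sum>i<d. V s $ i * W s $ i) - V s $ d * W s $ d) has_real_derivative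
      (\<Sum>i<d. v $ i * W t $ i + w $ i * V t $ i) - (v $ d * W t $ d + w $ d * V t $ d)) (at t)"
    by (intro DERIV_diff DERIV_sum DERIV_mult Vi Wi) auto
  moreover have "(\<Sum>i<d. v $ i * W t $ i + w $ i * V t $ i) - (v $ d * W t $ d + w $ d * V t $ d)
     = minkowski d v (W t) + minkowski d (V t) w"
    using c V(2) W(2) by (simp add: minkowski_sum sum.distrib algebra_simps)
  moreover have "(\<lambda>s. minkowski d (V s) (W s)) = (\<lambda>s. (\<Sum>i<d. V s $ i * W s $ i) - V s $ d * W s $
      d)"
    by (rule ext) (rule minkowski_sum[OF V(2) W(2)])
  ultimately show ?thesis by simp
qed

text \<open>The product of V with the velocity of \<gamma> has derivative 0, so V stays orthogonal
  to the velocity. Differentiating the product of V with \<gamma>, which is 0, then shows that the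
  multiplier c in the derivative of V vanishes. Parallel transport of normal vectors is thus trivial
  in ambient coordinates.\<close>

lemma parallel_normal_constant:
  assumes \<gamma>: "geodesic_line d \<gamma>" and u: "has_vec_derivative (d + 1) \<gamma> u 0"
    and V: "parallel_along d \<gamma> V" and n: "minkowski d (V 0) u = 0"
  shows "V t = V 0"
proof -
  note form = geodesic_form[OF \<gamma> u]
  define p where "p = \<gamma> 0"
  have uc: "u \<in> carrier_vec (d + 1)" using u by (simp add: has_vec_derivative_def)
  have pc: "p \<in> carrier_vec (d + 1)" using form(2) by (simp add: p_def)
  define \<gamma>' where "\<gamma>' = (\<lambda>t. sinh t \<cdot>\<^sub>v p + cosh t \<cdot>\<^sub>v u)"
  have c': "\<gamma>' t \<in> carrier_vec (d + 1)" for t using uc pc by (simp add: \<gamma>'_def)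
  have d1: "has_vec_derivative (d + 1) \<gamma> (\<gamma>' t) t" for t
    unfolding has_vec_derivative_def
  proof (intro conjI allI impI c')
    fix i assume i: "i < d + 1"
    have "(\<lambda>s. \<gamma> s $ i) = (\<lambda>s. cosh s * p $ i + sinh s * u $ i)"
      by (subst form(1)) (use i pc uc in \<open>simp add: p_def\<close>)
    then show "((\<lambda>s. \<gamma> s $ i) has_real_derivative \<gamma>' t $ i) (at t)"
      using i pc uc by (auto simp: \<gamma>'_def intro!: derivative_eq_intros)
  qed
  have d2: "has_vec_derivative (d + 1) \<gamma>' (\<gamma> t) t" for t
    unfolding has_vec_derivative_def
  proof (intro conjI allI impI form(2))
    fix i assume i: "i < d + 1"
    have "(\<lambda>s. \<gamma>' s $ i) = (\<lambda>s. sinh s * p $ i + cosh s * u $ i)"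
      using i pc uc by (simp add: \<gamma>'_def)
    moreover have "\<gamma> t $ i = cosh t * p $ i + sinh t * u $ i"
      by (subst form(1)) (use i pc uc in \<open>simp add: p_def\<close>)
    ultimately show "((\<lambda>s. \<gamma>' s $ i) has_real_derivative \<gamma> t $ i) (at t)"
      by (auto intro!: derivative_eq_intros)
  qed
  have up: "minkowski d u p = 0" using form(5) minkowski_comm[OF pc uc] by (simp add: p_def)
  have gg': "minkowski d (\<gamma> t) (\<gamma>' t) = 0" for t
    unfolding \<gamma>'_def minkowski_comb(2)[OF pc uc form(2)]
    by (subst (1 2) form(1)) (simp add: minkowski_comb(1)[OF pc uc pc] minkowski_comb(1)[OF pc uc
        uc] up form(3-5)[folded p_def] p_def[symmetric])
  have gg: "minkowski d (\<gamma> t) (\<gamma> t) = - 1" for t using geodesic_minkowski[OF \<gamma>, of t t] by simp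
  have Vc: "V t \<in> carrier_vec (d + 1)" and Vg: "minkowski d (V t) (\<gamma> t) = 0" for t
    using V by (auto simp: parallel_along_def)
  have "\<exists>c. \<forall>t. has_vec_derivative (d + 1) V (c t \<cdot>\<^sub>v \<gamma> t) t"
    using V unfolding parallel_along_def by metis
  then obtain c where Vd: "\<And>t. has_vec_derivative (d + 1) V (c t \<cdot>\<^sub>v \<gamma> t) t" by blast
  define f where "f = (\<lambda>t. minkowski d (V t) (\<gamma>' t))"
  have "(f has_real_derivative 0) (at t)" for t
  proof -
    have "(f has_real_derivative minkowski d (c t \<cdot>\<^sub>v \<gamma> t) (\<gamma>' t) + minkowski d (V t) (\<gamma> t)) (at t)"
      unfolding f_def by (rule minkowski_has_derivative[OF Vd Vc d2 c'])
    then show ?thesis using minkowski_comb(3)[OF form(2) form(2) c'] gg' Vg by simp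
  qed
  then have "f t = f 0" for t using DERIV_isconst_all[of f t 0] by blast
  moreover have "f 0 = sinh 0 * minkowski d (V 0) p + cosh 0 * minkowski d (V 0) u"
    unfolding f_def \<gamma>'_def by (rule minkowski_comb(2)[OF pc uc Vc])
  ultimately have f0: "f t = 0" for t using n by simp
  have c0: "c t = 0" for t
  proof -
    have "((\<lambda>s. minkowski d (V s) (\<gamma> s)) has_real_derivative minkowski d (c t \<cdot>\<^sub>v \<gamma> t) (\<gamma> t) +
        minkowski d (V t) (\<gamma>' t)) (at t)"
      by (rule minkowski_has_derivative[OF Vd Vc d1 form(2)])
    moreover have "minkowski d (c t \<cdot>\<^sub>v \<gamma> t) (\<gamma> t) = - c t"
        using minkowski_comb(3)[OF form(2) form(2) form(2)] gg by simp
    ultimately have "((\<lambda>s. 0) has_real_derivative - c t) (at t)" using Vg f0 by (simp add: f_def)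
    then show ?thesis using DERIV_unique[OF _ DERIV_const[of 0]] by fastforce
  qed
  show ?thesis
  proof (rule eq_vecI)
    fix i assume "i < dim_vec (V 0)"
    then have i: "i < d + 1" using Vc[of 0] by simp
    have "((\<lambda>s. V s $ i) has_real_derivative 0) (at s)" for s
      using Vd[of s] i form(2)[of s] by (simp add: has_vec_derivative_def c0)
    then show "V t $ i = V 0 $ i" using DERIV_isconst_all[of "\<lambda>s. V s $ i" t 0] by blast
  qed (use Vc[of t] Vc[of 0] in auto)
qed

text \<open>The axis is unique, and along it l is the distance from a point to its image; this
  justifies the definite description in \<open>translation_length\<close>.\<close>

lemma translation_length_unique:
  assumes lox: "loxodromic d g" and tr: "translates_along d g \<gamma> l"
  shows "translation_length d g = l"
proof -
  obtain \<gamma>0 l0 where 0: "translates_along d g \<gamma>0 l0"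
    and uniq: "\<And>\<gamma>'. geodesic_line d \<gamma>' \<Longrightarrow> (\<lambda>x. g *\<^sub>v x) ` range \<gamma>' = range \<gamma>' \<Longrightarrow> range \<gamma>' = range \<gamma>0"
    using lox by (auto simp: loxodromic_def)
  have eq: "l' = l0" if t: "translates_along d g \<gamma>' l'" for \<gamma>' l'
  proof -
    have t': "geodesic_line d \<gamma>'" "l' > 0" "\<And>s. g *\<^sub>v \<gamma>' s = \<gamma>' (s + l')" using t
        by (auto simp: translates_along_def)
    have "(\<lambda>x. g *\<^sub>v x) ` range \<gamma>' = range \<gamma>'"
    proof (intro equalityI subsetI)
      fix x assume "x \<in> range \<gamma>'"
      then obtain s where "x = \<gamma>' s" by blast
      then have "x = g *\<^sub>v \<gamma>' (s - l')" using t'(3)[of "s - l'"] by simp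
      then show "x \<in> (\<lambda>x. g *\<^sub>v x) ` range \<gamma>'" by blast
    qed (use t'(3) in auto)
    then have "range \<gamma>' = range \<gamma>0" using uniq t'(1) by blast
    then obtain s where s: "\<gamma>' 0 = \<gamma>0 s" by (metis rangeE rangeI)
    have "\<gamma>' l' = g *\<^sub>v \<gamma>' 0" using t'(3)[of 0] by simp
    also have "\<dots> = \<gamma>0 (s + l0)" using 0 s by (simp add: translates_along_def)
    finally have "hyp_dist d (\<gamma>' 0) (\<gamma>' l') = hyp_dist d (\<gamma>0 s) (\<gamma>0 (s + l0))" using s by simp
    then show ?thesis using t'(1,2) 0 by (auto simp: translates_along_def geodesic_line_def)
  qed
  show ?thesis unfolding translation_length_def
    by (rule the_equality) (use tr eq in blast, use tr eq in blast)
qed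

section \<open>Eigenvalues of a loxodromic isometry\<close>

definition boost :: "real \<Rightarrow> real mat" where
  "boost l = mat 2 2 (\<lambda>(i, j). if i = j then cosh l else sinh l)"

text \<open>The sum and the difference of the two coordinates diagonalise the matrix, with
  eigenvalues cosh l + sinh l and cosh l - sinh l.\<close>

lemma eigenvalue_boost:
  "eigenvalue (map_mat complex_of_real (boost l)) z \<longleftrightarrow> z = of_real (exp l) \<or> z = of_real (exp (- l))"
proof -
  let ?B = "map_mat complex_of_real (boost l)"
  have B: "?B \<in> carrier_mat 2 2" by (simp add: boost_def)
  define c s where cs: "c = complex_of_real (cosh l)" "s = complex_of_real (sinh l)"
  have Bv: "(?B *\<^sub>v v) $ 0 = c * v $ 0 + s * v $ 1" "(?B *\<^sub>v v) $ 1 = s * v $ 0 + c * v $ 1"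
      if "v \<in> carrier_vec 2" for v
    using that by (simp_all add: boost_def scalar_prod_def cs numeral_2_eq_2)
  have e: "of_real (exp l) = c + s" "of_real (exp (- l)) = c - s"
    unfolding cs of_real_add[symmetric] of_real_diff[symmetric]
        by (simp_all only: cosh_plus_sinh cosh_minus_sinh)
  show ?thesis
  proof
    assume "eigenvalue ?B z"
    then obtain v where v: "v \<in> carrier_vec 2" "v \<noteq> 0\<^sub>v 2" "?B *\<^sub>v v = z \<cdot>\<^sub>v v"
      using B by (auto simp: eigenvalue_def eigenvector_def)
    have r: "c * v $ 0 + s * v $ 1 = z * v $ 0" "s * v $ 0 + c * v $ 1 = z * v $ 1"
      using Bv[OF v(1)] v(1) unfolding v(3) by simp_all
    have "(z - (c + s)) * (v $ 0 + v $ 1) = (z * v $ 0 - (c * v $ 0 + s * v $ 1)) +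
        (z * v $ 1 - (s * v $ 0 + c * v $ 1))"
      "(z - (c - s)) * (v $ 0 - v $ 1) = (z * v $ 0 - (c * v $ 0 + s * v $ 1)) -
          (z * v $ 1 - (s * v $ 0 + c * v $ 1))"
      by (simp_all add: algebra_simps)
    then have "(z - (c + s)) * (v $ 0 + v $ 1) = 0" "(z - (c - s)) * (v $ 0 - v $ 1) = 0"
      unfolding r by simp_all
    moreover have "v $ 0 + v $ 1 \<noteq> 0 \<or> v $ 0 - v $ 1 \<noteq> 0"
    proof (rule ccontr)
      assume "\<not> ?thesis"
      then have "v $ 0 + v $ 1 = 0" "v $ 0 = v $ 1" by auto
      then have "v $ 0 = 0" "v $ 1 = 0" by simp_all
      then have "v = 0\<^sub>v 2" using v(1) by (intro eq_vecI) (auto simp: less_2_cases_iff)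
      then show False using v(2) by simp
    qed
    ultimately show "z = of_real (exp l) \<or> z = of_real (exp (- l))" unfolding e by auto
  next
    assume z: "z = of_real (exp l) \<or> z = of_real (exp (- l))"
    define w where "w = (if z = c + s then 1 else - 1 :: complex)"
    define v where "v = vec 2 (\<lambda>i. if i = 0 then 1 else w)"
    have v: "v \<in> carrier_vec 2" "v $ 0 = 1" "v $ 1 = w" by (auto simp: v_def)
    have "?B *\<^sub>v v = z \<cdot>\<^sub>v v"
    proof (rule eq_vecI)
      fix i assume "i < dim_vec (z \<cdot>\<^sub>v v)"
      then have "i = 0 \<or> i = 1" using v(1) by auto
      then show "(?B *\<^sub>v v) $ i = (z \<cdot>\<^sub>v v) $ i"
        using Bv[OF v(1)] z v unfolding e by (auto simp: w_def)
    qed (use B v in auto)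
    moreover have "v \<noteq> 0\<^sub>v 2" using v(2) by (metis index_zero_vec(1) pos2 zero_neq_one)
    ultimately show "eigenvalue ?B z" using B v(1) by (auto simp: eigenvalue_def eigenvector_def)
  qed
qed

text \<open>In the basis formed by the frame, the velocity u and the point p, the matrix of g is
  block diagonal with blocks A and \<open>boost l\<close>: on the frame because parallel fields
  normal to the axis are constant, on u and p by the form of a geodesic.\<close>

theorem eigenvalue_holonomy:
  assumes d: "d \<ge> 1" and g: "g \<in> carrier_mat (d + 1) (d + 1)" and lox: "loxodromic d g"
      and A: "holonomy_matrix d g A"
    and l: "translation_length d g = l"
  shows "eigenvalue (map_mat complex_of_real g) z \<longleftrightarrow>
    eigenvalue (map_mat complex_of_real A) z \<or> z = of_real (exp l) \<or> z = of_real (exp (- l))"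
proof -
  obtain \<gamma> l' es where Ac: "A \<in> carrier_mat (d - 1) (d - 1)" and tr: "translates_along d g \<gamma> l'"
      and fr: "normal_frame d \<gamma> es"
    and par: "\<And>j. j < d - 1 \<Longrightarrow> \<exists>V. parallel_along d \<gamma> V \<and> V l' = g *\<^sub>v (es ! j) \<and> V 0 =
        mat_of_cols (d + 1) es *\<^sub>v col A j"
    using A by (auto simp: holonomy_matrix_def)
  have l': "l' = l" using translation_length_unique[OF lox tr] l by simp
  have \<gamma>: "geodesic_line d \<gamma>" and gt: "\<And>t. g *\<^sub>v \<gamma> t = \<gamma> (t + l)" using tr l'
      by (auto simp: translates_along_def)
  obtain u where u: "has_vec_derivative (d + 1) \<gamma> u 0"
      and es: "length es = d - 1" "set es \<subseteq> carrier_vec (d + 1)"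
    "\<And>e. e \<in> set es \<Longrightarrow> minkowski d e u = 0" and det: "det (mat_of_cols (d + 1) (es @ [u, \<gamma> 0])) > 0"
    using fr by (auto simp: normal_frame_def)
  note form = geodesic_form[OF \<gamma> u]
  define p where "p = \<gamma> 0"
  have uc: "u \<in> carrier_vec (d + 1)" using u by (simp add: has_vec_derivative_def)
  have pc: "p \<in> carrier_vec (d + 1)" using form(2) by (simp add: p_def)
  have gp: "g *\<^sub>v p = cosh l \<cdot>\<^sub>v p + sinh l \<cdot>\<^sub>v u" using gt[of 0] form(1)[of l] by (simp add: p_def)
  \<comment> \<open>What is given is the action of g on points of the line, so the image of u is
    extracted from those of \<gamma> 1 and p.\<close>
  have gu: "g *\<^sub>v u = sinh l \<cdot>\<^sub>v p + cosh l \<cdot>\<^sub>v u"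
  proof (rule eq_vecI)
    fix i assume "i < dim_vec (sinh l \<cdot>\<^sub>v p + cosh l \<cdot>\<^sub>v u)"
    then have i: "i < d + 1" using uc by simp
    have "g *\<^sub>v (cosh 1 \<cdot>\<^sub>v p + sinh 1 \<cdot>\<^sub>v u) = cosh (1 + l) \<cdot>\<^sub>v p + sinh (1 + l) \<cdot>\<^sub>v u"
      using gt[of 1] form(1)[of 1] form(1)[of "1 + l"] by (simp add: p_def)
    moreover have "g *\<^sub>v (cosh 1 \<cdot>\<^sub>v p + sinh 1 \<cdot>\<^sub>v u) = cosh 1 \<cdot>\<^sub>v (g *\<^sub>v p) + sinh 1 \<cdot>\<^sub>v (g *\<^sub>v u)"
      using g pc uc by (simp add: mult_add_distrib_mat_vec[of _ "d + 1" "d + 1"]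
          mult_mat_vec[of _ "d + 1" "d + 1"])
    ultimately have "(cosh 1 \<cdot>\<^sub>v (g *\<^sub>v p) + sinh 1 \<cdot>\<^sub>v (g *\<^sub>v u)) $ i =
        (cosh (1 + l) \<cdot>\<^sub>v p + sinh (1 + l) \<cdot>\<^sub>v u) $ i" by simp
    then have "cosh 1 * (cosh l * p $ i + sinh l * u $ i) + sinh 1 * (g *\<^sub>v u) $ i =
        cosh (1 + l) * p $ i + sinh (1 + l) * u $ i"
      unfolding gp using i g pc uc by simp
    then have "sinh 1 * (g *\<^sub>v u) $ i = sinh 1 * (sinh l * p $ i + cosh l * u $ i)"
      by (simp add: cosh_add sinh_add algebra_simps)
    then show "(g *\<^sub>v u) $ i = (sinh l \<cdot>\<^sub>v p + cosh l \<cdot>\<^sub>v u) $ i" using i pc uc by simp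
  qed (use g uc in auto)
  define E where "E = mat_of_cols (d + 1) es"
  have Ec: "E \<in> carrier_mat (d + 1) (d - 1)" using mat_of_cols_carrier(1)[of "d + 1" es]
      unfolding E_def es(1) .
  have ge: "g *\<^sub>v (es ! j) = E *\<^sub>v col A j" if j: "j < d - 1" for j
  proof -
    obtain V where V: "parallel_along d \<gamma> V" "V l = g *\<^sub>v (es ! j)" "V 0 = E *\<^sub>v col A j"
      using par[OF j] l' unfolding E_def by blast
    have colc: "col A j \<in> carrier_vec (d - 1)" using Ac by (rule col_carrier_vec[OF j])
    have Ju: "signature_mat d 1 *\<^sub>v u \<in> carrier_vec (d + 1)" using uc signature_mat_carrier
        by (rule mult_mat_vec_carrier[rotated])
    have "minkowski d (V 0) u = (E *\<^sub>v col A j) \<bullet> (signature_mat d 1 *\<^sub>v u)"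
        by (simp add: minkowski_def V(3))
    also have "\<dots> = (signature_mat d 1 *\<^sub>v u) \<bullet> (E *\<^sub>v col A j)"
      by (rule comm_scalar_prod[OF _ Ju]) (use Ec colc in auto)
    also have "\<dots> = (E\<^sup>T *\<^sub>v (signature_mat d 1 *\<^sub>v u)) \<bullet> col A j"
      using transpose_vec_mult_scalar[OF Ec colc Ju] by simp
    also have "E\<^sup>T *\<^sub>v (signature_mat d 1 *\<^sub>v u) = 0\<^sub>v (d - 1)"
    proof (rule eq_vecI)
      fix k assume "k < dim_vec (0\<^sub>v (d - 1) :: real vec)"
      then have k: "k < d - 1" by simp
      have ek: "es ! k \<in> set es" using k es(1) by simp
      have "col E k = es ! k" unfolding E_def using k es ek by (intro col_mat_of_cols) auto
      then have "(E\<^sup>T *\<^sub>v (signature_mat d 1 *\<^sub>v u)) $ k = minkowski d (es ! k) u" using k Ec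
          by (simp add: minkowski_def)
      then show "(E\<^sup>T *\<^sub>v (signature_mat d 1 *\<^sub>v u)) $ k = 0\<^sub>v (d - 1) $ k" using es(3)[OF ek] k by simp
    qed (use Ec in auto)
    finally have "minkowski d (V 0) u = 0" using colc by simp
    then have "V l = V 0" using parallel_normal_constant[OF \<gamma> u V(1)] by blast
    then show ?thesis using V by simp
  qed
  define U where "U = mat_of_cols (d + 1) (es @ [u, p])"
  have "length (es @ [u, p]) = d + 1" using es(1) d by simp
  then have Uc: "U \<in> carrier_mat (d + 1) (d + 1)"
      using mat_of_cols_carrier(1)[of "d + 1" "es @ [u, p]"] unfolding U_def by simp
  have dne: "d \<noteq> d - 1" "\<not> d < d - 1" using d by linarith+
  define B where "B = four_block_mat A (0\<^sub>m (d - 1) 2) (0\<^sub>m 2 (d - 1)) (boost l)"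
  have bc: "boost l \<in> carrier_mat 2 2" by (simp add: boost_def)
  have dd: "d - 1 + 2 = d + 1" using d by simp
  have Bc: "B \<in> carrier_mat (d + 1) (d + 1)"
    using four_block_carrier_mat[OF Ac bc, of "0\<^sub>m (d - 1) 2" "0\<^sub>m 2 (d - 1)"] unfolding B_def dd .
  have colU: "col U j = (if j < d - 1 then es ! j else if j = d - 1 then u else p)"
      if "j < d + 1" for j
  proof -
    have "j < length (es @ [u, p])" using that es(1) by simp
    moreover have "(es @ [u, p]) ! j \<in> carrier_vec (d + 1)"
      using that es uc pc by (auto simp: nth_append nth_Cons split: nat.splits intro!:
          subsetD[OF es(2)])
    ultimately have "col U j = (es @ [u, p]) ! j" unfolding U_def by (rule col_mat_of_cols)
    also have "\<dots> = (if j < d - 1 then es ! j else if j = d - 1 then u else p)"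
      using that es(1) by (auto simp: nth_append nth_Cons split: nat.splits)
    finally show ?thesis .
  qed
  have Uent: "U $$ (i, k) = col U k $ i" if "i < d + 1" "k < d + 1" for i k using that Uc by simp
  have split: "(\<Sum>k<d + 1. f k) = (\<Sum>k<d - 1. f k) + f (d - 1) + f d" for f :: "nat \<Rightarrow> real"
  proof -
    obtain e where "d = Suc e" using d by (cases d) auto
    then show ?thesis by simp
  qed
  have gU: "g * U = U * B"
  proof (rule eq_matI)
    fix i j assume "i < dim_row (U * B)" "j < dim_col (U * B)"
    then have ij: "i < d + 1" "j < d + 1" using Uc Bc by auto
    have L: "(g * U) $$ (i, j) = (g *\<^sub>v col U j) $ i" using ij g Uc by simp
    have "(U * B) $$ (i, j) = (\<Sum>k<d + 1. col U k $ i * B $$ (k, j))"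
      using ij Uc Bc by (simp add: scalar_prod_def atLeast0LessThan del: sum.lessThan_Suc)
    also have "\<dots> = (\<Sum>k<d - 1. (es ! k) $ i * B $$ (k, j)) + u $ i * B $$ (d - 1, j) + p $ i * B
        $$ (d, j)"
      unfolding split using dne by (simp add: colU)
    finally have R: "(U * B) $$ (i, j) = (\<Sum>k<d - 1. (es ! k) $ i * B $$ (k, j)) + u $ i * B $$
        (d - 1, j) + p $ i * B $$ (d, j)" .
    consider "j < d - 1" | "j = d - 1" | "j = d" using ij(2) by linarith
    then show "(g * U) $$ (i, j) = (U * B) $$ (i, j)"
    proof cases
      case 1
      have "(g * U) $$ (i, j) = (E *\<^sub>v col A j) $ i" unfolding L colU[OF ij(2)] using 1 ge by simp
      also have "\<dots> = (\<Sum>k<d - 1. (es ! k) $ i * A $$ (k, j))"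
        using ij(1) 1 Ac Ec es(1) by (simp add: E_def scalar_prod_def atLeast0LessThan
            mat_of_cols_index)
      finally show ?thesis unfolding R using 1 Ac bc d by (simp add: B_def)
    next
      case 2
      then have "(g * U) $$ (i, j) = (g *\<^sub>v u) $ i" unfolding L colU[OF ij(2)] by simp
      then show ?thesis unfolding R gu using 2 Ac bc d ij pc uc by (simp add: B_def boost_def)
    next
      case 3
      then have "(g * U) $$ (i, j) = (g *\<^sub>v p) $ i" unfolding L colU[OF ij(2)] using dne by simp
      then show ?thesis unfolding R gp using 3 Ac bc d ij pc uc by (simp add: B_def boost_def)
    qed
  qed (use g Uc Bc in auto)
  have "det U \<noteq> 0" using det by (simp add: U_def p_def)
  then obtain Ui where Ui: "Ui \<in> carrier_mat (d + 1) (d + 1)" "U * Ui = 1\<^sub>m (d + 1)"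
      "Ui * U = 1\<^sub>m (d + 1)"
  proof -
    assume nz: "det U \<noteq> 0"
    note adj = adj_mat[OF Uc]
    show thesis
    proof (rule that[of "(1 / det U) \<cdot>\<^sub>m adj_mat U"])
      show "(1 / det U) \<cdot>\<^sub>m adj_mat U \<in> carrier_mat (d + 1) (d + 1)" using adj(1) by simp
      show "U * ((1 / det U) \<cdot>\<^sub>m adj_mat U) = 1\<^sub>m (d + 1)"
        using mult_smult_distrib[OF Uc adj(1)] adj(2) nz by (auto intro!: eq_matI)
      show "(1 / det U) \<cdot>\<^sub>m adj_mat U * U = 1\<^sub>m (d + 1)"
        using mult_smult_assoc_mat[OF adj(1) Uc] adj(3) nz by (auto intro!: eq_matI)
    qed
  qed
  have "g = U * B * Ui"
  proof -
    have "g = g * (U * Ui)" using Ui g by simp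
    also have "\<dots> = g * U * Ui" using g Uc Ui by simp
    finally show ?thesis unfolding gU .
  qed
  then have "similar_mat g B" using g Uc Bc Ui by (intro similar_matI[of _ _ U Ui "d + 1"]) auto
  then have "char_poly g = char_poly B" by (rule char_poly_similar)
  also have "\<dots> = char_poly A * char_poly (boost l)"
    unfolding B_def by (rule char_poly_four_block_lower_left_zero[OF Ac _ bc]) simp
  finally have "char_poly (map_mat complex_of_real g) = char_poly (map_mat complex_of_real A) *
      char_poly (map_mat complex_of_real (boost l))"
    unfolding of_real_hom.char_poly_hom[OF g] of_real_hom.char_poly_hom[OF Ac]
        of_real_hom.char_poly_hom[OF bc]
    by (simp add: hom_distribs)
  then have "poly (char_poly (map_mat complex_of_real g)) z = 0 \<longleftrightarrow>
     poly (char_poly (map_mat complex_of_real A)) z = 0 \<or>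
         poly (char_poly (map_mat complex_of_real (boost l))) z = 0" by simp
  then show ?thesis
    using eigenvalue_root_char_poly[of "map_mat complex_of_real g" "d + 1"]
        eigenvalue_root_char_poly[of "map_mat complex_of_real A" "d - 1"]
      eigenvalue_root_char_poly[of "map_mat complex_of_real (boost l)" 2] g Ac bc
          eigenvalue_boost by simp
qed

section \<open>Arithmetic groups\<close>

lemma elements_mat_mult:
  assumes R: "0 \<in> R" "\<And>x y. x \<in> R \<Longrightarrow> y \<in> R \<Longrightarrow> x + y \<in> R \<and> x * y \<in> R"
    and A: "A \<in> carrier_mat n n" "elements_mat A \<subseteq> R"
        and B: "B \<in> carrier_mat n n" "elements_mat B \<subseteq> R"
  shows "elements_mat (A * B) \<subseteq> (R :: real set)"
proof
  fix x assume "x \<in> elements_mat (A * B)"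
  then obtain i j where ij: "i < n" "j < n" and x: "x = (A * B) $$ (i, j)"
    using A(1) B(1) by (auto simp: elements_mat_def)
  have "x = (\<Sum>k<n. A $$ (i, k) * B $$ (k, j))"
    using ij A(1) B(1) x by (simp add: scalar_prod_def atLeast0LessThan)
  moreover have "(\<Sum>k\<in>F. A $$ (i, k) * B $$ (k, j)) \<in> R" if "finite F" "F \<subseteq> {..<n}" for F
    using that
  proof (induction F)
    case empty
    then show ?case using R by simp
  next
    case (insert k F)
    have "A $$ (i, k) \<in> R" "B $$ (k, j) \<in> R"
      using insert.prems ij elements_mat_entry[OF A(1)] elements_mat_entry[OF B(1)] A(2) B(2)
          by auto
    then show ?case using insert R(2) by simp
  qed
  ultimately show "x \<in> R" by auto
qed

lemma hyperboloid_components_carrier: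
  assumes "C \<in> hyperboloid_components Q" "Q \<in> carrier_mat n n"
  shows "C \<subseteq> carrier_vec n"
  using assms by (auto simp: hyperboloid_components_def hyperboloid_def)

lemma SO'_D:
  assumes "A \<in> SO' Q R" "Q \<in> carrier_mat n n"
  shows "A \<in> carrier_mat n n" "elements_mat A \<subseteq> R" "det A = 1" "A\<^sup>T * Q * A = Q"
    "\<And>C. C \<in> hyperboloid_components Q \<Longrightarrow> (\<lambda>x. A *\<^sub>v x) ` C = C"
  using assms by (auto simp: SO'_def SO_def)

lemma SO'_I:
  assumes "Q \<in> carrier_mat n n" "A \<in> carrier_mat n n" "elements_mat A \<subseteq> R" "det A = 1"
      "A\<^sup>T * Q * A = Q"
    "\<And>C. C \<in> hyperboloid_components Q \<Longrightarrow> (\<lambda>x. A *\<^sub>v x) ` C = C"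
  shows "A \<in> SO' Q R"
  using assms by (auto simp: SO'_def SO_def)

lemma SO'_mult:
  assumes Q: "Q \<in> carrier_mat n n"
    and R: "0 \<in> R" "\<And>x y. x \<in> R \<Longrightarrow> y \<in> R \<Longrightarrow> x + y \<in> R \<and> x * y \<in> R"
    and A: "A \<in> SO' Q R" and B: "B \<in> SO' Q R"
  shows "A * B \<in> SO' Q R"
proof (rule SO'_I[OF Q])
  note A = SO'_D[OF A Q] and B = SO'_D[OF B Q]
  show "A * B \<in> carrier_mat n n" using A(1) B(1) by simp
  show "elements_mat (A * B) \<subseteq> R" by (rule elements_mat_mult[OF R A(1,2) B(1,2)])
  show "det (A * B) = 1" using A B by (simp add: det_mult)
  have "(A * B)\<^sup>T * Q * (A * B) = B\<^sup>T * (A\<^sup>T * Q * A) * B"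
    using A(1) B(1) Q by (simp add: transpose_mult[of _ n n _ n] assoc_mult_mat[of _ n n _ n _ n])
  then show "(A * B)\<^sup>T * Q * (A * B) = Q" by (simp add: A(4) B(4))
  show "(\<lambda>x. A * B *\<^sub>v x) ` C = C" if C: "C \<in> hyperboloid_components Q" for C
  proof -
    have "(\<lambda>x. A * B *\<^sub>v x) ` C = (\<lambda>x. A *\<^sub>v (B *\<^sub>v x)) ` C"
      using A(1) B(1) hyperboloid_components_carrier[OF C Q] by (intro image_cong) auto
    also have "\<dots> = (\<lambda>x. A *\<^sub>v x) ` ((\<lambda>x. B *\<^sub>v x) ` C)" by (simp add: image_image)
    finally show ?thesis by (simp only: A(5)[OF C] B(5)[OF C])
  qed
qed

lemma SO'_one:
  assumes Q: "Q \<in> carrier_mat n n" and R: "0 \<in> R" "1 \<in> R"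
  shows "1\<^sub>m n \<in> SO' Q R"
proof (rule SO'_I[OF Q])
  show "(\<lambda>x. 1\<^sub>m n *\<^sub>v x) ` C = C" if C: "C \<in> hyperboloid_components Q" for C
  proof -
    have "(\<lambda>x. 1\<^sub>m n *\<^sub>v x) ` C = (\<lambda>x. x) ` C"
      using hyperboloid_components_carrier[OF C Q] by (intro image_cong) auto
    then show ?thesis by simp
  qed
qed (use Q R in \<open>auto simp: elements_mat_def\<close>)

lemma SO'_inverse:
  assumes Q: "Q \<in> carrier_mat n n" and A: "A \<in> SO' Q UNIV"
  obtains B where "B \<in> SO' Q UNIV" "A * B = 1\<^sub>m n" "B * A = 1\<^sub>m n"
proof -
  note A = SO'_D[OF A Q]
  define B where "B = adj_mat A"
  have B: "B \<in> carrier_mat n n" and AB: "A * B = 1\<^sub>m n" and BA: "B * A = 1\<^sub>m n"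
    using adj_mat[OF A(1)] A(3) by (auto simp: B_def)
  have "det A * det B = det (A * B)" using A(1) B by (simp add: det_mult)
  then have dB: "det B = 1" using A(3) AB by simp
  have "B\<^sup>T * Q * B = B\<^sup>T * (A\<^sup>T * Q * A) * B" by (simp add: A(4))
  also have "\<dots> = (A * B)\<^sup>T * Q * (A * B)"
    using A(1) B Q by (simp add: transpose_mult[of _ n n _ n] assoc_mult_mat[of _ n n _ n _ n])
  also have "\<dots> = Q" using AB Q by simp
  finally have BQ: "B\<^sup>T * Q * B = Q" .
  have img: "(\<lambda>x. B *\<^sub>v x) ` C = C" if C: "C \<in> hyperboloid_components Q" for C
  proof -
    have "(\<lambda>x. B *\<^sub>v x) ` C = (\<lambda>x. B *\<^sub>v x) ` ((\<lambda>x. A *\<^sub>v x) ` C)" by (simp only: A(5)[OF C])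
    also have "\<dots> = (\<lambda>x. B *\<^sub>v (A *\<^sub>v x)) ` C" by (simp add: image_image)
    also have "\<dots> = (\<lambda>x. x) ` C"
    proof (rule image_cong[OF refl])
      fix x assume "x \<in> C"
      then have "x \<in> carrier_vec n" using hyperboloid_components_carrier[OF C Q] by blast
      then show "B *\<^sub>v (A *\<^sub>v x) = x"
        using assoc_mult_mat_vec[OF B A(1), of x] BA by simp
    qed
    finally show ?thesis by simp
  qed
  show ?thesis
    by (rule that[OF _ AB BA], rule SO'_I[OF Q B _ dB BQ img]) auto
qed

lemma carrier_Isom_plus [simp]: "carrier (Isom_plus d) = SO' (signature_mat d 1) UNIV"
  by (simp add: Isom_plus_def mat_group_def)

lemma mult_Isom_plus [simp]: "x \<otimes>\<^bsub>Isom_plus d\<^esub> y = x * y"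
  by (simp add: Isom_plus_def mat_group_def)

lemma one_Isom_plus [simp]: "\<one>\<^bsub>Isom_plus d\<^esub> = 1\<^sub>m (d + 1)"
  by (simp add: Isom_plus_def mat_group_def)

lemma Isom_plus_carrier_mat: "x \<in> SO' (signature_mat d 1) R \<Longrightarrow> x \<in> carrier_mat (d + 1) (d + 1)"
  using SO'_D(1) signature_mat_carrier by blast

lemma group_Isom_plus: "group (Isom_plus d)"
proof (rule groupI; unfold carrier_Isom_plus mult_Isom_plus one_Isom_plus)
  note J = signature_mat_carrier[of d 1]
  let ?S = "SO' (signature_mat d 1) UNIV"
  fix x assume x: "x \<in> ?S"
  note xc = Isom_plus_carrier_mat[OF x]
  show "1\<^sub>m (d + 1) * x = x" by (rule left_mult_one_mat[OF xc])
  obtain y where "y \<in> ?S" "x * y = 1\<^sub>m (d + 1)" "y * x = 1\<^sub>m (d + 1)" by (rule SO'_inverse[OF J x])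
  then show "\<exists>y\<in>?S. y * x = 1\<^sub>m (d + 1)" by blast
  fix y assume y: "y \<in> ?S"
  note yc = Isom_plus_carrier_mat[OF y]
  show "x * y \<in> ?S" by (rule SO'_mult[OF J _ _ x y]) auto
  fix z assume z: "z \<in> ?S"
  show "x * y * z = x * (y * z)" by (rule assoc_mult_mat[OF xc yc Isom_plus_carrier_mat[OF z]])
qed (rule SO'_one[OF signature_mat_carrier], auto)

section \<open>Powers and subgroups of finite index\<close>

lemma pow_mat_add:
  assumes "x \<in> carrier_mat n n"
  shows "x ^\<^sub>m (i + j) = x ^\<^sub>m i * x ^\<^sub>m j"
proof (induction j)
  case 0
  show ?case using assms by (simp add: right_mult_one_mat[of _ n n])
next
  case (Suc j)
  then show ?case using assms by (simp add: assoc_mult_mat[of _ n n _ n _ n])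
qed

text \<open>Two powers x^i and x^j with i < j give the same coset of S; as 1 is in S, this means x^j
  = s x^i with s in S, and x^(j - i) = s.\<close>

lemma power_in_finite_index:
  fixes H S :: "real mat set"
  assumes fin: "finite (rcosets\<^bsub>(Isom_plus d)\<lparr>carrier := H\<rparr>\<^esub> S)"
    and one: "1\<^sub>m (d + 1) \<in> S" and S: "S \<subseteq> carrier_mat (d + 1) (d + 1)"
    and x: "x \<in> carrier_mat (d + 1) (d + 1)" "xi \<in> carrier_mat (d + 1) (d + 1)"
        "x * xi = 1\<^sub>m (d + 1)"
    and pow: "\<And>k. x ^\<^sub>m k \<in> H"
  shows "\<exists>k\<ge>1. x ^\<^sub>m k \<in> S"
proof -
  define n where "n = d + 1"
  have x': "x \<in> carrier_mat n n" "xi \<in> carrier_mat n n" "x * xi = 1\<^sub>m n" and one': "1\<^sub>m n \<in> S"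
    and S': "S \<subseteq> carrier_mat n n"
    using x one S by (simp_all add: n_def)
  define c where "c = (\<lambda>k. S #>\<^bsub>(Isom_plus d)\<lparr>carrier := H\<rparr>\<^esub> (x ^\<^sub>m k))"
  have c: "c k = (\<lambda>s. s * x ^\<^sub>m k) ` S" for k
    by (auto simp: c_def r_coset_def)
  have "range c \<subseteq> rcosets\<^bsub>(Isom_plus d)\<lparr>carrier := H\<rparr>\<^esub> S"
    using pow by (auto simp: c_def RCOSETS_def)
  then have "finite (range c)" using fin finite_subset by blast
  then have "\<not> inj c" using finite_imageD[of c UNIV] infinite_UNIV_nat by blast
  then obtain i j where ij: "i < j" "c i = c j" by (metis linorder_inj_onI')
  have pc: "x ^\<^sub>m k \<in> carrier_mat n n" for k using x' by simp
  have "x ^\<^sub>m j = 1\<^sub>m n * x ^\<^sub>m j" using left_mult_one_mat[OF pc] by simp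
  then have "x ^\<^sub>m j \<in> c j" unfolding c using one' by (intro image_eqI)
  then have "x ^\<^sub>m j \<in> c i" by (simp only: ij(2))
  then obtain s where s: "s \<in> S" "x ^\<^sub>m j = s * x ^\<^sub>m i" by (auto simp: c)
  have sc: "s \<in> carrier_mat n n" using s S' by blast
  have inv: "x ^\<^sub>m k * xi ^\<^sub>m k = 1\<^sub>m n" for k
  proof (induction k)
    case 0
    then show ?case using x' by simp
  next
    case (Suc k)
    have xis: "xi ^\<^sub>m Suc k = xi * xi ^\<^sub>m k"
      using pow_mat_add[of xi n 1 k] x'(2) by (simp add: left_mult_one_mat[of _ n n])
    have "x ^\<^sub>m Suc k * xi ^\<^sub>m Suc k = x ^\<^sub>m k * x * (xi * xi ^\<^sub>m k)" unfolding xis by simp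
    also have "\<dots> = x ^\<^sub>m k * (x * xi) * xi ^\<^sub>m k"
      using x'(1,2) by (simp add: assoc_mult_mat[of _ n n _ n _ n])
    also have "\<dots> = 1\<^sub>m n" using x' pc Suc by simp
    finally show ?case .
  qed
  have "x ^\<^sub>m (j - i) = x ^\<^sub>m (j - i) * (x ^\<^sub>m i * xi ^\<^sub>m i)" using right_mult_one_mat[OF pc]
      by (simp add: inv)
  also have "\<dots> = x ^\<^sub>m ((j - i) + i) * xi ^\<^sub>m i"
    using x'(1,2) by (simp add: pow_mat_add[of _ n] assoc_mult_mat[of _ n n _ n _ n])
  also have "\<dots> = s * (x ^\<^sub>m i * xi ^\<^sub>m i)"
    using ij(1) s(2) x'(1,2) sc by (simp add: assoc_mult_mat[of _ n n _ n _ n])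
  also have "\<dots> = s" using sc by (simp add: inv)
  finally have "x ^\<^sub>m (j - i) \<in> S" using s(1) by simp
  then show ?thesis using ij(1) by (intro exI[of _ "j - i"]) auto
qed

section \<open>From an admissible form to the locale \<open>adm\<close>\<close>

lemma det_signature_mat: "det (signature_mat p m) \<noteq> 0"
proof -
  let ?J = "signature_mat p m"
  have "upper_triangular ?J" by (auto simp: upper_triangular_def signature_mat_def)
  then have "det ?J = prod_list (diag_mat ?J)"
      by (rule det_upper_triangular) (rule signature_mat_carrier)
  moreover have "0 \<notin> set (diag_mat ?J)" by (auto simp: diag_mat_def signature_mat_def)
  ultimately show ?thesis by (simp add: prod_list_zero_iff)
qed

lemma rational_approximation:
  fixes v :: "nat \<Rightarrow> real"
  obtains r :: "nat \<Rightarrow> nat \<Rightarrow> rat" where "\<And>i. (\<lambda>k. of_rat (r k i)) \<longlonglongrightarrow> v i"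
proof -
  have *: "\<exists>q :: rat. v i < of_rat q \<and> of_rat q < v i + inverse (real (Suc k))" for i k
    by (rule of_rat_dense) simp
  define r where "r = (\<lambda>k i. SOME q :: rat. v i < of_rat q \<and> of_rat q < v i + inverse
      (real (Suc k)))"
  have r: "v i < of_rat (r k i)" "of_rat (r k i) < v i + inverse (real (Suc k))" for k i
    using someI_ex[OF *[of i k]] by (auto simp: r_def)
  have "(\<lambda>k. of_rat (r k i)) \<longlonglongrightarrow> v i" for i
  proof (rule tendsto_sandwich)
    show "(\<lambda>k. v i) \<longlonglongrightarrow> v i" by simp
    show "(\<lambda>k. v i + inverse (real (Suc k))) \<longlonglongrightarrow> v i"
      using tendsto_add[OF tendsto_const[of "v i"] LIMSEQ_inverse_real_of_nat] by simp
  qed (use r in \<open>auto intro!: always_eventually less_imp_le\<close>)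
  then show ?thesis by (rule that)
qed

text \<open>The form is compared with the Minkowski form through P. A timelike vector over K is
  found among the rational vectors close to the image of the last unit vector under P. The embedding
  that sends t to y is not the identity because it moves t.\<close>

lemma adm_if_admissible:
  assumes adm: "admissible d K Q" and d: "d \<ge> 3"
  shows "\<exists>t m. adm K t m (d + 1) Q"
proof -
  define n where "n = d + 1"
  define J where "J = signature_mat d 1"
  have QQ: "Q \<in> carrier_mat n n" "Q\<^sup>T = Q" "elements_mat Q \<subseteq> K"
      and K: "real_number_field K" "totally_real K"
    and pd: "\<And>\<sigma> :: real \<Rightarrow> real. field_embedding K \<sigma> \<Longrightarrow> (\<exists>x\<in>K. \<sigma> x \<noteq> x) \<Longrightarrow> pos_def (map_mat \<sigma> Q)"
    using adm by (auto simp: admissible_def n_def)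
  have J: "J \<in> carrier_mat n n" using signature_mat_carrier[of d 1] by (simp add: J_def n_def)
  obtain P where P: "P \<in> carrier_mat n n" "invertible_mat P" "P\<^sup>T * Q * P = J"
    using adm by (auto simp: admissible_def has_signature_def n_def J_def)
  obtain P' where PP: "inverts_mat P P'" "inverts_mat P' P" using P(2)
      by (auto simp: invertible_mat_def)
  have PP1: "P * P' = 1\<^sub>m n" using PP(1) P(1) by (simp add: inverts_mat_def)
  have P'c: "P' \<in> carrier_mat n n"
  proof
    have "dim_col (P * P') = n" using PP1 by simp
    then show "dim_col P' = n" by simp
    have "P' * P = 1\<^sub>m (dim_row P')" using PP(2) by (simp add: inverts_mat_def)
    then have "dim_col (P' * P) = dim_row P'" by simp
    then show "dim_row P' = n" using P(1) by simp
  qed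
  obtain t m where tm: "tr_field K t m" using tr_field_exists[OF K] by blast
  interpret tr_field K t m by (rule tm)
  interpret quad n Q by unfold_locales (rule QQ(1), rule QQ(2))
  have bl_J: "bl a b = minkowski d (P' *\<^sub>v vec n a) (P' *\<^sub>v vec n b)" for a b
  proof -
    define x y where xy: "x = P' *\<^sub>v vec n a" "y = P' *\<^sub>v vec n b"
    have c: "x \<in> carrier_vec n" "y \<in> carrier_vec n" using P'c by (simp_all add: xy)
    have Px: "P *\<^sub>v x = vec n a" "P *\<^sub>v y = vec n b"
      unfolding xy using assoc_mult_mat_vec[OF P(1) P'c] PP1 by simp_all
    have "minkowski d x y = x \<bullet> (P\<^sup>T * Q * P *\<^sub>v y)" by (simp only: minkowski_def P(3) J_def)
    also have "P\<^sup>T * Q * P *\<^sub>v y = P\<^sup>T *\<^sub>v (Q *\<^sub>v (P *\<^sub>v y))"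
      using P(1) QQ(1) c by (simp add: assoc_mult_mat_vec[of _ n n _ n])
    also have "x \<bullet> \<dots> = (P *\<^sub>v x) \<bullet> (Q *\<^sub>v (P *\<^sub>v y))"
      using transpose_vec_mult_scalar[OF P(1) c(1), of "Q *\<^sub>v (P *\<^sub>v y)"] P(1) QQ(1) c
      by (simp add: comm_scalar_prod[of _ n])
    also have "\<dots> = bl a b" unfolding Px using QQ(1)
      by (simp add: bl_def ip_def Qf_def scalar_prod_def atLeast0LessThan)
    finally show ?thesis by (simp add: xy)
  qed
  have "adm K t m n Q"
  proof unfold_locales
    show "elements_mat Q \<subseteq> K" by (rule QQ(3))
    show "n \<ge> 3" using d by (simp add: n_def)
    have "det J = det P * det Q * det P"
      unfolding P(3)[symmetric] using P(1) QQ(1) by (simp add: det_mult[of _ n] det_transpose)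
    then show "det Q \<noteq> 0" using det_signature_mat by (auto simp: J_def)
    show "bl b b > 0" if ab: "bl a a < 0" "bl a b = 0" "\<exists>i<n. b i \<noteq> 0" for a b
    proof -
      define x y where xy: "x = P' *\<^sub>v vec n a" "y = P' *\<^sub>v vec n b"
      have c: "x \<in> carrier_vec (d + 1)" "y \<in> carrier_vec (d + 1)" using P'c
          by (simp_all add: xy n_def)
      have "P *\<^sub>v y = vec n b" unfolding xy using assoc_mult_mat_vec[OF P(1) P'c] PP1 by simp
      moreover have "P *\<^sub>v 0\<^sub>v n = 0\<^sub>v n" using P(1) by (intro eq_vecI) auto
      ultimately have "vec n b = 0\<^sub>v n" if "y = 0\<^sub>v n" using that by simp
      moreover have "vec n b \<noteq> 0\<^sub>v n"
      proof
        assume 0: "vec n b = 0\<^sub>v n"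
        obtain i where i: "i < n" "b i \<noteq> 0" using ab(3) by blast
        then show False using arg_cong[OF 0, of "\<lambda>u. u $ i"] by simp
      qed
      ultimately have "y \<noteq> 0\<^sub>v n" by blast
      have "\<exists>i\<le>d. y $ i \<noteq> 0"
      proof (rule ccontr)
        assume "\<not> ?thesis"
        then have "y = 0\<^sub>v n" using c(2) by (intro eq_vecI) (auto simp: n_def)
        then show False using \<open>y \<noteq> 0\<^sub>v n\<close> by simp
      qed
      then have "y $ d * y $ d < (\<Sum>i<d. y $ i * y $ i)"
        using lorentz_orthogonal[where d = d and x = "\<lambda>i. x $ i" and y = "\<lambda>i. y $ i"] ab(1,2) c
        by (simp add: bl_J xy[symmetric] minkowski_sum)
      then show ?thesis using c by (simp add: bl_J xy[symmetric] minkowski_sum)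
    qed
    show "\<exists>a. (\<forall>i. a i \<in> K) \<and> bl a a < 0"
    proof -
      define v where "v = (\<lambda>i. if i < n then (P *\<^sub>v unit_vec n d) $ i else 0)"
      obtain r :: "nat \<Rightarrow> nat \<Rightarrow> rat" where r: "\<And>i. (\<lambda>k. of_rat (r k i)) \<longlonglongrightarrow> v i"
        using rational_approximation[of v] by blast
      have P'v: "P' *\<^sub>v vec n v = unit_vec n d"
      proof -
        have "vec n v = P *\<^sub>v unit_vec n d" using P(1) by (intro eq_vecI) (auto simp: v_def)
        moreover have "P' * P = 1\<^sub>m n" using PP(2) P'c by (simp add: inverts_mat_def)
        ultimately show ?thesis using assoc_mult_mat_vec[OF P'c P(1), of "unit_vec n d"] by simp
      qed
      have "bl v v = - 1"
        unfolding bl_J P'v using minkowski_sum[of "unit_vec n d" d "unit_vec n d"]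
            by (simp add: n_def unit_vec_def)
      moreover have "(\<lambda>k. bl (\<lambda>i. of_rat (r k i)) (\<lambda>i. of_rat (r k i))) \<longlonglongrightarrow> bl v v"
        unfolding bl_def ip_def Qf_def by (intro tendsto_intros r)
      ultimately have lim: "(\<lambda>k. bl (\<lambda>i. of_rat (r k i)) (\<lambda>i. of_rat (r k i))) \<longlonglongrightarrow> - 1" by simp
      have "\<forall>\<^sub>F k in sequentially. bl (\<lambda>i. of_rat (r k i)) (\<lambda>i. of_rat (r k i)) < 0"
        by (rule order_tendstoD(2)[OF lim]) simp
      then obtain k where "bl (\<lambda>i. of_rat (r k i)) (\<lambda>i. of_rat (r k i)) < 0"
        using eventually_happens'[OF sequentially_bot] by blast
      then show ?thesis using subfield_set_of_rat[OF sub]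
          by (intro exI[of _ "\<lambda>i. of_rat (r k i)"]) simp
    qed
    show "pos_def (map_mat (conj_emb t y) Q)" if y: "reval m y = 0" "y \<noteq> t" for y
    proof (rule pd)
      show "field_embedding K (conj_emb t y)" unfolding K
          by (rule field_embedding_conj_emb[OF m y(1)])
      have "conj_emb t y t = y" using conj_emb_reval[OF m y(1), of "[:0, 1:]"] by simp
      then show "\<exists>x\<in>K. conj_emb t y x \<noteq> x" using y(2) adjoin_self[of t] K
          by (intro bexI[of _ t]) auto
    qed
  qed
  then show ?thesis by (auto simp: n_def)
qed

section \<open>Change of basis and the commensurator property\<close>

lemma pow_mat_conj:
  assumes "X \<in> carrier_mat n n" "Y \<in> carrier_mat n n" "A \<in> carrier_mat n n" "X * Y = 1\<^sub>m n"
      "Y * X = 1\<^sub>m n"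
  shows "(Y * A * X) ^\<^sub>m k = Y * A ^\<^sub>m k * X"
proof (induction k)
  case 0
  show ?case using assms by (simp add: right_mult_one_mat[of _ n n])
next
  case (Suc k)
  define Z where "Z = A ^\<^sub>m k"
  have Z: "Z \<in> carrier_mat n n" using assms(3) by (simp add: Z_def)
  have "(Y * A * X) ^\<^sub>m Suc k = Y * Z * (X * Y) * A * X"
    unfolding pow_mat.simps Suc Z_def[symmetric] using assms(1,2,3) Z
        by (simp add: assoc_mult_mat[of _ n n _ n _ n])
  also have "\<dots> = Y * A ^\<^sub>m Suc k * X"
    using assms Z by (simp add: assoc_mult_mat[of _ n n _ n _ n] left_mult_one_mat[of _ n n]
        flip: Z_def)
  finally show ?case .
qed

lemma pow_mat_mult:
  assumes "x \<in> carrier_mat n n"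
  shows "(x ^\<^sub>m i) ^\<^sub>m j = x ^\<^sub>m (i * j)"
proof (induction j)
  case 0
  show ?case using assms by simp
next
  case (Suc j)
  have "x ^\<^sub>m (i * Suc j) = x ^\<^sub>m (i * j) * x ^\<^sub>m i"
    using pow_mat_add[OF assms, of "i * j" i] by (simp add: add.commute)
  then show ?case by (simp add: Suc)
qed

lemma SO'_pow:
  assumes Q: "Q \<in> carrier_mat n n"
    and R: "0 \<in> R" "1 \<in> R" "\<And>x y. x \<in> R \<Longrightarrow> y \<in> R \<Longrightarrow> x + y \<in> R \<and> x * y \<in> R"
    and A: "A \<in> SO' Q R"
  shows "A ^\<^sub>m k \<in> SO' Q R"
proof (induction k)
  case 0
  then show ?case using SO'_one[OF Q R(1,2)] SO'_D(1)[OF A Q] by simp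
next
  case (Suc k)
  then show ?case using SO'_mult[OF Q R(1,3) _ A] by simp
qed

lemma isometry_change_of_basis:
  assumes c: "Q \<in> carrier_mat n n" "P \<in> carrier_mat n n" "P' \<in> carrier_mat n n"
      "g \<in> carrier_mat n n"
    and PP: "P * P' = 1\<^sub>m n" and J: "P\<^sup>T * Q * P = J" and g: "g\<^sup>T * J * g = J"
  shows "(P * g * P')\<^sup>T * Q * (P * g * P') = (Q :: real mat)"
proof -
  have "(P * g * P')\<^sup>T * Q * (P * g * P') = P'\<^sup>T * (g\<^sup>T * (P\<^sup>T * Q * P) * g) * P'"
    using c by (simp add: transpose_mult[of _ n n _ n] assoc_mult_mat[of _ n n _ n _ n])
  also have "\<dots> = P'\<^sup>T * (P\<^sup>T * Q * P) * P'" by (simp only: J g)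
  also have "\<dots> = (P * P')\<^sup>T * Q * (P * P')"
    using c by (simp add: transpose_mult[of _ n n _ n] assoc_mult_mat[of _ n n _ n _ n])
  also have "\<dots> = Q" using c PP by simp
  finally show ?thesis .
qed

text \<open>G is the element g moved into the coordinates of Q, by the conjugator h and the basis
  change P. Finite index is used on both sides: powers of integral isometries fall into the
  conjugated lattice, and powers of its elements are integral.\<close>

lemma arithmetic_square:
  assumes ar: "arithmetic_simplest_type d \<Gamma>" and d: "d \<ge> 3" and g: "g \<in> \<Gamma>"
  shows "\<exists>K t m Q G k. adm K t m (d + 1) Q \<and> similar_mat G g \<and> G \<in> carrier_mat (d + 1) (d + 1) \<and>
    G\<^sup>T * Q * G = Q \<and> elements_mat (G * G) \<subseteq> K \<and> k \<ge> 1 \<and>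
    elements_mat ((G * G) ^\<^sub>m k) \<subseteq> {x. algebraic_int x}"
proof -
  define n where "n = d + 1"
  define J where "J = signature_mat d 1"
  define S0 where "S0 = SO' J UNIV"
  obtain K Q P P' h where sub: "subgroup \<Gamma> (Isom_plus d)" and admi: "admissible d K Q"
    and st: "standardizes d Q P P'" and h: "h \<in> carrier (Isom_plus d)"
    and cm: "commensurable (Isom_plus d)
             ((\<lambda>g. h \<otimes>\<^bsub>Isom_plus d\<^esub> g \<otimes>\<^bsub>Isom_plus d\<^esub> inv\<^bsub>Isom_plus d\<^esub> h) ` \<Gamma>)
             ((\<lambda>A. P' * A * P) ` SO' Q (ring_of_integers K))"
    using ar unfolding arithmetic_simplest_type_def by blast
  obtain t m where "adm K t m n Q" using adm_if_admissible[OF admi d] by (auto simp: n_def)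
  then interpret A: adm K t m n Q .
  interpret I: group "Isom_plus d" by (rule group_Isom_plus)
  interpret \<Gamma>: subgroup \<Gamma> "Isom_plus d" by (rule sub)
  have J: "J \<in> carrier_mat n n" using signature_mat_carrier[of d 1] by (simp add: J_def n_def)
  have S0: "carrier (Isom_plus d) = S0" by (simp add: S0_def J_def)
  have S0c: "x \<in> carrier_mat n n" if "x \<in> S0" for x using SO'_D(1)[OF _ J] that
      by (simp add: S0_def)
  have one: "\<one>\<^bsub>Isom_plus d\<^esub> = 1\<^sub>m n" by (simp add: n_def)
  define hi where "hi = inv\<^bsub>Isom_plus d\<^esub> h"
  have hS: "h \<in> S0" "hi \<in> S0" using h I.inv_closed[OF h] by (simp_all only: S0 hi_def)
  have hh: "h * hi = 1\<^sub>m n" "hi * h = 1\<^sub>m n" using I.r_inv[OF h] I.l_inv[OF h]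
      by (simp_all add: hi_def n_def)
  note hc = S0c[OF hS(1)] S0c[OF hS(2)]
  have \<Gamma>S: "\<Gamma> \<subseteq> S0" using \<Gamma>.subset by (simp only: S0)
  define O' where "O' = ring_of_integers K"
  define H where "H = (\<lambda>g. h * g * hi) ` \<Gamma>"
  define L where "L = (\<lambda>A. P' * A * P) ` SO' Q O'"
  have Ofin: "0 \<in> O'" "1 \<in> O'" "\<And>x y. x \<in> O' \<Longrightarrow> y \<in> O' \<Longrightarrow> x + y \<in> O' \<and> x * y \<in> O'"
    using subfield_setD[OF A.sub] by (auto simp: O'_def ring_of_integers_def intro:
        algebraic_int_plus algebraic_int_times)
  have fin: "finite (rcosets\<^bsub>(Isom_plus d)\<lparr>carrier := H\<rparr>\<^esub> (H \<inter> L))"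
    "finite (rcosets\<^bsub>(Isom_plus d)\<lparr>carrier := L\<rparr>\<^esub> (H \<inter> L))"
    using cm by (simp_all add: commensurable_def H_def L_def O'_def hi_def)
  have P: "P \<in> carrier_mat n n" "P' \<in> carrier_mat n n" "P * P' = 1\<^sub>m n" "P' * P = 1\<^sub>m n"
      "P\<^sup>T * Q * P = J"
    using st by (auto simp: standardizes_def n_def J_def inverts_mat_def)
  have HS: "H \<subseteq> S0"
  proof
    fix x assume "x \<in> H"
    then obtain a where a: "a \<in> \<Gamma>" "x = h * a * hi" by (auto simp: H_def)
    have "h \<otimes>\<^bsub>Isom_plus d\<^esub> a \<otimes>\<^bsub>Isom_plus d\<^esub> hi \<in> carrier (Isom_plus d)"
      using a \<Gamma>S hS by (intro I.m_closed) (auto simp only: S0)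
    then show "x \<in> S0" using a by (simp only: S0 mult_Isom_plus)
  qed
  have H1: "1\<^sub>m n \<in> H"
  proof -
    have "1\<^sub>m n = h * 1\<^sub>m n * hi" using hc hh by simp
    moreover have "1\<^sub>m n \<in> \<Gamma>" using \<Gamma>.one_closed by (simp only: one)
    ultimately show ?thesis by (auto simp: H_def)
  qed
  have Hm: "x * y \<in> H" if xy: "x \<in> H" "y \<in> H" for x y
  proof -
    obtain a b where ab: "a \<in> \<Gamma>" "b \<in> \<Gamma>" "x = h * a * hi" "y = h * b * hi" using xy
        by (auto simp: H_def)
    have c: "a \<in> carrier_mat n n" "b \<in> carrier_mat n n" using ab \<Gamma>S S0c by auto
    have "x * y = h * a * (hi * h) * b * hi"
      unfolding ab using c hc by (simp add: assoc_mult_mat[of _ n n _ n _ n])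
    also have "\<dots> = h * (a * b) * hi"
      using c hc hh by (simp add: assoc_mult_mat[of _ n n _ n _ n] left_mult_one_mat[of _ n n])
    finally show ?thesis using \<Gamma>.m_closed[OF ab(1,2)] by (auto simp: H_def)
  qed
  have Hpow: "x ^\<^sub>m k \<in> H" if "x \<in> H" for x k
  proof (induction k)
    case 0
    then show ?case using H1 S0c HS that by auto
  next
    case (Suc k)
    then show ?case using Hm[OF _ that] by simp
  qed
  have L1: "1\<^sub>m n \<in> L"
  proof -
    have "1\<^sub>m n = P' * 1\<^sub>m n * P" using P by simp
    moreover have "1\<^sub>m n \<in> SO' Q O'" by (rule SO'_one[OF A.Q Ofin(1,2)])
    ultimately show ?thesis by (auto simp: L_def)
  qed
  have LD: "P * x * P' \<in> SO' Q O'" if x: "x \<in> L" for x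
  proof -
    obtain B where B: "B \<in> SO' Q O'" "x = P' * B * P" using x by (auto simp: L_def)
    have Bc: "B \<in> carrier_mat n n" by (rule SO'_D(1)[OF B(1) A.Q])
    have "P * x * P' = (P * P') * B * (P * P')"
      unfolding B(2) using Bc P(1,2) by (simp add: assoc_mult_mat[of _ n n _ n _ n])
    then show ?thesis using B(1) Bc P by simp
  qed
  have HLc: "H \<inter> L \<subseteq> carrier_mat (d + 1) (d + 1)" and HL1: "1\<^sub>m (d + 1) \<in> H \<inter> L"
    using HS S0c H1 L1 by (auto simp: n_def)
  have powHL: "\<exists>k\<ge>1. x ^\<^sub>m k \<in> H \<inter> L" if x: "x \<in> H" for x
  proof -
    obtain xi where xi: "xi \<in> SO' J UNIV" "x * xi = 1\<^sub>m n" "xi * x = 1\<^sub>m n"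
      using SO'_inverse[OF J, of x] x HS by (auto simp: S0_def)
    have c: "x \<in> carrier_mat n n" "xi \<in> carrier_mat n n" using S0c HS x xi(1) by (auto simp: S0_def)
    show ?thesis
      by (rule power_in_finite_index[OF fin(1) HL1 HLc c[unfolded n_def] xi(2)[unfolded n_def]
          Hpow[OF x]])
  qed
  define g1 where "g1 = h * g * hi"
  define gi where "gi = inv\<^bsub>Isom_plus d\<^esub> g"
  define g1i where "g1i = h * gi * hi"
  have gS: "g \<in> S0" using g \<Gamma>S by blast
  have giG: "gi \<in> \<Gamma>" unfolding gi_def by (rule \<Gamma>.m_inv_closed[OF g])
  have gc: "g \<in> carrier_mat n n" "gi \<in> carrier_mat n n" using gS giG \<Gamma>S S0c by auto
  have gg: "g * gi = 1\<^sub>m n" "gi * g = 1\<^sub>m n"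
    using I.r_inv[of g] I.l_inv[of g] gS by (simp_all add: gi_def n_def S0_def J_def)
  have g1H: "g1 \<in> H" "g1i \<in> H" using g giG by (auto simp: g1_def g1i_def H_def)
  have g1c: "g1 \<in> carrier_mat n n" "g1i \<in> carrier_mat n n" using g1H HS S0c by auto
  have conj1: "(X * a * Y) * (X * b * Y) = 1\<^sub>m n"
    if "X \<in> carrier_mat n n" "Y \<in> carrier_mat n n" "a \<in> carrier_mat n n" "b \<in> carrier_mat n n"
      "X * Y = 1\<^sub>m n" "Y * X = 1\<^sub>m n" "a * b = 1\<^sub>m n" for X Y a b :: "real mat"
  proof -
    have "(X * a * Y) * (X * b * Y) = X * a * (Y * X) * b * Y"
      using that(1-4) by (simp add: assoc_mult_mat[of _ n n _ n _ n])
    also have "\<dots> = X * (a * b) * Y"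
      using that(1-4,6) by (simp add: assoc_mult_mat[of _ n n _ n _ n] left_mult_one_mat[of _ n n])
    also have "\<dots> = 1\<^sub>m n" using that by simp
    finally show ?thesis .
  qed
  have g11: "g1 * g1i = 1\<^sub>m n" "g1i * g1 = 1\<^sub>m n"
    unfolding g1_def g1i_def using conj1[OF hc gc hh gg(1)] conj1[OF hc gc(2,1) hh gg(2)] by auto
  define G where "G = P * g1 * P'"
  define Gi where "Gi = P * g1i * P'"
  have Gc: "G \<in> carrier_mat n n" "Gi \<in> carrier_mat n n" using P g1c by (auto simp: G_def Gi_def)
  have GG: "G * Gi = 1\<^sub>m n" "Gi * G = 1\<^sub>m n"
    unfolding G_def Gi_def using conj1[OF P(1,2) g1c P(3,4) g11(1)] conj1[OF P(1,2) g1c(2,1)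
        P(3,4) g11(2)] by auto
  have iso: "G\<^sup>T * Q * G = Q"
    unfolding G_def
  proof (rule isometry_change_of_basis[OF A.Q P(1,2) g1c(1) P(3,5)])
    show "g1\<^sup>T * J * g1 = J" using SO'_D(4)[OF _ J] g1H HS by (auto simp: S0_def)
  qed
  \<comment> \<open>In the coordinates of Q, some power of \<eta> lies in the conjugate of \<Gamma>;
    its conjugate by G stays there because G belongs to this group, and a further power is
    integral.\<close>
  have comm: "\<exists>k\<ge>1. elements_mat (G * (\<eta> ^\<^sub>m k) * Gi) \<subseteq> K" if \<eta>: "\<eta> \<in> SO' Q (ring_of_integers K)"
      for \<eta>
  proof -
    have \<eta>': "\<eta> \<in> SO' Q O'" using \<eta> by (simp add: O'_def)
    have \<eta>c: "\<eta> \<in> carrier_mat n n" by (rule SO'_D(1)[OF \<eta> A.Q])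
    have "\<eta> \<in> SO' Q UNIV" using \<eta> by (auto simp: SO'_def SO_def)
    then obtain \<eta>i where "\<eta>i \<in> SO' Q UNIV" and \<eta>i: "\<eta> * \<eta>i = 1\<^sub>m n" by (rule SO'_inverse[OF A.Q])
    then have \<eta>ic: "\<eta>i \<in> carrier_mat n n" using SO'_D(1)[OF _ A.Q] by blast
    define x where "x = P' * \<eta> * P"
    define xi where "xi = P' * \<eta>i * P"
    have xc: "x \<in> carrier_mat n n" "xi \<in> carrier_mat n n" using P \<eta>c \<eta>ic
        by (auto simp: x_def xi_def)
    have xxi: "x * xi = 1\<^sub>m n" unfolding x_def xi_def by (rule conj1[OF P(2,1) \<eta>c \<eta>ic P(4,3) \<eta>i])
    have xpow: "x ^\<^sub>m k = P' * \<eta> ^\<^sub>m k * P" for k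
      unfolding x_def by (rule pow_mat_conj[OF P(1,2) \<eta>c P(3,4)])
    have "x ^\<^sub>m k \<in> L" for k
      unfolding xpow L_def using SO'_pow[OF A.Q Ofin \<eta>'] by blast
    then obtain k where k: "k \<ge> 1" "x ^\<^sub>m k \<in> H"
      using power_in_finite_index[OF fin(2) HL1 HLc xc[unfolded n_def] xxi[unfolded n_def]] by blast
    define y where "y = g1 * x ^\<^sub>m k * g1i"
    have "y \<in> H" unfolding y_def by (intro Hm g1H k)
    then obtain j where j: "j \<ge> 1" "y ^\<^sub>m j \<in> L" using powHL by blast
    have xkc: "x ^\<^sub>m k \<in> carrier_mat n n" using xc by simp
    have \<eta>kc: "\<eta> ^\<^sub>m (k * j) \<in> carrier_mat n n" using \<eta>c by simp
    have "y ^\<^sub>m j = g1 * (x ^\<^sub>m k) ^\<^sub>m j * g1i"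
      unfolding y_def by (rule pow_mat_conj[OF g1c(2,1) xkc g11(2,1)])
    also have "(x ^\<^sub>m k) ^\<^sub>m j = x ^\<^sub>m (k * j)" by (rule pow_mat_mult[OF xc(1)])
    also have "x ^\<^sub>m (k * j) = P' * \<eta> ^\<^sub>m (k * j) * P" by (rule xpow)
    finally have "P * y ^\<^sub>m j * P' = P * (g1 * (P' * \<eta> ^\<^sub>m (k * j) * P) * g1i) * P'" by simp
    then have "P * y ^\<^sub>m j * P' = G * \<eta> ^\<^sub>m (k * j) * Gi"
      using P(1,2) g1c \<eta>kc by (simp add: G_def Gi_def assoc_mult_mat[of _ n n _ n _ n])
    then have "elements_mat (G * \<eta> ^\<^sub>m (k * j) * Gi) \<subseteq> O'" using SO'_D(2)[OF LD[OF j(2)] A.Q] by simp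
    then have "elements_mat (G * \<eta> ^\<^sub>m (k * j) * Gi) \<subseteq> K" by (auto simp: O'_def ring_of_integers_def)
    moreover have "k * j \<ge> 1" using k(1) j(1) by simp
    ultimately show ?thesis by blast
  qed
  have sq: "G * G \<in> A.KM" by (rule A.square_of_commensurator[OF Gc GG iso comm])
  obtain k where k: "k \<ge> 1" "g1 ^\<^sub>m k \<in> L" using powHL[OF g1H(1)] by blast
  have "G ^\<^sub>m k = P * g1 ^\<^sub>m k * P'" unfolding G_def by (rule pow_mat_conj[OF P(2,1) g1c(1) P(4,3)])
  then have Gk: "G ^\<^sub>m k \<in> SO' Q O'" using LD[OF k(2)] by simp
  have G2: "G * G = G ^\<^sub>m 2" using Gc by (simp add: numeral_2_eq_2 left_mult_one_mat[of _ n n])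
  have "(G * G) ^\<^sub>m k = G ^\<^sub>m k * G ^\<^sub>m k"
    unfolding G2 pow_mat_mult[OF Gc(1)] using pow_mat_add[OF Gc(1), of k k] by (simp add: mult_2)
  then have "(G * G) ^\<^sub>m k \<in> SO' Q O'" using SO'_mult[OF A.Q Ofin(1,3) Gk Gk] by simp
  then have "elements_mat ((G * G) ^\<^sub>m k) \<subseteq> {x. algebraic_int x}"
    using SO'_D(2)[OF _ A.Q] by (auto simp: O'_def ring_of_integers_def)
  moreover have "elements_mat (G * G) \<subseteq> K" using sq A.KM_iff A.KM_carrier by blast
  moreover have "similar_mat G g"
  proof (rule similar_matI)
    show "{G, g, P * h, hi * P'} \<subseteq> carrier_mat n n" using Gc gc P hc by auto
    have "(P * h) * (hi * P') = P * (h * hi) * P'" using P(1,2) hc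
        by (simp add: assoc_mult_mat[of _ n n _ n _ n])
    then show "(P * h) * (hi * P') = 1\<^sub>m n" using P hh by simp
    have "(hi * P') * (P * h) = hi * (P' * P) * h" using P(1,2) hc
        by (simp add: assoc_mult_mat[of _ n n _ n _ n])
    then show "(hi * P') * (P * h) = 1\<^sub>m n" using P hc hh by simp
    show "G = P * h * g * (hi * P')"
      unfolding G_def g1_def using P(1,2) hc gc by (simp add: assoc_mult_mat[of _ n n _ n _ n])
  qed
  ultimately show ?thesis
    using A.adm_axioms Gc(1) iso k(1) unfolding n_def by blast
qed

section \<open>Eigenvalues of the square and the conclusion\<close>

lemma eigenvalue_square:
  fixes A :: "'a :: field mat"
  assumes A: "A \<in> carrier_mat n n" and z: "eigenvalue A z"
  shows "eigenvalue (A * A) (z * z)"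
proof -
  obtain v where v: "v \<in> carrier_vec n" "v \<noteq> 0\<^sub>v n" "A *\<^sub>v v = z \<cdot>\<^sub>v v"
    using z A by (auto simp: eigenvalue_def eigenvector_def)
  have "A * A *\<^sub>v v = A *\<^sub>v (z \<cdot>\<^sub>v v)" using A v by (simp add: assoc_mult_mat_vec[of _ n n _ n])
  also have "\<dots> = (z * z) \<cdot>\<^sub>v v" using A v by (simp add: mult_mat_vec[of _ n n] smult_smult_assoc)
  finally show ?thesis using A v by (auto simp: eigenvalue_def eigenvector_def)
qed

text \<open>Put u = (A - w) v. Either u = 0 and v is an eigenvector for w, or u is one for - w
  because (A + w) u = 0.\<close>

lemma eigenvalue_square_root:
  fixes A :: "'a :: field mat"
  assumes A: "A \<in> carrier_mat n n" and w: "eigenvalue (A * A) (w * w)"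
  shows "eigenvalue A w \<or> eigenvalue A (- w)"
proof -
  obtain v where v: "v \<in> carrier_vec n" "v \<noteq> 0\<^sub>v n" "A * A *\<^sub>v v = (w * w) \<cdot>\<^sub>v v"
    using w A by (auto simp: eigenvalue_def eigenvector_def)
  define u where "u = A *\<^sub>v v - w \<cdot>\<^sub>v v"
  have u: "u \<in> carrier_vec n" using A v by (simp add: u_def)
  show ?thesis
  proof (cases "u = 0\<^sub>v n")
    case True
    have "A *\<^sub>v v = w \<cdot>\<^sub>v v"
    proof (intro eq_vecI)
      fix i assume i: "i < dim_vec (w \<cdot>\<^sub>v v)"
      then have "u $ i = 0" using True v(1) by simp
      then show "(A *\<^sub>v v) $ i = (w \<cdot>\<^sub>v v) $ i" using i A v(1) by (simp add: u_def)
    qed (use A v in auto)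
    then show ?thesis using A v by (auto simp: eigenvalue_def eigenvector_def)
  next
    case False
    have "A *\<^sub>v u = A *\<^sub>v (A *\<^sub>v v) - A *\<^sub>v (w \<cdot>\<^sub>v v)"
      unfolding u_def using A v(1) by (intro mult_minus_distrib_mat_vec[of _ n n]) auto
    also have "A *\<^sub>v (A *\<^sub>v v) = (w * w) \<cdot>\<^sub>v v"
      using v(3) A v(1) by (simp add: assoc_mult_mat_vec[of _ n n _ n])
    also have "A *\<^sub>v (w \<cdot>\<^sub>v v) = w \<cdot>\<^sub>v (A *\<^sub>v v)" using A v(1) by (rule mult_mat_vec)
    also have "(w * w) \<cdot>\<^sub>v v - w \<cdot>\<^sub>v (A *\<^sub>v v) = (- w) \<cdot>\<^sub>v u"
      using A v(1) by (intro eq_vecI) (auto simp: u_def algebra_simps)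
    finally show ?thesis using A u False by (auto simp: eigenvalue_def eigenvector_def)
  qed
qed

lemma eigenvalue_of_real:
  assumes A: "A \<in> carrier_mat n n"
  shows "eigenvalue (map_mat complex_of_real A) (of_real x) \<longleftrightarrow> eigenvalue A x"
proof -
  have "eigenvalue (map_mat complex_of_real A) (of_real x) \<longleftrightarrow>
      poly (map_poly complex_of_real (char_poly A)) (of_real x) = 0"
    using A by (simp add: eigenvalue_root_char_poly[of _ n] of_real_hom.char_poly_hom[OF A])
  then show ?thesis using A by (simp add: eigenvalue_root_char_poly)
qed

lemma eigenvalue_similar:
  assumes "similar_mat A B" "A \<in> carrier_mat n n" "B \<in> carrier_mat n n"
  shows "eigenvalue (map_mat complex_of_real A) z \<longleftrightarrow> eigenvalue (map_mat complex_of_real B) z"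
  using assms char_poly_similar[OF assms(1)]
  by (simp add: eigenvalue_root_char_poly[of _ n] of_real_hom.char_poly_hom)

lemma pos_def_one: "pos_def (1\<^sub>m n)"
  unfolding pos_def_def
proof (intro ballI impI)
  fix x :: "real vec" assume x: "x \<in> carrier_vec (dim_row (1\<^sub>m n :: real mat))"
      "x \<noteq> 0\<^sub>v (dim_row (1\<^sub>m n :: real mat))"
  then have c: "x \<in> carrier_vec n" "x \<noteq> 0\<^sub>v n" by simp_all
  obtain i where i: "i < n" "x $ i \<noteq> 0"
  proof (rule ccontr)
    assume "\<not> thesis"
    then have "x = 0\<^sub>v n" using c(1) that by (intro eq_vecI) auto
    then show False using c(2) by simp
  qed
  have "x \<bullet> x = (\<Sum>i<n. x $ i * x $ i)" using c(1) by (simp add: scalar_prod_def atLeast0LessThan)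
  also have "\<dots> > 0"
  proof (rule sum_pos2)
    show "0 < x $ i * x $ i" using i(2) by (metis not_real_square_gt_zero)
  qed (use i in auto)
  finally have "x \<bullet> x > 0" .
  then show "x \<bullet> (1\<^sub>m n *\<^sub>v x) > 0" using c by simp
qed

text \<open>G is similar to g, so its eigenvalues are those of A, on the unit circle as A is
  orthogonal, together with \<open>lam\<close> and its inverse. The bound is applied to G * G, with
  largest eigenvalue \<open>lam * lam\<close> in the field of \<open>lam\<close>; hence it speaks of
  the square of \<mu>.\<close>

lemma holonomy_eigenvalue:
  assumes lam: "lam > 1" "minpoly lam h" and d: "d \<ge> 3"
    and ar: "arithmetic_simplest_type d \<Gamma>" "g \<in> \<Gamma>"
        and lox: "loxodromic d g" "translation_length d g = ln lam"
    and A: "holonomy_matrix d g A" "A \<in> orth_mats (d - 1)"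
        and \<mu>: "eigenvalue (map_mat complex_of_real A) \<mu>"
  shows "\<mu> * \<mu> \<in> bounded_roots (d + 1) (degree h) ((1 + lam * lam) ^ (d + 1))"
proof -
  define n where "n = d + 1"
  obtain K t m Q G k where adm: "adm K t m n Q" and sim: "similar_mat G g"
      and G: "G \<in> carrier_mat n n" and
    iso: "G\<^sup>T * Q * G = Q" and GK: "elements_mat (G * G) \<subseteq> K" and k: "k \<ge> 1"
    and int: "elements_mat ((G * G) ^\<^sub>m k) \<subseteq> {x. algebraic_int x}"
    using arithmetic_square[OF ar(1) d ar(2)] unfolding n_def by blast
  interpret adm K t m n Q by (rule adm)
  have g: "g \<in> carrier_mat n n" using sim G by (auto simp: similar_mat_def similar_mat_wit_def
      Let_def)
  have evG: "eigenvalue (map_mat complex_of_real G) z \<longleftrightarrow>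
    eigenvalue (map_mat complex_of_real A) z \<or> z = of_real lam \<or> z = of_real (inverse lam)" for z
    using eigenvalue_holonomy[OF _ g[unfolded n_def] lox(1) A(1) lox(2), of z]
        eigenvalue_similar[OF sim G g] lam(1) d
    by (simp add: exp_minus)
  have le: "cmod z \<le> lam" if "eigenvalue (map_mat complex_of_real G) z" for z
  proof -
    have "inverse lam \<le> 1" using lam(1) by (simp add: inverse_le_1_iff)
    moreover have "cmod z = 1" if "eigenvalue (map_mat complex_of_real A) z"
      using orth_matsD(1,2)[OF A(2)] that
      by (intro pos_def_isometry_eigenvalue[OF _ pos_def_one[of "d - 1"], where A = A]) auto
    ultimately show ?thesis using that lam(1) unfolding evG by (auto simp del: of_real_inverse)
  qed
  have hom: "map_mat complex_of_real (G * G) = map_mat complex_of_real G * map_mat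
      complex_of_real G"
    using G by (intro of_real_hom.mat_hom_mult) auto
  have Gc: "map_mat complex_of_real G \<in> carrier_mat n n" using G by simp
  have GGc: "G * G \<in> carrier_mat n n" using G by simp
  have "\<mu> * \<mu> \<in> bounded_roots n (degree h) ((1 + lam * lam) ^ n)"
  proof (rule eigenvalues_bounded[OF _ _ k, of "G * G"])
    show "G * G \<in> KM" using GK KM_iff[OF GGc] by simp
    have "(G * G)\<^sup>T * Q * (G * G) = G\<^sup>T * (G\<^sup>T * Q * G) * G"
      using G Q by (simp add: transpose_mult[of _ n n _ n] assoc_mult_mat[of _ n n _ n _ n])
    then show "(G * G)\<^sup>T * Q * (G * G) = Q" by (simp only: iso)
    show "algebraic_int (((G * G) ^\<^sub>m k) $$ (i, j))" if "i < n" "j < n" for i j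
      using elements_mat_entry[OF _ that, of "(G * G) ^\<^sub>m k"] GGc int by auto
    have "1 * 1 < lam * lam" using lam(1) by (intro mult_strict_mono) auto
    then show "lam * lam > 1" by simp
    have "eigenvalue G lam" using evG[of "of_real lam"] eigenvalue_of_real[OF G] by simp
    then show "eigenvalue (G * G) (lam * lam)" by (rule eigenvalue_square[OF G])
    \<comment> \<open>One of the two complex square roots of an eigenvalue of G * G is an eigenvalue
      of G.\<close>
    show "cmod z \<le> lam * lam" if z: "eigenvalue (map_mat complex_of_real (G * G)) z" for z
    proof -
      have zz: "csqrt z * csqrt z = z" using power2_csqrt[of z] by (simp add: power2_eq_square)
      then have "cmod (csqrt z) \<le> lam"
        using eigenvalue_square_root[OF Gc, of "csqrt z"] z le[of "csqrt z"] le[of "- csqrt z"]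
            by (auto simp: hom)
      then have "cmod (csqrt z) * cmod (csqrt z) \<le> lam * lam" by (intro mult_mono) (use lam in auto)
      then show ?thesis by (simp only: zz flip: norm_mult)
    qed
    show "minpoly lam h" by (rule lam(2))
    show "lam * lam \<in> adjoin lam"
      using subfield_setD(5)[OF subfield_set_adjoin[OF lam(2)]] adjoin_self by blast
    show "eigenvalue (map_mat complex_of_real (G * G)) (\<mu> * \<mu>)"
      unfolding hom by (rule eigenvalue_square[OF Gc]) (use \<mu> evG in blast)
  qed
  then show ?thesis by (simp add: n_def)
qed

theorem proposition5:
  fixes lam :: real and d :: nat
  assumes "salem lam" and "d \<ge> 3"
  shows "finite {C. \<exists>\<Gamma> g. arithmetic_simplest_type d \<Gamma> \<and> g \<in> \<Gamma> \<and> loxodromic d g \<and>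
                   translation_length d g = ln lam \<and> has_holonomy d g C}"
proof -
  have lam: "lam > 1" "algebraic_int lam" using assms(1) by (auto simp: salem_def)
  obtain p :: "int poly" where p: "poly (map_poly of_int p) lam = 0" "lead_coeff p = 1"
    using lam(2) by (auto simp: algebraic_int_altdef_ipoly)
  have "map_poly rat_of_int p \<noteq> 0" using p(2) by auto
  moreover have "reval (map_poly rat_of_int p) lam = 0" using p(1) by (simp only: reval_of_int_poly)
  ultimately obtain h where h: "minpoly lam h" using minpoly_exists by blast
  \<comment> \<open>R depends only on \<open>lam\<close> and d, through the minimal polynomial h;
    the lattice and its field no longer occur.\<close>
  define R where "R = bounded_roots (d + 1) (degree h) ((1 + lam * lam) ^ (d + 1))"
  \<comment> \<open>Square roots of the elements of R are taken because only the squares of the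
    holonomy eigenvalues are known to lie in R.\<close>
  define E where "E = {\<mu>. \<mu> * \<mu> \<in> R}"
  have "finite R" unfolding R_def using lam(1) by (intro finite_bounded_roots) simp
  moreover have "E \<subseteq> csqrt ` R \<union> (\<lambda>r. - csqrt r) ` R"
  proof
    fix \<mu> assume "\<mu> \<in> E"
    moreover have "\<mu> = csqrt (\<mu> * \<mu>) \<or> \<mu> = - csqrt (\<mu> * \<mu>)"
      using power2_csqrt[of "\<mu> * \<mu>"] power2_eq_iff[of \<mu> "csqrt (\<mu> * \<mu>)"]
          by (simp add: power2_eq_square)
    ultimately show "\<mu> \<in> csqrt ` R \<union> (\<lambda>r. - csqrt r) ` R" by (auto simp: E_def)
  qed
  ultimately have "finite E" by (meson finite_UnI finite_imageI finite_subset)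
  show ?thesis
  proof (rule finite_subset[OF _ finite_SO_classes[OF \<open>finite E\<close>, of "d - 1"]], clarify)
    fix C \<Gamma> g
    assume ar: "arithmetic_simplest_type d \<Gamma>" "g \<in> \<Gamma>"
        and lox: "loxodromic d g" "translation_length d g = ln lam"
      and hol: "has_holonomy d g C"
    interpret S: group "SO_group (d - 1)" by (rule group_SO_group)
    obtain A where C: "C \<in> conjugacy_classes (SO_group (d - 1))"
        and A: "A \<in> C" "holonomy_matrix d g A"
      using hol by (auto simp: has_holonomy_def)
    have "C \<subseteq> carrier (SO_group (d - 1))"
    proof
      fix x assume "x \<in> C"
      then obtain a b where "a \<in> carrier (SO_group (d - 1))" "b \<in> carrier (SO_group (d - 1))"
        and x: "x = b \<otimes>\<^bsub>SO_group (d - 1)\<^esub> a \<otimes>\<^bsub>SO_group (d - 1)\<^esub> inv\<^bsub>SO_group (d - 1)\<^esub> b"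
        using C unfolding conjugacy_classes_def by blast
      then show "x \<in> carrier (SO_group (d - 1))" unfolding x by (intro S.m_closed S.inv_closed)
    qed
    then have "A \<in> orth_mats (d - 1)" using A(1) carrier_SO_group by blast
    then have "z \<in> E" if "eigenvalue (map_mat complex_of_real A) z" for z
      using holonomy_eigenvalue[OF lam(1) h assms(2) ar lox A(2) _ that] by (simp add: E_def R_def)
    then show "C \<in> conjugacy_classes (SO_group (d - 1)) \<and>
        (\<exists>A\<in>C. \<forall>z. eigenvalue (map_mat complex_of_real A) z \<longrightarrow> z \<in> E)"
      using C A(1) by blast
  qed
qed

end
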